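(* Let $m>1$ be an integer. One has a short exact sequence $$0\to H(s\ell_{m+1},\mathcal{D}^0_{01}(\mathbb{R}^m))\xrightarrow{\,i_\sharp\,}H(s\ell_{m+1},\mathcal{D}^1_{01}(\mathbb{R}^m))\xrightarrow{\,\sigma_\sharp\,}H(s\ell_{m+1},C_\infty(\mathbb{R}^m,S^1_1\mathbb{R}^m))\to0$$ where the kernel $H(s\ell_{m+1},\mathcal{D}^0_{01}(\mathbb{R}^m))$ and the quotient $H(s\ell_{m+1},C_\infty(\mathbb{R}^m,S^1_1\mathbb{R}^m))$ are both isomorphic to $(\Lambda\, g\ell(m,\mathbb{R})^* )_{g\text{-}inv}$. The inclusion of $\mathcal{D}^1_{01}(\mathbb{R}^m)$ into $\mathcal{D}_{01}(\mathbb{R}^m)$ induces an isomorphism in cohomology of $s\ell_{m+1}$.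
   Context: $s\ell_{m+1}$ denotes the Lie subalgebra of the Lie algebra $Vect(\mathbb{R}^m)$ of smooth vector fields on $\mathbb{R}^m$ spanned by $\partial_i$, $x^j\partial_i$ and $x^jE$ ($1\le i,j\le m$), where $E=\sum_i x^i\partial_i$; it is isomorphic to $s\ell(m+1,\mathbb{R})$. The space of scalar $\lambda$-densities on $\mathbb{R}^m$ is identified with $C_\infty(\mathbb{R}^m)$ with Lie derivative $L^\lambda_Xf=X.f+\lambda\,\mathrm{tr}(DX)f$, where $X.f=\sum_iX^i\partial_if$ and $DX=(\partial_jX^i)$. $\mathcal{D}^k_{\lambda\mu}(\mathbb{R}^m)$ is the space of linear differential operators of order $\le k$ from $\lambda$-densities to $\mu$-densities and $\mathcal{D}_{\lambda\mu}(\mathbb{R}^m)=\bigcup_k\mathcal{D}^k_{\lambda\mu}(\mathbb{R}^m)$, with $X$ acting by $A\mapsto L^\mu_X\circ A-A\circ L^\lambda_X$; here $(\lambda,\mu)=(0,1)$. $C_\infty(\mathbb{R}^m,S^k_\delta\mathbb{R}^m)$ is the space $C_\infty(\mathbb{R}^m,\vee^k\mathbb{R}^m)$ of symmetric $k$-contravariant tensor fields valued in $\delta$-densities, with action $L_XP=X.P-\rho(DX)P+\delta\,\mathrm{tr}(DX)P$, $\rho$ being the natural representation of $g\ell(m,\mathbb{R})$ on $\vee^k\mathbb{R}^m$; here $k=\delta=1$. $i$ is the inclusion $\mathcal{D}^0_{01}(\mathbb{R}^m)\to\mathcal{D}^1_{01}(\mathbb{R}^m)$, $\sigma$ is the symbol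 map $\mathcal{D}^1_{01}(\mathbb{R}^m)\to C_\infty(\mathbb{R}^m,S^1_1\mathbb{R}^m)$, $a_0+\sum_ia^i\partial_i\mapsto(a^i)$ (an $s\ell_{m+1}$-equivariant map), and $i_\sharp,\sigma_\sharp$ are the induced maps in cohomology. $H(s\ell_{m+1},W)=\bigoplus_uH^u(s\ell_{m+1},W)$ is Chevalley–Eilenberg cohomology; "isomorphic" means isomorphic as real vector spaces. $(\Lambda\, g\ell(m,\mathbb{R})^* )_{g\text{-}inv}$ is the space of alternating multilinear forms on $g\ell(m,\mathbb{R})$ (all degrees) invariant under the adjoint action of $g\ell(m,\mathbb{R})$. *)

theory Defs
  imports "HOL-Analysis.Analysis" "HOL-Library.Function_Algebras"
begin

section \<open>Real vector spaces\<close>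

text \<open>Pointwise scalar multiplication makes functions into a real vector space, so that
  \<open>span\<close>, \<open>subspace\<close>, \<open>linear\<close> are available for fields and operators
  (the additive structure is the one of \<^theory>\<open>HOL-Library.Function_Algebras\<close>).\<close>

instantiation "fun" :: (type, real_vector) real_vector
begin

definition scaleR_fun :: "real \<Rightarrow> ('a \<Rightarrow> 'b) \<Rightarrow> 'a \<Rightarrow> 'b"
  where "scaleR_fun r f = (\<lambda>x. r *\<^sub>R f x)"

instance
  by standard (simp_all add: scaleR_fun_def fun_eq_iff scaleR_add_right scaleR_add_left)

end

lemma scaleR_fun_apply [simp]: "(r *\<^sub>R f) x = r *\<^sub>R f x"
  by (simp add: scaleR_fun_def)

text \<open>Quotient spaces are not types, so real vector spaces with an explicit carrier are needed
  to speak about cohomology spaces and linear maps between them.\<close>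

record 'v vspace =
  vs_carrier :: "'v set"
  vs_zero :: 'v
  vs_add :: "'v \<Rightarrow> 'v \<Rightarrow> 'v"
  vs_scale :: "real \<Rightarrow> 'v \<Rightarrow> 'v"

definition subspace_vs :: "'a::real_vector set \<Rightarrow> 'a vspace"
  where "subspace_vs S =
    \<lparr>vs_carrier = S, vs_zero = 0, vs_add = (+), vs_scale = (*\<^sub>R)\<rparr>"

definition quotient_vs :: "'a::real_vector set \<Rightarrow> 'a set \<Rightarrow> 'a set vspace"
  where "quotient_vs Z B =
    \<lparr>vs_carrier = (\<lambda>z. {z + b | b. b \<in> B}) ` Z,
     vs_zero = B,
     vs_add = (\<lambda>C D. {c + d | c d. c \<in> C \<and> d \<in> D}),
     vs_scale = (\<lambda>r C. {r *\<^sub>R c + b | c b. c \<in> C \<and> b \<in> B})\<rparr>"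

definition direct_sum_vs :: "(nat \<Rightarrow> 'v vspace) \<Rightarrow> (nat \<Rightarrow> 'v) vspace"
  where "direct_sum_vs V =
    \<lparr>vs_carrier = {h. (\<forall>u. h u \<in> vs_carrier (V u)) \<and> finite {u. h u \<noteq> vs_zero (V u)}},
     vs_zero = (\<lambda>u. vs_zero (V u)),
     vs_add = (\<lambda>h k u. vs_add (V u) (h u) (k u)),
     vs_scale = (\<lambda>r h u. vs_scale (V u) r (h u))\<rparr>"

definition linear_vs :: "'v vspace \<Rightarrow> 'w vspace \<Rightarrow> ('v \<Rightarrow> 'w) \<Rightarrow> bool"
  where "linear_vs V W f \<longleftrightarrow>
    f ` vs_carrier V \<subseteq> vs_carrier W \<and>
    (\<forall>x\<in>vs_carrier V. \<forall>y\<in>vs_carrier V. f (vs_add V x y) = vs_add W (f x) (f y)) \<and>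
    (\<forall>r. \<forall>x\<in>vs_carrier V. f (vs_scale V r x) = vs_scale W r (f x))"

definition iso_map_vs :: "'v vspace \<Rightarrow> 'w vspace \<Rightarrow> ('v \<Rightarrow> 'w) \<Rightarrow> bool"
  where "iso_map_vs V W f \<longleftrightarrow>
    linear_vs V W f \<and> bij_betw f (vs_carrier V) (vs_carrier W)"

definition isomorphic_vs :: "'v vspace \<Rightarrow> 'w vspace \<Rightarrow> bool"
  where "isomorphic_vs V W \<longleftrightarrow> (\<exists>f. iso_map_vs V W f)"

text \<open>\<open>short_exact_vs U f V g W\<close>: the sequence
  \<open>0 \<longrightarrow> U \<longrightarrow> V \<longrightarrow> W \<longrightarrow> 0\<close> with maps \<open>f\<close>, \<open>g\<close> is exact.\<close>

definition short_exact_vs ::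
  "'u vspace \<Rightarrow> ('u \<Rightarrow> 'v) \<Rightarrow> 'v vspace \<Rightarrow> ('v \<Rightarrow> 'w) \<Rightarrow> 'w vspace \<Rightarrow> bool"
  where "short_exact_vs U f V g W \<longleftrightarrow>
    linear_vs U V f \<and> linear_vs V W g \<and>
    inj_on f (vs_carrier U) \<and>
    f ` vs_carrier U = {v \<in> vs_carrier V. g v = vs_zero W} \<and>
    g ` vs_carrier V = vs_carrier W"


section \<open>Chevalley--Eilenberg cohomology\<close>

record 'g lie_alg =
  la_carrier :: "'g set"
  la_bracket :: "'g \<Rightarrow> 'g \<Rightarrow> 'g"

record ('g, 'w) lie_module =
  lm_carrier :: "'w set"
  lm_act :: "'g \<Rightarrow> 'w \<Rightarrow> 'w"

text \<open>The alternating \<open>u\<close>-linear maps from \<open>g\<close> to \<open>W\<close>. The arguments are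
  collected in a list; a map is extended by \<open>0\<close> to the lists that are not \<open>u\<close>-tuples
  of elements of \<open>g\<close>, so that equality of maps is equality of functions.\<close>

definition alt_forms ::
  "'g::real_vector set \<Rightarrow> 'w::real_vector set \<Rightarrow> nat \<Rightarrow> ('g list \<Rightarrow> 'w) set"
  where "alt_forms g W u = {c.
    (\<forall>xs. length xs = u \<and> set xs \<subseteq> g \<longrightarrow> c xs \<in> W) \<and>
    (\<forall>xs. \<not> (length xs = u \<and> set xs \<subseteq> g) \<longrightarrow> c xs = 0) \<and>
    (\<forall>xs. length xs = u \<and> set xs \<subseteq> g \<longrightarrow>
      (\<forall>i<u. \<forall>x\<in>g. \<forall>y\<in>g. \<forall>r s.
        c (xs[i := r *\<^sub>R x + s *\<^sub>R y]) = r *\<^sub>R c (xs[i := x]) + s *\<^sub>R c (xs[i := y])) \<and>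
      (\<forall>i j. i < j \<and> j < u \<and> xs ! i = xs ! j \<longrightarrow> c xs = 0))}"

text \<open>\<open>nths xs (- {i, j})\<close> is \<open>xs\<close> with the entries of index \<open>i\<close> and
  \<open>j\<close> omitted.\<close>

definition ce_diff ::
  "'g lie_alg \<Rightarrow> ('g, 'w::real_vector) lie_module \<Rightarrow> ('g list \<Rightarrow> 'w) \<Rightarrow> 'g list \<Rightarrow> 'w"
  where "ce_diff g W c xs =
    (if set xs \<subseteq> la_carrier g then
       (\<Sum>i<length xs. (-1) ^ i *\<^sub>R lm_act W (xs ! i) (c (nths xs (- {i})))) +
       (\<Sum>j<length xs. \<Sum>i<j.
          (-1) ^ (i + j) *\<^sub>R c (la_bracket g (xs ! i) (xs ! j) # nths xs (- {i, j})))
     else 0)"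

definition cochains ::
  "'g::real_vector lie_alg \<Rightarrow> ('g, 'w::real_vector) lie_module \<Rightarrow> nat \<Rightarrow> ('g list \<Rightarrow> 'w) set"
  where "cochains g W u = alt_forms (la_carrier g) (lm_carrier W) u"

definition cocycles ::
  "'g::real_vector lie_alg \<Rightarrow> ('g, 'w::real_vector) lie_module \<Rightarrow> nat \<Rightarrow> ('g list \<Rightarrow> 'w) set"
  where "cocycles g W u = {c \<in> cochains g W u. ce_diff g W c = 0}"

definition coboundaries ::
  "'g::real_vector lie_alg \<Rightarrow> ('g, 'w::real_vector) lie_module \<Rightarrow> nat \<Rightarrow> ('g list \<Rightarrow> 'w) set"
  where "coboundaries g W u = (case u of 0 \<Rightarrow> {0} | Suc v \<Rightarrow> ce_diff g W ` cochains g W v)"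

definition cohomology_deg ::
  "'g::real_vector lie_alg \<Rightarrow> ('g, 'w::real_vector) lie_module \<Rightarrow> nat \<Rightarrow> ('g list \<Rightarrow> 'w) set vspace"
  where "cohomology_deg g W u = quotient_vs (cocycles g W u) (coboundaries g W u)"

definition cohomology ::
  "'g::real_vector lie_alg \<Rightarrow> ('g, 'w::real_vector) lie_module \<Rightarrow> (nat \<Rightarrow> ('g list \<Rightarrow> 'w) set) vspace"
  where "cohomology g W = direct_sum_vs (cohomology_deg g W)"

text \<open>The map induced by \<open>\<phi>\<close> on cohomology with target module \<open>W\<close>: in each degree it
  sends the class of \<open>c\<close> to the class of \<open>\<phi> \<circ> c\<close>.\<close>

definition induced_map ::
  "'g::real_vector lie_alg \<Rightarrow> ('g, 'w::real_vector) lie_module \<Rightarrow> ('v \<Rightarrow> 'w) \<Rightarrow>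
    (nat \<Rightarrow> ('g list \<Rightarrow> 'v) set) \<Rightarrow> (nat \<Rightarrow> ('g list \<Rightarrow> 'w) set)"
  where "induced_map g W \<phi> h =
    (\<lambda>u. {(\<phi> \<circ> c) + b | c b. c \<in> h u \<and> b \<in> coboundaries g W u})"


section \<open>Invariant forms on the general linear Lie algebra\<close>

definition gl_bracket :: "real^'m^'m \<Rightarrow> real^'m^'m \<Rightarrow> real^'m^'m::finite"
  where "gl_bracket A B = A ** B - B ** A"

definition gl_inv_forms_deg :: "nat \<Rightarrow> ((real^'m::finite^'m) list \<Rightarrow> real) set"
  where "gl_inv_forms_deg u = {c \<in> alt_forms UNIV UNIV u.
    \<forall>A xs. length xs = u \<longrightarrow> (\<Sum>i<u. c (xs[i := gl_bracket A (xs ! i)])) = 0}"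

definition gl_inv_forms :: "(nat \<Rightarrow> (real^'m::finite^'m) list \<Rightarrow> real) vspace"
  where "gl_inv_forms = direct_sum_vs (\<lambda>u. subspace_vs (gl_inv_forms_deg u))"


section \<open>Smooth functions, vector fields and the projective Lie algebra\<close>

type_synonym 'm scalar_field = "real^'m \<Rightarrow> real"
type_synonym 'm vector_field = "real^'m \<Rightarrow> real^'m"

definition partial :: "'m \<Rightarrow> 'm::finite scalar_field \<Rightarrow> 'm scalar_field"
  where "partial i f x = frechet_derivative f (at x) (axis i 1)"

definition iter_partial :: "'m list \<Rightarrow> 'm::finite scalar_field \<Rightarrow> 'm scalar_field"
  where "iter_partial js f = foldr partial js f"

text \<open>Differentiability of every iterated partial derivative makes all of them exist and be
  continuous, and conversely; \<open>smooth\<close> is therefore the usual infinite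
  differentiability.\<close>

definition smooth :: "'m::finite scalar_field \<Rightarrow> bool"
  where "smooth f \<longleftrightarrow> (\<forall>js x. iter_partial js f differentiable (at x))"

definition smooth_vf :: "'m::finite vector_field \<Rightarrow> bool"
  where "smooth_vf P \<longleftrightarrow> (\<forall>i. smooth (\<lambda>x. P x $ i))"

definition deriv_along :: "'m::finite vector_field \<Rightarrow> 'm scalar_field \<Rightarrow> 'm scalar_field"
  where "deriv_along X f x = (\<Sum>i\<in>UNIV. X x $ i * partial i f x)"

definition deriv_along_vf :: "'m::finite vector_field \<Rightarrow> 'm vector_field \<Rightarrow> 'm vector_field"
  where "deriv_along_vf X P x = (\<chi> i. deriv_along X (\<lambda>y. P y $ i) x)"

definition jacobian_matrix :: "'m::finite vector_field \<Rightarrow> real^'m \<Rightarrow> real^'m^'m"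
  where "jacobian_matrix X x = (\<chi> i j. partial j (\<lambda>y. X y $ i) x)"

definition vf_bracket :: "'m::finite vector_field \<Rightarrow> 'm vector_field \<Rightarrow> 'm vector_field"
  where "vf_bracket X Y = deriv_along_vf X Y - deriv_along_vf Y X"

definition coord_vf :: "'m::finite \<Rightarrow> 'm vector_field"
  where "coord_vf i = (\<lambda>x. axis i 1)"

definition euler_vf :: "'m::finite vector_field"
  where "euler_vf = (\<lambda>x. \<Sum>i\<in>UNIV. (x $ i) *\<^sub>R coord_vf i x)"

text \<open>The subalgebra \<open>sl\<^sub>m\<^sub>+\<^sub>1\<close> of the vector fields on \<open>real^'m\<close>,
  where \<open>m = CARD('m)\<close>.\<close>

definition sl_proj :: "'m::finite vector_field lie_alg"
  where "sl_proj =
    \<lparr>la_carrier = span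
       (range coord_vf \<union>
        {\<lambda>x. (x $ j) *\<^sub>R coord_vf i x | i j. True} \<union>
        {\<lambda>x. (x $ j) *\<^sub>R euler_vf x | j. True}),
     la_bracket = vf_bracket\<rparr>"

abbreviation H_sl :: "('m::finite vector_field, 'w::real_vector) lie_module \<Rightarrow>
    (nat \<Rightarrow> ('m vector_field list \<Rightarrow> 'w) set) vspace"
  where "H_sl W \<equiv> cohomology sl_proj W"

abbreviation H_sl_map :: "('m::finite vector_field, 'w::real_vector) lie_module \<Rightarrow> ('v \<Rightarrow> 'w) \<Rightarrow>
    (nat \<Rightarrow> ('m vector_field list \<Rightarrow> 'v) set) \<Rightarrow> (nat \<Rightarrow> ('m vector_field list \<Rightarrow> 'w) set)"
  where "H_sl_map W \<phi> \<equiv> induced_map sl_proj W \<phi>"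


section \<open>Densities, differential operators and symbols\<close>

definition lie_density ::
  "real \<Rightarrow> 'm::finite vector_field \<Rightarrow> 'm scalar_field \<Rightarrow> 'm scalar_field"
  where "lie_density l X f =
    (\<lambda>x. deriv_along X f x + l * trace (jacobian_matrix X x) * f x)"

text \<open>Operators are only meaningful on smooth functions; they are extended by \<open>0\<close> to the
  others, so that equality of operators is equality of functions.\<close>

type_synonym 'm operator = "'m scalar_field \<Rightarrow> 'm scalar_field"

definition on_smooth :: "'m::finite operator \<Rightarrow> 'm operator"
  where "on_smooth A = (\<lambda>f. if smooth f then A f else 0)"

text \<open>The operators of order at most \<open>k\<close>, i.e. the sums of \<open>a \<partial>\<^sub>j \<dots> \<partial>\<^sub>l\<close> with
  smooth coefficient \<open>a\<close> and at most \<open>k\<close> partial derivatives. They are indexed by lists of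
  indices; as the derivatives commute, the coefficients are not unique for \<open>k > 1\<close>.\<close>

definition diff_ops :: "nat \<Rightarrow> 'm::finite operator set"
  where "diff_ops k = {A. \<exists>a. (\<forall>js. smooth (a js)) \<and>
    A = on_smooth (\<lambda>f x. \<Sum>js\<in>{js. length js \<le> k}. a js x * iter_partial js f x)}"

definition op_act ::
  "real \<Rightarrow> real \<Rightarrow> 'm::finite vector_field \<Rightarrow> 'm operator \<Rightarrow> 'm operator"
  where "op_act l \<mu> X A =
    on_smooth (\<lambda>f. lie_density \<mu> X (A f) - A (lie_density l X f))"

definition D_ord ::
  "real \<Rightarrow> real \<Rightarrow> nat \<Rightarrow> ('m::finite vector_field, 'm operator) lie_module"
  where "D_ord l \<mu> k = \<lparr>lm_carrier = diff_ops k, lm_act = op_act l \<mu>\<rparr>"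

definition D_all ::
  "real \<Rightarrow> real \<Rightarrow> ('m::finite vector_field, 'm operator) lie_module"
  where "D_all l \<mu> = \<lparr>lm_carrier = (\<Union>k. diff_ops k), lm_act = op_act l \<mu>\<rparr>"

text \<open>Contravariant tensor fields of degree \<open>1\<close> with values in \<open>\<delta>\<close>-densities; the natural
  representation of a matrix on the first symmetric power is its action on vectors.\<close>

definition S1_module ::
  "real \<Rightarrow> ('m::finite vector_field, 'm vector_field) lie_module"
  where "S1_module \<delta> =
    \<lparr>lm_carrier = {P. smooth_vf P},
     lm_act = (\<lambda>X P x. deriv_along_vf X P x - jacobian_matrix X x *v P x
                + (\<delta> * trace (jacobian_matrix X x)) *\<^sub>R P x)\<rparr>"

definition first_order_op :: "'m::finite scalar_field \<Rightarrow> 'm vector_field \<Rightarrow> 'm operator"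
  where "first_order_op a0 P =
    on_smooth (\<lambda>f x. a0 x * f x + (\<Sum>i\<in>UNIV. P x $ i * partial i f x))"

definition symbol_map :: "'m::finite operator \<Rightarrow> 'm vector_field"
  where "symbol_map A =
    (THE P. smooth_vf P \<and> (\<exists>a0. smooth a0 \<and> A = first_order_op a0 P))"

lemma diff_ops_1:
  "diff_ops 1 = {first_order_op a0 P | a0 P. smooth a0 \<and> smooth_vf P}"
proof -
  have idx: "{js::'a list. length js \<le> 1} = insert [] (range (\<lambda>i. [i]))"
    by (auto simp: le_Suc_eq length_Suc_conv)
  have sum_idx: "(\<Sum>js\<in>{js::'a list. length js \<le> 1}. h js) = h [] + (\<Sum>i\<in>UNIV. h [i])"
    for h :: "'a list \<Rightarrow> real"
    unfolding idx by (subst sum.insert) (auto simp: sum.reindex inj_on_def)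
  show ?thesis
  proof (intro equalityI subsetI)
    fix A :: "'a operator" assume "A \<in> diff_ops 1"
    then obtain a where a: "\<And>js. smooth (a js)"
      and A: "A = on_smooth (\<lambda>f x. \<Sum>js\<in>{js. length js \<le> 1}. a js x * iter_partial js f x)"
      unfolding diff_ops_def by blast
    have "A = first_order_op (a []) (\<lambda>x. \<chi> i. a [i] x)"
      unfolding A first_order_op_def sum_idx by (simp add: iter_partial_def)
    moreover have "smooth_vf (\<lambda>x. \<chi> i. a [i] x)"
      using a by (simp add: smooth_vf_def)
    ultimately show "A \<in> {first_order_op a0 P | a0 P. smooth a0 \<and> smooth_vf P}"
      using a by blast
  next
    fix A :: "'a operator" assume "A \<in> {first_order_op a0 P | a0 P. smooth a0 \<and> smooth_vf P}"
    then obtain a0 P where a0: "smooth a0" and P: "smooth_vf P" and A: "A = first_order_op a0 P"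
      by blast
    let ?a = "\<lambda>js. if js = [] then a0 else (\<lambda>x. P x $ hd js)"
    have "A = on_smooth (\<lambda>f x. \<Sum>js\<in>{js. length js \<le> 1}. ?a js x * iter_partial js f x)"
      unfolding A first_order_op_def sum_idx by (simp add: iter_partial_def)
    moreover have "smooth (?a js)" for js
      using a0 P by (simp add: smooth_vf_def)
    ultimately show "A \<in> diff_ops 1"
      unfolding diff_ops_def mem_Collect_eq by (intro exI[of _ ?a] conjI allI)
  qed
qed

lemma partial_const [simp]: "partial i (\<lambda>x. c) = (\<lambda>x. 0)"
  by (rule ext) (simp add: partial_def)

lemma partial_coord: "partial i (\<lambda>x :: real^'a::finite. x $ k) = (\<lambda>x. if i = k then 1 else 0)"
proof
  fix x :: "real^'a"
  have "((\<lambda>x :: real^'a. x $ k) has_derivative (\<lambda>x. x $ k)) (at x)"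
    by (rule bounded_linear_imp_has_derivative) (rule bounded_linear_vec_nth)
  then have "frechet_derivative (\<lambda>x :: real^'a. x $ k) (at x) = (\<lambda>x. x $ k)"
    by (rule frechet_derivative_at[symmetric])
  then show "partial i (\<lambda>x. x $ k) x = (if i = k then 1 else 0)"
    by (simp add: partial_def axis_def)
qed

lemma smooth_const: "smooth (\<lambda>x :: real^'m::finite. c)"
proof -
  have *: "\<exists>d. iter_partial js (\<lambda>x. c) = (\<lambda>x. d)" for js :: "'m list"
    by (induction js) (auto simp: iter_partial_def)
  show ?thesis
    unfolding smooth_def
  proof (intro allI)
    fix js :: "'m list" and x
    show "iter_partial js (\<lambda>x. c) differentiable (at x)"
      using *[of js] by auto
  qed
qed

lemma smooth_coord: "smooth (\<lambda>x :: real^'m::finite. x $ k)"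
proof -
  let ?p = "\<lambda>x :: real^'m. x $ k"
  have *: "iter_partial js ?p = ?p \<or> (\<exists>d. iter_partial js ?p = (\<lambda>x. d))" for js
    by (induction js) (auto simp: iter_partial_def partial_coord)
  have "?p differentiable (at x)" for x
    by (rule bounded_linear_imp_differentiable) (rule bounded_linear_vec_nth)
  then have "iter_partial js ?p differentiable (at x)" for js x
    using *[of js] by auto
  then show ?thesis
    by (simp add: smooth_def)
qed

lemma symbol_map_first_order_op:
  assumes "smooth a0" "smooth_vf P"
  shows "symbol_map (first_order_op a0 P) = P"
  unfolding symbol_map_def
proof (rule the_equality)
  show "smooth_vf P \<and> (\<exists>a. smooth a \<and> first_order_op a0 P = first_order_op a P)"
    using assms by blast
next
  fix Q assume "smooth_vf Q \<and> (\<exists>a. smooth a \<and> first_order_op a0 P = first_order_op a Q)"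
  then obtain b where eq: "first_order_op a0 P = first_order_op b Q" by blast
  have "a0 x = b x" for x
    using fun_cong[OF fun_cong[OF eq, of "\<lambda>x. 1"], of x]
    by (simp add: first_order_op_def on_smooth_def smooth_const)
  moreover have "a0 x * x $ k + P x $ k = b x * x $ k + Q x $ k" for x k
    using fun_cong[OF fun_cong[OF eq, of "\<lambda>x. x $ k"], of x]
    by (simp add: first_order_op_def on_smooth_def smooth_coord partial_coord if_distrib
        cong: if_cong)
  ultimately show "Q = P"
    by (simp add: fun_eq_iff vec_eq_iff)
qed

end

theory Submission
  imports Defs
begin

text \<open>
  Write \<open>g\<close> for the projective algebra, \<open>m\<close> for \<open>CARD('m)\<close>, \<open>F\<close> for the densities of weight one and
  \<open>S\<close> for the symbols of order one. Everything rests on two facts about Chevalley--Eilenberg cochains: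
  Cartan's formula (\<open>contract_ce_diff\<close>), and a homotopy formula (\<open>casimir_homotopy_formula\<close>): if
  operators \<open>\<theta>\<^sub>a\<close> on a module transform dually to elements \<open>e\<^sub>a\<close> of \<open>g\<close>, then \<open>\<Sum> \<theta>\<^sub>a \<circ> e\<^sub>a\<close> is null-homotopic.

  \<^emph>\<open>The sequence.\<close> The Lie derivative of weight zero annihilates the constant function \<open>1\<close>; hence
  \<open>A \<mapsto> A 1\<close> is equivariant, and the operators of order one are, as a module over \<open>g\<close>, the direct sum
  of the operators of order zero, a copy of \<open>F\<close>, and of \<open>S\<close>. This gives \<open>first_order_short_exact\<close>.

  \<^emph>\<open>Densities.\<close> The Lie derivative along the Euler field \<open>E\<close> commutes with the differential and is
  zero in cohomology. On the value of a cochain at fields of total weight \<open>w\<close> it is \<open>x \<cdot> \<partial> + m - w\<close>. Only the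
  \<open>m\<close> fields \<open>x\<^sup>k E\<close> have weight one, so \<open>w \<le> m\<close>, and integration along rays shows that the cochain
  complex is the sum of the kernel and the image of this operator. The cochains in the kernel have
  constant values and live in weight \<open>m\<close>: they must be fed all the fields \<open>x\<^sup>k E\<close>, and linear fields
  besides. Restricting them to these arguments identifies the kernel with the forms on \<open>gl\<^sub>m\<close>, in a
  degree that is lower by \<open>m\<close> (\<open>restrict_diff\<close>, \<open>restrict_injective\<close>, \<open>restrict_surjective\<close>). A Casimir
  operator that is symmetric and positive for an inner product shows that the cohomology of \<open>gl\<^sub>m\<close> is
  the space of invariant forms (\<open>gl_cocycle_inv\<close>, \<open>gl_inv_exact\<close>).

  \<^emph>\<open>Symbols.\<close> Mapping \<open>P\<close> to \<open>P.(div X)\<close> is a cocycle that extends \<open>S\<close> by \<open>F\<close>. The homotopy formula,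
  applied to this extension, produces an invertible operator that is zero in cohomology; thus the
  extension is acyclic (\<open>ext_acyclic\<close>), and its connecting map is an isomorphism from the cohomology of
  \<open>S\<close> to that of \<open>F\<close>, raising the degree by one.

  \<^emph>\<open>All operators.\<close> The Casimir operator of \<open>g\<close> on differential operators is null-homotopic, and on
  symbols of order \<open>k\<close> it is multiplication by \<open>2 k (k - 1)\<close> (\<open>op_casimir_symbol\<close>). A cochain takes
  values in operators of bounded order, \<open>g\<close> being of finite dimension; as long as the order exceeds one
  it can be lowered by subtracting a coboundary (\<open>order_reduction\<close>).
\<close>

section \<open>Linear maps and alternating forms on subspaces\<close>

lemma sum_fun_eval [simp]: "(sum f A) x = (\<Sum>i\<in>A. f i x)"
  by (induction A rule: infinite_finite_induct) auto

text \<open>Modules are subsets of a type, and the maps between them need not be linear, or even meaningful, elsewhere.\<close>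

definition lin_on :: "'a::real_vector set \<Rightarrow> 'b::real_vector set \<Rightarrow> ('a \<Rightarrow> 'b) \<Rightarrow> bool"
  where "lin_on V W f \<longleftrightarrow> (\<forall>x\<in>V. f x \<in> W) \<and>
    (\<forall>x\<in>V. \<forall>y\<in>V. \<forall>r s. f (r *\<^sub>R x + s *\<^sub>R y) = r *\<^sub>R f x + s *\<^sub>R f y)"

lemma lin_onI:
  assumes "\<And>x. x \<in> V \<Longrightarrow> f x \<in> W"
    and "\<And>x y r s. x \<in> V \<Longrightarrow> y \<in> V \<Longrightarrow> f (r *\<^sub>R x + s *\<^sub>R y) = r *\<^sub>R f x + s *\<^sub>R f y"
  shows "lin_on V W f"
  using assms by (auto simp: lin_on_def)

lemma lin_on_in: "lin_on V W f \<Longrightarrow> x \<in> V \<Longrightarrow> f x \<in> W"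
  by (auto simp: lin_on_def)

lemma lin_on_comb:
  "lin_on V W f \<Longrightarrow> x \<in> V \<Longrightarrow> y \<in> V \<Longrightarrow> f (r *\<^sub>R x + s *\<^sub>R y) = r *\<^sub>R f x + s *\<^sub>R f y"
  by (auto simp: lin_on_def)

lemma lin_on_add: "lin_on V W f \<Longrightarrow> x \<in> V \<Longrightarrow> y \<in> V \<Longrightarrow> f (x + y) = f x + f y"
  using lin_on_comb[of V W f x y 1 1] by simp

lemma lin_on_diff: "lin_on V W f \<Longrightarrow> x \<in> V \<Longrightarrow> y \<in> V \<Longrightarrow> f (x - y) = f x - f y"
  using lin_on_comb[of V W f x y 1 "-1"] by simp

lemma lin_on_scale: "lin_on V W f \<Longrightarrow> x \<in> V \<Longrightarrow> f (r *\<^sub>R x) = r *\<^sub>R f x"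
  using lin_on_comb[of V W f x x r 0] by simp

lemma lin_on_minus: "lin_on V W f \<Longrightarrow> x \<in> V \<Longrightarrow> f (- x) = - f x"
  using lin_on_scale[of V W f x "-1"] by simp

lemma lin_on_zero: "lin_on V W f \<Longrightarrow> subspace V \<Longrightarrow> f 0 = 0"
  using lin_on_scale[of V W f 0 0] by (simp add: subspace_0)

lemma subspace_lin_image:
  assumes f: "lin_on V W f" and V: "subspace V"
  shows "subspace (f ` V)"
  unfolding subspace_def
proof (intro conjI ballI allI)
  show "0 \<in> f ` V" using lin_on_zero[OF f V] subspace_0[OF V] by force
  show "x + y \<in> f ` V" if "x \<in> f ` V" "y \<in> f ` V" for x y
    using that lin_on_add[OF f] subspace_add[OF V] by (auto simp: image_iff) metis
  show "k *\<^sub>R x \<in> f ` V" if "x \<in> f ` V" for k x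
    using that lin_on_scale[OF f] subspace_scale[OF V] by (auto simp: image_iff) metis
qed

lemma subspace_lin_kernel:
  assumes f: "lin_on V W f" and V: "subspace V"
  shows "subspace {x \<in> V. f x = 0}"
  using lin_on_zero[OF f V] unfolding subspace_def
  by (auto simp: subspace_0[OF V] subspace_add[OF V] subspace_scale[OF V] lin_on_add[OF f] lin_on_scale[OF f])

lemma lin_on_sum:
  assumes "lin_on V W f" "subspace V" "\<And>i. i \<in> I \<Longrightarrow> h i \<in> V"
  shows "f (\<Sum>i\<in>I. h i) = (\<Sum>i\<in>I. f (h i))"
  using assms(3)
  by (induction I rule: infinite_finite_induct)
    (auto simp: lin_on_zero[OF assms(1,2)] lin_on_add[OF assms(1)] subspace_sum[OF assms(2)])

lemma subspace_comb:
  "subspace V \<Longrightarrow> x \<in> V \<Longrightarrow> y \<in> V \<Longrightarrow> r *\<^sub>R x + s *\<^sub>R y \<in> V"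
  by (simp add: subspace_add subspace_scale)

lemma lin_on_compose: "lin_on V W f \<Longrightarrow> lin_on W U h \<Longrightarrow> lin_on V U (\<lambda>x. h (f x))"
  by (simp add: lin_on_def)

lemma lin_on_combI:
  assumes "lin_on V W f" "lin_on V W h" "subspace W"
  shows "lin_on V W (\<lambda>x. r *\<^sub>R f x + s *\<^sub>R h x)"
  using assms by (auto simp: lin_on_def subspace_comb algebra_simps)

lemma lin_on_sumI:
  assumes "\<And>i. i \<in> I \<Longrightarrow> lin_on V W (f i)" "subspace W"
  shows "lin_on V W (\<lambda>x. \<Sum>i\<in>I. f i x)"
proof (rule lin_onI)
  fix x assume "x \<in> V"
  then show "(\<Sum>i\<in>I. f i x) \<in> W"
    using assms by (intro subspace_sum) (auto intro: lin_on_in)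
next
  fix x y r s assume "x \<in> V" "y \<in> V"
  then have "(\<Sum>i\<in>I. f i (r *\<^sub>R x + s *\<^sub>R y)) = (\<Sum>i\<in>I. r *\<^sub>R f i x + s *\<^sub>R f i y)"
    by (intro sum.cong refl lin_on_comb[OF assms(1)])
  then show "(\<Sum>i\<in>I. f i (r *\<^sub>R x + s *\<^sub>R y)) = r *\<^sub>R (\<Sum>i\<in>I. f i x) + s *\<^sub>R (\<Sum>i\<in>I. f i y)"
    by (simp add: sum.distrib scaleR_sum_right)
qed

lemma lin_on_eq_span:
  assumes f: "lin_on V W f" and h: "lin_on V W h" and V: "V = span B" and eq: "\<And>b. b \<in> B \<Longrightarrow> f b = h b"
    and x: "x \<in> V"
  shows "f x = h x"
proof -
  have sV: "subspace V"
    by (simp add: V)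
  have "x \<in> span B" using x V by simp
  then have "x \<in> V \<and> f x = h x"
  proof (induction rule: span_induct_alt)
    case base
    then show ?case
      by (simp add: lin_on_zero[OF f sV] lin_on_zero[OF h sV] subspace_0[OF sV])
  next
    case (step c b y)
    then have "b \<in> V" "y \<in> V"
      by (auto simp: V span_base)
    then show ?case
      using step eq[of b] lin_on_comb[OF f, of b y c 1] lin_on_comb[OF h, of b y c 1]
        subspace_comb[OF sV, of b y c 1] by simp
  qed
  then show ?thesis ..
qed

definition contract :: "'g \<Rightarrow> ('g list \<Rightarrow> 'w) \<Rightarrow> 'g list \<Rightarrow> 'w"
  where "contract X c = (\<lambda>xs. c (X # xs))"

lemma contract_apply [simp]: "contract X c xs = c (X # xs)"
  by (simp add: contract_def)

lemma contract_add: "contract X (c + c') = contract X c + contract X c'"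
  and contract_diff: "contract X (c - c') = contract X c - contract X c'"
  and contract_scaleR: "contract X (r *\<^sub>R c) = r *\<^sub>R contract X c"
  and contract_zero: "contract X 0 = 0"
  for c :: "'g list \<Rightarrow> 'w::real_vector"
  by (auto simp: fun_eq_iff)

lemma form_eqI:
  assumes "c [] = c' []" "\<And>X. contract X c = contract X c'"
  shows "c = c'"
proof
  fix xs show "c xs = c' xs"
    using assms(1) fun_cong[OF assms(2)] by (cases xs) auto
qed

lemma alt_forms_in: "c \<in> alt_forms G W u \<Longrightarrow> length xs = u \<Longrightarrow> set xs \<subseteq> G \<Longrightarrow> c xs \<in> W"
  by (auto simp: alt_forms_def)

lemma alt_forms_out: "c \<in> alt_forms G W u \<Longrightarrow> \<not> (length xs = u \<and> set xs \<subseteq> G) \<Longrightarrow> c xs = 0"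
  by (auto simp: alt_forms_def)

lemma alt_forms_mem: "subspace W \<Longrightarrow> c \<in> alt_forms G W u \<Longrightarrow> c xs \<in> W"
  using alt_forms_in alt_forms_out by (metis subspace_0)

lemma alt_forms_slot:
  "c \<in> alt_forms G W u \<Longrightarrow> length xs = u \<Longrightarrow> set xs \<subseteq> G \<Longrightarrow> i < u \<Longrightarrow> x \<in> G \<Longrightarrow> y \<in> G \<Longrightarrow>
    c (xs[i := r *\<^sub>R x + s *\<^sub>R y]) = r *\<^sub>R c (xs[i := x]) + s *\<^sub>R c (xs[i := y])"
  unfolding alt_forms_def by blast

lemma alt_forms_repeat:
  assumes "c \<in> alt_forms G W u" "i < j" "j < length xs" "xs ! i = xs ! j"
  shows "c xs = 0"
proof (cases "length xs = u \<and> set xs \<subseteq> G")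
  case True
  then show ?thesis
    using assms unfolding alt_forms_def by blast
next
  case False
  then show ?thesis using alt_forms_out[OF assms(1)] by blast
qed

lemma alt_forms_0_iff: "c \<in> alt_forms G W 0 \<longleftrightarrow> c [] \<in> W \<and> (\<forall>xs. xs \<noteq> [] \<longrightarrow> c xs = 0)"
  by (auto simp: alt_forms_def)

lemma subspace_alt_forms:
  assumes "subspace W"
  shows "subspace (alt_forms G W u)"
  using assms unfolding subspace_def alt_forms_def
  by (auto simp: algebra_simps)

lemma alt_forms_lin_head:
  assumes c: "c \<in> alt_forms G W (Suc u)" and X: "X \<in> G" and Y: "Y \<in> G" and G: "subspace G"
  shows "c ((r *\<^sub>R X + s *\<^sub>R Y) # xs) = r *\<^sub>R c (X # xs) + s *\<^sub>R c (Y # xs)"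
proof (cases "length xs = u \<and> set xs \<subseteq> G")
  case True
  then show ?thesis
    using alt_forms_slot[OF c, of "X # xs" 0 X Y r s] X Y by simp
next
  case False
  then have "c (Z # xs) = 0" for Z
    by (intro alt_forms_out[OF c]) auto
  then show ?thesis by simp
qed

lemma contract_alt:
  assumes c: "c \<in> alt_forms G W (Suc u)" and X: "X \<in> G"
  shows "contract X c \<in> alt_forms G W u"
  unfolding alt_forms_def mem_Collect_eq
proof (intro conjI allI impI ballI)
  fix xs assume "length xs = u \<and> set xs \<subseteq> G"
  then show "contract X c xs \<in> W"
    using alt_forms_in[OF c, of "X # xs"] X by simp
next
  fix xs assume "\<not> (length xs = u \<and> set xs \<subseteq> G)"
  then show "contract X c xs = 0"
    using alt_forms_out[OF c, of "X # xs"] by auto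
next
  fix xs i x y r s assume "length xs = u \<and> set xs \<subseteq> G" "i < u" "x \<in> G" "y \<in> G"
  then show "contract X c (xs[i := r *\<^sub>R x + s *\<^sub>R y]) =
      r *\<^sub>R contract X c (xs[i := x]) + s *\<^sub>R contract X c (xs[i := y])"
    using alt_forms_slot[OF c, of "X # xs" "Suc i" x y r s] X by simp
next
  fix xs i j assume "length xs = u \<and> set xs \<subseteq> G" "i < j \<and> j < u \<and> xs ! i = xs ! j"
  then show "contract X c xs = 0"
    using alt_forms_repeat[OF c, of "Suc i" "Suc j" "X # xs"] by simp
qed

lemma contract_out:
  assumes c: "c \<in> alt_forms G W u" and X: "X \<notin> G"
  shows "contract X c = 0"
  using alt_forms_out[OF c] X by (auto simp: fun_eq_iff)

lemma contract_0: "c \<in> alt_forms G W 0 \<Longrightarrow> contract X c = 0"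
  by (auto simp: alt_forms_0_iff fun_eq_iff)

lemma contract_anticommute:
  assumes c: "c \<in> alt_forms G W u" and X: "X \<in> G" and Y: "Y \<in> G" and G: "subspace G"
  shows "c (X # Y # xs) = - c (Y # X # xs)"
proof (cases "u < 2")
  case True
  then have "c (P # Q # xs) = 0" for P Q
    by (intro alt_forms_out[OF c]) auto
  then show ?thesis by simp
next
  case False
  then obtain v where u: "u = Suc (Suc v)"
    by (metis add_2_eq_Suc le_Suc_ex not_less)
  have "0 = c ((X + Y) # (X + Y) # xs)"
    using alt_forms_repeat[OF c, of 0 1 "(X + Y) # (X + Y) # xs"] by simp
  also have "\<dots> = c (X # (X + Y) # xs) + c (Y # (X + Y) # xs)"
    using alt_forms_lin_head[of c G W "Suc v" X Y 1 1] c u X Y G by simp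
  also have "c (X # (X + Y) # xs) = c (X # X # xs) + c (X # Y # xs)"
    using alt_forms_lin_head[OF contract_alt[of c G W "Suc v" X], of X Y 1 1] c u X Y G by simp
  also have "c (Y # (X + Y) # xs) = c (Y # X # xs) + c (Y # Y # xs)"
    using alt_forms_lin_head[OF contract_alt[of c G W "Suc v" Y], of X Y 1 1] c u X Y G by simp
  also have "c (X # X # xs) = 0" using alt_forms_repeat[OF c, of 0 1 "X # X # xs"] by simp
  also have "c (Y # Y # xs) = 0" using alt_forms_repeat[OF c, of 0 1 "Y # Y # xs"] by simp
  finally show ?thesis by (simp add: eq_neg_iff_add_eq_0 add.commute)
qed

text \<open>The argument \<open>X\<close> can be moved to the front at the cost of a sign.\<close>

lemma alt_vanish_member:
  assumes "c \<in> alt_forms G W u" "subspace G" "X \<in> G" "\<And>zs. c (X # zs) = 0" "X \<in> set ys"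
  shows "c ys = 0"
  using assms
proof (induction u arbitrary: c ys)
  case 0
  then show ?case by (cases ys) (auto simp: alt_forms_0_iff)
next
  case (Suc u)
  obtain Y zs where ys: "ys = Y # zs" using Suc.prems(5) by (cases ys) auto
  show ?case
  proof (cases "Y = X \<or> Y \<notin> G")
    case True
    then show ?thesis
      using Suc.prems(4) alt_forms_out[OF Suc.prems(1), of ys] ys by auto
  next
    case False
    then have Y: "Y \<in> G" and X: "X \<in> set zs" using Suc.prems(5) ys by auto
    have "contract Y c (X # vs) = 0" for vs
      using contract_anticommute[OF Suc.prems(1) Y Suc.prems(3,2), of vs] Suc.prems(4) by simp
    then have "contract Y c zs = 0"
      by (rule Suc.IH[OF contract_alt[OF Suc.prems(1) Y] Suc.prems(2,3) _ X])
    then show ?thesis by (simp add: ys)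
  qed
qed

text \<open>Alternating forms can be recognised by looking at their contractions alone. All identities
  of the Cartan calculus below are proved by induction on the degree through this criterion.\<close>

lemma alt_forms_SucI:
  assumes G: "subspace G" and nil: "c [] = 0"
    and out: "\<And>X. X \<notin> G \<Longrightarrow> contract X c = 0"
    and tail: "\<And>X. X \<in> G \<Longrightarrow> contract X c \<in> alt_forms G W u"
    and lin: "\<And>X Y r s. X \<in> G \<Longrightarrow> Y \<in> G \<Longrightarrow>
      contract (r *\<^sub>R X + s *\<^sub>R Y) c = r *\<^sub>R contract X c + s *\<^sub>R contract Y c"
    and rep: "\<And>X. X \<in> G \<Longrightarrow> contract X (contract X c) = 0"
  shows "c \<in> alt_forms G W (Suc u)"
  unfolding alt_forms_def mem_Collect_eq
proof (intro conjI allI impI ballI)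
  fix xs assume "length xs = Suc u \<and> set xs \<subseteq> G"
  then show "c xs \<in> W"
    using alt_forms_in[OF tail] by (cases xs) auto
next
  fix xs assume a: "\<not> (length xs = Suc u \<and> set xs \<subseteq> G)"
  show "c xs = 0"
  proof (cases xs)
    case Nil
    then show ?thesis using nil by simp
  next
    case (Cons X ys)
    then show ?thesis
      using a fun_cong[OF out[of X], of ys] alt_forms_out[OF tail[of X], of ys]
      by (cases "X \<in> G") auto
  qed
next
  fix xs i x y r s assume a: "length xs = Suc u \<and> set xs \<subseteq> G" "i < Suc u" "x \<in> G" "y \<in> G"
  then obtain X ys where xs: "xs = X # ys" by (cases xs) auto
  show "c (xs[i := r *\<^sub>R x + s *\<^sub>R y]) = r *\<^sub>R c (xs[i := x]) + s *\<^sub>R c (xs[i := y])"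
  proof (cases i)
    case 0
    then show ?thesis using fun_cong[OF lin[of x y r s], of ys] a xs by simp
  next
    case (Suc k)
    then show ?thesis
      using alt_forms_slot[OF tail[of X], of ys k x y r s] a xs by simp
  qed
next
  fix xs i j assume a: "length xs = Suc u \<and> set xs \<subseteq> G" "i < j \<and> j < Suc u \<and> xs ! i = xs ! j"
  then obtain X ys where xs: "xs = X # ys" by (cases xs) auto
  obtain k where j: "j = Suc k" using a by (cases j) auto
  show "c xs = 0"
  proof (cases i)
    case 0
    then have "X \<in> set ys" using a xs j by auto
    moreover have X: "X \<in> G" using a xs by simp
    moreover have "contract X c (X # zs) = 0" for zs
      using fun_cong[OF rep[OF X], of zs] by simp
    ultimately have "contract X c ys = 0"
      by (metis alt_vanish_member[OF tail[OF X] G])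
    then show ?thesis using xs by simp
  next
    case (Suc l)
    then show ?thesis
      using alt_forms_repeat[OF tail[of X], of l k ys] a xs j by simp
  qed
qed

text \<open>Multilinearity allows one argument after the other to be replaced by generators.\<close>

lemma alt_forms_values:
  assumes c: "c \<in> alt_forms G W u" and G: "G = span B" and U: "subspace U"
    and B: "\<And>xs. set xs \<subseteq> B \<Longrightarrow> length xs = u \<Longrightarrow> c xs \<in> U"
  shows "c xs \<in> U"
  using c B
proof (induction u arbitrary: c xs)
  case 0
  then show ?case using U by (cases "xs = []") (auto simp: alt_forms_0_iff subspace_0)
next
  case (Suc u)
  have sG: "subspace G" by (simp add: G)
  show ?case
  proof (cases xs)
    case Nil
    then show ?thesis using alt_forms_out[OF Suc.prems(1), of xs] U by (simp add: subspace_0)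
  next
    case (Cons X ys)
    show ?thesis
    proof (cases "X \<in> G")
      case True
      then have "X \<in> span B" using G by simp
      then have "X \<in> G \<and> c (X # ys) \<in> U"
      proof (induction rule: span_induct_alt)
        case base
        have "c (0 # ys) = 0"
          using alt_forms_lin_head[OF Suc.prems(1) _ _ sG, of 0 0 0 0 ys] subspace_0[OF sG] by simp
        then show ?case using U sG by (simp add: subspace_0)
      next
        case (step r b Y)
        have b: "b \<in> G" and Y: "Y \<in> G" using step by (auto simp: G span_base)
        have "contract b c ys \<in> U"
        proof (rule Suc.IH[OF contract_alt[OF Suc.prems(1) b]])
          fix zs assume "set zs \<subseteq> B" "length zs = u"
          then show "contract b c zs \<in> U" using Suc.prems(2)[of "b # zs"] step by simp
        qed
        then show ?case
          using alt_forms_lin_head[OF Suc.prems(1) b Y sG, of r 1 ys] step U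
            subspace_comb[OF sG b Y, of r 1]
          by (simp add: subspace_add subspace_scale)
      qed
      then show ?thesis using Cons by simp
    next
      case False
      then show ?thesis
        using Cons alt_forms_out[OF Suc.prems(1), of xs] U by (simp add: subspace_0)
    qed
  qed
qed

lemma alt_forms_zero_span:
  assumes "c \<in> alt_forms G W u" "G = span B" "\<And>xs. set xs \<subseteq> B \<Longrightarrow> length xs = u \<Longrightarrow> c xs = 0"
  shows "c = 0"
  using alt_forms_values[OF assms(1,2), of "{0}"] assms(3) by (auto simp: fun_eq_iff)

text \<open>The sign is that of a cycle of length \<open>length ys + 1\<close>.\<close>

lemma alt_forms_move:
  assumes "c \<in> alt_forms G W u" "subspace G" "Y \<in> G" "set ys \<subseteq> G"
  shows "c (ys @ Y # zs) = (-1) ^ length ys *\<^sub>R c (Y # ys @ zs)"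
  using assms
proof (induction ys arbitrary: c u)
  case Nil
  then show ?case by simp
next
  case (Cons X ys)
  show ?case
  proof (cases u)
    case 0
    then show ?thesis using Cons.prems by (auto simp: alt_forms_0_iff)
  next
    case (Suc v)
    have "contract X c (ys @ Y # zs) = (-1) ^ length ys *\<^sub>R contract X c (Y # ys @ zs)"
      using Cons.prems Suc by (intro Cons.IH contract_alt) auto
    moreover have "X \<in> G" using Cons.prems by simp
    ultimately show ?thesis
      using contract_anticommute[OF Cons.prems(1) _ Cons.prems(3,2), of X "ys @ zs"]
      by simp
  qed
qed

text \<open>A permutation of the arguments changes the value by a sign only.\<close>

lemma alt_forms_mset_zero:
  assumes "c \<in> alt_forms G W u" "subspace G" "mset xs = mset ys" "c xs = 0"
  shows "c ys = 0"
proof (cases "set xs \<subseteq> G")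
  case True
  then show ?thesis using assms
  proof (induction xs arbitrary: c u ys)
    case Nil
    then show ?case by simp
  next
    case (Cons X xs)
    then have "X \<in> set ys" by (metis list.set_intros(1) mset_eq_setD)
    then obtain as bs where ys: "ys = as @ X # bs" by (meson split_list)
    have XG: "X \<in> G" and sxs: "set xs \<subseteq> G" using Cons.prems by auto
    have set: "set (X # xs) = set ys" using Cons.prems(4) by (metis mset_eq_setD)
    show ?case
    proof (cases u)
      case 0
      then show ?thesis using Cons.prems ys by (auto simp: alt_forms_0_iff)
    next
      case (Suc v)
      have c: "contract X c \<in> alt_forms G W v"
        using Cons.prems(2) Suc XG by (intro contract_alt) auto
      have "contract X c (as @ bs) = 0"
        using Cons.prems ys by (intro Cons.IH[OF sxs c Cons.prems(3), of "as @ bs"]) auto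
      then show ?thesis
        using alt_forms_move[OF Cons.prems(2,3) XG, of as bs] set Cons.prems ys by auto
    qed
  qed
next
  case False
  then show ?thesis
    using alt_forms_out[OF assms(1), of ys] mset_eq_setD[OF assms(3)] by auto
qed

lemma post_alt:
  assumes c: "c \<in> alt_forms G W u" and f: "lin_on W U f" and W: "subspace W"
  shows "f \<circ> c \<in> alt_forms G U u"
proof -
  have m: "c xs \<in> W" for xs by (rule alt_forms_mem[OF W c])
  have "f 0 = 0" by (rule lin_on_zero[OF f W])
  note f0 = this
  show ?thesis
    unfolding alt_forms_def mem_Collect_eq
  proof (intro conjI allI impI ballI)
    fix xs show "(f \<circ> c) xs \<in> U" using lin_on_in[OF f m] by simp
    show "(f \<circ> c) xs = 0" if "\<not> (length xs = u \<and> set xs \<subseteq> G)"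
      using alt_forms_out[OF c that] f0 by simp
    fix i x y r s
    assume "length xs = u \<and> set xs \<subseteq> G" "i < u" "x \<in> G" "y \<in> G"
    then show "(f \<circ> c) (xs[i := r *\<^sub>R x + s *\<^sub>R y]) = r *\<^sub>R (f \<circ> c) (xs[i := x]) + s *\<^sub>R (f \<circ> c) (xs[i := y])"
      using alt_forms_slot[OF c, of xs i x y r s] lin_on_comb[OF f m m] by simp
  next
    fix xs i j assume "length xs = u \<and> set xs \<subseteq> G" "i < j \<and> j < u \<and> xs ! i = xs ! j"
    then show "(f \<circ> c) xs = 0"
      using alt_forms_repeat[OF c, of i j xs] f0 by simp
  qed
qed

text \<open>The differential and the exterior multiplication by a one-form both satisfy
  \<open>\<iota>\<^sub>X K = A\<^sub>X - K \<iota>\<^sub>X\<close> with some \<open>A\<^sub>X\<close> that preserves forms and commutes with \<open>\<iota>\<^sub>X\<close>. By induction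
  on the degree this relation is all that is needed for \<open>K\<close> to have alternating values.\<close>

lemma odd_operator_alt:
  fixes K :: "('g::real_vector list \<Rightarrow> 'v::real_vector) \<Rightarrow> 'g list \<Rightarrow> 'w::real_vector"
  assumes G: "subspace G" and V: "subspace V" and W: "subspace W"
    and K0: "K 0 = 0"
    and nil: "\<And>u c. c \<in> alt_forms G V u \<Longrightarrow> K c [] = 0"
    and out: "\<And>u c X. c \<in> alt_forms G V u \<Longrightarrow> X \<notin> G \<Longrightarrow> contract X (K c) = 0"
    and lin: "\<And>u c d r s. c \<in> alt_forms G V u \<Longrightarrow> d \<in> alt_forms G V u \<Longrightarrow> K (r *\<^sub>R c + s *\<^sub>R d) = r *\<^sub>R K c + s *\<^sub>R K d"
    and K: "\<And>u c X. c \<in> alt_forms G V u \<Longrightarrow> X \<in> G \<Longrightarrow> contract X (K c) = A X c - K (contract X c)"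
    and A: "\<And>u c X. c \<in> alt_forms G V u \<Longrightarrow> X \<in> G \<Longrightarrow> A X c \<in> alt_forms G W u"
    and Alin: "\<And>u c X Y r s. c \<in> alt_forms G V u \<Longrightarrow> X \<in> G \<Longrightarrow> Y \<in> G \<Longrightarrow>
        A (r *\<^sub>R X + s *\<^sub>R Y) c = r *\<^sub>R A X c + s *\<^sub>R A Y c"
    and Acomm: "\<And>u c X. c \<in> alt_forms G V (Suc u) \<Longrightarrow> X \<in> G \<Longrightarrow>
        contract X (A X c) = A X (contract X c)"
    and c: "c \<in> alt_forms G V u"
  shows "K c \<in> alt_forms G W (Suc u)"
  using c
proof (induction u arbitrary: c)
  case 0
  have contr: "contract X (K c) = A X c" if "X \<in> G" for X
    using K[OF 0 that] K0 contract_0[OF 0, of X] by simp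
  show ?case
  proof (rule alt_forms_SucI[OF G nil[OF 0] out[OF 0]])
    fix X assume "X \<in> G"
    then show "contract X (K c) \<in> alt_forms G W 0" using contr A[OF 0] by simp
    show "contract X (contract X (K c)) = 0"
      using contr[OF \<open>X \<in> G\<close>] A[OF 0 \<open>X \<in> G\<close>] contract_0 by metis
  next
    fix X Y r s assume "X \<in> G" "Y \<in> G"
    then show "contract (r *\<^sub>R X + s *\<^sub>R Y) (K c) = r *\<^sub>R contract X (K c) + s *\<^sub>R contract Y (K c)"
      using contr Alin[OF 0] by (simp add: subspace_comb[OF G])
  qed
next
  case (Suc u)
  note c = Suc.prems
  show ?case
  proof (rule alt_forms_SucI[OF G nil[OF c] out[OF c]])
    fix X assume X: "X \<in> G"
    show "contract X (K c) \<in> alt_forms G W (Suc u)"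
      unfolding K[OF c X]
      by (rule subspace_diff[OF subspace_alt_forms[OF W] A[OF c X] Suc.IH[OF contract_alt[OF c X]]])
    have XXc: "contract X (contract X c) = 0"
      using alt_forms_repeat[OF c, of 0 1 "X # X # xs" for xs] by (simp add: fun_eq_iff)
    have "contract X (contract X (K c)) =
        contract X (A X c) - (A X (contract X c) - K (contract X (contract X c)))"
      unfolding K[OF c X] contract_diff K[OF contract_alt[OF c X] X] ..
    then show "contract X (contract X (K c)) = 0"
      unfolding XXc K0 Acomm[OF c X] by simp
  next
    fix X Y r s assume X: "X \<in> G" and Y: "Y \<in> G"
    have "contract (r *\<^sub>R X + s *\<^sub>R Y) c = r *\<^sub>R contract X c + s *\<^sub>R contract Y c"
      using alt_forms_lin_head[OF c X Y G] by (simp add: fun_eq_iff)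
    then have "contract (r *\<^sub>R X + s *\<^sub>R Y) (K c) =
        r *\<^sub>R A X c + s *\<^sub>R A Y c - (r *\<^sub>R K (contract X c) + s *\<^sub>R K (contract Y c))"
      unfolding K[OF c subspace_comb[OF G X Y]] Alin[OF c X Y]
      using lin[OF contract_alt[OF c X] contract_alt[OF c Y], of r s] by simp
    then show "contract (r *\<^sub>R X + s *\<^sub>R Y) (K c) = r *\<^sub>R contract X (K c) + s *\<^sub>R contract Y (K c)"
      unfolding K[OF c X] K[OF c Y] by (simp add: scaleR_diff_right)
  qed
qed

section \<open>Exterior multiplication by one-forms with values in endomorphisms\<close>

text \<open>For \<open>\<gamma>\<close> the action on a module this is the part of the differential that involves the action; for a
  cocycle \<open>\<gamma>\<close> with values in linear maps it is the cup product with \<open>\<gamma>\<close>.\<close>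

definition wedge :: "'g set \<Rightarrow> ('g \<Rightarrow> 'v \<Rightarrow> 'w::real_vector) \<Rightarrow> ('g list \<Rightarrow> 'v) \<Rightarrow> 'g list \<Rightarrow> 'w"
  where "wedge G \<gamma> c xs =
    (if set xs \<subseteq> G then \<Sum>i<length xs. (-1) ^ i *\<^sub>R \<gamma> (xs ! i) (c (nths xs (- {i}))) else 0)"

lemma nths_Cons_delete_0: "nths (X # xs) (- {0}) = xs"
proof -
  have "{j. Suc j \<in> - {0}} = UNIV" by auto
  then show ?thesis by (simp add: nths_Cons nths_all)
qed

lemma nths_Cons_delete_Suc: "nths (X # xs) (- {Suc i}) = X # nths xs (- {i})"
proof -
  have "{j. Suc j \<in> - {Suc i}} = - {i}" by auto
  then show ?thesis by (simp add: nths_Cons)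
qed

lemma nths_delete: "i < length xs \<Longrightarrow> nths xs (- {i}) = take i xs @ drop (Suc i) xs"
proof (induction xs arbitrary: i)
  case (Cons x xs)
  then show ?case by (cases i) (simp_all add: nths_Cons_delete_0 nths_Cons_delete_Suc)
qed simp

lemma wedge_Cons:
  assumes X: "X \<in> G"
  shows "contract X (wedge G \<gamma> c) xs =
    (if set xs \<subseteq> G then \<gamma> X (c xs) else 0) - wedge G \<gamma> (contract X c) xs"
proof (cases "set xs \<subseteq> G")
  case True
  then show ?thesis
    using X by (simp add: wedge_def sum.lessThan_Suc_shift nths_Cons_delete_0 nths_Cons_delete_Suc
        sum_negf del: sum.lessThan_Suc)
qed (simp add: wedge_def)

lemma contract_wedge:
  assumes X: "X \<in> G" and c: "c \<in> alt_forms G V u" and \<gamma>: "\<gamma> X 0 = 0"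
  shows "contract X (wedge G \<gamma> c) = (\<gamma> X \<circ> c) - wedge G \<gamma> (contract X c)"
proof
  fix xs
  show "contract X (wedge G \<gamma> c) xs = ((\<gamma> X \<circ> c) - wedge G \<gamma> (contract X c)) xs"
    using wedge_Cons[OF X, of \<gamma> c xs] alt_forms_out[OF c, of xs] \<gamma> by (cases "set xs \<subseteq> G") auto
qed

lemma wedge_lin:
  assumes "\<And>X. X \<in> G \<Longrightarrow> lin_on V W (\<gamma> X)" "subspace V" "c \<in> alt_forms G V u" "d \<in> alt_forms G V u"
  shows "wedge G \<gamma> (r *\<^sub>R c + s *\<^sub>R d) = r *\<^sub>R wedge G \<gamma> c + s *\<^sub>R wedge G \<gamma> d"
proof
  fix xs
  have "\<gamma> (xs ! i) (r *\<^sub>R c zs + s *\<^sub>R d zs) = r *\<^sub>R \<gamma> (xs ! i) (c zs) + s *\<^sub>R \<gamma> (xs ! i) (d zs)"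
    if "set xs \<subseteq> G" "i < length xs" for i zs
    using that by (intro lin_on_comb[OF assms(1) alt_forms_mem[OF assms(2,3)] alt_forms_mem[OF assms(2,4)]]) auto
  then have "(\<Sum>i<length xs. (-1) ^ i *\<^sub>R \<gamma> (xs ! i) (r *\<^sub>R c (nths xs (- {i})) + s *\<^sub>R d (nths xs (- {i})))) =
      (\<Sum>i<length xs. r *\<^sub>R ((-1) ^ i *\<^sub>R \<gamma> (xs ! i) (c (nths xs (- {i})))) +
        s *\<^sub>R ((-1) ^ i *\<^sub>R \<gamma> (xs ! i) (d (nths xs (- {i})))))" if "set xs \<subseteq> G"
    using that by (intro sum.cong refl) (simp add: scaleR_add_right mult.commute)
  then show "wedge G \<gamma> (r *\<^sub>R c + s *\<^sub>R d) xs = (r *\<^sub>R wedge G \<gamma> c + s *\<^sub>R wedge G \<gamma> d) xs"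
    by (simp add: wedge_def scaleR_sum_right sum.distrib)
qed

lemma wedge_alt:
  assumes G: "subspace G" and V: "subspace V" and W: "subspace W"
    and \<gamma>: "\<And>X. X \<in> G \<Longrightarrow> lin_on V W (\<gamma> X)"
    and \<gamma>lin: "\<And>X Y r s v. X \<in> G \<Longrightarrow> Y \<in> G \<Longrightarrow> v \<in> V \<Longrightarrow> \<gamma> (r *\<^sub>R X + s *\<^sub>R Y) v = r *\<^sub>R \<gamma> X v + s *\<^sub>R \<gamma> Y v"
    and c: "c \<in> alt_forms G V u"
  shows "wedge G \<gamma> c \<in> alt_forms G W (Suc u)"
proof (rule odd_operator_alt[where A = "\<lambda>X c. \<gamma> X \<circ> c", OF G V W _ _ _ _ _ _ _ _ c])
  have z: "\<gamma> X 0 = 0" if "X \<in> G" for X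
    using lin_on_zero[OF \<gamma>[OF that] V] .
  show "wedge G \<gamma> 0 = 0"
    by (auto simp: wedge_def fun_eq_iff z subset_iff intro!: sum.neutral)
  fix u c d X Y and r s :: real assume c: "c \<in> alt_forms G V u"
  show "wedge G \<gamma> c [] = 0" by (simp add: wedge_def)
  show "contract X (wedge G \<gamma> c) = 0" if "X \<notin> G" using that by (auto simp: wedge_def fun_eq_iff)
  show "contract X (wedge G \<gamma> c) = (\<gamma> X \<circ> c) - wedge G \<gamma> (contract X c)" if "X \<in> G"
    by (rule contract_wedge[where V = V and u = u]) (use that c z in auto)
  show "\<gamma> X \<circ> c \<in> alt_forms G W u" if "X \<in> G"
    by (rule post_alt[OF c \<gamma>[OF that] V])
  show "\<gamma> (r *\<^sub>R X + s *\<^sub>R Y) \<circ> c = r *\<^sub>R (\<gamma> X \<circ> c) + s *\<^sub>R (\<gamma> Y \<circ> c)" if "X \<in> G" "Y \<in> G"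
    using \<gamma>lin[OF that] alt_forms_mem[OF V c] by (simp add: fun_eq_iff)
  show "wedge G \<gamma> (r *\<^sub>R c + s *\<^sub>R d) = r *\<^sub>R wedge G \<gamma> c + s *\<^sub>R wedge G \<gamma> d" if "d \<in> alt_forms G V u"
    using wedge_lin[OF \<gamma> V c that] .
qed (simp add: fun_eq_iff)

section \<open>Cartan calculus on Chevalley--Eilenberg cochains\<close>

lemma alt_forms_eqI:
  assumes c: "c \<in> alt_forms G W (Suc u)" and c': "c' \<in> alt_forms G W (Suc u)"
    and eq: "\<And>X. X \<in> G \<Longrightarrow> contract X c = contract X c'"
  shows "c = c'"
proof (rule form_eqI)
  show "c [] = c' []" using alt_forms_out[OF c, of "[]"] alt_forms_out[OF c', of "[]"] by simp
  show "contract X c = contract X c'" for X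
    using eq[of X] contract_out[OF c, of X] contract_out[OF c', of X] by (cases "X \<in> G") auto
qed

lemma alt_forms_0_eqI:
  assumes "c \<in> alt_forms G W 0" "c' \<in> alt_forms G W 0" "c [] = c' []"
  shows "c = c'"
proof
  fix xs show "c xs = c' xs" using assms by (cases "xs = []") (auto simp: alt_forms_0_iff)
qed

text \<open>The derivation induced by \<open>D\<close> on multilinear maps, up to sign.\<close>

definition slots :: "'g set \<Rightarrow> ('g \<Rightarrow> 'g) \<Rightarrow> ('g list \<Rightarrow> 'w::real_vector) \<Rightarrow> 'g list \<Rightarrow> 'w"
  where "slots G D c xs = (if set xs \<subseteq> G then \<Sum>j<length xs. c (xs[j := D (xs ! j)]) else 0)"

lemma contract_slots:
  assumes Y: "Y \<in> G" and c: "c \<in> alt_forms G W u"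
  shows "contract Y (slots G D c) = contract (D Y) c + slots G D (contract Y c)"
proof
  fix xs
  show "contract Y (slots G D c) xs = (contract (D Y) c + slots G D (contract Y c)) xs"
    using Y alt_forms_out[OF c, of "D Y # xs"]
    by (auto simp: slots_def sum.lessThan_Suc_shift simp del: sum.lessThan_Suc)
qed

lemma slots_0: "c \<in> alt_forms G W 0 \<Longrightarrow> slots G D c = 0"
proof
  fix xs assume c: "c \<in> alt_forms G W 0"
  have "c (xs[j := Y]) = 0" if "j < length xs" for j Y
    using that by (intro alt_forms_out[OF c]) auto
  then show "slots G D c xs = 0 xs" by (simp add: slots_def)
qed

lemma slots_lin: "slots G D (r *\<^sub>R c + s *\<^sub>R c') = r *\<^sub>R slots G D c + s *\<^sub>R slots G D c'"
  by (auto simp: slots_def fun_eq_iff sum.distrib scaleR_sum_right)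

lemma slots_zero: "slots G D 0 = 0"
  by (auto simp: slots_def fun_eq_iff)

lemma slots_alt:
  assumes G: "subspace G" and W: "subspace W" and D: "lin_on G G D" and c: "c \<in> alt_forms G W u"
  shows "slots G D c \<in> alt_forms G W u"
  using c
proof (induction u arbitrary: c)
  case 0
  show ?case unfolding slots_0[OF 0] by (rule subspace_0[OF subspace_alt_forms[OF W]])
next
  case (Suc u)
  note c = Suc.prems
  show ?case
  proof (rule alt_forms_SucI[OF G])
    show "slots G D c [] = 0" by (simp add: slots_def)
    fix X
    show "contract X (slots G D c) = 0" if "X \<notin> G" using that by (auto simp: slots_def fun_eq_iff)
    assume X: "X \<in> G"
    show "contract X (slots G D c) \<in> alt_forms G W u"
      unfolding contract_slots[OF X c]
      by (rule subspace_add[OF subspace_alt_forms[OF W] contract_alt[OF c lin_on_in[OF D X]]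
            Suc.IH[OF contract_alt[OF c X]]])
    have "contract X (contract X (slots G D c)) = contract X (contract (D X) c) +
        (contract (D X) (contract X c) + slots G D (contract X (contract X c)))"
      unfolding contract_slots[OF X c] contract_add contract_slots[OF X contract_alt[OF c X]] ..
    moreover have "contract X (contract X c) = 0"
      using alt_forms_repeat[OF c, of 0 1 "X # X # xs" for xs] by (simp add: fun_eq_iff)
    moreover have "contract X (contract (D X) c) = - contract (D X) (contract X c)"
      using contract_anticommute[OF c lin_on_in[OF D X] X G] by (simp add: fun_eq_iff)
    ultimately show "contract X (contract X (slots G D c)) = 0"
      by (simp add: slots_zero)
  next
    fix X Y r s assume X: "X \<in> G" and Y: "Y \<in> G"
    have "contract (r *\<^sub>R X + s *\<^sub>R Y) c = r *\<^sub>R contract X c + s *\<^sub>R contract Y c"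
      using alt_forms_lin_head[OF c X Y G] by (simp add: fun_eq_iff)
    moreover have "contract (D (r *\<^sub>R X + s *\<^sub>R Y)) c = r *\<^sub>R contract (D X) c + s *\<^sub>R contract (D Y) c"
      unfolding lin_on_comb[OF D X Y]
      using alt_forms_lin_head[OF c lin_on_in[OF D X] lin_on_in[OF D Y] G] by (simp add: fun_eq_iff)
    ultimately show "contract (r *\<^sub>R X + s *\<^sub>R Y) (slots G D c) =
        r *\<^sub>R contract X (slots G D c) + s *\<^sub>R contract Y (slots G D c)"
      unfolding contract_slots[OF X c] contract_slots[OF Y c] contract_slots[OF subspace_comb[OF G X Y] c]
      by (simp add: slots_lin scaleR_add_right)
  qed
qed

lemma alt_forms_replace:
  assumes c: "c \<in> alt_forms G W u" and G: "subspace G" and xs: "set xs \<subseteq> G" and j: "j < length xs"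
    and Y: "Y \<in> G"
  shows "c (Y # nths xs (- {j})) = (-1) ^ j *\<^sub>R c (xs[j := Y])"
proof -
  have t: "set (take j xs) \<subseteq> G" using xs set_take_subset[of j xs] by blast
  have "c (take j xs @ Y # drop (Suc j) xs) = (-1) ^ j *\<^sub>R c (Y # take j xs @ drop (Suc j) xs)"
    using alt_forms_move[OF c G Y t, of "drop (Suc j) xs"] j by simp
  then show ?thesis
    using j by (simp add: upd_conv_take_nth_drop nths_delete power_mult_distrib[symmetric])
qed

lemma nths_Cons_delete_0_Suc: "nths (X # xs) (- {0, Suc j}) = nths xs (- {j})"
proof -
  have "{k. Suc k \<in> - {0, Suc j}} = - {j}" by auto
  then show ?thesis by (simp add: nths_Cons)
qed

lemma nths_Cons_delete_Suc_Suc: "nths (X # xs) (- {Suc i, Suc j}) = X # nths xs (- {i, j})"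
proof -
  have "{k. Suc k \<in> - {Suc i, Suc j}} = - {i, j}" by auto
  then show ?thesis by (simp add: nths_Cons)
qed

definition lie_deriv ::
  "'g lie_alg \<Rightarrow> ('g, 'w::real_vector) lie_module \<Rightarrow> 'g \<Rightarrow> ('g list \<Rightarrow> 'w) \<Rightarrow> 'g list \<Rightarrow> 'w"
  where "lie_deriv g M X c = (lm_act M X \<circ> c) - slots (la_carrier g) (la_bracket g X) c"

locale lie_algebra_on =
  fixes g :: "'g::real_vector lie_alg"
  assumes sub_alg: "subspace (la_carrier g)"
    and bracket_lin: "X \<in> la_carrier g \<Longrightarrow> lin_on (la_carrier g) (la_carrier g) (la_bracket g X)"
    and bracket_anti: "X \<in> la_carrier g \<Longrightarrow> Y \<in> la_carrier g \<Longrightarrow> la_bracket g X Y = - la_bracket g Y X"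
    and jacobi: "X \<in> la_carrier g \<Longrightarrow> Y \<in> la_carrier g \<Longrightarrow> Z \<in> la_carrier g \<Longrightarrow>
      la_bracket g X (la_bracket g Y Z) = la_bracket g (la_bracket g X Y) Z + la_bracket g Y (la_bracket g X Z)"
begin

lemma bracket_in: "X \<in> la_carrier g \<Longrightarrow> Y \<in> la_carrier g \<Longrightarrow> la_bracket g X Y \<in> la_carrier g"
  by (rule lin_on_in[OF bracket_lin])

lemma bracket_self: "X \<in> la_carrier g \<Longrightarrow> la_bracket g X X = 0"
  using bracket_anti[of X X] scaleR_2[of "la_bracket g X X"] by (simp add: eq_neg_iff_add_eq_0)

lemma bracket_lin_left:
  assumes "X \<in> la_carrier g" "Y \<in> la_carrier g" "Z \<in> la_carrier g"
  shows "la_bracket g (r *\<^sub>R X + s *\<^sub>R Y) Z = r *\<^sub>R la_bracket g X Z + s *\<^sub>R la_bracket g Y Z"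
  using assms lin_on_comb[OF bracket_lin[OF assms(3)] assms(1,2), of r s]
    bracket_anti[OF subspace_comb[OF sub_alg assms(1,2), of r s] assms(3)]
    bracket_anti[of X Z] bracket_anti[of Y Z]
  by simp

end

locale lie_module_on = lie_algebra_on g for g :: "'g::real_vector lie_alg" +
  fixes M :: "('g, 'w::real_vector) lie_module"
  assumes sub_mod: "subspace (lm_carrier M)"
    and act_lin: "X \<in> la_carrier g \<Longrightarrow> lin_on (lm_carrier M) (lm_carrier M) (lm_act M X)"
    and act_lin_left: "X \<in> la_carrier g \<Longrightarrow> Y \<in> la_carrier g \<Longrightarrow> v \<in> lm_carrier M \<Longrightarrow>
      lm_act M (r *\<^sub>R X + s *\<^sub>R Y) v = r *\<^sub>R lm_act M X v + s *\<^sub>R lm_act M Y v"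
    and act_bracket: "X \<in> la_carrier g \<Longrightarrow> Y \<in> la_carrier g \<Longrightarrow> v \<in> lm_carrier M \<Longrightarrow>
      lm_act M (la_bracket g X Y) v = lm_act M X (lm_act M Y v) - lm_act M Y (lm_act M X v)"
begin

abbreviation G where "G \<equiv> la_carrier g"
abbreviation V where "V \<equiv> lm_carrier M"
abbreviation br where "br \<equiv> la_bracket g"
abbreviation act where "act \<equiv> lm_act M"
abbreviation Alt where "Alt \<equiv> alt_forms G V"
abbreviation d where "d \<equiv> ce_diff g M"
abbreviation lied where "lied \<equiv> lie_deriv g M"

lemma sub_Alt: "subspace (Alt u)"
  by (rule subspace_alt_forms[OF sub_mod])

lemma Alt_mem: "c \<in> Alt u \<Longrightarrow> c xs \<in> V"
  by (rule alt_forms_mem[OF sub_mod])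

lemma act_in: "X \<in> G \<Longrightarrow> v \<in> V \<Longrightarrow> act X v \<in> V"
  by (rule lin_on_in[OF act_lin])

lemma act_0: "X \<in> G \<Longrightarrow> act X 0 = 0"
  by (rule lin_on_zero[OF act_lin sub_mod])

lemma lied_alt:
  assumes X: "X \<in> G" and c: "c \<in> Alt u"
  shows "lied X c \<in> Alt u"
  unfolding lie_deriv_def
  by (rule subspace_diff[OF sub_Alt post_alt[OF c act_lin[OF X] sub_mod]
        slots_alt[OF sub_alg sub_mod bracket_lin[OF X] c]])

lemma lied_lin:
  assumes X: "X \<in> G" and c: "c \<in> Alt u" and c': "c' \<in> Alt u"
  shows "lied X (r *\<^sub>R c + s *\<^sub>R c') = r *\<^sub>R lied X c + s *\<^sub>R lied X c'"
proof -
  have "act X \<circ> (r *\<^sub>R c + s *\<^sub>R c') = r *\<^sub>R (act X \<circ> c) + s *\<^sub>R (act X \<circ> c')"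
    using lin_on_comb[OF act_lin[OF X] Alt_mem[OF c] Alt_mem[OF c']] by (simp add: fun_eq_iff)
  then show ?thesis
    by (simp add: lie_deriv_def slots_lin scaleR_diff_right)
qed

lemma lied_lin_on: "X \<in> G \<Longrightarrow> lin_on (Alt u) (Alt u) (lied X)"
  by (auto intro: lin_onI simp: lied_alt lied_lin)

lemma lied_lin_left:
  assumes X: "X \<in> G" and Y: "Y \<in> G" and c: "c \<in> Alt u"
  shows "lied (r *\<^sub>R X + s *\<^sub>R Y) c = r *\<^sub>R lied X c + s *\<^sub>R lied Y c"
proof
  fix xs
  have "c (xs[j := br (r *\<^sub>R X + s *\<^sub>R Y) (xs ! j)]) =
      r *\<^sub>R c (xs[j := br X (xs ! j)]) + s *\<^sub>R c (xs[j := br Y (xs ! j)])"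
    if xs: "set xs \<subseteq> G" and j: "j < length xs" for j
  proof (cases "length xs = u")
    case True
    have "xs ! j \<in> G" using xs j by auto
    then show ?thesis
      unfolding bracket_lin_left[OF X Y \<open>xs ! j \<in> G\<close>]
      using X Y True j xs by (intro alt_forms_slot[OF c]) (auto intro: bracket_in)
  next
    case False
    then show ?thesis by (simp add: alt_forms_out[OF c])
  qed
  then show "lied (r *\<^sub>R X + s *\<^sub>R Y) c xs = (r *\<^sub>R lied X c + s *\<^sub>R lied Y c) xs"
    by (auto simp: lie_deriv_def slots_def act_lin_left[OF X Y Alt_mem[OF c]] sum.distrib
        scaleR_sum_right scaleR_diff_right)
qed

lemma contract_lied:
  assumes X: "X \<in> G" and Y: "Y \<in> G" and c: "c \<in> Alt u"
  shows "contract Y (lied X c) = lied X (contract Y c) - contract (br X Y) c"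
proof -
  have "contract Y (act X \<circ> c) = act X \<circ> contract Y c" by (simp add: fun_eq_iff)
  then show ?thesis
    by (simp add: lie_deriv_def contract_diff contract_slots[OF Y c])
qed

text \<open>Cartan's formula. The bracket terms of the differential that involve the first argument
  are exactly those of the Lie derivative, once the bracket is moved back to its place.\<close>

lemma contract_ce_diff:
  assumes X: "X \<in> G" and c: "c \<in> Alt u"
  shows "contract X (d c) = lied X c - d (contract X c)"
proof
  fix xs
  show "contract X (d c) xs = (lied X c - d (contract X c)) xs"
  proof (cases "set xs \<subseteq> G")
    case False
    then show ?thesis
      using alt_forms_out[OF c, of xs] act_0[OF X]
      by (simp add: ce_diff_def lie_deriv_def slots_def)
  next
    case True
    have 1: "(-1) ^ (Suc j) *\<^sub>R c (br X (xs ! j) # nths xs (- {j})) = - c (xs[j := br X (xs ! j)])"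
      if "j < length xs" for j
    proof -
      have "xs ! j \<in> G" using that True by auto
      then have "br X (xs ! j) \<in> G" by (rule bracket_in[OF X])
      then show ?thesis
        using alt_forms_replace[OF c sub_alg True that] by (simp add: power_mult_distrib[symmetric])
    qed
    have 2: "c (br (xs ! i) (xs ! j) # X # zs) = - c (X # br (xs ! i) (xs ! j) # zs)"
      if "i < length xs" "j < length xs" for i j zs
    proof (rule contract_anticommute[OF c _ X sub_alg])
      show "br (xs ! i) (xs ! j) \<in> G" using that True by (intro bracket_in) auto
    qed
    have A: "(\<Sum>i<length (X # xs). (-1) ^ i *\<^sub>R act ((X # xs) ! i) (c (nths (X # xs) (- {i})))) =
        act X (c xs) - (\<Sum>i<length xs. (-1) ^ i *\<^sub>R act (xs ! i) (c (X # nths xs (- {i}))))"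
      by (simp add: sum.lessThan_Suc_shift nths_Cons_delete_0 nths_Cons_delete_Suc sum_negf
          del: sum.lessThan_Suc)
    have "(\<Sum>j<length (X # xs). \<Sum>i<j. (-1) ^ (i + j) *\<^sub>R
          c (br ((X # xs) ! i) ((X # xs) ! j) # nths (X # xs) (- {i, j}))) =
        (\<Sum>j<length xs. (-1) ^ (Suc j) *\<^sub>R c (br X (xs ! j) # nths xs (- {j})) +
          (\<Sum>i<j. (-1) ^ (i + j) *\<^sub>R c (br (xs ! i) (xs ! j) # X # nths xs (- {i, j}))))"
      by (simp add: sum.lessThan_Suc_shift nths_Cons_delete_0_Suc nths_Cons_delete_Suc_Suc
          del: sum.lessThan_Suc)
    also have "\<dots> = (\<Sum>j<length xs. - c (xs[j := br X (xs ! j)]) -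
          (\<Sum>i<j. (-1) ^ (i + j) *\<^sub>R c (X # br (xs ! i) (xs ! j) # nths xs (- {i, j}))))"
    proof (rule sum.cong[OF refl])
      fix j assume j: "j \<in> {..<length xs}"
      have "(\<Sum>i<j. (-1) ^ (i + j) *\<^sub>R c (br (xs ! i) (xs ! j) # X # nths xs (- {i, j}))) =
          (\<Sum>i<j. - ((-1) ^ (i + j) *\<^sub>R c (X # br (xs ! i) (xs ! j) # nths xs (- {i, j}))))"
        using j by (intro sum.cong refl) (simp add: 2)
      then show "(-1) ^ (Suc j) *\<^sub>R c (br X (xs ! j) # nths xs (- {j})) +
          (\<Sum>i<j. (-1) ^ (i + j) *\<^sub>R c (br (xs ! i) (xs ! j) # X # nths xs (- {i, j}))) =
          - c (xs[j := br X (xs ! j)]) -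
          (\<Sum>i<j. (-1) ^ (i + j) *\<^sub>R c (X # br (xs ! i) (xs ! j) # nths xs (- {i, j})))"
        using j 1[of j] by (simp add: sum_negf)
    qed
    finally have B: "(\<Sum>j<length (X # xs). \<Sum>i<j. (-1) ^ (i + j) *\<^sub>R
          c (br ((X # xs) ! i) ((X # xs) ! j) # nths (X # xs) (- {i, j}))) =
        - (\<Sum>j<length xs. c (xs[j := br X (xs ! j)])) -
        (\<Sum>j<length xs. \<Sum>i<j. (-1) ^ (i + j) *\<^sub>R c (X # br (xs ! i) (xs ! j) # nths xs (- {i, j})))"
      by (simp add: sum_subtractf sum_negf)
    show ?thesis
      using True X
      by (simp only: contract_apply minus_apply ce_diff_def lie_deriv_def slots_def A B o_apply
          set_simps insert_subset simp_thms if_True) simp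
  qed
qed

lemma ce_diff_lin:
  assumes c: "c \<in> Alt u" and c': "c' \<in> Alt u"
  shows "d (r *\<^sub>R c + s *\<^sub>R c') = r *\<^sub>R d c + s *\<^sub>R d c'"
proof
  fix xs
  have "act (xs ! i) (r *\<^sub>R c zs + s *\<^sub>R c' zs) = r *\<^sub>R act (xs ! i) (c zs) + s *\<^sub>R act (xs ! i) (c' zs)"
    if "set xs \<subseteq> G" "i < length xs" for i zs
    using that by (intro lin_on_comb[OF act_lin Alt_mem[OF c] Alt_mem[OF c']]) auto
  then show "d (r *\<^sub>R c + s *\<^sub>R c') xs = (r *\<^sub>R d c + s *\<^sub>R d c') xs"
    by (auto simp: ce_diff_def scaleR_sum_right sum.distrib scaleR_add_right mult.commute)
qed

lemma ce_diff_0: "d 0 = 0"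
  using ce_diff_lin[of 0 0 0 0 0] subspace_0[OF sub_Alt] by simp

lemma ce_diff_alt:
  assumes c: "c \<in> Alt u"
  shows "d c \<in> Alt (Suc u)"
proof (rule odd_operator_alt[where K = d and A = lied and u = u and c = c, OF sub_alg sub_mod sub_mod ce_diff_0 _ _ _ _ _ _ _ c])
  fix u c X
  show "d c [] = 0" by (simp add: ce_diff_def)
  show "contract X (d c) = 0" if "X \<notin> G" using that by (auto simp: ce_diff_def fun_eq_iff)
  show "contract X (lied X c) = lied X (contract X c)" if c: "c \<in> Alt (Suc u)" and X: "X \<in> G"
  proof -
    have "contract (br X X) c = 0"
      unfolding bracket_self[OF X]
      using alt_forms_lin_head[OF c _ _ sub_alg, of 0 0 0 0] subspace_0[OF sub_alg]
      by (simp add: fun_eq_iff)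
    then show ?thesis using contract_lied[OF X X c] by simp
  qed
qed (simp_all add: ce_diff_lin contract_ce_diff lied_alt lied_lin_left)

lemma ce_diff_lin_on: "lin_on (Alt u) (Alt (Suc u)) d"
  by (auto intro: lin_onI simp: ce_diff_alt ce_diff_lin)

text \<open>As in the two lemmas that follow, both sides have the same contractions by the induction
  hypothesis, and a form of positive degree is determined by its contractions.\<close>

lemma lied_commutator:
  assumes X: "X \<in> G" and Y: "Y \<in> G" and c: "c \<in> Alt u"
  shows "lied X (lied Y c) = lied Y (lied X c) + lied (br X Y) c"
  using c
proof (induction u arbitrary: c)
  case 0
  note m = Alt_mem[OF 0]
  show ?case
    using act_bracket[OF X Y m] X Y 0
    by (intro alt_forms_0_eqI[of _ G V] lied_alt subspace_add[OF sub_Alt] bracket_in)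
      (simp_all add: lie_deriv_def slots_def)
next
  case (Suc u)
  note c = Suc.prems
  show ?case
  proof (rule alt_forms_eqI)
    show "lied X (lied Y c) \<in> Alt (Suc u)" using X Y c by (intro lied_alt)
    show "lied Y (lied X c) + lied (br X Y) c \<in> Alt (Suc u)"
      using X Y c by (intro subspace_add[OF sub_Alt] lied_alt bracket_in)
    fix Z assume Z: "Z \<in> G"
    note cZ = contract_alt[OF c]
    have b: "br P Q \<in> G" if "P \<in> G" "Q \<in> G" for P Q using that by (rule bracket_in)
    have e: "contract Z (lied P (lied Q c)) =
        lied P (lied Q (contract Z c)) - lied P (contract (br Q Z) c) - lied Q (contract (br P Z) c)
        + contract (br Q (br P Z)) c" if P: "P \<in> G" and Q: "Q \<in> G" for P Q
      using contract_lied[OF P Z lied_alt[OF Q c]] contract_lied[OF Q Z c]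
        contract_lied[OF Q b[OF P Z] c]
        lin_on_diff[OF lied_lin_on[OF P] lied_alt[OF Q cZ[OF Z]] cZ[OF b[OF Q Z]]]
      by simp
    have jac: "contract (br X (br Y Z)) c = contract (br (br X Y) Z) c + contract (br Y (br X Z)) c"
      unfolding jacobi[OF X Y Z]
      using alt_forms_lin_head[OF c b[OF b[OF X Y] Z] b[OF Y b[OF X Z]] sub_alg, of 1 1]
      by (simp add: fun_eq_iff)
    show "contract Z (lied X (lied Y c)) = contract Z (lied Y (lied X c) + lied (br X Y) c)"
      unfolding contract_add e[OF X Y] e[OF Y X] contract_lied[OF b[OF X Y] Z c] Suc.IH[OF cZ[OF Z]] jac
      by simp
  qed
qed

lemma ce_diff_lied:
  assumes X: "X \<in> G" and c: "c \<in> Alt u"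
  shows "d (lied X c) = lied X (d c)"
  using c
proof (induction u arbitrary: c)
  case 0
  show ?case
  proof (rule alt_forms_eqI[OF ce_diff_alt[OF lied_alt[OF X 0]] lied_alt[OF X ce_diff_alt[OF 0]]])
    fix Y assume Y: "Y \<in> G"
    have c0: "contract P c = 0" for P by (rule contract_0[OF 0])
    have dY: "contract P (d c) = lied P c" if "P \<in> G" for P
      using contract_ce_diff[OF that 0] c0 ce_diff_0 by simp
    have z: "contract Y (lied X c) = 0" by (rule contract_0[OF lied_alt[OF X 0]])
    show "contract Y (d (lied X c)) = contract Y (lied X (d c))"
      using contract_ce_diff[OF Y lied_alt[OF X 0]] z contract_lied[OF X Y ce_diff_alt[OF 0]]
        dY[OF Y] dY[OF bracket_in[OF X Y]] lied_commutator[OF X Y 0] ce_diff_0 by simp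
  qed
next
  case (Suc u)
  note c = Suc.prems
  show ?case
  proof (rule alt_forms_eqI[OF ce_diff_alt[OF lied_alt[OF X c]] lied_alt[OF X ce_diff_alt[OF c]]])
    fix Y assume Y: "Y \<in> G"
    note cY = contract_alt[OF c]
    note XY = bracket_in[OF X Y]
    have e1: "contract Y (d (lied X c)) = lied Y (lied X c) - d (lied X (contract Y c) - contract (br X Y) c)"
      using contract_ce_diff[OF Y lied_alt[OF X c]] contract_lied[OF X Y c] by (simp del: contract_apply)
    have e2: "d (lied X (contract Y c) - contract (br X Y) c) =
        lied X (d (contract Y c)) - d (contract (br X Y) c)"
      using lin_on_diff[OF ce_diff_lin_on lied_alt[OF X cY[OF Y]] cY[OF XY]] Suc.IH[OF cY[OF Y]]
      by (simp del: contract_apply)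
    have e3: "contract Y (lied X (d c)) = lied X (lied Y c - d (contract Y c)) - (lied (br X Y) c - d (contract (br X Y) c))"
      using contract_lied[OF X Y ce_diff_alt[OF c]] contract_ce_diff[OF Y c] contract_ce_diff[OF XY c]
      by (simp del: contract_apply)
    have e4: "lied X (lied Y c - d (contract Y c)) = lied X (lied Y c) - lied X (d (contract Y c))"
      by (rule lin_on_diff[OF lied_lin_on[OF X] lied_alt[OF Y c] ce_diff_alt[OF cY[OF Y]]])
    show "contract Y (d (lied X c)) = contract Y (lied X (d c))"
      unfolding e1 e2 e3 e4 lied_commutator[OF X Y c] by simp
  qed
qed

lemma ce_diff_ce_diff:
  assumes c: "c \<in> Alt u"
  shows "d (d c) = 0"
proof -
  have z: "(0 :: 'g list \<Rightarrow> 'w) \<in> Alt v" for v by (rule subspace_0[OF sub_Alt])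
  have e: "contract X (d (d c)) = d (d (contract X c))" if X: "X \<in> G" and c: "c \<in> Alt u"
    and dcX: "d (contract X c) \<in> Alt u" for X c u
  proof -
    have "d (lied X c - d (contract X c)) = d (lied X c) - d (d (contract X c))"
      by (rule lin_on_diff[OF ce_diff_lin_on lied_alt[OF X c] dcX])
    then show ?thesis
      unfolding contract_ce_diff[OF X ce_diff_alt[OF c]] contract_ce_diff[OF X c]
      using ce_diff_lied[OF X c] by (simp del: contract_apply)
  qed
  show ?thesis using c
  proof (induction u arbitrary: c)
    case 0
    show ?case
    proof (rule alt_forms_eqI[OF ce_diff_alt[OF ce_diff_alt[OF 0]] z])
      fix X assume X: "X \<in> G"
      have "d (contract X c) = 0" unfolding contract_0[OF 0] by (rule ce_diff_0)
      then show "contract X (d (d c)) = contract X 0"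
        using e[OF X 0] z by (simp add: ce_diff_0 contract_zero del: contract_apply)
    qed
  next
    case (Suc u)
    show ?case
    proof (rule alt_forms_eqI[OF ce_diff_alt[OF ce_diff_alt[OF Suc.prems]] z])
      fix X assume X: "X \<in> G"
      note cX = contract_alt[OF Suc.prems X]
      show "contract X (d (d c)) = contract X 0"
        unfolding e[OF X Suc.prems ce_diff_alt[OF cX]] Suc.IH[OF cX] contract_zero ..
    qed
  qed
qed

end

lemma (in lie_module_on) subspace_coboundaries: "subspace (coboundaries g M u)"
  by (cases u) (simp_all add: coboundaries_def cochains_def subspace_lin_image[OF ce_diff_lin_on sub_Alt])

lemma (in lie_module_on) subspace_cocycles: "subspace (cocycles g M u)"
  unfolding cocycles_def cochains_def by (rule subspace_lin_kernel[OF ce_diff_lin_on sub_Alt])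

lemma (in lie_module_on) coboundaries_cocycles: "coboundaries g M u \<subseteq> cocycles g M u"
proof (cases u)
  case 0
  then show ?thesis using subspace_0[OF subspace_cocycles[of u]] by (simp add: coboundaries_def)
next
  case (Suc v)
  then show ?thesis
    using ce_diff_alt ce_diff_ce_diff by (auto simp: coboundaries_def cocycles_def cochains_def)
qed

section \<open>Coefficient maps\<close>

text \<open>The differential fails to commute with a coefficient map by the exterior product with the defect
  of equivariance of that map. For equivariant maps the defect is zero; for the maps \<open>\<theta>\<^sub>a\<close> of the homotopy
  below it is compensated by the brackets with \<open>e\<^sub>a\<close>.\<close>

lemma (in lie_module_on) ce_diff_post:
  assumes N: "subspace (lm_carrier N)" and actN: "\<And>X. X \<in> G \<Longrightarrow> lin_on (lm_carrier N) (lm_carrier N) (lm_act N X)"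
    and f: "lin_on V (lm_carrier N) f" and c: "c \<in> Alt u"
  shows "ce_diff g N (f \<circ> c) = (f \<circ> d c) + wedge G (\<lambda>X v. lm_act N X (f v) - f (act X v)) c"
proof
  fix xs
  show "ce_diff g N (f \<circ> c) xs = ((f \<circ> d c) + wedge G (\<lambda>X v. lm_act N X (f v) - f (act X v)) c) xs"
  proof (cases "set xs \<subseteq> G")
    case False
    then show ?thesis using lin_on_zero[OF f sub_mod] by (simp add: ce_diff_def wedge_def)
  next
    case True
    have a: "act (xs ! i) (c zs) \<in> V" if "i < length xs" for i zs
      using that True by (intro act_in Alt_mem[OF c]) auto
    have s1: "(\<Sum>i<length xs. (-1) ^ i *\<^sub>R act (xs ! i) (c (nths xs (- {i})))) \<in> V"
      by (intro subspace_sum[OF sub_mod] subspace_scale[OF sub_mod] a) simp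
    have s2: "(\<Sum>i<j. (-1) ^ (i + j) *\<^sub>R c (br (xs ! i) (xs ! j) # nths xs (- {i, j}))) \<in> V" for j
      by (intro subspace_sum[OF sub_mod] subspace_scale[OF sub_mod] Alt_mem[OF c])
    have "f ((\<Sum>i<length xs. (-1) ^ i *\<^sub>R act (xs ! i) (c (nths xs (- {i})))) +
        (\<Sum>j<length xs. \<Sum>i<j. (-1) ^ (i + j) *\<^sub>R c (br (xs ! i) (xs ! j) # nths xs (- {i, j})))) =
      (\<Sum>i<length xs. f ((-1) ^ i *\<^sub>R act (xs ! i) (c (nths xs (- {i}))))) +
        (\<Sum>j<length xs. \<Sum>i<j. f ((-1) ^ (i + j) *\<^sub>R c (br (xs ! i) (xs ! j) # nths xs (- {i, j}))))"
      unfolding lin_on_add[OF f s1 subspace_sum[OF sub_mod s2]] lin_on_sum[OF f sub_mod s2]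
      by (intro arg_cong2[where f = "(+)"] sum.cong refl lin_on_sum[OF f sub_mod]
          subspace_scale[OF sub_mod] a Alt_mem[OF c]) auto
    also have "\<dots> = (\<Sum>i<length xs. (-1) ^ i *\<^sub>R f (act (xs ! i) (c (nths xs (- {i}))))) +
        (\<Sum>j<length xs. \<Sum>i<j. (-1) ^ (i + j) *\<^sub>R f (c (br (xs ! i) (xs ! j) # nths xs (- {i, j}))))"
      using a Alt_mem[OF c] by (simp add: lin_on_scale[OF f])
    finally show ?thesis
      using True by (simp add: ce_diff_def wedge_def sum.distrib scaleR_diff_right sum_subtractf)
  qed
qed

lemma (in lie_module_on) ce_diff_equivariant:
  assumes N: "subspace (lm_carrier N)" and actN: "\<And>X. X \<in> G \<Longrightarrow> lin_on (lm_carrier N) (lm_carrier N) (lm_act N X)"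
    and f: "lin_on V (lm_carrier N) f" and c: "c \<in> Alt u"
    and eq: "\<And>X v. X \<in> G \<Longrightarrow> v \<in> V \<Longrightarrow> f (act X v) = lm_act N X (f v)"
  shows "ce_diff g N (f \<circ> c) = f \<circ> d c"
proof -
  have "wedge G (\<lambda>X v. lm_act N X (f v) - f (act X v)) c = 0"
    by (auto simp: wedge_def fun_eq_iff eq Alt_mem[OF c] subset_iff intro!: sum.neutral)
  then show ?thesis using ce_diff_post[OF N actN f c] by simp
qed

text \<open>The basic source of null-homotopic maps. The hypothesis \<open>inv\<close> says that the element
  \<open>\<Sum> \<theta>\<^sub>a \<otimes> e\<^sub>a\<close> of \<open>End V \<otimes> g\<close> is invariant; the operator \<open>\<Sum> \<theta>\<^sub>a \<circ> e\<^sub>a\<close> on the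
  coefficients then acts trivially in cohomology. For \<open>\<theta>\<^sub>a\<close> the action of a dual basis this
  is the classical argument with the Casimir operator.\<close>

definition casimir_homotopy :: "'i set \<Rightarrow> ('i \<Rightarrow> 'g) \<Rightarrow> ('i \<Rightarrow> 'w \<Rightarrow> 'w::real_vector) \<Rightarrow> ('g list \<Rightarrow> 'w) \<Rightarrow> 'g list \<Rightarrow> 'w"
  where "casimir_homotopy I e \<theta> c = (\<Sum>a\<in>I. \<theta> a \<circ> contract (e a) c)"

lemma (in lie_module_on) casimir_homotopy_formula:
  assumes e: "\<And>a. a \<in> I \<Longrightarrow> e a \<in> G" and \<theta>: "\<And>a. a \<in> I \<Longrightarrow> lin_on V V (\<theta> a)"
    and inv: "\<And>X v. X \<in> G \<Longrightarrow> lin_on G V v \<Longrightarrow>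
      (\<Sum>a\<in>I. act X (\<theta> a (v (e a))) - \<theta> a (act X (v (e a)))) + (\<Sum>a\<in>I. \<theta> a (v (br X (e a)))) = 0"
    and c: "c \<in> Alt u"
  shows "d (casimir_homotopy I e \<theta> c) + casimir_homotopy I e \<theta> (d c) = (\<lambda>v. \<Sum>a\<in>I. \<theta> a (act (e a) v)) \<circ> c"
proof -
  have ia: "\<exists>v. contract (e a) c \<in> Alt v" if "a \<in> I" for a
    using contract_alt[of c G V _ "e a"] contract_0[of c G V "e a"] c e[OF that] subspace_0[OF sub_Alt]
    by (cases u) auto
  have dth: "d (\<theta> a \<circ> contract (e a) c) = (\<theta> a \<circ> d (contract (e a) c)) +
      wedge G (\<lambda>X v. act X (\<theta> a v) - \<theta> a (act X v)) (contract (e a) c)" if "a \<in> I" for a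
    using ce_diff_post[OF sub_mod act_lin \<theta>[OF that]] ia[OF that] by blast
  have d_sum: "d (\<Sum>a\<in>I. \<theta> a \<circ> contract (e a) c) = (\<Sum>a\<in>I. d (\<theta> a \<circ> contract (e a) c))"
  proof (cases u)
    case 0
    then have "\<theta> a \<circ> contract (e a) c = 0" if "a \<in> I" for a
      using contract_0[of c G V "e a"] c lin_on_zero[OF \<theta>[OF that] sub_mod] by (simp add: fun_eq_iff)
    then show ?thesis by (simp add: ce_diff_0)
  next
    case (Suc v)
    show ?thesis
      using c Suc by (intro lin_on_sum[OF ce_diff_lin_on[of v] sub_Alt] post_alt[OF contract_alt \<theta> sub_mod] e) auto
  qed
  have hd: "\<theta> a \<circ> contract (e a) (d c) = (\<theta> a \<circ> (act (e a) \<circ> c)) - (\<theta> a \<circ> slots G (br (e a)) c) - (\<theta> a \<circ> d (contract (e a) c))"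
    if a: "a \<in> I" for a
  proof
    fix xs
    obtain v where v: "contract (e a) c \<in> Alt v" using ia[OF a] by blast
    show "(\<theta> a \<circ> contract (e a) (d c)) xs =
        ((\<theta> a \<circ> (act (e a) \<circ> c)) - (\<theta> a \<circ> slots G (br (e a)) c) - (\<theta> a \<circ> d (contract (e a) c))) xs"
      using Alt_mem[OF c] Alt_mem[OF slots_alt[OF sub_alg sub_mod bracket_lin[OF e[OF a]] c]]
        Alt_mem[OF ce_diff_alt[OF v]]
      by (simp add: contract_ce_diff[OF e[OF a] c] lie_deriv_def lin_on_diff[OF \<theta>[OF a]]
          subspace_diff[OF sub_mod] act_in[OF e[OF a]] del: contract_apply)
  qed
  have key: "(\<Sum>a\<in>I. wedge G (\<lambda>X v. act X (\<theta> a v) - \<theta> a (act X v)) (contract (e a) c) xs) =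
      (\<Sum>a\<in>I. \<theta> a (slots G (br (e a)) c xs))" for xs
  proof (cases "set xs \<subseteq> G \<and> length xs = u")
    case False
    then have "wedge G (\<lambda>X v. act X (\<theta> a v) - \<theta> a (act X v)) (contract (e a) c) xs = 0"
        "\<theta> a (slots G (br (e a)) c xs) = 0" if a: "a \<in> I" for a
    proof -
      have z: "c (e a # nths xs (- {i})) = 0" if "i < length xs" "set xs \<subseteq> G" for i
        using False that by (intro alt_forms_out[OF c]) (auto simp: nths_delete)
      have "xs ! i \<in> G" if "set xs \<subseteq> G" "i < length xs" for i using that by auto
      then show "wedge G (\<lambda>X v. act X (\<theta> a v) - \<theta> a (act X v)) (contract (e a) c) xs = 0"
        using z by (auto simp: wedge_def act_0 lin_on_zero[OF \<theta>[OF a] sub_mod] intro!: sum.neutral)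
      have "slots G (br (e a)) c xs = 0"
        using False by (auto simp: slots_def alt_forms_out[OF c] intro!: sum.neutral)
      then show "\<theta> a (slots G (br (e a)) c xs) = 0" by (simp add: lin_on_zero[OF \<theta>[OF a] sub_mod])
    qed
    then show ?thesis by simp
  next
    case True
    then have xs: "set xs \<subseteq> G" and len: "length xs = u" by auto
    have "(\<Sum>a\<in>I. act (xs ! i) (\<theta> a (c (e a # nths xs (- {i})))) - \<theta> a (act (xs ! i) (c (e a # nths xs (- {i}))))) =
        (-1) ^ i *\<^sub>R (\<Sum>a\<in>I. \<theta> a (c (xs[i := br (e a) (xs ! i)])))" if i: "i < u" for i
    proof -
      have X: "xs ! i \<in> G" using i xs len by auto
      obtain w where u: "u = Suc w" using i by (cases u) auto
      have lin: "lin_on G V (\<lambda>Y. c (Y # nths xs (- {i})))"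
        using alt_forms_lin_head[OF c[unfolded u] _ _ sub_alg] Alt_mem[OF c] by (intro lin_onI)
      have eq: "\<theta> a (c (br (xs ! i) (e a) # nths xs (- {i}))) = - ((-1) ^ i *\<^sub>R \<theta> a (c (xs[i := br (e a) (xs ! i)])))"
        if a: "a \<in> I" for a
      proof -
        have b: "br (e a) (xs ! i) \<in> G" by (rule bracket_in[OF e[OF a] X])
        have "c (br (xs ! i) (e a) # nths xs (- {i})) = - c (br (e a) (xs ! i) # nths xs (- {i}))"
          unfolding bracket_anti[OF X e[OF a]] using lin_on_minus[OF lin b] .
        also have "\<dots> = - ((-1) ^ i *\<^sub>R c (xs[i := br (e a) (xs ! i)]))"
          using alt_forms_replace[OF c sub_alg xs _ b] i len by simp
        finally show ?thesis
          using Alt_mem[OF c] by (simp add: lin_on_minus[OF \<theta>[OF a]] lin_on_scale[OF \<theta>[OF a]] subspace_scale[OF sub_mod])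
      qed
      have "(\<Sum>a\<in>I. \<theta> a (c (br (xs ! i) (e a) # nths xs (- {i})))) =
          - ((-1) ^ i *\<^sub>R (\<Sum>a\<in>I. \<theta> a (c (xs[i := br (e a) (xs ! i)]))))"
        unfolding scaleR_sum_right sum_negf[symmetric] by (rule sum.cong[OF refl eq])
      note B = this
      \<comment> \<open>the invariance, applied to the value of \<open>c\<close> as a linear function of its first argument\<close>
      show ?thesis
        using inv[OF X lin] unfolding B by (simp only: add_uminus_conv_diff right_minus_eq)
    qed
    then have e1: "(-1) ^ i *\<^sub>R (\<Sum>a\<in>I. act (xs ! i) (\<theta> a (c (e a # nths xs (- {i})))) - \<theta> a (act (xs ! i) (c (e a # nths xs (- {i}))))) =
        (\<Sum>a\<in>I. \<theta> a (c (xs[i := br (e a) (xs ! i)])))" if i: "i < u" for i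
      using that by (simp add: power_mult_distrib[symmetric])
    have "(\<Sum>a\<in>I. wedge G (\<lambda>X v. act X (\<theta> a v) - \<theta> a (act X v)) (contract (e a) c) xs) =
        (\<Sum>i<u. (-1) ^ i *\<^sub>R (\<Sum>a\<in>I. act (xs ! i) (\<theta> a (c (e a # nths xs (- {i})))) - \<theta> a (act (xs ! i) (c (e a # nths xs (- {i}))))))"
      using True by (simp add: wedge_def scaleR_sum_right) (rule sum.swap)
    also have "\<dots> = (\<Sum>i<u. \<Sum>a\<in>I. \<theta> a (c (xs[i := br (e a) (xs ! i)])))"
      using e1 by (intro sum.cong refl) auto
    also have "\<dots> = (\<Sum>a\<in>I. \<Sum>i<u. \<theta> a (c (xs[i := br (e a) (xs ! i)])))"
      by (rule sum.swap)
    also have "\<dots> = (\<Sum>a\<in>I. \<theta> a (slots G (br (e a)) c xs))"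
      using True Alt_mem[OF c] by (intro sum.cong refl) (simp add: slots_def lin_on_sum[OF \<theta> sub_mod])
    finally show ?thesis .
  qed
  show ?thesis
  proof
    fix xs
    have e1: "(d (casimir_homotopy I e \<theta> c) + casimir_homotopy I e \<theta> (d c)) xs =
        (\<Sum>a\<in>I. d (\<theta> a \<circ> contract (e a) c) xs) + (\<Sum>a\<in>I. (\<theta> a \<circ> contract (e a) (d c)) xs)"
      by (simp add: casimir_homotopy_def d_sum)
    have e2: "(\<Sum>a\<in>I. d (\<theta> a \<circ> contract (e a) c) xs) = (\<Sum>a\<in>I. \<theta> a (d (contract (e a) c) xs)) +
        (\<Sum>a\<in>I. wedge G (\<lambda>X v. act X (\<theta> a v) - \<theta> a (act X v)) (contract (e a) c) xs)"
      unfolding sum.distrib[symmetric] by (rule sum.cong[OF refl]) (simp add: dth)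
    have e3: "(\<Sum>a\<in>I. (\<theta> a \<circ> contract (e a) (d c)) xs) = (\<Sum>a\<in>I. \<theta> a (act (e a) (c xs))) -
        (\<Sum>a\<in>I. \<theta> a (slots G (br (e a)) c xs)) - (\<Sum>a\<in>I. \<theta> a (d (contract (e a) c) xs))"
      unfolding sum_subtractf[symmetric] by (rule sum.cong[OF refl]) (simp add: hd del: contract_apply)
    show "(d (casimir_homotopy I e \<theta> c) + casimir_homotopy I e \<theta> (d c)) xs =
        ((\<lambda>v. \<Sum>a\<in>I. \<theta> a (act (e a) v)) \<circ> c) xs"
      unfolding e1 e2 e3 key[of xs] by simp
  qed
qed

lemma (in lie_module_on) casimir_homotopy_alt:
  assumes e: "\<And>a. a \<in> I \<Longrightarrow> e a \<in> G" and \<theta>: "\<And>a. a \<in> I \<Longrightarrow> lin_on V V (\<theta> a)" and c: "c \<in> Alt (Suc u)"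
  shows "casimir_homotopy I e \<theta> c \<in> Alt u"
  unfolding casimir_homotopy_def
  by (intro subspace_sum[OF sub_Alt] post_alt[OF contract_alt[OF c e] \<theta> sub_mod])

lemma (in lie_module_on) casimir_homotopy_0:
  assumes \<theta>: "\<And>a. a \<in> I \<Longrightarrow> lin_on V V (\<theta> a)" and c: "c \<in> Alt 0"
  shows "casimir_homotopy I e \<theta> c = 0"
  using contract_0[OF c] lin_on_zero[OF \<theta> sub_mod]
  by (auto simp: casimir_homotopy_def fun_eq_iff intro!: sum.neutral)

section \<open>An operator commuting with the differential\<close>

text \<open>If \<open>L\<close> commutes with the differential and each cochain space is the direct sum of
  \<open>ker L\<close> and \<open>im L\<close>, the complex is the direct sum of the subcomplexes \<open>ker L\<close> and \<open>im L\<close>,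
  and \<open>L\<close> is invertible on the latter.\<close>

lemma fitting_cocycle:
  fixes A :: "nat \<Rightarrow> 'a::real_vector set"
  assumes A: "\<And>u. subspace (A u)" and D: "\<And>u. lin_on (A u) (A (Suc u)) D" and L: "\<And>u. lin_on (A u) (A u) L"
    and comm: "\<And>u c. c \<in> A u \<Longrightarrow> D (L c) = L (D c)"
    and split: "\<And>u c. c \<in> A u \<Longrightarrow> \<exists>z\<in>A u. \<exists>b\<in>A u. L z = 0 \<and> c = z + L b"
    and disj: "\<And>u b. b \<in> A u \<Longrightarrow> L (L b) = 0 \<Longrightarrow> L b = 0"
    and c: "c \<in> A u" and dc: "D c = 0"
  shows "\<exists>z\<in>A u. \<exists>b\<in>A u. L z = 0 \<and> D z = 0 \<and> D b = 0 \<and> c = z + L b"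
proof -
  obtain z b where z: "z \<in> A u" "L z = 0" and b: "b \<in> A u" and c_eq: "c = z + L b"
    using split[OF c] by blast
  obtain y a where y: "y \<in> A u" "L y = 0" and a: "a \<in> A u" and b_eq: "b = y + L a"
    using split[OF b] by blast
  have La: "L a \<in> A u" using L a by (rule lin_on_in)
  have "L b = L (L a)" unfolding b_eq lin_on_add[OF L y(1) La] y(2) by simp
  then have c_eq': "c = z + L (L a)" using c_eq by simp
  have LLa: "L (L a) \<in> A u" using L La by (rule lin_on_in)
  have Da: "D a \<in> A (Suc u)" using D a by (rule lin_on_in)
  have LDa: "L (D a) \<in> A (Suc u)" using L Da by (rule lin_on_in)
  have Dz: "D z + L (L (D a)) = 0"
    using dc unfolding c_eq' lin_on_add[OF D z(1) LLa] comm[OF La] comm[OF a] .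
  have "L (D z) = 0" using comm[OF z(1)] z(2) lin_on_zero[OF D A] by simp
  moreover have "D z = - L (L (D a))" using Dz by (simp add: eq_neg_iff_add_eq_0)
  ultimately have "L (L (L (D a))) = 0"
    using lin_on_minus[OF L lin_on_in[OF L LDa]] by simp
  then have 1: "L (L (D a)) = 0" by (rule disj[OF LDa])
  then have 2: "L (D a) = 0" by (rule disj[OF Da])
  show ?thesis
    using z La c_eq' Dz 1 2 comm[OF a] by (intro bexI[of _ z] bexI[of _ "L a"]) auto
qed

lemma fitting_exact:
  fixes A :: "nat \<Rightarrow> 'a::real_vector set"
  assumes A: "\<And>u. subspace (A u)" and D: "\<And>u. lin_on (A u) (A (Suc u)) D" and L: "\<And>u. lin_on (A u) (A u) L"
    and comm: "\<And>u c. c \<in> A u \<Longrightarrow> D (L c) = L (D c)"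
    and split: "\<And>u c. c \<in> A u \<Longrightarrow> \<exists>z\<in>A u. \<exists>b\<in>A u. L z = 0 \<and> c = z + L b"
    and disj: "\<And>u b. b \<in> A u \<Longrightarrow> L (L b) = 0 \<Longrightarrow> L b = 0"
    and a: "a \<in> A u" and da: "L (D a) = 0"
  shows "\<exists>z\<in>A u. L z = 0 \<and> D z = D a"
proof -
  obtain z b where z: "z \<in> A u" "L z = 0" and b: "b \<in> A u" and a_eq: "a = z + L b"
    using split[OF a] by blast
  have Lb: "L b \<in> A u" using L b by (rule lin_on_in)
  have Db: "D b \<in> A (Suc u)" using D b by (rule lin_on_in)
  have Da: "D a = D z + L (D b)" unfolding a_eq lin_on_add[OF D z(1) Lb] comm[OF b] ..
  have "L (D z) = 0" using comm[OF z(1)] z(2) lin_on_zero[OF D A] by simp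
  then have "L (L (D b)) = 0"
    using da lin_on_add[OF L lin_on_in[OF D z(1)] lin_on_in[OF L Db]] Da by simp
  then have "L (D b) = 0" by (rule disj[OF Db])
  then show ?thesis using z Da by auto
qed

section \<open>Calculus of smooth functions and vector fields\<close>

lemma smooth_differentiable: "smooth f \<Longrightarrow> f differentiable (at x)"
  unfolding smooth_def by (drule spec[of _ "[]"]) (simp add: iter_partial_def)

lemma iter_partial_snoc: "iter_partial (js @ [i]) f = iter_partial js (partial i f)"
  by (simp add: iter_partial_def)

lemma iter_partial_Cons: "iter_partial (i # js) f = partial i (iter_partial js f)"
  by (simp add: iter_partial_def)

lemma iter_partial_Nil [simp]: "iter_partial [] f = f"
  by (simp add: iter_partial_def)

lemma smooth_partial: "smooth f \<Longrightarrow> smooth (partial i f)"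
  unfolding smooth_def iter_partial_snoc[symmetric] by blast

text \<open>Smoothness is the greatest property that implies differentiability and passes to partial derivatives.\<close>

lemma smooth_coinduct:
  assumes P: "P f" and step: "\<And>h. P h \<Longrightarrow> (\<forall>x. h differentiable (at x)) \<and> (\<forall>i. P (partial i h))"
  shows "smooth f"
proof -
  have "P f \<Longrightarrow> \<forall>x. iter_partial js f differentiable (at x)" for js f
  proof (induction js arbitrary: f rule: rev_induct)
    case Nil
    then show ?case using step by simp
  next
    case (snoc i js)
    then show ?case using step by (simp add: iter_partial_snoc)
  qed
  then show ?thesis using P by (simp add: smooth_def)
qed

lemma partial_has_derivative:
  assumes "f differentiable (at x)"
  shows "(f has_derivative (\<lambda>v. \<Sum>i\<in>UNIV. v $ i * partial i f x)) (at x)"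
proof -
  have D: "(f has_derivative frechet_derivative f (at x)) (at x)"
    using assms frechet_derivative_works by blast
  then have lin: "linear (frechet_derivative f (at x))"
    using has_derivative_linear by blast
  have "frechet_derivative f (at x) v = (\<Sum>i\<in>UNIV. v $ i * partial i f x)" for v
  proof -
    have "frechet_derivative f (at x) v = frechet_derivative f (at x) (\<Sum>i\<in>UNIV. (v $ i) *\<^sub>R axis i 1)"
      by (simp add: basis_expansion scalar_mult_eq_scaleR[symmetric])
    also have "\<dots> = (\<Sum>i\<in>UNIV. v $ i * partial i f x)"
      by (simp add: linear_sum[OF lin] linear_cmul[OF lin] partial_def)
    finally show ?thesis .
  qed
  then have "frechet_derivative f (at x) = (\<lambda>v. \<Sum>i\<in>UNIV. v $ i * partial i f x)" by blast
  then show ?thesis using D by simp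
qed

lemma partial_eqI:
  assumes "(f has_derivative D) (at x)"
  shows "partial i f x = D (axis i 1)"
  using frechet_derivative_at[OF assms] by (simp add: partial_def)

lemma smooth_continuous: "smooth f \<Longrightarrow> continuous_on S f"
  by (meson continuous_at_imp_continuous_on differentiable_imp_continuous_within smooth_differentiable)

lemma smooth_path_derivative:
  assumes f: "smooth f" and p: "(p has_vector_derivative v) (at t within S)"
  shows "((\<lambda>t. f (p t)) has_real_derivative (\<Sum>i\<in>UNIV. v $ i * partial i f (p t))) (at t within S)"
proof -
  have "((f \<circ> p) has_derivative (\<lambda>v. \<Sum>i\<in>UNIV. v $ i * partial i f (p t)) \<circ> (\<lambda>s. s *\<^sub>R v)) (at t within S)"
    using p partial_has_derivative[OF smooth_differentiable[OF f]]
    by (intro diff_chain_within) (auto simp: has_vector_derivative_def intro: has_derivative_at_withinI)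
  moreover have "(\<lambda>v. \<Sum>i\<in>UNIV. v $ i * partial i f (p t)) \<circ> (\<lambda>s. s *\<^sub>R v) = (*) (\<Sum>i\<in>UNIV. v $ i * partial i f (p t))"
    by (rule ext) (simp add: sum_distrib_left mult_ac)
  ultimately show ?thesis
    by (simp add: has_field_derivative_def o_def)
qed

lemma
  assumes f: "smooth f" and h: "smooth h"
  shows partial_add: "partial i (\<lambda>x. f x + h x) = (\<lambda>x. partial i f x + partial i h x)"
    and partial_mult: "partial i (\<lambda>x. f x * h x) = (\<lambda>x. partial i f x * h x + f x * partial i h x)"
proof -
  note F = partial_has_derivative[OF smooth_differentiable[OF f]]
    and H = partial_has_derivative[OF smooth_differentiable[OF h]]
  have [simp]: "(\<Sum>j\<in>UNIV. axis i (1::real) $ j * partial j k x) = partial i k x" for k x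
    by (simp add: axis_def if_distrib[where f = "\<lambda>u. u * _"] cong: if_cong)
  show "partial i (\<lambda>x. f x + h x) = (\<lambda>x. partial i f x + partial i h x)"
    by (rule ext) (simp add: partial_eqI[OF has_derivative_add[OF F H]])
  show "partial i (\<lambda>x. f x * h x) = (\<lambda>x. partial i f x * h x + f x * partial i h x)"
    by (rule ext) (simp add: partial_eqI[OF has_derivative_mult[OF F H]])
qed

text \<open>Products of two smooth functions are not closed under partial derivatives, finite sums of such
  products are; coinduction therefore applies to the latter.\<close>

lemma smooth_sum_prod:
  assumes "\<And>p. p \<in> set ps \<Longrightarrow> smooth (fst p) \<and> smooth (snd p)"
  shows "smooth (\<lambda>x. \<Sum>p\<leftarrow>ps. fst p x * snd p x)"
proof -
  define P where "P h \<longleftrightarrow> (\<exists>ps. (\<forall>p\<in>set ps. smooth (fst p) \<and> smooth (snd p)) \<and>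
    h = (\<lambda>x. \<Sum>p\<leftarrow>ps. fst p x * snd p x))" for h :: "'a scalar_field"
  show ?thesis
  proof (rule smooth_coinduct[of P])
    show "P (\<lambda>x. \<Sum>p\<leftarrow>ps. fst p x * snd p x)" using assms unfolding P_def by blast
    fix h assume "P h"
    then obtain ps where ps: "\<forall>p\<in>set ps. smooth (fst p) \<and> smooth (snd p)"
      and h: "h = (\<lambda>x. \<Sum>p\<leftarrow>ps. fst p x * snd p x)" unfolding P_def by blast
    have "(h has_derivative (\<lambda>v. \<Sum>i\<in>UNIV. v $ i *
        (\<Sum>p\<leftarrow>concat (map (\<lambda>p. [(partial i (fst p), snd p), (fst p, partial i (snd p))]) ps). fst p x * snd p x))) (at x)" for x
      unfolding h using ps
    proof (induction ps)
      case Nil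
      then show ?case by simp
    next
      case (Cons p ps)
      have "((\<lambda>x. fst p x * snd p x + (\<Sum>p\<leftarrow>ps. fst p x * snd p x)) has_derivative
        (\<lambda>v. (fst p x * (\<Sum>i\<in>UNIV. v $ i * partial i (snd p) x) + (\<Sum>i\<in>UNIV. v $ i * partial i (fst p) x) * snd p x) +
         (\<Sum>i\<in>UNIV. v $ i *
        (\<Sum>p\<leftarrow>concat (map (\<lambda>p. [(partial i (fst p), snd p), (fst p, partial i (snd p))]) ps). fst p x * snd p x)))) (at x)"
        using Cons by (intro has_derivative_add has_derivative_mult partial_has_derivative smooth_differentiable) auto
      then show ?case
        by (simp add: sum_distrib_left sum_distrib_right sum.distrib[symmetric] algebra_simps)
    qed
    note D = this
    have "partial i h = (\<lambda>x. \<Sum>p\<leftarrow>concat (map (\<lambda>p. [(partial i (fst p), snd p), (fst p, partial i (snd p))]) ps). fst p x * snd p x)" for i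
    proof
      fix x
      show "partial i h x = (\<Sum>p\<leftarrow>concat (map (\<lambda>p. [(partial i (fst p), snd p), (fst p, partial i (snd p))]) ps). fst p x * snd p x)"
        unfolding partial_eqI[OF D]
        by (simp add: axis_def if_distrib[where f = "\<lambda>u. u * _"] cong: if_cong)
    qed
    moreover have "\<forall>p\<in>set (concat (map (\<lambda>p. [(partial i (fst p), snd p), (fst p, partial i (snd p))]) ps)).
        smooth (fst p) \<and> smooth (snd p)" for i
      using ps by (auto intro: smooth_partial)
    ultimately have "P (partial i h)" for i unfolding P_def by blast
    moreover have "h differentiable (at x)" for x using D differentiableI by blast
    ultimately show "(\<forall>x. h differentiable (at x)) \<and> (\<forall>i. P (partial i h))" by blast
  qed
qed

lemma smooth_mult: "smooth f \<Longrightarrow> smooth h \<Longrightarrow> smooth (\<lambda>x. f x * h x)"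
  using smooth_sum_prod[of "[(f, h)]"] by simp

lemma smooth_add: "smooth f \<Longrightarrow> smooth h \<Longrightarrow> smooth (\<lambda>x. f x + h x)"
  using smooth_sum_prod[of "[(f, \<lambda>x. 1), (h, \<lambda>x. 1)]"] smooth_const[of 1] by fastforce

lemma smooth_cmult: "smooth f \<Longrightarrow> smooth (\<lambda>x. c * f x)"
  by (rule smooth_mult[OF smooth_const])

lemma smooth_minus: "smooth f \<Longrightarrow> smooth (\<lambda>x. - f x)"
  using smooth_cmult[of f "-1"] by simp

lemma smooth_diff: "smooth f \<Longrightarrow> smooth h \<Longrightarrow> smooth (\<lambda>x. f x - h x)"
  using smooth_add[of f "\<lambda>x. - h x"] smooth_minus by auto

lemma smooth_sum: "(\<And>i. i \<in> I \<Longrightarrow> smooth (f i)) \<Longrightarrow> smooth (\<lambda>x. \<Sum>i\<in>I. f i x)"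
  by (induction I rule: infinite_finite_induct) (auto simp: smooth_const smooth_add)

lemma partial_cmult: "smooth f \<Longrightarrow> partial i (\<lambda>x. c * f x) = (\<lambda>x. c * partial i f x)"
  using partial_mult[OF smooth_const[of c], of f i] by simp

lemma partial_minus: "smooth f \<Longrightarrow> partial i (\<lambda>x. - f x) = (\<lambda>x. - partial i f x)"
  using partial_cmult[of f i "-1"] by simp

lemma partial_diff:
  "smooth f \<Longrightarrow> smooth h \<Longrightarrow> partial i (\<lambda>x. f x - h x) = (\<lambda>x. partial i f x - partial i h x)"
  using partial_add[of f "\<lambda>x. - h x" i] smooth_minus[of h] by (simp add: partial_minus)

lemma partial_sum:
  "(\<And>k. k \<in> I \<Longrightarrow> smooth (f k)) \<Longrightarrow> partial i (\<lambda>x. \<Sum>k\<in>I. f k x) = (\<lambda>x. \<Sum>k\<in>I. partial i (f k) x)"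
  by (induction I rule: infinite_finite_induct) (auto simp: partial_add smooth_sum)

text \<open>Integrating \<open>\<partial>\<^sub>i f\<close> in direction \<open>i\<close> and differentiating under the integral sign writes \<open>\<partial>\<^sub>j f\<close> along
  a segment in direction \<open>i\<close> as a constant plus the integral of \<open>\<partial>\<^sub>j \<partial>\<^sub>i f\<close>; it remains to differentiate
  with respect to the end point of the segment.\<close>

lemma partial_commute:
  assumes f: "smooth f"
  shows "partial i (partial j f) = partial j (partial i f)"
proof
  fix x
  let ?p = "\<lambda>s t. x + s *\<^sub>R axis i 1 + t *\<^sub>R axis j 1 :: real^'a"
  have sum_axis: "(\<Sum>k\<in>UNIV. axis l (1::real) $ k * partial k h y) = partial l h y" for l h y
    by (simp add: axis_def if_distrib[where f = "\<lambda>u. u * _"] cong: if_cong)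
  have ds: "((\<lambda>s. h (?p s t)) has_real_derivative partial i h (?p s t)) (at s within S)"
    if "smooth h" for h s t S
  proof -
    have "((\<lambda>s. ?p s t) has_vector_derivative axis i 1) (at s within S)"
      by (auto intro!: derivative_eq_intros)
    from smooth_path_derivative[OF that this] show ?thesis by (simp add: sum_axis)
  qed
  have dt: "((\<lambda>t. h (?p s t)) has_real_derivative partial j h (?p s t)) (at t within S)"
    if "smooth h" for h s t S
  proof -
    have "((\<lambda>t. ?p s t) has_vector_derivative axis j 1) (at t within S)"
      by (auto intro!: derivative_eq_intros)
    from smooth_path_derivative[OF that this] show ?thesis by (simp add: sum_axis)
  qed
  have cont: "continuous_on S (\<lambda>u. h (?p (a u) (b u)))" if "smooth h" "continuous_on S a" "continuous_on S b"
    for h a b and S :: "'c::t2_space set"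
    using that by (intro continuous_on_compose2[OF smooth_continuous[OF that(1), of UNIV]] continuous_intros) auto
  note si = smooth_partial[OF f, of i] and sj = smooth_partial[OF f, of j]
  have F: "f (?p s t) = f (?p 0 t) + integral {0..s} (\<lambda>\<sigma>. partial i f (?p \<sigma> t))" if "0 \<le> s" for s t
  proof -
    have "((\<lambda>\<sigma>. partial i f (?p \<sigma> t)) has_integral (f (?p s t) - f (?p 0 t))) {0..s}"
      using that ds[OF f, unfolded has_real_derivative_iff_has_vector_derivative]
      by (intro fundamental_theorem_of_calculus) auto
    then show ?thesis by (simp add: integral_unique)
  qed
  have G: "partial j f (?p s 0) = partial j f (?p 0 0) + integral {0..s} (\<lambda>\<sigma>. partial j (partial i f) (?p \<sigma> 0))"
    if s: "0 \<le> s" for s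
  proof -
    have "((\<lambda>t. integral (cbox 0 s) (\<lambda>\<sigma>. partial i f (?p \<sigma> t))) has_field_derivative
        integral (cbox 0 s) (\<lambda>\<sigma>. partial j (partial i f) (?p \<sigma> 0))) (at 0 within UNIV)"
    proof (rule leibniz_rule_field_derivative[where fx = "\<lambda>t \<sigma>. partial j (partial i f) (?p \<sigma> t)"])
      show "((\<lambda>t. partial i f (?p \<sigma> t)) has_field_derivative partial j (partial i f) (?p \<sigma> t)) (at t within UNIV)" for t \<sigma>
        by (rule dt[OF si])
      show "(\<lambda>\<sigma>. partial i f (?p \<sigma> t)) integrable_on cbox 0 s" for t
        by (intro integrable_continuous cont[OF si] continuous_intros)
      show "continuous_on (UNIV \<times> cbox 0 s) (\<lambda>(t, \<sigma>). partial j (partial i f) (?p \<sigma> t))"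
        unfolding split_beta by (intro cont[OF smooth_partial[OF si]] continuous_intros)
    qed auto
    then have "((\<lambda>t. f (?p 0 t) + integral {0..s} (\<lambda>\<sigma>. partial i f (?p \<sigma> t))) has_real_derivative
        partial j f (?p 0 0) + integral {0..s} (\<lambda>\<sigma>. partial j (partial i f) (?p \<sigma> 0))) (at 0)"
      using dt[OF f, of 0 0 UNIV] by (intro DERIV_add) auto
    then have "((\<lambda>t. f (?p s t)) has_real_derivative
        partial j f (?p 0 0) + integral {0..s} (\<lambda>\<sigma>. partial j (partial i f) (?p \<sigma> 0))) (at 0)"
      using F[OF s] by simp
    then show ?thesis using dt[OF f, of s 0 UNIV] DERIV_unique by blast
  qed
  have "continuous_on {0..1} (\<lambda>\<sigma>. partial j (partial i f) (?p \<sigma> 0))"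
    by (rule cont[OF smooth_partial[OF si] continuous_on_id continuous_on_const])
  then have "((\<lambda>s. integral {0..s} (\<lambda>\<sigma>. partial j (partial i f) (?p \<sigma> 0))) has_real_derivative
      partial j (partial i f) (?p 0 0)) (at 0 within {0..1})"
    by (rule integral_has_real_derivative) simp
  then have "((\<lambda>s. partial j f (?p 0 0) + integral {0..s} (\<lambda>\<sigma>. partial j (partial i f) (?p \<sigma> 0))) has_real_derivative
      partial j (partial i f) (?p 0 0)) (at 0 within {0..1})"
    by (auto intro!: derivative_eq_intros)
  then have "((\<lambda>s. partial j f (?p s 0)) has_real_derivative partial j (partial i f) (?p 0 0)) (at 0 within {0..1})"
  proof (rule has_field_derivative_transform_within[where d = 1])
    fix s :: real assume "s \<in> {0..1}"
    then show "partial j f (?p 0 0) + integral {0..s} (\<lambda>\<sigma>. partial j (partial i f) (?p \<sigma> 0)) = partial j f (?p s 0)"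
      using G[of s] by simp
  qed auto
  moreover have "((\<lambda>s. partial j f (?p s 0)) has_real_derivative partial i (partial j f) (?p 0 0)) (at 0 within {0..1})"
    by (rule ds[OF sj])
  moreover have "at (0::real) within {0..1} \<noteq> bot"
    by (simp add: trivial_limit_within islimpt_Icc)
  ultimately have "partial i (partial j f) (?p 0 0) = partial j (partial i f) (?p 0 0)"
    using vector_derivative_unique_within[of 0 "{0..1}"] by (auto simp: has_real_derivative_iff_has_vector_derivative)
  then show "partial i (partial j f) x = partial j (partial i f) x" by simp
qed

section \<open>Radial integration\<close>

text \<open>The inverse of \<open>x \<cdot> \<partial> + n + 1\<close> on smooth functions.\<close>

definition radial :: "nat \<Rightarrow> 'm::finite scalar_field \<Rightarrow> 'm scalar_field"
  where "radial n f x = integral {0..1} (\<lambda>t. t ^ n * f (t *\<^sub>R x))"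

definition euler :: "'m::finite scalar_field \<Rightarrow> 'm scalar_field"
  where "euler f x = (\<Sum>i\<in>UNIV. x $ i * partial i f x)"

lemma smooth_euler: "smooth f \<Longrightarrow> smooth (euler f)"
  unfolding euler_def by (intro smooth_sum smooth_mult smooth_coord smooth_partial)

lemma radial_integrable:
  assumes "smooth f"
  shows "(\<lambda>t. t ^ n * f (t *\<^sub>R x)) integrable_on {0..1}"
  by (intro integrable_continuous_real continuous_intros
      continuous_on_compose2[OF smooth_continuous[OF assms, of UNIV]]) auto

lemma radial_has_derivative:
  assumes f: "smooth f"
  shows "(radial n f has_derivative (\<lambda>v. \<Sum>i\<in>UNIV. v $ i * radial (Suc n) (partial i f) x)) (at x)"
proof -
  let ?D = "\<lambda>x t. \<Sum>i\<in>UNIV. (t ^ Suc n * partial i f (t *\<^sub>R x)) *\<^sub>R blinfun_inner_left (axis i 1 :: real^'a)"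
  have D_apply: "blinfun_apply (?D x t) v = (\<Sum>i\<in>UNIV. v $ i * (t ^ Suc n * partial i f (t *\<^sub>R x)))" for x t v
    by (simp add: blinfun.sum_left blinfun.scaleR_left blinfun_inner_left.rep_eq inner_axis inner_axis' mult_ac)
  have "((\<lambda>x. integral (cbox 0 1) (\<lambda>t. t ^ n * f (t *\<^sub>R x))) has_derivative integral (cbox 0 1) (?D x)) (at x within UNIV)"
  proof (rule leibniz_rule)
    fix x :: "real^'a" and t :: real
    have "((\<lambda>x. t ^ n * f (t *\<^sub>R x)) has_derivative (\<lambda>v. t ^ n * (\<Sum>i\<in>UNIV. (t *\<^sub>R v) $ i * partial i f (t *\<^sub>R x)))) (at x)"
      by (intro has_derivative_mult_right has_derivative_compose[OF _ partial_has_derivative[OF smooth_differentiable[OF f]]]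
          bounded_linear_imp_has_derivative bounded_linear_scaleR_right)
    moreover have "(\<lambda>v. t ^ n * (\<Sum>i\<in>UNIV. (t *\<^sub>R v) $ i * partial i f (t *\<^sub>R x))) = blinfun_apply (?D x t)"
      by (rule ext) (simp only: D_apply, simp add: sum_distrib_left algebra_simps)
    ultimately show "((\<lambda>x. t ^ n * f (t *\<^sub>R x)) has_derivative blinfun_apply (?D x t)) (at x within UNIV)"
      by simp
  next
    show "(\<lambda>t. t ^ n * f (t *\<^sub>R x)) integrable_on cbox 0 1" for x
      using radial_integrable[OF f] by simp
    show "continuous_on (UNIV \<times> cbox 0 1) (\<lambda>(x, t). ?D x t)"
      unfolding split_beta
      by (intro continuous_intros continuous_on_compose2[OF smooth_continuous[OF smooth_partial[OF f], of UNIV]]) auto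
  qed auto
  moreover have "blinfun_apply (integral (cbox 0 1) (?D x)) = (\<lambda>v. \<Sum>i\<in>UNIV. v $ i * radial (Suc n) (partial i f) x)"
  proof
    fix v
    have int: "?D x integrable_on cbox 0 1"
      by (intro integrable_continuous continuous_intros continuous_on_compose2[OF smooth_continuous[OF smooth_partial[OF f], of UNIV]]) auto
    have "blinfun_apply (integral (cbox 0 1) (?D x)) v = integral {0..1} (\<lambda>t. \<Sum>i\<in>UNIV. v $ i * (t ^ Suc n * partial i f (t *\<^sub>R x)))"
      unfolding blinfun_apply_integral[OF int] D_apply by simp
    also have "\<dots> = (\<Sum>i\<in>UNIV. v $ i * radial (Suc n) (partial i f) x)"
      unfolding radial_def
      by (subst integral_sum) (auto intro!: integrable_on_mult_right radial_integrable[OF smooth_partial[OF f], of "Suc n", simplified])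
    finally show "blinfun_apply (integral (cbox 0 1) (?D x)) v = (\<Sum>i\<in>UNIV. v $ i * radial (Suc n) (partial i f) x)" .
  qed
  ultimately show ?thesis by (simp add: radial_def[abs_def])
qed

lemma partial_radial: "smooth f \<Longrightarrow> partial i (radial n f) = radial (Suc n) (partial i f)"
proof
  fix x assume "smooth f"
  then show "partial i (radial n f) x = radial (Suc n) (partial i f) x"
    by (subst partial_eqI[OF radial_has_derivative])
      (auto simp: axis_def if_distrib[where f = "\<lambda>u. u * _"] cong: if_cong)
qed

lemma smooth_radial:
  assumes "smooth f"
  shows "smooth (radial n f)"
proof (rule smooth_coinduct[of "\<lambda>h. \<exists>n f. smooth f \<and> h = radial n f"])
  show "\<exists>n' f'. smooth f' \<and> radial n f = radial n' f'" using assms by blast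
  fix h :: "'a scalar_field" assume "\<exists>n f. smooth f \<and> h = radial n f"
  then obtain n f where f: "smooth f" and h: "h = radial n f" by blast
  show "(\<forall>x. h differentiable at x) \<and> (\<forall>i. \<exists>n f. smooth f \<and> partial i h = radial n f)"
  proof (intro conjI allI)
    show "h differentiable at x" for x
      unfolding h using radial_has_derivative[OF f] differentiableI by blast
    show "\<exists>n f. smooth f \<and> partial i h = radial n f" for i
      unfolding h partial_radial[OF f] using smooth_partial[OF f] by blast
  qed
qed

lemma radial_comb:
  assumes "smooth f" "smooth h"
  shows "radial n (\<lambda>x. r * f x + s * h x) = (\<lambda>x. r * radial n f x + s * radial n h x)"
proof
  fix x
  have "radial n (\<lambda>x. r * f x + s * h x) x =
      integral {0..1} (\<lambda>t. r * (t ^ n * f (t *\<^sub>R x)) + s * (t ^ n * h (t *\<^sub>R x)))"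
    unfolding radial_def by (simp add: algebra_simps)
  also have "\<dots> = r * radial n f x + s * radial n h x"
    unfolding radial_def using radial_integrable[OF assms(1), of n x] radial_integrable[OF assms(2), of n x]
    by (subst integral_add) (auto intro: integrable_on_mult_right)
  finally show "radial n (\<lambda>x. r * f x + s * h x) x = r * radial n f x + s * radial n h x" .
qed

text \<open>The integrand is the derivative of \<open>t ^ (n + 1) * f (t x)\<close>.\<close>

lemma radial_euler:
  assumes f: "smooth f"
  shows "radial n (\<lambda>x. euler f x + real (Suc n) * f x) x = f x"
proof -
  have "((\<lambda>t. t ^ Suc n * f (t *\<^sub>R x)) has_real_derivative
      t ^ n * (euler f (t *\<^sub>R x) + real (Suc n) * f (t *\<^sub>R x))) (at t within S)" for t S
  proof -
    have "((\<lambda>t. f (t *\<^sub>R x)) has_real_derivative (\<Sum>i\<in>UNIV. x $ i * partial i f (t *\<^sub>R x))) (at t within S)"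
      by (rule smooth_path_derivative[OF f]) (auto intro!: derivative_eq_intros)
    then have "((\<lambda>t. t ^ Suc n * f (t *\<^sub>R x)) has_real_derivative
        real (Suc n) * t ^ n * f (t *\<^sub>R x) + t ^ Suc n * (\<Sum>i\<in>UNIV. x $ i * partial i f (t *\<^sub>R x))) (at t within S)"
      by (auto intro!: derivative_eq_intros simp del: power_Suc)
    moreover have "t ^ Suc n * (\<Sum>i\<in>UNIV. x $ i * partial i f (t *\<^sub>R x)) = t ^ n * euler f (t *\<^sub>R x)"
      by (simp add: euler_def sum_distrib_left mult_ac)
    moreover have "t ^ n * (euler f (t *\<^sub>R x) + real (Suc n) * f (t *\<^sub>R x)) =
        real (Suc n) * t ^ n * f (t *\<^sub>R x) + t ^ n * euler f (t *\<^sub>R x)"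
      by (simp add: algebra_simps)
    ultimately show ?thesis by (simp only:)
  qed
  then have "((\<lambda>t. t ^ n * (euler f (t *\<^sub>R x) + real (Suc n) * f (t *\<^sub>R x))) has_integral
      1 ^ Suc n * f (1 *\<^sub>R x) - 0 ^ Suc n * f (0 *\<^sub>R x)) {0..1}"
    by (intro fundamental_theorem_of_calculus) (auto simp: has_real_derivative_iff_has_vector_derivative)
  then show ?thesis by (simp add: radial_def integral_unique)
qed

text \<open>The Euler operator commutes with dilations, hence with \<open>radial n\<close>.\<close>

lemma euler_radial:
  assumes f: "smooth f"
  shows "euler (radial n f) x + real (Suc n) * radial n f x = f x"
proof -
  have "radial n (\<lambda>x. 1 * euler f x + real (Suc n) * f x) = (\<lambda>x. 1 * radial n (euler f) x + real (Suc n) * radial n f x)"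
    by (rule radial_comb[OF smooth_euler[OF f] f])
  then have "f x = radial n (euler f) x + real (Suc n) * radial n f x"
    using radial_euler[OF f, of n x] by simp
  moreover have "radial n (euler f) x = euler (radial n f) x"
  proof -
    have "radial n (euler f) x = integral {0..1} (\<lambda>t. \<Sum>i\<in>UNIV. x $ i * (t ^ Suc n * partial i f (t *\<^sub>R x)))"
      by (simp add: radial_def euler_def sum_distrib_left mult_ac)
    also have "\<dots> = (\<Sum>i\<in>UNIV. x $ i * radial (Suc n) (partial i f) x)"
      unfolding radial_def
      by (subst integral_sum) (auto intro!: integrable_on_mult_right radial_integrable[OF smooth_partial[OF f], of "Suc n", simplified])
    finally show ?thesis by (simp add: euler_def partial_radial[OF f])
  qed
  ultimately show ?thesis by simp
qed

text \<open>The fundamental theorem of calculus on the segment from the origin to \<open>x\<close>.\<close>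

lemma hadamard:
  assumes f: "smooth f"
  shows "f x - f 0 = (\<Sum>i\<in>UNIV. x $ i * radial 0 (partial i f) x)"
proof -
  have "((\<lambda>t. f (t *\<^sub>R x)) has_real_derivative (\<Sum>i\<in>UNIV. x $ i * partial i f (t *\<^sub>R x))) (at t within S)" for t S
    by (rule smooth_path_derivative[OF f]) (auto intro!: derivative_eq_intros)
  then have "((\<lambda>t. \<Sum>i\<in>UNIV. x $ i * partial i f (t *\<^sub>R x)) has_integral f (1 *\<^sub>R x) - f (0 *\<^sub>R x)) {0..1}"
    by (intro fundamental_theorem_of_calculus) (auto simp: has_real_derivative_iff_has_vector_derivative)
  then have "f x - f 0 = integral {0..1} (\<lambda>t. \<Sum>i\<in>UNIV. x $ i * (t ^ 0 * partial i f (t *\<^sub>R x)))"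
    by (simp add: integral_unique)
  also have "\<dots> = (\<Sum>i\<in>UNIV. x $ i * radial 0 (partial i f) x)"
    unfolding radial_def
    by (subst integral_sum) (auto intro!: integrable_on_mult_right radial_integrable[OF smooth_partial[OF f], of 0, simplified])
  finally show ?thesis .
qed

lemma euler_zero_const:
  assumes f: "smooth f" and e: "\<And>x. euler f x = 0"
  shows "f x = f 0"
proof -
  have "((\<lambda>t. f (t *\<^sub>R x)) has_real_derivative (\<Sum>i\<in>UNIV. x $ i * partial i f (t *\<^sub>R x))) (at t within S)" for t S
    by (rule smooth_path_derivative[OF f]) (auto intro!: derivative_eq_intros)
  then have I: "((\<lambda>t. \<Sum>i\<in>UNIV. x $ i * partial i f (t *\<^sub>R x)) has_integral f (1 *\<^sub>R x) - f (0 *\<^sub>R x)) {0..1}"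
    by (intro fundamental_theorem_of_calculus) (auto simp: has_real_derivative_iff_has_vector_derivative)
  have "(\<Sum>i\<in>UNIV. x $ i * partial i f (t *\<^sub>R x)) = 0" if "t \<noteq> 0" for t
  proof -
    have "t * (\<Sum>i\<in>UNIV. x $ i * partial i f (t *\<^sub>R x)) = 0"
      using e[of "t *\<^sub>R x"] by (simp add: euler_def sum_distrib_left mult.assoc)
    then show ?thesis using that by simp
  qed
  then have "((\<lambda>t. \<Sum>i\<in>UNIV. x $ i * partial i f (t *\<^sub>R x)) has_integral 0) {0..1}"
    using has_integral_spike_finite[of "{0}" "{0..1}"
        "\<lambda>t. \<Sum>i\<in>UNIV. x $ i * partial i f (t *\<^sub>R x)" "\<lambda>t. 0" 0] by simp
  then have "f (1 *\<^sub>R x) - f (0 *\<^sub>R x) = 0" using I has_integral_unique by blast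
  then show ?thesis by simp
qed

lemma euler_weight_zero:
  assumes f: "smooth f" and e: "\<And>x. euler f x + real (Suc n) * f x = 0"
  shows "f x = 0"
  using radial_euler[OF f, of n x] unfolding e by (simp add: radial_def)

text \<open>A right inverse of the Euler operator on the functions that vanish at the origin; it
  exists because such functions are combinations of the coordinates, which have weight one.\<close>

definition radial0 :: "'m::finite scalar_field \<Rightarrow> 'm scalar_field"
  where "radial0 f x = (\<Sum>i\<in>UNIV. x $ i * radial 0 (radial 0 (partial i f)) x)"

lemma smooth_radial0: "smooth f \<Longrightarrow> smooth (radial0 f)"
  unfolding radial0_def by (intro smooth_sum smooth_mult smooth_coord smooth_radial smooth_partial)

lemma euler_radial0:
  assumes f: "smooth f"
  shows "euler (radial0 f) x = f x - f 0"
proof -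
  let ?v = "\<lambda>k. radial 0 (radial 0 (partial k f))"
  have v: "smooth (?v k)" for k by (intro smooth_radial smooth_partial f)
  have "partial i (radial0 f) = (\<lambda>x. \<Sum>k\<in>UNIV. (if i = k then 1 else 0) * ?v k x + x $ k * partial i (?v k) x)" for i
    unfolding radial0_def
    by (subst partial_sum) (auto simp: partial_mult smooth_coord v smooth_mult partial_coord)
  then have "euler (radial0 f) x = (\<Sum>i\<in>UNIV. \<Sum>k\<in>UNIV. x $ i * ((if i = k then 1 else 0) * ?v k x) + x $ k * (x $ i * partial i (?v k) x))"
    by (simp add: euler_def sum_distrib_left algebra_simps)
  also have "\<dots> = (\<Sum>k\<in>UNIV. \<Sum>i\<in>UNIV. x $ i * ((if i = k then 1 else 0) * ?v k x) + x $ k * (x $ i * partial i (?v k) x))"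
    by (rule sum.swap)
  also have "\<dots> = (\<Sum>k\<in>UNIV. x $ k * (euler (?v k) x + ?v k x))"
  proof (rule sum.cong[OF refl])
    fix k
    have "(\<Sum>i\<in>UNIV. x $ i * ((if i = k then 1 else 0) * ?v k x)) = x $ k * ?v k x"
      by (subst sum.remove[of UNIV k]) auto
    then show "(\<Sum>i\<in>UNIV. x $ i * ((if i = k then 1 else 0) * ?v k x) + x $ k * (x $ i * partial i (?v k) x)) =
        x $ k * (euler (?v k) x + ?v k x)"
      by (simp only: euler_def sum.distrib sum_distrib_left[symmetric] distrib_left)
  qed
  also have "\<dots> = (\<Sum>k\<in>UNIV. x $ k * radial 0 (partial k f) x)"
    using euler_radial[OF smooth_radial[OF smooth_partial[OF f]], of 0 0] by simp
  also have "\<dots> = f x - f 0" using hadamard[OF f, of x] by simp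
  finally show ?thesis .
qed

lemma radial0_comb:
  assumes f: "smooth f" and h: "smooth h"
  shows "radial0 (\<lambda>x. r * f x + s * h x) = (\<lambda>x. r * radial0 f x + s * radial0 h x)"
proof -
  have "radial 0 (radial 0 (partial i (\<lambda>x. r * f x + s * h x))) =
      (\<lambda>x. r * radial 0 (radial 0 (partial i f)) x + s * radial 0 (radial 0 (partial i h)) x)" for i
    using f h by (simp add: partial_add partial_cmult smooth_cmult radial_comb smooth_partial smooth_radial)
  then show ?thesis
    by (simp add: radial0_def[abs_def] sum.distrib sum_distrib_left algebra_simps)
qed

section \<open>Vector fields, divergence and bracket\<close>

definition divg :: "'m::finite vector_field \<Rightarrow> 'm scalar_field"
  where "divg X x = (\<Sum>i\<in>UNIV. partial i (\<lambda>y. X y $ i) x)"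

lemma trace_jacobian: "trace (jacobian_matrix X x) = divg X x"
  by (simp add: trace_def jacobian_matrix_def divg_def)

lemma lie_density_eq: "lie_density l X f = (\<lambda>x. deriv_along X f x + l * divg X x * f x)"
  by (simp add: lie_density_def trace_jacobian)

lemma smooth_vf_comp: "smooth_vf X \<Longrightarrow> smooth (\<lambda>x. X x $ i)"
  by (simp add: smooth_vf_def)

lemma smooth_deriv_along: "smooth_vf X \<Longrightarrow> smooth f \<Longrightarrow> smooth (deriv_along X f)"
  unfolding deriv_along_def by (intro smooth_sum smooth_mult smooth_vf_comp smooth_partial)

lemma smooth_divg: "smooth_vf X \<Longrightarrow> smooth (divg X)"
  unfolding divg_def by (intro smooth_sum smooth_partial smooth_vf_comp)

lemma deriv_along_vf_comp: "deriv_along_vf X P x $ i = deriv_along X (\<lambda>y. P y $ i) x"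
  by (simp add: deriv_along_vf_def)

lemma vf_bracket_comp:
  "vf_bracket X Y x $ i = deriv_along X (\<lambda>y. Y y $ i) x - deriv_along Y (\<lambda>y. X y $ i) x"
  by (simp add: vf_bracket_def deriv_along_vf_comp)

lemma smooth_vf_bracket: "smooth_vf X \<Longrightarrow> smooth_vf Y \<Longrightarrow> smooth_vf (vf_bracket X Y)"
  unfolding smooth_vf_def vf_bracket_comp
  by (auto intro!: smooth_diff smooth_deriv_along simp: smooth_vf_def)

lemma smooth_vf_comb: "smooth_vf X \<Longrightarrow> smooth_vf Y \<Longrightarrow> smooth_vf (r *\<^sub>R X + s *\<^sub>R Y)"
  by (auto simp: smooth_vf_def intro!: smooth_add smooth_cmult)

lemma smooth_vf_0: "smooth_vf 0"
  by (simp add: smooth_vf_def smooth_const)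

lemma smooth_vf_fmult: "smooth h \<Longrightarrow> smooth_vf X \<Longrightarrow> smooth_vf (\<lambda>x. h x *\<^sub>R X x)"
  by (simp add: smooth_vf_def smooth_mult)

lemma subspace_smooth_vf: "subspace {X. smooth_vf X}"
  using smooth_vf_comb[of _ _ 1 1] smooth_vf_comb[of _ 0 _ 0] by (auto simp: subspace_def smooth_vf_0)

lemma subspace_smooth: "subspace {f. smooth f}"
  by (auto simp: subspace_def smooth_const zero_fun_def plus_fun_def scaleR_fun_def
      intro: smooth_add smooth_cmult)

lemma deriv_along_comb_left: "deriv_along (r *\<^sub>R X + s *\<^sub>R Y) f x = r * deriv_along X f x + s * deriv_along Y f x"
  by (simp add: deriv_along_def sum.distrib sum_distrib_left algebra_simps)

lemma deriv_along_add:
  "smooth f \<Longrightarrow> smooth h \<Longrightarrow> deriv_along X (\<lambda>x. f x + h x) x = deriv_along X f x + deriv_along X h x"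
  by (simp add: deriv_along_def partial_add sum.distrib algebra_simps)

lemma deriv_along_diff:
  "smooth f \<Longrightarrow> smooth h \<Longrightarrow> deriv_along X (\<lambda>x. f x - h x) x = deriv_along X f x - deriv_along X h x"
  by (simp add: deriv_along_def partial_diff sum_subtractf algebra_simps)

lemma deriv_along_cmult: "smooth f \<Longrightarrow> deriv_along X (\<lambda>x. c * f x) x = c * deriv_along X f x"
  by (simp add: deriv_along_def partial_cmult sum_distrib_left algebra_simps)

lemma deriv_along_mult:
  "smooth f \<Longrightarrow> smooth h \<Longrightarrow> deriv_along X (\<lambda>x. f x * h x) x = deriv_along X f x * h x + f x * deriv_along X h x"
  by (simp add: deriv_along_def partial_mult sum.distrib sum_distrib_left algebra_simps)

lemma deriv_along_const [simp]: "deriv_along X (\<lambda>x. c) x = 0"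
  by (simp add: deriv_along_def)

lemma deriv_along_sum:
  "(\<And>k. k \<in> I \<Longrightarrow> smooth (f k)) \<Longrightarrow> deriv_along X (\<lambda>x. \<Sum>k\<in>I. f k x) x = (\<Sum>k\<in>I. deriv_along X (f k) x)"
  by (induction I rule: infinite_finite_induct) (simp_all add: deriv_along_add smooth_sum)

lemma deriv_along_bracket:
  assumes X: "smooth_vf X" and Y: "smooth_vf Y" and f: "smooth f"
  shows "deriv_along (vf_bracket X Y) f x = deriv_along X (deriv_along Y f) x - deriv_along Y (deriv_along X f) x"
proof -
  have e: "deriv_along X (deriv_along Y f) x =
      (\<Sum>j\<in>UNIV. deriv_along X (\<lambda>y. Y y $ j) x * partial j f x) +
      (\<Sum>i\<in>UNIV. \<Sum>j\<in>UNIV. X x $ i * (Y x $ j * partial i (partial j f) x))" if Y: "smooth_vf Y" for X Y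
  proof -
    have "deriv_along X (deriv_along Y f) x = (\<Sum>j\<in>UNIV. deriv_along X (\<lambda>y. Y y $ j * partial j f y) x)"
      unfolding deriv_along_def[of Y f, abs_def] using Y f
      by (intro deriv_along_sum) (auto intro!: smooth_mult smooth_partial smooth_vf_comp)
    also have "\<dots> = (\<Sum>j\<in>UNIV. deriv_along X (\<lambda>y. Y y $ j) x * partial j f x + Y x $ j * deriv_along X (partial j f) x)"
      using Y f by (intro sum.cong refl deriv_along_mult smooth_partial smooth_vf_comp)
    also have "\<dots> = (\<Sum>j\<in>UNIV. deriv_along X (\<lambda>y. Y y $ j) x * partial j f x) +
        (\<Sum>j\<in>UNIV. \<Sum>i\<in>UNIV. X x $ i * (Y x $ j * partial i (partial j f) x))"
      by (simp add: sum.distrib deriv_along_def[of X "partial _ f"] sum_distrib_left mult_ac)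
    also have "(\<Sum>j\<in>UNIV. \<Sum>i\<in>UNIV. X x $ i * (Y x $ j * partial i (partial j f) x)) =
        (\<Sum>i\<in>UNIV. \<Sum>j\<in>UNIV. X x $ i * (Y x $ j * partial i (partial j f) x))" by (rule sum.swap)
    finally show ?thesis .
  qed
  have "(\<Sum>i\<in>UNIV. \<Sum>j\<in>UNIV. Y x $ i * (X x $ j * partial i (partial j f) x)) =
      (\<Sum>j\<in>UNIV. \<Sum>i\<in>UNIV. Y x $ i * (X x $ j * partial j (partial i f) x))"
    by (subst sum.swap) (simp add: partial_commute[OF f])
  then have "(\<Sum>i\<in>UNIV. \<Sum>j\<in>UNIV. Y x $ i * (X x $ j * partial i (partial j f) x)) =
      (\<Sum>i\<in>UNIV. \<Sum>j\<in>UNIV. X x $ i * (Y x $ j * partial i (partial j f) x))"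
    by (simp add: mult_ac)
  then show ?thesis
    unfolding e[OF X] e[OF Y]
    by (simp add: deriv_along_def[of "vf_bracket X Y"] vf_bracket_comp left_diff_distrib sum_subtractf)
qed

lemma divg_bracket:
  assumes X: "smooth_vf X" and Y: "smooth_vf Y"
  shows "divg (vf_bracket X Y) x = deriv_along X (divg Y) x - deriv_along Y (divg X) x"
proof -
  note sX = smooth_vf_comp[OF X] and sY = smooth_vf_comp[OF Y]
  have p: "partial i (deriv_along X (\<lambda>y. Y y $ i)) x =
      (\<Sum>k\<in>UNIV. partial i (\<lambda>y. X y $ k) x * partial k (\<lambda>y. Y y $ i) x) +
      deriv_along X (partial i (\<lambda>y. Y y $ i)) x"
    if "smooth_vf X" "smooth_vf Y" for X Y i
  proof -
    have "partial i (deriv_along X (\<lambda>y. Y y $ i)) x =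
        (\<Sum>k\<in>UNIV. partial i (\<lambda>y. X y $ k * partial k (\<lambda>y. Y y $ i) y) x)"
      unfolding deriv_along_def[abs_def] using that
      by (subst partial_sum) (auto intro!: smooth_mult smooth_partial smooth_vf_comp)
    also have "\<dots> = (\<Sum>k\<in>UNIV. partial i (\<lambda>y. X y $ k) x * partial k (\<lambda>y. Y y $ i) x +
        X x $ k * partial k (partial i (\<lambda>y. Y y $ i)) x)"
      using that by (simp add: partial_mult smooth_partial smooth_vf_comp partial_commute[of _ i])
    finally show ?thesis by (simp add: sum.distrib deriv_along_def)
  qed
  have q: "deriv_along X (divg Y) x = (\<Sum>i\<in>UNIV. deriv_along X (partial i (\<lambda>y. Y y $ i)) x)" if "smooth_vf Y" for X Y
    unfolding divg_def[abs_def] using that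
    by (intro deriv_along_sum) (auto intro!: smooth_partial smooth_vf_comp)
  have "divg (vf_bracket X Y) x = (\<Sum>i\<in>UNIV. partial i (deriv_along X (\<lambda>y. Y y $ i)) x - partial i (deriv_along Y (\<lambda>y. X y $ i)) x)"
    using X Y by (simp add: divg_def vf_bracket_comp partial_diff smooth_deriv_along smooth_vf_comp)
  also have "\<dots> = deriv_along X (divg Y) x - deriv_along Y (divg X) x +
     ((\<Sum>i\<in>UNIV. \<Sum>k\<in>UNIV. partial i (\<lambda>y. X y $ k) x * partial k (\<lambda>y. Y y $ i) x) -
      (\<Sum>i\<in>UNIV. \<Sum>k\<in>UNIV. partial i (\<lambda>y. Y y $ k) x * partial k (\<lambda>y. X y $ i) x))"
    unfolding p[OF X Y] p[OF Y X] q[OF X] q[OF Y] by (simp add: sum.distrib sum_subtractf)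
  also have "(\<Sum>i\<in>UNIV. \<Sum>k\<in>UNIV. partial i (\<lambda>y. Y y $ k) x * partial k (\<lambda>y. X y $ i) x) =
      (\<Sum>i\<in>UNIV. \<Sum>k\<in>UNIV. partial i (\<lambda>y. X y $ k) x * partial k (\<lambda>y. Y y $ i) x)"
    by (subst sum.swap) (simp add: mult.commute)
  finally show ?thesis by simp
qed

lemma divg_comb:
  assumes "smooth_vf X" "smooth_vf Y"
  shows "divg (r *\<^sub>R X + s *\<^sub>R Y) x = r * divg X x + s * divg Y x"
  using assms by (simp add: divg_def partial_add partial_cmult smooth_cmult smooth_vf_comp sum.distrib sum_distrib_left)

lemma divg_fmult:
  assumes "smooth h" "smooth_vf X"
  shows "divg (\<lambda>x. h x *\<^sub>R X x) x = deriv_along X h x + h x * divg X x"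
  using assms by (simp add: divg_def deriv_along_def partial_mult smooth_vf_comp sum.distrib sum_distrib_left algebra_simps)

lemma vf_bracket_anti: "vf_bracket X Y = - vf_bracket Y X"
  by (simp add: vf_bracket_def)

lemma vf_bracket_comb:
  assumes "smooth_vf Y" "smooth_vf Z"
  shows "vf_bracket X (r *\<^sub>R Y + s *\<^sub>R Z) = r *\<^sub>R vf_bracket X Y + s *\<^sub>R vf_bracket X Z"
  using assms
  by (simp add: fun_eq_iff vec_eq_iff vf_bracket_comp deriv_along_add deriv_along_cmult smooth_cmult smooth_vf_comp
      deriv_along_comb_left algebra_simps)

lemma vf_bracket_jacobi:
  assumes X: "smooth_vf X" and Y: "smooth_vf Y" and Z: "smooth_vf Z"
  shows "vf_bracket X (vf_bracket Y Z) = vf_bracket (vf_bracket X Y) Z + vf_bracket Y (vf_bracket X Z)"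
  using assms
  by (simp add: fun_eq_iff vec_eq_iff vf_bracket_comp deriv_along_diff deriv_along_bracket
      smooth_deriv_along smooth_vf_comp smooth_vf_bracket algebra_simps)

section \<open>The projective algebra in homogeneous coordinates\<close>

text \<open>Homogeneous coordinates: the index \<open>None\<close> stands for the coordinate \<open>X\<^sup>0\<close>, set to \<open>1\<close>. A function
  on the affine chart is homogeneous of degree zero in \<open>m + 1\<close> variables, so that \<open>X\<^sup>0 \<partial>\<^sub>0\<close> acts on it as
  \<open>- E\<close>; therefore \<open>hvec None\<close> is \<open>- E\<close>, and \<open>proj_vf a b\<close> is \<open>X\<^sup>a \<partial>\<^sub>b\<close>.\<close>

definition hcoord :: "'m::finite option \<Rightarrow> 'm scalar_field"
  where "hcoord a x = (case a of None \<Rightarrow> 1 | Some i \<Rightarrow> x $ i)"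

definition hvec :: "'m::finite option \<Rightarrow> 'm vector_field"
  where "hvec b = (case b of None \<Rightarrow> - euler_vf | Some j \<Rightarrow> coord_vf j)"

definition proj_vf :: "'m::finite option \<Rightarrow> 'm option \<Rightarrow> 'm vector_field"
  where "proj_vf a b = (\<lambda>x. hcoord a x *\<^sub>R hvec b x)"

abbreviation \<delta> :: "'i \<Rightarrow> 'i \<Rightarrow> real"
  where "\<delta> a b \<equiv> (if a = b then 1 else 0)"

abbreviation sl_carrier :: "'m::finite vector_field set"
  where "sl_carrier \<equiv> la_carrier sl_proj"

lemma euler_vf_eq: "euler_vf x = x"
  by (simp add: euler_vf_def coord_vf_def vec_eq_iff axis_def if_distrib[where f = "\<lambda>u. _ * u"] cong: if_cong)

lemma hcoord_simps [simp]: "hcoord None x = 1" "hcoord (Some i) x = x $ i"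
  by (simp_all add: hcoord_def)

lemma smooth_hcoord: "smooth (hcoord a)"
  by (cases a) (simp_all add: hcoord_def[abs_def] smooth_const smooth_coord)

lemma hvec_comp: "hvec b x $ i = \<delta> b (Some i) - \<delta> b None * x $ i"
  by (cases b) (auto simp: hvec_def euler_vf_eq coord_vf_def axis_def)

lemma smooth_hvec: "smooth_vf (hvec b)"
  unfolding smooth_vf_def hvec_comp by (intro allI smooth_diff smooth_const smooth_cmult smooth_coord)

lemma smooth_proj_vf: "smooth_vf (proj_vf a b)"
  unfolding proj_vf_def by (rule smooth_vf_fmult[OF smooth_hcoord smooth_hvec])

lemma deriv_along_hvec_Some: "deriv_along (hvec (Some j)) f x = partial j f x"
  by (simp add: deriv_along_def hvec_comp if_distrib[where f = "\<lambda>u. u * _"] eq_commute[of j] cong: if_cong)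

lemma deriv_along_hvec_None: "deriv_along (hvec None) f x = - euler f x"
  by (simp add: deriv_along_def hvec_comp euler_def sum_negf)

lemma deriv_along_scaled: "deriv_along (\<lambda>x. h x *\<^sub>R X x) f x = h x * deriv_along X f x"
  by (simp add: deriv_along_def sum_distrib_left mult.assoc)

lemma deriv_along_proj: "deriv_along (proj_vf a b) f x = hcoord a x * deriv_along (hvec b) f x"
  unfolding proj_vf_def by (rule deriv_along_scaled)

lemma deriv_along_coord: "deriv_along P (\<lambda>x. x $ i) x = P x $ i"
  by (simp add: deriv_along_def partial_coord if_distrib[where f = "\<lambda>u. _ * u"] eq_commute[of _ i] cong: if_cong)

lemma deriv_along_hcoord: "deriv_along P (hcoord a) x = (case a of None \<Rightarrow> 0 | Some i \<Rightarrow> P x $ i)"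
  by (cases a) (simp_all add: hcoord_def[abs_def] deriv_along_coord)

lemma hvec_hcoord: "deriv_along (hvec b) (hcoord c) x = \<delta> b c - \<delta> b None * hcoord c x"
  by (cases c) (auto simp: deriv_along_hcoord hvec_comp)

lemma divg_hvec: "divg (hvec b :: 'm::finite vector_field) x = - real CARD('m) * \<delta> b None"
  by (cases b) (simp_all add: divg_def hvec_comp partial_coord partial_minus smooth_coord)

lemma divg_proj:
  "divg (proj_vf a b :: 'm::finite vector_field) x = \<delta> a b - (real CARD('m) + 1) * \<delta> b None * hcoord a x"
  unfolding proj_vf_def divg_fmult[OF smooth_hcoord smooth_hvec] hvec_hcoord divg_hvec
  by (auto simp: algebra_simps)

lemma vf_bracket_fmult:
  assumes "smooth h" "smooth_vf Y"
  shows "vf_bracket X (\<lambda>x. h x *\<^sub>R Y x) x = deriv_along X h x *\<^sub>R Y x + h x *\<^sub>R vf_bracket X Y x"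
  using assms
  by (simp add: vec_eq_iff vf_bracket_comp deriv_along_mult smooth_vf_comp deriv_along_scaled algebra_simps)

text \<open>These are the relations of the elementary matrices of \<open>gl\<^sub>m\<^sub>+\<^sub>1\<close>; the identity matrix corresponds to
  the zero field.\<close>

lemma proj_bracket:
  "vf_bracket (proj_vf p q) (proj_vf a b) = \<delta> q a *\<^sub>R proj_vf p b - \<delta> p b *\<^sub>R proj_vf a q"
proof (rule ext, unfold vec_eq_iff, rule allI)
  fix x and i :: 'a
  have comp: "(\<lambda>y. proj_vf a b y $ i) = (\<lambda>y. hcoord a y * (\<delta> b (Some i) - \<delta> b None * hcoord (Some i) y))" for a b
    by (simp add: proj_vf_def hvec_comp)
  have s: "smooth (\<lambda>y. \<delta> b (Some i) - \<delta> b None * hcoord (Some i) y)" for b :: "'a option"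
    by (intro smooth_diff smooth_const smooth_cmult smooth_hcoord)
  have D: "deriv_along (proj_vf p q) (\<lambda>y. proj_vf a b y $ i) x =
      hcoord p x * (\<delta> q a - \<delta> q None * hcoord a x) * (\<delta> b (Some i) - \<delta> b None * hcoord (Some i) x)
      - \<delta> b None * hcoord a x * hcoord p x * (\<delta> q (Some i) - \<delta> q None * hcoord (Some i) x)" for p q a b
    unfolding comp deriv_along_mult[OF smooth_hcoord s] deriv_along_diff[OF smooth_const smooth_cmult[OF smooth_hcoord]]
      deriv_along_cmult[OF smooth_hcoord] deriv_along_proj hvec_hcoord deriv_along_const
    by (simp add: algebra_simps)
  show "vf_bracket (proj_vf p q) (proj_vf a b) x $ i = (\<delta> q a *\<^sub>R proj_vf p b - \<delta> p b *\<^sub>R proj_vf a q) x $ i"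
  proof -
    have "\<delta> b p = \<delta> p b" by simp
    moreover have "(\<delta> q a *\<^sub>R proj_vf p b - \<delta> p b *\<^sub>R proj_vf a q) x $ i =
      \<delta> q a * (hcoord p x * (\<delta> b (Some i) - \<delta> b None * hcoord (Some i) x)) -
      \<delta> p b * (hcoord a x * (\<delta> q (Some i) - \<delta> q None * hcoord (Some i) x))"
      by (simp add: proj_vf_def hvec_comp split del: if_split)
    ultimately show ?thesis
      unfolding vf_bracket_comp D by (simp add: algebra_simps split del: if_split)
  qed
qed

lemma sl_carrier_eq: "sl_carrier = span (range (\<lambda>(a, b). proj_vf a b))" (is "_ = span ?B")
proof -
  let ?A = "range coord_vf \<union> {\<lambda>x. (x $ j) *\<^sub>R coord_vf i x | i j. True} \<union> {\<lambda>x. (x $ j) *\<^sub>R euler_vf x | j. True}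
    :: 'a vector_field set"
  have base: "proj_vf a b \<in> span ?B" for a b
    by (rule span_base) auto
  have A: "?A \<subseteq> span ?B"
  proof
    fix X assume "X \<in> ?A"
    then consider i where "X = coord_vf i" | i j where "X = (\<lambda>x. (x $ j) *\<^sub>R coord_vf i x)"
      | j where "X = (\<lambda>x. (x $ j) *\<^sub>R euler_vf x)" by blast
    then show "X \<in> span ?B"
    proof cases
      case 1
      then have "X = proj_vf None (Some i)" by (simp add: proj_vf_def hvec_def fun_eq_iff)
      then show ?thesis using base by simp
    next
      case 2
      then have "X = proj_vf (Some j) (Some i)" by (simp add: proj_vf_def hvec_def fun_eq_iff)
      then show ?thesis using base by simp
    next
      case 3
      then have "X = - proj_vf (Some j) None" by (simp add: proj_vf_def hvec_def fun_eq_iff)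
      then show ?thesis using base by (simp add: span_neg)
    qed
  qed
  have B: "?B \<subseteq> span ?A"
  proof
    fix X assume "X \<in> ?B"
    then obtain a b where X: "X = proj_vf a b" by auto
    have s: "(\<lambda>x. (x $ j) *\<^sub>R coord_vf i x) \<in> span ?A" for i j by (rule span_base) blast
    have c: "coord_vf i \<in> span ?A" for i by (rule span_base) blast
    have e: "(\<lambda>x. (x $ j) *\<^sub>R euler_vf x) \<in> span ?A" for j by (rule span_base) blast
    show "X \<in> span ?A"
    proof (cases b)
      case (Some i)
      have "X = (case a of None \<Rightarrow> coord_vf i | Some j \<Rightarrow> (\<lambda>x. (x $ j) *\<^sub>R coord_vf i x))"
        unfolding X Some by (cases a) (simp_all add: proj_vf_def hvec_def fun_eq_iff)
      then show ?thesis using s c by (cases a) auto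
    next
      case None
      have "X = - (case a of None \<Rightarrow> (\<Sum>i\<in>UNIV. (\<lambda>x. (x $ i) *\<^sub>R coord_vf i x)) | Some j \<Rightarrow> (\<lambda>x. (x $ j) *\<^sub>R euler_vf x))"
        unfolding X None by (cases a) (simp_all add: proj_vf_def hvec_def fun_eq_iff euler_vf_def)
      then show ?thesis using s e by (cases a) (auto intro!: span_neg span_sum)
    qed
  qed
  have "span ?A = span ?B"
    using A B by (intro antisym span_minimal subspace_span)
  then show ?thesis by (simp add: sl_proj_def)
qed

lemma proj_in: "proj_vf a b \<in> sl_carrier"
  unfolding sl_carrier_eq by (rule span_base) auto

lemma sub_sl: "subspace sl_carrier"
  by (simp add: sl_carrier_eq)

lemma sl_smooth: "X \<in> sl_carrier \<Longrightarrow> smooth_vf X"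
proof -
  have "range (\<lambda>(a, b). proj_vf a b) \<subseteq> {X. smooth_vf X}" by (auto simp: smooth_proj_vf)
  then have "sl_carrier \<subseteq> {X. smooth_vf X}"
    unfolding sl_carrier_eq by (intro span_minimal subspace_smooth_vf)
  then show "X \<in> sl_carrier \<Longrightarrow> smooth_vf X" by blast
qed

lemma sl_bracket [simp]: "la_bracket sl_proj = vf_bracket"
  by (simp add: sl_proj_def)

lemma sl_bracket_in:
  fixes X Y :: "'m::finite vector_field"
  assumes X: "X \<in> sl_carrier" and Y: "Y \<in> sl_carrier"
  shows "vf_bracket X Y \<in> sl_carrier"
proof -
  have 1: "Z \<in> sl_carrier \<and> vf_bracket X Z \<in> sl_carrier" if X: "smooth_vf X"
    and e: "\<And>a b. vf_bracket X (proj_vf a b) \<in> sl_carrier" and Z: "Z \<in> span (range (\<lambda>(a, b). proj_vf a b))" for X Z :: "'m vector_field"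
    using Z
  proof (induction rule: span_induct_alt)
    case base
    have "vf_bracket X 0 = 0"
      using vf_bracket_comb[OF smooth_vf_0 smooth_vf_0, of X 0 0] by simp
    then show ?case using subspace_0[OF sub_sl] by (simp add: zero_fun_def[symmetric])
  next
    case (step c Z W)
    then have Z: "Z \<in> sl_carrier" and W: "W \<in> sl_carrier" and "vf_bracket X Z \<in> sl_carrier" "vf_bracket X W \<in> sl_carrier"
      using e proj_in by auto
    then have 1: "c *\<^sub>R Z + W \<in> sl_carrier" and 2: "c *\<^sub>R vf_bracket X Z + vf_bracket X W \<in> sl_carrier"
      using subspace_comb[OF sub_sl, of _ _ c 1] by simp_all
    have "vf_bracket X (c *\<^sub>R Z + W) = c *\<^sub>R vf_bracket X Z + vf_bracket X W"
      using vf_bracket_comb[OF sl_smooth[OF Z] sl_smooth[OF W], of X c 1] by simp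
    then have "vf_bracket X (c *\<^sub>R Z + W) \<in> sl_carrier" using 2 by simp
    with 1 show ?case by (rule conjI)
  qed
  have 2: "vf_bracket (proj_vf p q) (proj_vf a b) \<in> sl_carrier" for p q a b :: "'m option"
    unfolding proj_bracket
    by (intro subspace_diff[OF sub_sl] subspace_scale[OF sub_sl] proj_in)
  have 3: "vf_bracket (proj_vf p q) Z \<in> sl_carrier" if "Z \<in> sl_carrier" for p q :: "'m option" and Z
    using 1[OF smooth_proj_vf 2] that by (simp add: sl_carrier_eq)
  have "vf_bracket Y (proj_vf p q) \<in> sl_carrier" for p q :: "'m option"
    unfolding vf_bracket_anti[of Y] using 3[OF Y] by (rule subspace_neg[OF sub_sl])
  then have "vf_bracket Y X \<in> sl_carrier"
    using 1[OF sl_smooth[OF Y]] X by (simp add: sl_carrier_eq)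
  then show ?thesis
    unfolding vf_bracket_anti[of X] by (rule subspace_neg[OF sub_sl])
qed

lemma sl_lie_algebra: "lie_algebra_on sl_proj"
proof
  show "subspace sl_carrier" by (rule sub_sl)
  fix X Y Z :: "'a vector_field"
  assume X: "X \<in> sl_carrier"
  show "lin_on sl_carrier sl_carrier (la_bracket sl_proj X)"
    using X by (intro lin_onI) (auto simp: sl_bracket_in vf_bracket_comb sl_smooth)
  assume Y: "Y \<in> sl_carrier"
  show "la_bracket sl_proj X Y = - la_bracket sl_proj Y X" by (simp add: vf_bracket_anti[of X])
  assume Z: "Z \<in> sl_carrier"
  show "la_bracket sl_proj X (la_bracket sl_proj Y Z) =
      la_bracket sl_proj (la_bracket sl_proj X Y) Z + la_bracket sl_proj Y (la_bracket sl_proj X Z)"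
    unfolding sl_bracket by (intro vf_bracket_jacobi sl_smooth X Y Z)
qed

text \<open>The actions of interest are defined and well behaved for all smooth vector fields.\<close>

lemma sl_moduleI:
  fixes M :: "('m::finite vector_field, 'w::real_vector) lie_module"
  assumes "subspace (lm_carrier M)"
    and "\<And>X v. smooth_vf X \<Longrightarrow> v \<in> lm_carrier M \<Longrightarrow> X \<in> sl_carrier \<Longrightarrow> lm_act M X v \<in> lm_carrier M"
    and "\<And>X v w r s. smooth_vf X \<Longrightarrow> v \<in> lm_carrier M \<Longrightarrow> w \<in> lm_carrier M \<Longrightarrow>
      lm_act M X (r *\<^sub>R v + s *\<^sub>R w) = r *\<^sub>R lm_act M X v + s *\<^sub>R lm_act M X w"
    and "\<And>X Y v r s. smooth_vf X \<Longrightarrow> smooth_vf Y \<Longrightarrow> v \<in> lm_carrier M \<Longrightarrow>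
      lm_act M (r *\<^sub>R X + s *\<^sub>R Y) v = r *\<^sub>R lm_act M X v + s *\<^sub>R lm_act M Y v"
    and "\<And>X Y v. smooth_vf X \<Longrightarrow> smooth_vf Y \<Longrightarrow> v \<in> lm_carrier M \<Longrightarrow>
      lm_act M (vf_bracket X Y) v = lm_act M X (lm_act M Y v) - lm_act M Y (lm_act M X v)"
  shows "lie_module_on sl_proj M"
proof (intro lie_module_on.intro sl_lie_algebra lie_module_on_axioms.intro)
  show "subspace (lm_carrier M)" by (rule assms(1))
  fix X Y :: "'m vector_field" and v and r s :: real assume X: "X \<in> sl_carrier"
  show "lin_on (lm_carrier M) (lm_carrier M) (lm_act M X)"
    by (intro lin_onI assms(2,3) sl_smooth X)
  assume Y: "Y \<in> sl_carrier" and v: "v \<in> lm_carrier M"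
  show "lm_act M (r *\<^sub>R X + s *\<^sub>R Y) v = r *\<^sub>R lm_act M X v + s *\<^sub>R lm_act M Y v"
    by (intro assms(4) sl_smooth X Y v)
  show "lm_act M (la_bracket sl_proj X Y) v = lm_act M X (lm_act M Y v) - lm_act M Y (lm_act M X v)"
    unfolding sl_bracket by (intro assms(5) sl_smooth X Y v)
qed

section \<open>Densities, vector densities and an extension of the latter by the former\<close>

definition dens_module :: "real \<Rightarrow> ('m::finite vector_field, 'm scalar_field) lie_module"
  where "dens_module l = \<lparr>lm_carrier = {f. smooth f}, lm_act = lie_density l\<rparr>"

lemma dens_carrier [simp]: "lm_carrier (dens_module l) = {f. smooth f}"
  and dens_act [simp]: "lm_act (dens_module l) = lie_density l"
  by (simp_all add: dens_module_def)

lemma fun_comb: "r *\<^sub>R f + s *\<^sub>R h = (\<lambda>x. r *\<^sub>R f x + s *\<^sub>R h x)" for f h :: "'a \<Rightarrow> 'b::real_vector"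
  by (simp add: fun_eq_iff)

lemma fun_diff_eq: "f - h = (\<lambda>x. f x - h x)" for f h :: "'a \<Rightarrow> 'b::ab_group_add"
  by (simp add: fun_eq_iff)

lemma deriv_along_comb:
  "smooth f \<Longrightarrow> smooth h \<Longrightarrow> deriv_along X (\<lambda>x. r * f x + s * h x) x = r * deriv_along X f x + s * deriv_along X h x"
  by (simp add: deriv_along_add deriv_along_cmult smooth_cmult)

lemma smooth_lie_density: "smooth_vf X \<Longrightarrow> smooth f \<Longrightarrow> smooth (lie_density l X f)"
  unfolding lie_density_eq
  by (intro smooth_add smooth_deriv_along smooth_mult smooth_const smooth_divg)

lemma lie_density_comb:
  "smooth f \<Longrightarrow> smooth h \<Longrightarrow> lie_density l X (r *\<^sub>R f + s *\<^sub>R h) = r *\<^sub>R lie_density l X f + s *\<^sub>R lie_density l X h"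
  unfolding fun_comb by (rule ext) (simp add: lie_density_eq deriv_along_comb algebra_simps)

lemma lie_density_comb_left:
  "smooth_vf X \<Longrightarrow> smooth_vf Y \<Longrightarrow>
    lie_density l (r *\<^sub>R X + s *\<^sub>R Y) f = r *\<^sub>R lie_density l X f + s *\<^sub>R lie_density l Y f"
  by (rule ext) (simp add: lie_density_eq deriv_along_comb_left divg_comb algebra_simps)

lemma lie_density_bracket:
  assumes X: "smooth_vf X" and Y: "smooth_vf Y" and f: "smooth f"
  shows "lie_density l (vf_bracket X Y) f = lie_density l X (lie_density l Y f) - lie_density l Y (lie_density l X f)"
proof
  fix x
  have e: "lie_density l X (lie_density l Y f) x = deriv_along X (deriv_along Y f) x + l * (deriv_along X (divg Y) x * f x +
      divg Y x * deriv_along X f x) + l * divg X x * (deriv_along Y f x + l * divg Y x * f x)"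
    if "smooth_vf X" "smooth_vf Y" for X Y
    using that f unfolding lie_density_eq
    by (simp add: deriv_along_add smooth_deriv_along smooth_cmult smooth_mult smooth_divg deriv_along_mult
        mult.assoc deriv_along_cmult)
  show "lie_density l (vf_bracket X Y) f x = (lie_density l X (lie_density l Y f) - lie_density l Y (lie_density l X f)) x"
    unfolding minus_apply e[OF X Y] e[OF Y X]
    by (simp add: lie_density_eq deriv_along_bracket[OF X Y f] divg_bracket[OF X Y] algebra_simps)
qed

lemma dens_module: "lie_module_on sl_proj (dens_module l)"
  by (rule sl_moduleI)
    (auto simp: subspace_smooth smooth_lie_density lie_density_comb lie_density_comb_left lie_density_bracket)

lemma S1_carrier [simp]: "lm_carrier (S1_module l) = {P. smooth_vf P}"
  by (simp add: S1_module_def)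

lemma S1_act: "lm_act (S1_module l) X P = (\<lambda>x. vf_bracket X P x + (l * divg X x) *\<^sub>R P x)"
proof
  fix x
  have "jacobian_matrix X x *v P x = deriv_along_vf P X x"
    by (simp add: vec_eq_iff matrix_vector_mult_def jacobian_matrix_def deriv_along_vf_comp deriv_along_def mult.commute)
  then show "lm_act (S1_module l) X P x = vf_bracket X P x + (l * divg X x) *\<^sub>R P x"
    by (simp add: S1_module_def vf_bracket_def trace_jacobian)
qed

lemma smooth_S1_act:
  assumes "smooth_vf X" "smooth_vf P"
  shows "smooth_vf (lm_act (S1_module l) X P)"
proof -
  have "smooth_vf (\<lambda>x. (l * divg X x) *\<^sub>R P x)"
    using assms by (intro smooth_vf_fmult smooth_mult smooth_const smooth_divg)
  then show ?thesis
    using smooth_vf_comb[OF smooth_vf_bracket[OF assms], of _ 1 1] by (simp add: S1_act plus_fun_def)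
qed

text \<open>The extension by the cocycle that takes \<open>X\<close> to \<open>P \<mapsto> P.(div X)\<close>. It is a rescaled form of the
  operators of order one from \<open>\<lambda>\<close>- to \<open>(\<lambda> + 1)\<close>-densities for any \<open>\<lambda> \<noteq> 0\<close>. It is also, as a module
  over \<open>sl\<^sub>m\<^sub>+\<^sub>1\<close>, the space of densities of weight \<open>1 - 1 / (m + 1)\<close> with values in the dual of the
  standard representation, which is why its cohomology can be computed by a homotopy.\<close>

definition ext_module :: "('m::finite vector_field, 'm vector_field \<times> 'm scalar_field) lie_module"
  where "ext_module = \<lparr>lm_carrier = {P. smooth_vf P} \<times> {f. smooth f},
    lm_act = (\<lambda>X v. (lm_act (S1_module 1) X (fst v), lie_density 1 X (snd v) + deriv_along (fst v) (divg X)))\<rparr>"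

lemma ext_carrier: "lm_carrier ext_module = {P. smooth_vf P} \<times> {f. smooth f}"
  and ext_act: "lm_act ext_module X v = (lm_act (S1_module 1) X (fst v), lie_density 1 X (snd v) + deriv_along (fst v) (divg X))"
  by (simp_all add: ext_module_def)

lemma S1_act_comb:
  assumes "smooth_vf P" "smooth_vf Q"
  shows "lm_act (S1_module l) X (r *\<^sub>R P + s *\<^sub>R Q) = r *\<^sub>R lm_act (S1_module l) X P + s *\<^sub>R lm_act (S1_module l) X Q"
  by (rule ext) (simp add: S1_act vf_bracket_comb[OF assms] algebra_simps)

lemma S1_act_comb_left:
  assumes "smooth_vf X" "smooth_vf Y" "smooth_vf P"
  shows "lm_act (S1_module l) (r *\<^sub>R X + s *\<^sub>R Y) P = r *\<^sub>R lm_act (S1_module l) X P + s *\<^sub>R lm_act (S1_module l) Y P"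
  unfolding S1_act vf_bracket_anti[of _ P] vf_bracket_comb[OF assms(1,2)]
  by (rule ext) (simp add: divg_comb[OF assms(1,2)] algebra_simps)

lemma S1_act_act:
  assumes X: "smooth_vf X" and Y: "smooth_vf Y" and P: "smooth_vf P"
  shows "lm_act (S1_module l) X (lm_act (S1_module l) Y P) x =
    vf_bracket X (vf_bracket Y P) x + (l * deriv_along X (divg Y) x) *\<^sub>R P x +
    (l * divg Y x) *\<^sub>R vf_bracket X P x + (l * divg X x) *\<^sub>R (vf_bracket Y P x + (l * divg Y x) *\<^sub>R P x)"
proof -
  have s: "smooth (\<lambda>x. l * divg Y x)" by (intro smooth_cmult smooth_divg Y)
  have "vf_bracket X (lm_act (S1_module l) Y P) = vf_bracket X (1 *\<^sub>R vf_bracket Y P + 1 *\<^sub>R (\<lambda>x. (l * divg Y x) *\<^sub>R P x))"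
    by (simp add: S1_act plus_fun_def)
  also have "\<dots> = vf_bracket X (vf_bracket Y P) + vf_bracket X (\<lambda>x. (l * divg Y x) *\<^sub>R P x)"
    by (subst vf_bracket_comb) (simp_all add: smooth_vf_bracket Y P smooth_vf_fmult s)
  finally show ?thesis
    using vf_bracket_fmult[OF s P, of X x]
    by (simp add: S1_act[of l X] deriv_along_cmult smooth_divg Y) (simp add: S1_act)
qed

lemma S1_act_bracket:
  assumes X: "smooth_vf X" and Y: "smooth_vf Y" and P: "smooth_vf P"
  shows "lm_act (S1_module l) (vf_bracket X Y) P =
    lm_act (S1_module l) X (lm_act (S1_module l) Y P) - lm_act (S1_module l) Y (lm_act (S1_module l) X P)"
  unfolding fun_eq_iff minus_apply S1_act_act[OF X Y P] S1_act_act[OF Y X P]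
  by (simp add: S1_act vf_bracket_jacobi[OF X Y P] divg_bracket[OF X Y] algebra_simps)

lemma S1_module: "lie_module_on sl_proj (S1_module l)"
  by (rule sl_moduleI)
    (auto simp: subspace_smooth_vf smooth_S1_act S1_act_comb S1_act_comb_left S1_act_bracket)

lemma deriv_along_S1:
  assumes X: "smooth_vf X" and P: "smooth_vf P" and f: "smooth f"
  shows "deriv_along (lm_act (S1_module 1) X P) f x =
    deriv_along X (deriv_along P f) x - deriv_along P (deriv_along X f) x + divg X x * deriv_along P f x"
proof -
  have "lm_act (S1_module 1) X P = 1 *\<^sub>R vf_bracket X P + 1 *\<^sub>R (\<lambda>x. divg X x *\<^sub>R P x)"
    by (simp add: S1_act plus_fun_def)
  then show ?thesis
    using deriv_along_comb_left[of 1 "vf_bracket X P" 1 "\<lambda>x. divg X x *\<^sub>R P x" f x]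
    by (simp add: deriv_along_bracket[OF X P f] deriv_along_scaled)
qed

lemma ext_module: "lie_module_on sl_proj (ext_module :: ('m::finite vector_field, _) lie_module)"
proof (rule sl_moduleI)
  show "subspace (lm_carrier (ext_module :: ('m vector_field, _) lie_module))"
    unfolding ext_carrier by (intro subspace_Times subspace_smooth_vf subspace_smooth)
  fix X :: "'m vector_field" and v
  assume X: "smooth_vf X" and v: "v \<in> lm_carrier (ext_module :: ('m vector_field, _) lie_module)"
  then have P: "smooth_vf (fst v)" and f: "smooth (snd v)" by (auto simp: ext_carrier)
  show "lm_act ext_module X v \<in> lm_carrier ext_module"
    using X P f by (simp add: ext_carrier ext_act smooth_S1_act plus_fun_def smooth_add smooth_lie_density smooth_deriv_along smooth_divg)
  {
    fix w r s assume "w \<in> lm_carrier (ext_module :: ('m vector_field, _) lie_module)"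
    then have Q: "smooth_vf (fst w)" and h: "smooth (snd w)" by (auto simp: ext_carrier)
    show "lm_act ext_module X (r *\<^sub>R v + s *\<^sub>R w) = r *\<^sub>R lm_act ext_module X v + s *\<^sub>R lm_act ext_module X w"
      using P f Q h by (simp add: ext_act S1_act_comb lie_density_comb scaleR_prod_def plus_prod_def fun_eq_iff
          deriv_along_comb_left algebra_simps)
  }
  fix Y :: "'m vector_field" assume Y: "smooth_vf Y"
  show "lm_act ext_module (r *\<^sub>R X + s *\<^sub>R Y) v = r *\<^sub>R lm_act ext_module X v + s *\<^sub>R lm_act ext_module Y v" for r s
  proof -
    have "divg (r *\<^sub>R X + s *\<^sub>R Y) = (\<lambda>x. r * divg X x + s * divg Y x)"
      by (rule ext) (rule divg_comb[OF X Y])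
    then have "deriv_along (fst v) (divg (r *\<^sub>R X + s *\<^sub>R Y)) x = r * deriv_along (fst v) (divg X) x + s * deriv_along (fst v) (divg Y) x" for x
      by (simp add: deriv_along_comb smooth_divg X Y)
    then show ?thesis
      using X Y P f by (simp add: ext_act S1_act_comb_left lie_density_comb_left scaleR_prod_def plus_prod_def fun_eq_iff algebra_simps)
  qed
  have D: "deriv_along (fst v) (divg (vf_bracket X Y)) x =
      deriv_along (fst v) (deriv_along X (divg Y)) x - deriv_along (fst v) (deriv_along Y (divg X)) x" for x
  proof -
    have "divg (vf_bracket X Y) = (\<lambda>x. deriv_along X (divg Y) x - deriv_along Y (divg X) x)"
      by (rule ext) (rule divg_bracket[OF X Y])
    then show ?thesis by (simp add: deriv_along_diff smooth_deriv_along smooth_divg X Y)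
  qed
  have E: "lie_density 1 X (lie_density 1 Y (snd v) + deriv_along (fst v) (divg Y)) x =
      lie_density 1 X (lie_density 1 Y (snd v)) x + deriv_along X (deriv_along (fst v) (divg Y)) x
      + divg X x * deriv_along (fst v) (divg Y) x"
    if X: "smooth_vf X" and Y: "smooth_vf Y" for X Y :: "'m vector_field" and x
    using lie_density_comb[of "lie_density 1 Y (snd v)" "deriv_along (fst v) (divg Y)" 1 X 1 1]
      smooth_lie_density[OF Y f] smooth_deriv_along[OF P smooth_divg[OF Y]]
    by (simp add: lie_density_eq[of 1 X "deriv_along (fst v) (divg Y)"])
  show "lm_act ext_module (vf_bracket X Y) v =
      lm_act ext_module X (lm_act ext_module Y v) - lm_act ext_module Y (lm_act ext_module X v)"
    by (simp add: ext_act minus_prod_def S1_act_bracket[OF X Y P] lie_density_bracket[OF X Y f] fun_eq_iff D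
        E[OF X Y] E[OF Y X] deriv_along_S1[OF X P smooth_divg[OF Y]] deriv_along_S1[OF Y P smooth_divg[OF X]])
qed

section \<open>Homotopies from equivariant families of operators\<close>

lemma sum_UNIV_pair: "(\<Sum>p\<in>UNIV. F p) = (\<Sum>a\<in>UNIV. \<Sum>b\<in>UNIV. F (a, b))"
  for F :: "'a::finite \<times> 'b::finite \<Rightarrow> 'c::comm_monoid_add"
  by (simp add: sum.cartesian_product)

text \<open>A family of operators that transforms like the elementary matrices of \<open>gl\<^sub>m\<^sub>+\<^sub>1\<close>
  satisfies the hypothesis of the homotopy formula.\<close>

lemma proj_homotopy_formula:
  fixes M :: "('m::finite vector_field, 'w::real_vector) lie_module"
  assumes M: "lie_module_on sl_proj M"
    and T: "\<And>a b. lin_on (lm_carrier M) (lm_carrier M) (T a b)"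
    and comm: "\<And>p q a b v. v \<in> lm_carrier M \<Longrightarrow>
      lm_act M (proj_vf p q) (T a b v) - T a b (lm_act M (proj_vf p q) v) = \<delta> q a *\<^sub>R T p b v - \<delta> p b *\<^sub>R T a q v"
    and c: "c \<in> alt_forms sl_carrier (lm_carrier M) u"
  defines "h \<equiv> casimir_homotopy UNIV (\<lambda>(a, b). proj_vf a b) (\<lambda>(a, b). T b a)"
  shows "ce_diff sl_proj M (h c) + h (ce_diff sl_proj M c) =
    (\<lambda>v. \<Sum>a\<in>UNIV. \<Sum>b\<in>UNIV. T b a (lm_act M (proj_vf a b) v)) \<circ> c"
proof -
  interpret lie_module_on sl_proj M by (rule M)
  let ?e = "\<lambda>(a, b). proj_vf a b :: 'm vector_field" and ?\<theta> = "\<lambda>(a, b). T b a"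
  have inv: "(\<Sum>a\<in>UNIV. act X (?\<theta> a (v (?e a))) - ?\<theta> a (act X (v (?e a)))) + (\<Sum>a\<in>UNIV. ?\<theta> a (v (br X (?e a)))) = 0"
    (is "?F X = 0") if X: "X \<in> G" and v: "lin_on G V v" for X v
  proof -
    have e: "?e a \<in> G" for a by (cases a) (simp add: proj_in)
    have \<theta>: "lin_on V V (?\<theta> a)" for a by (cases a) (simp add: T)
    have "lin_on G V (\<lambda>X. act X (?\<theta> a (v (?e a))))" for a
      by (intro lin_onI act_in act_lin_left lin_on_in[OF \<theta>] lin_on_in[OF v] e)
    moreover have "lin_on G V (\<lambda>X. ?\<theta> a (act X (v (?e a))))" for a
      by (rule lin_on_compose[OF _ \<theta>]) (intro lin_onI act_in act_lin_left lin_on_in[OF v] e)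
    moreover have "lin_on G V (\<lambda>X. ?\<theta> a (v (br X (?e a))))" for a
      by (rule lin_on_compose[OF lin_on_compose[OF _ v] \<theta>]) (intro lin_onI bracket_in bracket_lin_left e)
    ultimately have "lin_on G V (\<lambda>X. 1 *\<^sub>R (\<Sum>a\<in>UNIV. 1 *\<^sub>R act X (?\<theta> a (v (?e a))) + (-1) *\<^sub>R ?\<theta> a (act X (v (?e a)))) +
        1 *\<^sub>R (\<Sum>a\<in>UNIV. ?\<theta> a (v (br X (?e a)))))"
      by (intro lin_on_combI lin_on_sumI sub_mod)
    then have lin: "lin_on G V ?F" by simp
    have lin0: "lin_on G V (\<lambda>X. 0)" by (simp add: lin_on_def subspace_0[OF sub_mod])
    have "?F X = (\<lambda>X. 0) X"
    proof (rule lin_on_eq_span[OF lin lin0 sl_carrier_eq _ X])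
      fix Y :: "'m vector_field" assume "Y \<in> range (\<lambda>(a, b). proj_vf a b)"
      then obtain p q where Y: "Y = proj_vf p q" by auto
      have vm: "v (proj_vf a b) \<in> V" for a b by (rule lin_on_in[OF v proj_in])
      have vb: "v (vf_bracket (proj_vf p q) (proj_vf a b)) = \<delta> q a *\<^sub>R v (proj_vf p b) - \<delta> p b *\<^sub>R v (proj_vf a q)" for a b
        unfolding proj_bracket using lin_on_comb[OF v proj_in[of p b] proj_in[of a q], of "\<delta> q a" "- \<delta> p b"] by simp
      have Tb: "T b a (v (vf_bracket (proj_vf p q) (proj_vf a b))) = \<delta> q a *\<^sub>R T b a (v (proj_vf p b)) - \<delta> p b *\<^sub>R T b a (v (proj_vf a q))" for a b
        unfolding vb using lin_on_comb[OF T[of b a] vm[of p b] vm[of a q], of "\<delta> q a" "- \<delta> p b"] by simp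
      have s1: "(\<Sum>a\<in>UNIV. \<Sum>b\<in>UNIV. \<delta> q b *\<^sub>R T p a (v (proj_vf a b))) = (\<Sum>a\<in>UNIV. T p a (v (proj_vf a q)))"
        by (intro sum.cong refl) (subst sum.remove[of UNIV q]; auto)
      have s2: "(\<Sum>a\<in>UNIV. \<Sum>b\<in>UNIV. \<delta> p a *\<^sub>R T b q (v (proj_vf a b))) = (\<Sum>b\<in>UNIV. T b q (v (proj_vf p b)))"
        by (subst sum.swap, intro sum.cong refl) (subst sum.remove[of UNIV p]; auto)
      have s3: "(\<Sum>a\<in>UNIV. \<Sum>b\<in>UNIV. \<delta> q a *\<^sub>R T b a (v (proj_vf p b))) = (\<Sum>b\<in>UNIV. T b q (v (proj_vf p b)))"
        by (subst sum.swap, intro sum.cong refl) (subst sum.remove[of UNIV q]; auto)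
      have s4: "(\<Sum>a\<in>UNIV. \<Sum>b\<in>UNIV. \<delta> p b *\<^sub>R T b a (v (proj_vf a q))) = (\<Sum>a\<in>UNIV. T p a (v (proj_vf a q)))"
        by (intro sum.cong refl) (subst sum.remove[of UNIV p]; auto)
      have "?F Y = (\<Sum>a\<in>UNIV. \<Sum>b\<in>UNIV. act (proj_vf p q) (T b a (v (proj_vf a b))) - T b a (act (proj_vf p q) (v (proj_vf a b)))) +
          (\<Sum>a\<in>UNIV. \<Sum>b\<in>UNIV. T b a (v (vf_bracket (proj_vf p q) (proj_vf a b))))"
        unfolding Y sum_UNIV_pair by simp
      also have "\<dots> = 0"
        unfolding comm[OF vm] Tb sum_subtractf s1 s2 s3 s4 by simp
      finally show "?F Y = (\<lambda>X. 0) Y" by simp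
    qed
    then show ?thesis by simp
  qed
  have "ce_diff sl_proj M (h c) + h (ce_diff sl_proj M c) = (\<lambda>v. \<Sum>a\<in>UNIV. ?\<theta> a (act (?e a) v)) \<circ> c"
    unfolding h_def
    by (rule casimir_homotopy_formula[OF _ _ inv c]) (auto simp: proj_in T)
  then show ?thesis
    unfolding sum_UNIV_pair by simp
qed

section \<open>The extension is acyclic\<close>

lemma sum_UNIV_option: "(\<Sum>a\<in>UNIV. F a) = F None + (\<Sum>i\<in>UNIV. F (Some i))"
  for F :: "'a::finite option \<Rightarrow> 'c::comm_monoid_add"
  by (simp add: UNIV_option_conv sum.reindex)

text \<open>The maps \<open>ext_phi a\<close> are the components of the identification of the extension with vector valued
  densities of weight \<open>1 - 1 / (m + 1)\<close>; the maps \<open>ext_kappa b\<close> go back from such densities. As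
  operators the former transform like vectors, the latter like covectors, up to a trace that cancels in
  the composites \<open>ext_theta a b\<close>.\<close>

definition ext_phi :: "'m::finite option \<Rightarrow> 'm vector_field \<times> 'm scalar_field \<Rightarrow> 'm scalar_field"
  where "ext_phi a v x = deriv_along (fst v) (hcoord a) x + hcoord a x * snd v x / (real CARD('m) + 1)"

definition ext_kappa :: "'m::finite option \<Rightarrow> 'm scalar_field \<Rightarrow> 'm vector_field \<times> 'm scalar_field"
  where "ext_kappa b h = ((\<lambda>x. h x *\<^sub>R hvec b x), (\<lambda>x. (real CARD('m) + 1) * \<delta> b None * h x))"

abbreviation ext_weight :: "'m::finite itself \<Rightarrow> real"
  where "ext_weight _ \<equiv> 1 - 1 / (real CARD('m) + 1)"

lemma smooth_ext_phi:
  assumes "v \<in> lm_carrier ext_module"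
  shows "smooth (ext_phi a v)"
  using assms unfolding ext_phi_def[abs_def] divide_inverse ext_carrier
  by (intro smooth_add smooth_mult smooth_deriv_along smooth_hcoord smooth_const) auto

lemma ext_kappa_in: "smooth h \<Longrightarrow> ext_kappa b h \<in> lm_carrier ext_module"
  by (simp add: ext_carrier ext_kappa_def smooth_vf_fmult smooth_hvec smooth_cmult)

lemma ext_phi_act:
  fixes v :: "'m::finite vector_field \<times> 'm scalar_field"
  assumes v: "v \<in> lm_carrier ext_module"
  shows "ext_phi c (lm_act ext_module (proj_vf a b) v) x =
    lie_density (ext_weight TYPE('m)) (proj_vf a b) (ext_phi c v) x - \<delta> b c * ext_phi a v x
      + \<delta> a b / (real CARD('m) + 1) * ext_phi c v x"
proof -
  define n where "n = real CARD('m) + 1"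
  define i where "i = 1 / n"
  have ni: "n * i = 1" by (simp add: n_def i_def)
  let ?e = "proj_vf a b :: 'm vector_field" and ?P = "fst v" and ?f = "snd v"
  have P: "smooth_vf ?P" and f: "smooth ?f" using v by (auto simp: ext_carrier mem_Times_iff)
  have eX: "deriv_along ?e (hcoord c) = (\<lambda>x. hcoord a x * (\<delta> b c - \<delta> b None * hcoord c x))"
    by (rule ext) (simp add: deriv_along_proj hvec_hcoord)
  have dv: "divg ?e = (\<lambda>x. \<delta> a b - n * \<delta> b None * hcoord a x)"
    by (rule ext) (simp add: divg_proj n_def)
  have PeX: "deriv_along ?P (deriv_along ?e (hcoord c)) x =
      deriv_along ?P (hcoord a) x * (\<delta> b c - \<delta> b None * hcoord c x) - hcoord a x * (\<delta> b None * deriv_along ?P (hcoord c) x)"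
  proof -
    have s: "smooth (\<lambda>x. \<delta> b c - \<delta> b None * hcoord c x)"
      by (intro smooth_diff smooth_const smooth_cmult smooth_hcoord)
    show ?thesis
      unfolding eX deriv_along_mult[OF smooth_hcoord s]
        deriv_along_diff[OF smooth_const smooth_cmult[OF smooth_hcoord]] deriv_along_cmult[OF smooth_hcoord]
      by simp
  qed
  have Pd: "deriv_along ?P (divg ?e) x = - (n * \<delta> b None * deriv_along ?P (hcoord a) x)"
    unfolding dv by (simp add: deriv_along_diff deriv_along_cmult smooth_hcoord smooth_const smooth_cmult)
  have phi: "ext_phi c v = (\<lambda>x. deriv_along ?P (hcoord c) x + i * (hcoord c x * ?f x))"
    by (rule ext) (simp add: ext_phi_def i_def n_def)
  have ephi: "deriv_along ?e (ext_phi c v) x = deriv_along ?e (deriv_along ?P (hcoord c)) x +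
      i * (hcoord a x * (\<delta> b c - \<delta> b None * hcoord c x) * ?f x + hcoord c x * deriv_along ?e ?f x)"
    unfolding phi
    by (simp add: deriv_along_add deriv_along_cmult deriv_along_mult smooth_deriv_along smooth_mult smooth_cmult
        smooth_hcoord P f eX split del: if_split)
  have L: "ext_phi c (lm_act ext_module ?e v) x =
      deriv_along ?e (deriv_along ?P (hcoord c)) x - deriv_along ?P (deriv_along ?e (hcoord c)) x
      + divg ?e x * deriv_along ?P (hcoord c) x
      + i * (hcoord c x * (deriv_along ?e ?f x + divg ?e x * ?f x + deriv_along ?P (divg ?e) x))"
    by (simp add: ext_phi_def ext_act deriv_along_S1 smooth_proj_vf P smooth_hcoord lie_density_eq i_def n_def)
  have pure: "ePX - (PXa * (bc - b0 * Xc) - Xa * (b0 * PXc)) + (ab - n * b0 * Xa) * PXc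
      + i * (Xc * (ef + (ab - n * b0 * Xa) * F + - (n * b0 * PXa))) =
      ePX + i * (Xa * (bc - b0 * Xc) * F + Xc * ef) + (1 - i) * (ab - n * b0 * Xa) * (PXc + i * (Xc * F))
      - bc * (PXa + i * (Xa * F)) + ab * i * (PXc + i * (Xc * F))"
    for ePX PXa PXc Xa Xc ef F ab bc b0 :: real
    using ni by algebra
  have phi_a: "ext_phi a v x = deriv_along ?P (hcoord a) x + i * (hcoord a x * ?f x)"
    by (simp add: ext_phi_def i_def n_def)
  show ?thesis
    unfolding L PeX Pd lie_density_eq ephi fun_cong[OF phi] phi_a fun_cong[OF dv]
    using pure[of "deriv_along ?e (deriv_along ?P (hcoord c)) x" "deriv_along ?P (hcoord a) x" "\<delta> b c" "\<delta> b None"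
        "hcoord c x" "hcoord a x" "deriv_along ?P (hcoord c) x" "\<delta> a b" "deriv_along ?e ?f x" "?f x"]
    by (simp only: i_def n_def times_divide_eq_right mult_1_right)
qed

lemma ext_act_kappa:
  fixes h :: "'m::finite scalar_field"
  assumes h: "smooth h"
  shows "lm_act ext_module (proj_vf p q) (ext_kappa b h) =
    ext_kappa b (lie_density (ext_weight TYPE('m)) (proj_vf p q) h) - \<delta> p b *\<^sub>R ext_kappa q h
      + (\<delta> p q / (real CARD('m) + 1)) *\<^sub>R ext_kappa b h"
proof -
  define n where "n = real CARD('m) + 1"
  define i where "i = 1 / n"
  have ni: "n * i = 1" by (simp add: n_def i_def)
  let ?e = "proj_vf p q :: 'm vector_field"
  have dv: "divg ?e = (\<lambda>x. \<delta> p q - n * \<delta> q None * hcoord p x)"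
    by (rule ext) (simp add: divg_proj n_def)
  have hv: "hvec b = proj_vf None b" for b :: "'m option" by (simp add: proj_vf_def fun_eq_iff)
  have br: "vf_bracket ?e (hvec b) x = \<delta> q None *\<^sub>R (hcoord p x *\<^sub>R hvec b x) - \<delta> p b *\<^sub>R hvec q x" for x
    using fun_cong[OF proj_bracket[of p q None b], of x] by (simp add: hv[symmetric] proj_vf_def split del: if_split)
  have fst_eq: "lm_act (S1_module 1) ?e (\<lambda>x. h x *\<^sub>R hvec b x) x $ k =
      (lie_density (1 - i) ?e h x *\<^sub>R hvec b x - \<delta> p b *\<^sub>R (h x *\<^sub>R hvec q x) + (\<delta> p q * i) *\<^sub>R (h x *\<^sub>R hvec b x)) $ k" for x k
  proof -
    have pure: "eh * B + H * (q0 * (X * B) - pb * Q) + (pq - n * q0 * X) * (H * B) =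
        (eh + (1 - i) * (pq - n * q0 * X) * H) * B - pb * (H * Q) + (pq * i) * (H * B)" for eh B H q0 X Q pb pq :: real
      using ni by algebra
    have "lm_act (S1_module 1) ?e (\<lambda>x. h x *\<^sub>R hvec b x) x $ k =
        deriv_along ?e h x * (hvec b x $ k) + h x * (\<delta> q None * (hcoord p x * (hvec b x $ k)) - \<delta> p b * (hvec q x $ k))
        + (\<delta> p q - n * \<delta> q None * hcoord p x) * (h x * (hvec b x $ k))"
      unfolding S1_act vf_bracket_fmult[OF h smooth_hvec] br dv
      by (simp only: vector_add_component vector_minus_component vector_scaleR_component real_scaleR_def mult_1)
    then show ?thesis
      unfolding pure lie_density_eq dv by (simp split del: if_split)
  qed
  have snd_eq: "lie_density 1 ?e (\<lambda>x. n * \<delta> b None * h x) x + deriv_along (\<lambda>x. h x *\<^sub>R hvec b x) (divg ?e) x =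
      n * \<delta> b None * lie_density (1 - i) ?e h x - \<delta> p b * (n * \<delta> q None * h x) + (\<delta> p q * i) * (n * \<delta> b None * h x)" for x
  proof -
    have "deriv_along (\<lambda>x. h x *\<^sub>R hvec b x) (divg ?e) x = - (h x * (n * \<delta> q None * (\<delta> b p - \<delta> b None * hcoord p x)))"
      unfolding dv deriv_along_scaled
      by (subst deriv_along_diff) (auto intro: smooth_const smooth_cmult smooth_hcoord
          simp: deriv_along_cmult smooth_hcoord hvec_hcoord simp del: if_split split del: if_split)
    moreover have "\<delta> b p = \<delta> p b" by simp
    moreover have "lie_density 1 ?e (\<lambda>x. n * \<delta> b None * h x) x =
        n * \<delta> b None * deriv_along ?e h x + (\<delta> p q - n * \<delta> q None * hcoord p x) * (n * \<delta> b None * h x)"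
      unfolding lie_density_eq deriv_along_cmult[OF h] dv by simp
    moreover have "n * b0 * eh + (pq - n * q0 * X) * (n * b0 * H) + - (H * (n * q0 * (pb - b0 * X))) =
        n * b0 * (eh + (1 - i) * (pq - n * q0 * X) * H) - pb * (n * q0 * H) + (pq * i) * (n * b0 * H)"
      for eh H q0 X pb pq b0 :: real
      using ni by algebra
    ultimately show ?thesis by (simp only: lie_density_eq dv)
  qed
  have i_eq: "ext_weight TYPE('m) = 1 - i" "\<delta> p q / (real CARD('m) + 1) = \<delta> p q * i"
    by (simp_all add: i_def n_def)
  show ?thesis
    unfolding i_eq
  proof (rule prod_eqI)
    show "fst (lm_act ext_module ?e (ext_kappa b h)) =
        fst (ext_kappa b (lie_density (1 - i) ?e h) - \<delta> p b *\<^sub>R ext_kappa q h + (\<delta> p q * i) *\<^sub>R ext_kappa b h)"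
      using fst_eq by (simp add: ext_act ext_kappa_def fun_eq_iff vec_eq_iff split del: if_split)
    show "snd (lm_act ext_module ?e (ext_kappa b h)) =
        snd (ext_kappa b (lie_density (1 - i) ?e h) - \<delta> p b *\<^sub>R ext_kappa q h + (\<delta> p q * i) *\<^sub>R ext_kappa b h)"
      using snd_eq by (simp add: ext_act ext_kappa_def fun_eq_iff n_def[symmetric] split del: if_split)
  qed
qed

definition ext_theta ::
  "'m::finite option \<Rightarrow> 'm option \<Rightarrow> 'm vector_field \<times> 'm scalar_field \<Rightarrow> 'm vector_field \<times> 'm scalar_field"
  where "ext_theta a b v = ext_kappa b (ext_phi a v)"

lemma ext_kappa_comb: "ext_kappa b (\<lambda>x. r * f x + s * h x) = r *\<^sub>R ext_kappa b f + s *\<^sub>R ext_kappa b h"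
  by (simp add: ext_kappa_def fun_eq_iff algebra_simps)

lemma ext_phi_comb: "ext_phi a (r *\<^sub>R v + s *\<^sub>R w) = (\<lambda>x. r * ext_phi a v x + s * ext_phi a w x)"
  by (simp add: ext_phi_def fun_eq_iff deriv_along_comb_left add_divide_distrib algebra_simps)

lemma ext_theta_lin: "lin_on (lm_carrier ext_module) (lm_carrier ext_module) (ext_theta a b)"
  by (intro lin_onI) (simp_all add: ext_theta_def ext_kappa_in smooth_ext_phi ext_phi_comb ext_kappa_comb)

lemma ext_theta_comm:
  fixes v :: "'m::finite vector_field \<times> 'm scalar_field"
  assumes v: "v \<in> lm_carrier ext_module"
  shows "lm_act ext_module (proj_vf p q) (ext_theta a b v) - ext_theta a b (lm_act ext_module (proj_vf p q) v) =
    \<delta> q a *\<^sub>R ext_theta p b v - \<delta> p b *\<^sub>R ext_theta a q v"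
proof -
  let ?L = "lie_density (ext_weight TYPE('m)) (proj_vf p q) (ext_phi a v)"
  let ?n = "\<delta> p q / (real CARD('m) + 1)"
  have "ext_phi a (lm_act ext_module (proj_vf p q) v) =
      (\<lambda>x. 1 * (1 * ?L x + (- \<delta> q a) * ext_phi p v x) + ?n * ext_phi a v x)"
    by (rule ext) (simp add: ext_phi_act[OF v] split del: if_split)
  then have "ext_theta a b (lm_act ext_module (proj_vf p q) v) =
      ext_kappa b ?L - \<delta> q a *\<^sub>R ext_kappa b (ext_phi p v) + ?n *\<^sub>R ext_kappa b (ext_phi a v)"
    unfolding ext_theta_def by (simp only: ext_kappa_comb) simp
  then show ?thesis
    unfolding ext_theta_def[of a b v] ext_act_kappa[OF smooth_ext_phi[OF v]]
    by (simp add: ext_theta_def split del: if_split)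
qed

text \<open>This is \<open>- m\<close> plus a multiple of \<open>(P, f) \<mapsto> (0, div P)\<close>, which is nilpotent; hence an invertible
  operator.\<close>

lemma ext_theta_sum:
  fixes v :: "'m::finite vector_field \<times> 'm scalar_field"
  assumes v: "v \<in> lm_carrier ext_module"
  shows "(\<Sum>a\<in>UNIV. \<Sum>b\<in>UNIV. ext_theta b a (lm_act ext_module (proj_vf a b) v)) =
    (- real CARD('m) *\<^sub>R fst v, (\<lambda>x. - real CARD('m) * snd v x + (real CARD('m) + 1) * divg (fst v) x))"
proof -
  define n where "n = real CARD('m) + 1"
  define i where "i = 1 / n"
  have ni: "n * i = 1" and m: "real CARD('m) = n - 1" by (simp_all add: n_def i_def)
  let ?P = "fst v" and ?f = "snd v"
  have P: "smooth_vf ?P" and f: "smooth ?f" using v by (auto simp: ext_carrier mem_Times_iff)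
  have phi: "ext_phi c v = (\<lambda>x. deriv_along ?P (hcoord c) x + i * (hcoord c x * ?f x))" for c
    by (rule ext) (simp add: ext_phi_def i_def n_def)
  have Dsum: "(\<Sum>b\<in>UNIV. deriv_along (hvec b) (ext_phi b v) x) = divg ?P x + i * (n - 1) * ?f x" for x
  proof -
    have "deriv_along (hvec None) (ext_phi None v) x = - (i * euler ?f x)"
      unfolding phi deriv_along_hvec_None
      by (simp add: euler_def deriv_along_hcoord partial_cmult f sum_distrib_left mult_ac)
    moreover have "deriv_along (hvec (Some j)) (ext_phi (Some j) v) x =
        partial j (\<lambda>x. ?P x $ j) x + i * (?f x + x $ j * partial j ?f x)" for j
      unfolding phi deriv_along_hvec_Some
      by (simp add: deriv_along_hcoord partial_add partial_cmult partial_mult smooth_vf_comp P f smooth_mult smooth_coord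
          smooth_cmult partial_coord)
    ultimately show ?thesis
      unfolding sum_UNIV_option
      by (simp add: divg_def euler_def sum.distrib sum_distrib_left[symmetric] m[symmetric] algebra_simps)
  qed
  have phi0: "ext_phi None v x = i * ?f x" for x by (simp add: phi deriv_along_hcoord)
  have inner: "(\<Sum>b\<in>UNIV. ext_phi b (lm_act ext_module (proj_vf a b) v) x) = hcoord a x * divg ?P x - (n - 1) * ext_phi a v x" for a x
  proof -
    have "(\<Sum>b\<in>UNIV. ext_phi b (lm_act ext_module (proj_vf a b) v) x) =
        (\<Sum>b\<in>UNIV. hcoord a x * deriv_along (hvec b) (ext_phi b v) x + (1 - i) * (\<delta> a b * ext_phi b v x)
          - ((1 - i) * n * hcoord a x) * (\<delta> b None * ext_phi b v x) - ext_phi a v x + i * (\<delta> a b * ext_phi b v x))"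
    proof (rule sum.cong[OF refl])
      fix b
      have "ext_phi b (lm_act ext_module (proj_vf a b) v) x =
          hcoord a x * deriv_along (hvec b) (ext_phi b v) x + (1 - i) * (\<delta> a b - n * \<delta> b None * hcoord a x) * ext_phi b v x
          - ext_phi a v x + \<delta> a b * i * ext_phi b v x"
        using ext_phi_act[OF v, of b a b x]
        by (simp add: lie_density_eq deriv_along_proj divg_proj i_def n_def split del: if_split)
      then show "ext_phi b (lm_act ext_module (proj_vf a b) v) x =
          hcoord a x * deriv_along (hvec b) (ext_phi b v) x + (1 - i) * (\<delta> a b * ext_phi b v x)
          - ((1 - i) * n * hcoord a x) * (\<delta> b None * ext_phi b v x) - ext_phi a v x + i * (\<delta> a b * ext_phi b v x)"
        by (simp add: algebra_simps split del: if_split)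
    qed
    also have "\<dots> = hcoord a x * (\<Sum>b\<in>UNIV. deriv_along (hvec b) (ext_phi b v) x) + (1 - i) * ext_phi a v x
          - ((1 - i) * n * hcoord a x) * ext_phi None v x - n * ext_phi a v x + i * ext_phi a v x"
    proof -
      have "(\<Sum>b\<in>UNIV. \<delta> a b * ext_phi b v x) = ext_phi a v x" for a
        by (subst sum.remove[of UNIV a]) auto
      moreover have "(\<Sum>b\<in>UNIV. \<delta> b None * ext_phi b v x) = ext_phi None v x"
        by (simp add: sum_UNIV_option)
      moreover have "(\<Sum>b\<in>(UNIV :: 'm option set). ext_phi a v x) = n * ext_phi a v x"
        by (simp add: n_def)
      ultimately show ?thesis
        by (simp only: sum.distrib sum_subtractf sum_distrib_left[symmetric])
    qed
    also have "\<dots> = hcoord a x * divg ?P x - (n - 1) * ext_phi a v x"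
      unfolding Dsum phi0 using ni by algebra
    finally show ?thesis .
  qed
  have outer: "(\<Sum>b\<in>UNIV. ext_theta b a (lm_act ext_module (proj_vf a b) v)) =
      ext_kappa a (\<lambda>x. hcoord a x * divg ?P x - (n - 1) * ext_phi a v x)" for a
  proof -
    have "(\<Sum>b\<in>UNIV. ext_theta b a (lm_act ext_module (proj_vf a b) v)) =
        ext_kappa a (\<lambda>x. \<Sum>b\<in>UNIV. ext_phi b (lm_act ext_module (proj_vf a b) v) x)"
      by (simp add: ext_theta_def ext_kappa_def prod_eq_iff fst_sum snd_sum fun_eq_iff scaleR_sum_left sum_distrib_left
          split del: if_split)
    then show ?thesis unfolding inner .
  qed
  have k: "(\<Sum>a\<in>UNIV. ext_kappa a (\<lambda>x. hcoord a x * divg ?P x - (n - 1) * ext_phi a v x)) =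
      ((\<lambda>x. - (n - 1) *\<^sub>R ?P x), (\<lambda>x. - (n - 1) * ?f x + n * divg ?P x))"
  proof (rule prod_eqI)
    show "fst (\<Sum>a\<in>UNIV. ext_kappa a (\<lambda>x. hcoord a x * divg ?P x - (n - 1) * ext_phi a v x)) =
      fst ((\<lambda>x. - (n - 1) *\<^sub>R ?P x), (\<lambda>x. - (n - 1) * ?f x + n * divg ?P x))"
    proof (rule ext, unfold vec_eq_iff, rule allI)
      fix x k
      have e: "(\<Sum>j\<in>UNIV. F j * \<delta> j k) = F k" for F :: "'m \<Rightarrow> real"
        by (subst sum.remove[of UNIV k]) auto
      have "fst (\<Sum>a\<in>UNIV. ext_kappa a (\<lambda>x. hcoord a x * divg ?P x - (n - 1) * ext_phi a v x)) x $ k =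
         (\<Sum>a\<in>UNIV. (hcoord a x * divg ?P x - (n - 1) * ext_phi a v x) * (hvec a x $ k))"
        by (simp add: fst_sum ext_kappa_def)
      also have "\<dots> = - (divg ?P x - (n - 1) * (i * ?f x)) * x $ k +
          (\<Sum>j\<in>UNIV. (x $ j * divg ?P x - (n - 1) * (?P x $ j + i * (x $ j * ?f x))) * \<delta> j k)"
        by (simp add: sum_UNIV_option hvec_comp phi deriv_along_hcoord) (simp add: algebra_simps)
      also have "\<dots> = - (n - 1) * ?P x $ k"
        unfolding e by algebra
      finally show "fst (\<Sum>a\<in>UNIV. ext_kappa a (\<lambda>x. hcoord a x * divg ?P x - (n - 1) * ext_phi a v x)) x $ k =
          fst ((\<lambda>x. - (n - 1) *\<^sub>R ?P x), (\<lambda>x. - (n - 1) * ?f x + n * divg ?P x)) x $ k"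
        by simp
    qed
    show "snd (\<Sum>a\<in>UNIV. ext_kappa a (\<lambda>x. hcoord a x * divg ?P x - (n - 1) * ext_phi a v x)) =
      snd ((\<lambda>x. - (n - 1) *\<^sub>R ?P x), (\<lambda>x. - (n - 1) * ?f x + n * divg ?P x))"
    proof
      fix x
      have "snd (\<Sum>a\<in>UNIV. ext_kappa a (\<lambda>x. hcoord a x * divg ?P x - (n - 1) * ext_phi a v x)) x =
          n * (divg ?P x - (n - 1) * (i * ?f x))"
        by (simp add: snd_sum ext_kappa_def sum_UNIV_option phi0 n_def)
      also have "\<dots> = - (n - 1) * ?f x + n * divg ?P x" using ni by algebra
      finally show "snd (\<Sum>a\<in>UNIV. ext_kappa a (\<lambda>x. hcoord a x * divg ?P x - (n - 1) * ext_phi a v x)) x =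
          snd ((\<lambda>x. - (n - 1) *\<^sub>R ?P x), (\<lambda>x. - (n - 1) * ?f x + n * divg ?P x)) x" by simp
    qed
  qed
  show ?thesis unfolding outer k by (simp add: n_def fun_eq_iff)
qed

lemma divg_S1_act:
  assumes X: "smooth_vf X" and P: "smooth_vf P"
  shows "divg (lm_act (S1_module 1) X P) = lie_density 1 X (divg P)"
proof
  fix x
  have "lm_act (S1_module 1) X P = 1 *\<^sub>R vf_bracket X P + 1 *\<^sub>R (\<lambda>x. divg X x *\<^sub>R P x)"
    by (simp add: S1_act plus_fun_def)
  then show "divg (lm_act (S1_module 1) X P) x = lie_density 1 X (divg P) x"
    using divg_comb[OF smooth_vf_bracket[OF X P] smooth_vf_fmult[OF smooth_divg[OF X] P], of 1 1 x]
    by (simp add: divg_bracket[OF X P] divg_fmult[OF smooth_divg[OF X] P] lie_density_eq)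
qed

text \<open>By the homotopy formula an invertible equivariant operator is zero in cohomology. In degree zero the
  homotopy vanishes, so there are no invariants either.\<close>

lemma ext_acyclic:
  fixes c :: "'m::finite vector_field list \<Rightarrow> 'm vector_field \<times> 'm scalar_field"
  assumes c: "c \<in> alt_forms sl_carrier (lm_carrier ext_module) u" and dc: "ce_diff sl_proj ext_module c = 0"
  shows "case u of 0 \<Rightarrow> c = 0 | Suc w \<Rightarrow> \<exists>b\<in>alt_forms sl_carrier (lm_carrier ext_module) w. c = ce_diff sl_proj ext_module b"
proof -
  interpret lie_module_on sl_proj "ext_module :: ('m vector_field, _) lie_module" by (rule ext_module)
  define m where "m = real CARD('m)"
  have m: "m \<noteq> 0" by (simp add: m_def)
  let ?e = "\<lambda>(a, b). proj_vf a b :: 'm vector_field" and ?t = "\<lambda>(a, b). ext_theta b a"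
  define h where "h = casimir_homotopy UNIV ?e ?t"
  define \<Omega> where "\<Omega> v = (\<Sum>a\<in>UNIV. \<Sum>b\<in>UNIV. ext_theta b a (act (proj_vf a b) v))" for v :: "'m vector_field \<times> 'm scalar_field"
  \<comment> \<open>the inverse of \<open>- m + (m + 1) \<nu>\<close>, where \<open>\<nu> (P, f) = (0, div P)\<close> has square zero\<close>
  define \<Psi> where "\<Psi> v = ((-1/m) *\<^sub>R fst v, (-1/m) *\<^sub>R snd v + (- (m + 1) / m^2) *\<^sub>R divg (fst v))" for v :: "'m vector_field \<times> 'm scalar_field"
  have formula: "d (h c) + h (d c) = \<Omega> \<circ> c"
    using proj_homotopy_formula[OF ext_module ext_theta_lin ext_theta_comm c]
    by (simp add: h_def \<Omega>_def[abs_def])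
  have "h 0 = 0"
    using lin_on_zero[OF ext_theta_lin sub_mod]
    by (auto simp: h_def casimir_homotopy_def fun_eq_iff intro!: sum.neutral)
  then have dhc: "d (h c) = \<Omega> \<circ> c" using formula dc by simp
  have \<Psi>\<Omega>: "\<Psi> (\<Omega> v) = v" if v: "v \<in> V" for v
  proof -
    have P: "smooth_vf (fst v)" using v by (simp add: ext_carrier mem_Times_iff)
    have "divg (- m *\<^sub>R fst v + 0 *\<^sub>R fst v) x = - m * divg (fst v) x + 0 * divg (fst v) x" for x
      by (rule divg_comb[OF P P])
    then have "divg (- m *\<^sub>R fst v) x = - m * divg (fst v) x" for x by simp
    then show ?thesis
      unfolding \<Omega>_def ext_theta_sum[OF v] m_def[symmetric] \<Psi>_def
      using m by (simp add: prod_eq_iff fun_eq_iff field_simps power2_eq_square)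
  qed
  have \<Psi>_lin: "lin_on V V \<Psi>"
  proof (rule lin_onI)
    fix v w and r s :: real assume v: "v \<in> V"
    then have P: "smooth_vf (fst v)" and f: "smooth (snd v)" by (auto simp: ext_carrier mem_Times_iff)
    have "smooth_vf ((-1/m) *\<^sub>R fst v + 0 *\<^sub>R fst v)" by (rule smooth_vf_comb[OF P P])
    then have 1: "smooth_vf ((-1/m) *\<^sub>R fst v)" by (simp only: scaleR_zero_left add_0_right)
    have 2: "smooth (\<lambda>x. (-1/m) *\<^sub>R snd v x + (- (m + 1) / m^2) *\<^sub>R divg (fst v) x)"
      unfolding real_scaleR_def by (intro smooth_add smooth_cmult f smooth_divg P)
    show "\<Psi> v \<in> V"
      unfolding \<Psi>_def ext_carrier fun_comb[of "-1/m" "snd v"] using 1 2 by (intro SigmaI CollectI)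
    assume w: "w \<in> V"
    then have Q: "smooth_vf (fst w)" and h: "smooth (snd w)" by (auto simp: ext_carrier mem_Times_iff)
    show "\<Psi> (r *\<^sub>R v + s *\<^sub>R w) = r *\<^sub>R \<Psi> v + s *\<^sub>R \<Psi> w"
      by (simp add: \<Psi>_def prod_eq_iff fun_eq_iff divg_comb[OF P Q] algebra_simps)
  qed
  have \<Psi>_eq: "\<Psi> (act X v) = act X (\<Psi> v)" if X: "X \<in> G" and v: "v \<in> V" for X v
  proof -
    have sX: "smooth_vf X" by (rule sl_smooth[OF X])
    have P: "smooth_vf (fst v)" and f: "smooth (snd v)" using v by (auto simp: ext_carrier mem_Times_iff)
    have z: "smooth_vf 0" by (rule smooth_vf_0)
    have dP: "smooth (divg (fst v))" by (rule smooth_divg[OF P])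
    have nu: "(0, divg (fst v)) \<in> V" using z dP by (simp add: ext_carrier)
    have "\<Psi> v = (-1/m) *\<^sub>R v + (- (m + 1) / m^2) *\<^sub>R (0, divg (fst v))"
      by (simp add: \<Psi>_def prod_eq_iff fun_eq_iff)
    then have "act X (\<Psi> v) = (-1/m) *\<^sub>R act X v + (- (m + 1) / m^2) *\<^sub>R act X (0, divg (fst v))"
      by (simp only: lin_on_comb[OF act_lin[OF X] v nu])
    moreover have "act X (0, divg (fst v)) = (0, divg (fst (act X v)))"
    proof -
      have "lm_act (S1_module 1) X 0 = 0"
        using S1_act_comb[OF z z, of 1 X 0 0] by simp
      moreover have "deriv_along 0 (divg X) = 0" by (simp add: deriv_along_def fun_eq_iff)
      ultimately show ?thesis by (simp add: ext_act divg_S1_act[OF sX P])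
    qed
    ultimately show ?thesis by (simp add: \<Psi>_def prod_eq_iff fun_eq_iff)
  qed
  have c_eq: "c = \<Psi> \<circ> d (h c)"
    unfolding dhc using \<Psi>\<Omega>[OF Alt_mem[OF c]] by (simp add: fun_eq_iff)
  show ?thesis
  proof (cases u)
    case 0
    then have "h c = 0" unfolding h_def using c by (intro casimir_homotopy_0) (auto intro: ext_theta_lin)
    then have "c = \<Psi> \<circ> 0" using c_eq ce_diff_0 by simp
    then show ?thesis using 0 lin_on_zero[OF \<Psi>_lin sub_mod] by (simp add: fun_eq_iff)
  next
    case (Suc w)
    have hc: "h c \<in> Alt w"
      unfolding h_def using c Suc by (intro casimir_homotopy_alt) (auto intro: ext_theta_lin proj_in)
    have "d (\<Psi> \<circ> h c) = c"
      using ce_diff_equivariant[OF sub_mod act_lin \<Psi>_lin hc \<Psi>_eq] c_eq by simp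
    then have "\<exists>b\<in>Alt w. c = d b"
      using post_alt[OF hc \<Psi>_lin sub_mod] by (intro bexI[of _ "\<Psi> \<circ> h c"]) auto
    then show ?thesis using Suc by simp
  qed
qed

section \<open>The connecting map\<close>

definition div_cocycle :: "'m::finite vector_field \<Rightarrow> 'm vector_field \<Rightarrow> 'm scalar_field"
  where "div_cocycle X P = deriv_along P (divg X)"

abbreviation connecting :: "('m::finite vector_field list \<Rightarrow> 'm vector_field) \<Rightarrow> 'm vector_field list \<Rightarrow> 'm scalar_field"
  where "connecting \<equiv> wedge sl_carrier div_cocycle"

lemma connecting_zero: "connecting 0 = (0 :: 'm::finite vector_field list \<Rightarrow> 'm scalar_field)"
  by (auto simp: wedge_def div_cocycle_def deriv_along_def fun_eq_iff)

lemma connecting_alt: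
  assumes "p \<in> alt_forms sl_carrier {P. smooth_vf P} u"
  shows "connecting p \<in> alt_forms sl_carrier {f. smooth f} (Suc u)"
proof (rule wedge_alt[OF sub_sl subspace_smooth_vf subspace_smooth _ _ assms])
  fix X :: "'a vector_field" assume X: "X \<in> sl_carrier"
  note sX = sl_smooth[OF X]
  show "lin_on {P. smooth_vf P} {f. smooth f} (div_cocycle X)"
    by (rule lin_onI)
      (simp_all add: div_cocycle_def smooth_deriv_along smooth_divg sX fun_eq_iff deriv_along_comb_left)
  fix Y :: "'a vector_field" and r s and P :: "'a vector_field" assume Y: "Y \<in> sl_carrier"
  note sY = sl_smooth[OF Y]
  have "divg (r *\<^sub>R X + s *\<^sub>R Y) = (\<lambda>x. r * divg X x + s * divg Y x)"
    by (rule ext) (rule divg_comb[OF sX sY])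
  note dXY = this
  show "div_cocycle (r *\<^sub>R X + s *\<^sub>R Y) P = r *\<^sub>R div_cocycle X P + s *\<^sub>R div_cocycle Y P"
    unfolding div_cocycle_def dXY by (rule ext) (simp add: deriv_along_comb smooth_divg sX sY)
qed

lemma ce_diff_ext:
  "ce_diff sl_proj ext_module (\<lambda>xs. (p xs, q xs)) =
    (\<lambda>xs. (ce_diff sl_proj (S1_module 1) p xs, ce_diff sl_proj (dens_module 1) q xs + connecting p xs))"
  by (rule ext) (simp add: ce_diff_def wedge_def ext_act div_cocycle_def prod_eq_iff fst_sum snd_sum sum.distrib
      scaleR_add_right)

lemma pair_alt:
  assumes p: "p \<in> alt_forms G V u" and q: "q \<in> alt_forms G W u"
  shows "(\<lambda>xs. (p xs, q xs)) \<in> alt_forms G (V \<times> W) u"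
  using assms unfolding alt_forms_def by (auto simp: zero_prod_def)

lemma fst_alt: "subspace V \<Longrightarrow> subspace W \<Longrightarrow> c \<in> alt_forms G (V \<times> W) u \<Longrightarrow> fst \<circ> c \<in> alt_forms G V u"
  and snd_alt: "subspace V \<Longrightarrow> subspace W \<Longrightarrow> c \<in> alt_forms G (V \<times> W) u \<Longrightarrow> snd \<circ> c \<in> alt_forms G W u"
  by (auto intro!: post_alt subspace_Times simp: lin_on_def)

context
  fixes p :: "'m::finite vector_field list \<Rightarrow> 'm vector_field" and u :: nat
  assumes p: "p \<in> alt_forms sl_carrier {P. smooth_vf P} u"
begin

text \<open>The second component of the fact that the differential of the extension has square zero.\<close>

lemma connecting_diff:
  "ce_diff sl_proj (dens_module 1) (connecting p) = - connecting (ce_diff sl_proj (S1_module 1) p)"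
proof -
  interpret E: lie_module_on sl_proj "ext_module :: ('m vector_field, _) lie_module" by (rule ext_module)
  interpret F: lie_module_on sl_proj "dens_module 1 :: ('m vector_field, _) lie_module" by (rule dens_module)
  have q: "0 \<in> alt_forms sl_carrier {f. smooth f} u" by (rule subspace_0[OF subspace_alt_forms[OF subspace_smooth]])
  have "(\<lambda>xs. (p xs, 0 xs)) \<in> E.Alt u"
    unfolding ext_carrier by (rule pair_alt[OF p q])
  from E.ce_diff_ce_diff[OF this] show ?thesis
    unfolding ce_diff_ext F.ce_diff_0
    by (simp add: fun_eq_iff zero_prod_def eq_neg_iff_add_eq_0)
qed

text \<open>The cochain \<open>(p, - q)\<close> of the extension is a cocycle, hence exact; so is its first component.\<close>

lemma connecting_injective:
  assumes dp: "ce_diff sl_proj (S1_module 1) p = 0" and q: "q \<in> alt_forms sl_carrier {f. smooth f} u"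
    and eq: "connecting p = ce_diff sl_proj (dens_module 1) q"
  shows "p \<in> coboundaries sl_proj (S1_module 1) u"
proof -
  interpret E: lie_module_on sl_proj "ext_module :: ('m vector_field, _) lie_module" by (rule ext_module)
  interpret F: lie_module_on sl_proj "dens_module 1 :: ('m vector_field, _) lie_module" by (rule dens_module)
  have nq: "- q \<in> alt_forms sl_carrier {f. smooth f} u" using q by (rule subspace_neg[OF subspace_alt_forms[OF subspace_smooth]])
  have c: "(\<lambda>xs. (p xs, (- q) xs)) \<in> alt_forms sl_carrier (lm_carrier ext_module) u"
    unfolding ext_carrier by (rule pair_alt[OF p nq])
  have "ce_diff sl_proj (dens_module 1) (- q) = - connecting p"
    using lin_on_minus[OF F.ce_diff_lin_on, of q u] q eq by simp
  then have "ce_diff sl_proj ext_module (\<lambda>xs. (p xs, (- q) xs)) = 0"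
    unfolding ce_diff_ext[of p "- q"] dp by (simp add: fun_eq_iff zero_prod_def)
  from ext_acyclic[OF c this] show ?thesis
  proof (cases u)
    case 0
    then have "p xs = 0" for xs using \<open>case u of 0 \<Rightarrow> _ | Suc w \<Rightarrow> _\<close> by (simp add: fun_eq_iff zero_prod_def)
    then show ?thesis using 0 by (simp add: coboundaries_def fun_eq_iff)
  next
    case (Suc w)
    then obtain b where b: "b \<in> alt_forms sl_carrier (lm_carrier ext_module) w"
      and eq: "(\<lambda>xs. (p xs, (- q) xs)) = ce_diff sl_proj ext_module b"
      using \<open>case u of 0 \<Rightarrow> _ | Suc w \<Rightarrow> _\<close> by auto
    have "b = (\<lambda>xs. ((fst \<circ> b) xs, (snd \<circ> b) xs))" by simp
    then have "p = ce_diff sl_proj (S1_module 1) (fst \<circ> b)"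
      using eq ce_diff_ext[of "fst \<circ> b" "snd \<circ> b"] by (simp add: fun_eq_iff)
    moreover have "fst \<circ> b \<in> cochains sl_proj (S1_module 1) w"
      using fst_alt[OF subspace_smooth_vf subspace_smooth] b by (simp add: cochains_def ext_carrier)
    ultimately show ?thesis using Suc by (auto simp: coboundaries_def)
  qed
qed

end

text \<open>The cocycle \<open>(0, q)\<close> of the extension is the differential of some \<open>(p, q')\<close>.\<close>

lemma connecting_surjective:
  fixes q :: "'m::finite vector_field list \<Rightarrow> 'm scalar_field"
  assumes q: "q \<in> alt_forms sl_carrier {f. smooth f} (Suc u)" and dq: "ce_diff sl_proj (dens_module 1) q = 0"
  shows "\<exists>p q'. p \<in> alt_forms sl_carrier {P. smooth_vf P} u \<and> ce_diff sl_proj (S1_module 1) p = 0 \<and>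
    q' \<in> alt_forms sl_carrier {f. smooth f} u \<and> q = ce_diff sl_proj (dens_module 1) q' + connecting p"
proof -
  interpret S: lie_module_on sl_proj "S1_module 1 :: ('m vector_field, _) lie_module" by (rule S1_module)
  have p: "(0 :: 'm vector_field list \<Rightarrow> 'm vector_field) \<in> alt_forms sl_carrier {P. smooth_vf P} (Suc u)"
    by (rule subspace_0[OF subspace_alt_forms[OF subspace_smooth_vf]])
  have c: "(\<lambda>xs. (0 xs, q xs)) \<in> alt_forms sl_carrier (lm_carrier ext_module) (Suc u)"
    unfolding ext_carrier by (rule pair_alt[OF p q])
  have "ce_diff sl_proj ext_module (\<lambda>xs. (0 xs, q xs)) = (0 :: 'm vector_field list \<Rightarrow> 'm vector_field \<times> 'm scalar_field)"
    unfolding ce_diff_ext dq S.ce_diff_0 connecting_zero by (simp add: fun_eq_iff zero_prod_def)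
  from ext_acyclic[OF c this] obtain b where b: "b \<in> alt_forms sl_carrier (lm_carrier ext_module) u"
    and eq: "(\<lambda>xs. (0 xs, q xs)) = ce_diff sl_proj ext_module b" by auto
  have "b = (\<lambda>xs. ((fst \<circ> b) xs, (snd \<circ> b) xs))" by simp
  then have "ce_diff sl_proj ext_module b =
      (\<lambda>xs. (ce_diff sl_proj (S1_module 1) (fst \<circ> b) xs, ce_diff sl_proj (dens_module 1) (snd \<circ> b) xs + connecting (fst \<circ> b) xs))"
    using ce_diff_ext[of "fst \<circ> b" "snd \<circ> b"] by simp
  from fun_cong[OF trans[OF eq this]] have "ce_diff sl_proj (S1_module 1) (fst \<circ> b) xs = 0 \<and>
      q xs = ce_diff sl_proj (dens_module 1) (snd \<circ> b) xs + connecting (fst \<circ> b) xs" for xs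
    by simp
  moreover have "fst \<circ> b \<in> alt_forms sl_carrier {P. smooth_vf P} u" "snd \<circ> b \<in> alt_forms sl_carrier {f. smooth f} u"
    using b fst_alt[OF subspace_smooth_vf subspace_smooth] snd_alt[OF subspace_smooth_vf subspace_smooth]
    by (simp_all add: ext_carrier)
  ultimately show ?thesis
    by (intro exI[of _ "fst \<circ> b"] exI[of _ "snd \<circ> b"]) (auto simp: fun_eq_iff)
qed

section \<open>Orthogonal projection\<close>

text \<open>The Gram--Schmidt process. The form is only assumed to be definite on \<open>V\<close>, because it will be a sum
  over the values of functions at finitely many points.\<close>

lemma orthogonal_projection:
  fixes ip :: "'a::real_vector \<Rightarrow> 'a \<Rightarrow> real"
  assumes V: "subspace V" and sym: "\<And>x y. ip x y = ip y x"
    and lin: "\<And>x y z r s. ip (r *\<^sub>R x + s *\<^sub>R y) z = r * ip x z + s * ip y z"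
    and pos: "\<And>x. x \<in> V \<Longrightarrow> ip x x = 0 \<Longrightarrow> x = 0"
    and B: "finite B" "B \<subseteq> V" and c: "c \<in> V"
  shows "\<exists>w\<in>span B. \<forall>b\<in>span B. ip (c - w) b = 0"
proof -
  have lin2: "ip z (r *\<^sub>R x + s *\<^sub>R y) = r * ip z x + s * ip z y" for x y z r s
    using lin[of r x s y z] sym by metis
  have ip0: "ip x 0 = 0" for x using lin2[of x 0 0 0 0] by simp
  have perp: "\<forall>b\<in>span B. ip x b = 0" if "\<forall>b\<in>B. ip x b = 0" for x and B :: "'a set"
  proof
    fix b assume "b \<in> span B"
    then show "ip x b = 0"
    proof (induction rule: span_induct_alt)
      case base
      then show ?case by (rule ip0)
    next
      case (step r b y)
      then show ?case using that lin2[of x r b 1 y] by simp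
    qed
  qed
  show ?thesis using B c
  proof (induction B arbitrary: c rule: finite_induct)
    case empty
    then show ?case using ip0 by simp
  next
    case (insert b B)
    obtain w where w: "w \<in> span B" "\<forall>x\<in>span B. ip (c - w) x = 0"
      using insert.IH[of c] insert.prems by auto
    obtain v where v: "v \<in> span B" "\<forall>x\<in>span B. ip (b - v) x = 0" using insert.IH[of b] insert.prems by auto
    have BV: "span B \<subseteq> V" using insert.prems by (intro span_minimal V) auto
    define e where "e = b - v"
    have eV: "e \<in> V" using v BV insert.prems subspace_diff[OF V] by (auto simp: e_def)
    define k where "k = (if ip e e = 0 then 0 else ip (c - w) e / ip e e)"
    have d1: "ip (c - (w + k *\<^sub>R e)) x = ip (c - w) x - k * ip e x" for x
      using lin[of 1 "c - w" "- k" e x] by (simp add: algebra_simps)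
    have "ip (c - (w + k *\<^sub>R e)) x = 0" if "x \<in> insert b B" for x
    proof -
      have B0: "ip (c - (w + k *\<^sub>R e)) x = 0" if "x \<in> span B" for x
        using that w v d1 by (simp add: e_def)
      have "ip (c - (w + k *\<^sub>R e)) e = 0"
      proof (cases "ip e e = 0")
        case True
        then have "e = 0" using pos eV by blast
        then show ?thesis using ip0 by simp
      next
        case False
        then show ?thesis unfolding d1 by (simp add: k_def)
      qed
      then have "ip (c - (w + k *\<^sub>R e)) b = 0"
        using B0[OF v(1)] lin2[of "c - (w + k *\<^sub>R e)" 1 e 1 v] by (simp add: e_def)
      then show ?thesis using that B0 by (auto intro: span_base)
    qed
    then have "\<forall>x\<in>span (insert b B). ip (c - (w + k *\<^sub>R e)) x = 0" using perp by blast
    moreover have "w + k *\<^sub>R e \<in> span (insert b B)"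
    proof -
      have "span B \<subseteq> span (insert b B)" by (rule span_mono) blast
      then have "w \<in> span (insert b B)" "v \<in> span (insert b B)" using w(1) v(1) by blast+
      moreover have "b \<in> span (insert b B)" by (rule span_base) simp
      ultimately show ?thesis unfolding e_def by (intro span_add span_scale span_diff)
    qed
    ultimately show ?case by blast
  qed
qed

section \<open>Cohomology of the general linear algebra\<close>

definition gl_alg :: "(real^'m::finite^'m) lie_alg"
  where "gl_alg = \<lparr>la_carrier = UNIV, la_bracket = gl_bracket\<rparr>"

definition triv_module :: "('g, real) lie_module"
  where "triv_module = \<lparr>lm_carrier = UNIV, lm_act = (\<lambda>X r. 0)\<rparr>"

lemma gl_alg_simps [simp]: "la_carrier gl_alg = UNIV" "la_bracket gl_alg = gl_bracket"
  by (simp_all add: gl_alg_def)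

lemma triv_module_simps [simp]: "lm_carrier triv_module = UNIV" "lm_act triv_module X r = 0"
  by (simp_all add: triv_module_def)

lemma matrix_mul_comb:
  "(A :: real^'m::finite^'m) ** (r *\<^sub>R B + s *\<^sub>R C) = r *\<^sub>R (A ** B) + s *\<^sub>R (A ** C)"
  "(r *\<^sub>R B + s *\<^sub>R C) ** (A :: real^'m::finite^'m) = r *\<^sub>R (B ** A) + s *\<^sub>R (C ** A)"
  by (simp_all add: vec_eq_iff matrix_matrix_mult_def sum.distrib sum_distrib_left algebra_simps)

lemma gl_bracket_comb: "gl_bracket A (r *\<^sub>R B + s *\<^sub>R C) = r *\<^sub>R gl_bracket A B + s *\<^sub>R gl_bracket A C"
  by (simp add: gl_bracket_def matrix_mul_comb algebra_simps)

lemma gl_module: "lie_module_on gl_alg (triv_module :: (real^'m::finite^'m, real) lie_module)"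
proof
  show "subspace (la_carrier (gl_alg :: (real^'m^'m) lie_alg))" by simp
  show "subspace (lm_carrier (triv_module :: (real^'m^'m, real) lie_module))" by simp
  fix X Y Z :: "real^'m^'m"
  show "lin_on (la_carrier gl_alg) (la_carrier gl_alg) (la_bracket gl_alg X)"
    by (auto intro: lin_onI simp: gl_bracket_comb)
  show "la_bracket gl_alg X Y = - la_bracket gl_alg Y X" by (simp add: gl_bracket_def)
  have "A ** (B - C) = A ** B - A ** C" "(B - C) ** A = B ** A - C ** A" for A B C :: "real^'m^'m"
    using matrix_mul_comb(1)[of A 1 B "-1" C] matrix_mul_comb(2)[of 1 B "-1" C A] by simp_all
  then show "la_bracket gl_alg X (la_bracket gl_alg Y Z) =
      la_bracket gl_alg (la_bracket gl_alg X Y) Z + la_bracket gl_alg Y (la_bracket gl_alg X Z)"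
    by (simp add: gl_bracket_def matrix_mul_assoc)
qed (auto simp: lin_on_def)

interpretation gl: lie_module_on "gl_alg :: (real^'m::finite^'m) lie_alg" triv_module
  by (rule gl_module)

lemma gl_lied: "gl.lied A c xs = - (\<Sum>j<length xs. c (xs[j := gl_bracket A (xs ! j)]))"
  by (simp add: lie_deriv_def slots_def)

lemma gl_inv_iff: "c \<in> gl_inv_forms_deg u \<longleftrightarrow> c \<in> gl.Alt u \<and> (\<forall>A. gl.lied A c = 0)"
proof
  assume c: "c \<in> gl_inv_forms_deg u"
  then have a: "c \<in> gl.Alt u" by (simp add: gl_inv_forms_deg_def)
  have "gl.lied A c xs = 0" for A xs
  proof (cases "length xs = u")
    case True
    then show ?thesis using c by (simp add: gl_inv_forms_deg_def gl_lied)
  next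
    case False
    then have "c (xs[j := B]) = 0" for j B by (intro alt_forms_out[OF a]) auto
    then show ?thesis by (simp add: gl_lied)
  qed
  then show "c \<in> gl.Alt u \<and> (\<forall>A. gl.lied A c = 0)" using a by (auto simp: fun_eq_iff)
next
  assume "c \<in> gl.Alt u \<and> (\<forall>A. gl.lied A c = 0)"
  then have a: "c \<in> gl.Alt u" and "gl.lied A c xs = 0" for A xs by auto
  then show "c \<in> gl_inv_forms_deg u"
    by (auto simp: gl_inv_forms_deg_def gl_lied)
qed

text \<open>With trivial coefficients \<open>2 d c = \<Sum> e\<^sup>i \<and> L\<^sub>e\<^sub>i c\<close>, so that invariant forms are closed.\<close>

definition wedge_lied :: "((real^'m::finite^'m) list \<Rightarrow> real) \<Rightarrow> (real^'m^'m) list \<Rightarrow> real"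
  where "wedge_lied c xs = (\<Sum>i<length xs. (-1) ^ i * gl.lied (xs ! i) c (nths xs (- {i})))"

lemma twice_gl_diff:
  assumes "c \<in> gl.Alt u"
  shows "wedge_lied c = 2 *\<^sub>R gl.d c"
  using assms
proof (induction u arbitrary: c)
  have step: "contract X (wedge_lied c) = 2 *\<^sub>R gl.lied X c - wedge_lied (contract X c)" if c: "c \<in> gl.Alt u"
    for X c u
  proof
    fix xs
    have 1: "gl.lied Y c (X # zs) = gl.lied Y (contract X c) zs - c (gl_bracket Y X # zs)" for Y zs
      using fun_cong[OF gl.contract_lied[of Y X c u], of zs] c by simp
    have 2: "(-1) ^ i * c (gl_bracket (xs ! i) X # nths xs (- {i})) = c (xs[i := gl_bracket (xs ! i) X])"
      if "i < length xs" for i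
      using alt_forms_replace[OF c _ _ that, of "gl_bracket (xs ! i) X"] by (simp add: power_mult_distrib[symmetric])
    have 3: "c (xs[i := gl_bracket (xs ! i) X]) = - c (xs[i := gl_bracket X (xs ! i)])" if i: "i < length xs" for i
    proof (cases "length xs = u")
      case True
      have "gl_bracket (xs ! i) X = (-1) *\<^sub>R gl_bracket X (xs ! i) + 0 *\<^sub>R X" by (simp add: gl_bracket_def)
      then show ?thesis
        using alt_forms_slot[OF c True, of i "gl_bracket X (xs ! i)" X "-1" 0] i True by simp
    next
      case False
      then have "c (xs[j := B]) = 0" for j B by (intro alt_forms_out[OF c]) auto
      then show ?thesis by simp
    qed
    have e1: "contract X (wedge_lied c) xs = gl.lied X c xs - (\<Sum>i<length xs. (-1) ^ i * gl.lied (xs ! i) c (X # nths xs (- {i})))"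
      by (simp add: wedge_lied_def sum.lessThan_Suc_shift nths_Cons_delete_0 nths_Cons_delete_Suc sum_negf
          del: sum.lessThan_Suc)
    have e2: "(\<Sum>i<length xs. (-1) ^ i * gl.lied (xs ! i) c (X # nths xs (- {i}))) =
        wedge_lied (contract X c) xs - (\<Sum>i<length xs. (-1) ^ i * c (gl_bracket (xs ! i) X # nths xs (- {i})))"
      unfolding 1 by (simp add: wedge_lied_def sum_subtractf right_diff_distrib)
    have e3: "(\<Sum>i<length xs. (-1) ^ i * c (gl_bracket (xs ! i) X # nths xs (- {i}))) = gl.lied X c xs"
      using 2 3 by (simp add: gl_lied sum_negf)
    show "contract X (wedge_lied c) xs = (2 *\<^sub>R gl.lied X c - wedge_lied (contract X c)) xs"
      unfolding e1 e2 e3 by (simp del: contract_apply)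
  qed
  have nil: "wedge_lied c [] = (2 *\<^sub>R gl.d c) []" for c :: "(real^'m^'m) list \<Rightarrow> real"
    by (simp add: wedge_lied_def ce_diff_def)
  have z: "wedge_lied 0 = (2 *\<^sub>R gl.d 0 :: (real^'m^'m) list \<Rightarrow> real)"
    unfolding gl.ce_diff_0 by (auto simp: wedge_lied_def gl_lied fun_eq_iff)
  have fin: "wedge_lied c = 2 *\<^sub>R gl.d c"
    if c: "c \<in> gl.Alt u" and IH: "\<And>X. wedge_lied (contract X c) = 2 *\<^sub>R gl.d (contract X c)" for c :: "(real^'m^'m) list \<Rightarrow> real" and u
  proof (rule form_eqI, rule nil)
    fix X
    show "contract X (wedge_lied c) = contract X (2 *\<^sub>R gl.d c)"
      unfolding step[OF c] IH contract_scaleR using gl.contract_ce_diff[of X c u] c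
      by (simp add: scaleR_diff_right del: contract_apply)
  qed
  {
    case 0
    show ?case
    proof (rule fin[OF 0])
      show "wedge_lied (contract X c) = 2 *\<^sub>R gl.d (contract X c)" for X
        unfolding contract_0[OF 0] by (rule z)
    qed
  next
    case (Suc u)
    show ?case
      by (rule fin[OF Suc.prems]) (rule Suc.IH[OF contract_alt[OF Suc.prems]], simp)
  }
qed

lemma gl_inv_closed:
  assumes c: "c \<in> gl_inv_forms_deg u"
  shows "gl.d c = 0"
proof -
  have "wedge_lied c = 0" using c by (auto simp: gl_inv_iff wedge_lied_def fun_eq_iff)
  then show ?thesis using twice_gl_diff[of c u] c by (simp add: gl_inv_iff)
qed

text \<open>The decomposition of the forms into invariant ones and the image of the Casimir operator
  follows from complete reducibility. For a matrix unit the transpose acts by the adjoint operator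
  with respect to the inner product that makes the matrix units orthonormal; so the Casimir
  operator is a sum of operators \<open>T\<^sup>* T\<close>.\<close>

definition mat_unit :: "'m::finite \<times> 'm \<Rightarrow> real^'m^'m"
  where "mat_unit p = (\<chi> i j. if p = (i, j) then 1 else 0)"

lemma mat_unit_expand: "A = (\<Sum>p\<in>UNIV. (A $ fst p $ snd p) *\<^sub>R mat_unit p)"
proof -
  have "(\<Sum>p\<in>UNIV. (A $ fst p $ snd p) * \<delta> p (i, j)) = A $ i $ j" for i j
    by (subst sum.remove[of UNIV "(i, j)"]) auto
  then show ?thesis by (simp add: vec_eq_iff mat_unit_def)
qed

lemma mat_unit_span: "UNIV = span (range mat_unit)"
proof -
  have "A \<in> span (range mat_unit)" for A :: "real^'m^'m"
    by (subst mat_unit_expand) (intro span_sum span_scale span_base rangeI)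
  then show ?thesis by blast
qed

lemma mat_unit_mult: "mat_unit (i, j) ** mat_unit (k, l) = \<delta> j k *\<^sub>R mat_unit (i, l)"
proof -
  have "(\<Sum>c\<in>UNIV. \<delta> (i, j) (a, c) * \<delta> (k, l) (c, b)) = \<delta> j k * \<delta> (i, l) (a, b)" for a b
    by (subst sum.remove[of UNIV j]) auto
  then show ?thesis by (simp add: vec_eq_iff matrix_matrix_mult_def mat_unit_def)
qed

lemma mat_unit_bracket:
  "gl_bracket (mat_unit (i, j)) (mat_unit (k, l)) = \<delta> j k *\<^sub>R mat_unit (i, l) - \<delta> l i *\<^sub>R mat_unit (k, j)"
  by (simp add: gl_bracket_def mat_unit_mult)

definition bracket_coeff :: "'m::finite \<times> 'm \<Rightarrow> 'm \<times> 'm \<Rightarrow> 'm \<times> 'm \<Rightarrow> real"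
  where "bracket_coeff a q p = gl_bracket (mat_unit a) (mat_unit p) $ fst q $ snd q"

lemma bracket_coeff_transpose: "bracket_coeff (i, j) q p = bracket_coeff (j, i) p q"
proof -
  obtain a b where p: "p = (a, b)" by (cases p)
  obtain c d where q: "q = (c, d)" by (cases q)
  have "bracket_coeff (i, j) q p = \<delta> j a * \<delta> (i, b) (c, d) - \<delta> b i * \<delta> (a, j) (c, d)"
    unfolding bracket_coeff_def p q mat_unit_bracket by (simp add: mat_unit_def)
  moreover have "bracket_coeff (j, i) p q = \<delta> i c * \<delta> (j, d) (a, b) - \<delta> d j * \<delta> (c, i) (a, b)"
    unfolding bracket_coeff_def p q mat_unit_bracket by (simp add: mat_unit_def)
  ultimately show ?thesis by auto
qed

definition form_ip :: "nat \<Rightarrow> ((real^'m::finite^'m) list \<Rightarrow> real) \<Rightarrow> ((real^'m^'m) list \<Rightarrow> real) \<Rightarrow> real"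
  where "form_ip u c c' = (\<Sum>l | length l = u. c (map mat_unit l) * c' (map mat_unit l))"

lemma finite_index_lists: "finite {l :: 'a::finite list. length l = u}"
  using finite_lists_length_eq[of "UNIV :: 'a set" u] by simp

lemma form_ip_sym: "form_ip u c c' = form_ip u c' c"
  by (simp add: form_ip_def mult.commute)

lemma form_ip_comb: "form_ip u (r *\<^sub>R c + s *\<^sub>R d) e = r * form_ip u c e + s * form_ip u d e"
  by (simp add: form_ip_def sum.distrib sum_distrib_left algebra_simps)

lemma form_ip_sum: "form_ip u (\<Sum>i\<in>I. f i) e = (\<Sum>i\<in>I. form_ip u (f i) e)"
  by (simp add: form_ip_def sum_distrib_right) (rule sum.swap)

lemma form_ip_nonneg: "form_ip u c c \<ge> 0"
  by (simp add: form_ip_def sum_nonneg)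

lemma form_ip_zero:
  fixes c :: "(real^'m::finite^'m) list \<Rightarrow> real"
  assumes c: "c \<in> gl.Alt u" and z: "form_ip u c c = 0"
  shows "c = 0"
proof (rule alt_forms_zero_span[OF c, of "range mat_unit"])
  show "la_carrier gl_alg = span (range (mat_unit :: 'm \<times> 'm \<Rightarrow> real^'m^'m))" using mat_unit_span by simp
  fix xs :: "(real^'m^'m) list" assume xs: "set xs \<subseteq> range mat_unit" "length xs = u"
  have "\<exists>l. xs = map mat_unit l" unfolding ex_map_conv using xs(1) by blast
  then obtain l where l: "xs = map mat_unit l" by blast
  have "c (map mat_unit l) * c (map mat_unit l) = 0"
    using z xs(2) l unfolding form_ip_def
    by (subst (asm) sum_nonneg_eq_0_iff) (auto simp: finite_index_lists)
  then show "c xs = 0" using l by simp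
qed

lemma gl_lied_expand:
  assumes c: "c \<in> gl.Alt u" and l: "length l = u"
  shows "gl.lied (mat_unit a) c (map mat_unit l) =
    - (\<Sum>k<u. \<Sum>q\<in>UNIV. bracket_coeff a q (l ! k) * c (map mat_unit (l[k := q])))"
proof -
  have "c ((map mat_unit l)[k := gl_bracket (mat_unit a) (mat_unit (l ! k))]) =
      (\<Sum>q\<in>UNIV. bracket_coeff a q (l ! k) * c (map mat_unit (l[k := q])))" if k: "k < u" for k
  proof -
    define F where "F Y = c ((map mat_unit l)[k := Y])" for Y
    have lin: "lin_on UNIV UNIV F"
    proof (rule lin_onI)
      fix x y r s
      show "F (r *\<^sub>R x + s *\<^sub>R y) = r *\<^sub>R F x + s *\<^sub>R F y"
        unfolding F_def by (rule alt_forms_slot[OF c]) (use l k in auto)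
    qed simp
    have "gl_bracket (mat_unit a) (mat_unit (l ! k)) = (\<Sum>q\<in>UNIV. bracket_coeff a q (l ! k) *\<^sub>R mat_unit q)"
      unfolding bracket_coeff_def by (rule mat_unit_expand[of "gl_bracket (mat_unit a) (mat_unit (l ! k))"])
    then have "F (gl_bracket (mat_unit a) (mat_unit (l ! k))) = (\<Sum>q\<in>UNIV. F (bracket_coeff a q (l ! k) *\<^sub>R mat_unit q))"
      using lin_on_sum[OF lin, of UNIV "\<lambda>q. bracket_coeff a q (l ! k) *\<^sub>R mat_unit q"] by simp
    also have "\<dots> = (\<Sum>q\<in>UNIV. bracket_coeff a q (l ! k) * F (mat_unit q))"
      by (simp add: lin_on_scale[OF lin])
    finally show ?thesis by (simp add: F_def map_update)
  qed
  then show ?thesis using l by (simp add: gl_lied)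
qed

lemma form_ip_adjoint:
  assumes c: "c \<in> gl.Alt u" and c': "c' \<in> gl.Alt u"
  shows "form_ip u (gl.lied (mat_unit (i, j)) c) c' = form_ip u c (gl.lied (mat_unit (j, i)) c')"
proof -
  let ?L = "{l :: ('a \<times> 'a) list. length l = u}" and ?U = "UNIV :: ('a \<times> 'a) set"
  let ?c = "\<lambda>l. c (map mat_unit l)" and ?c' = "\<lambda>l. c' (map mat_unit l)"
  have sw: "(\<Sum>l\<in>?L. \<Sum>q\<in>?U. bracket_coeff (i, j) q (l ! k) * ?c (l[k := q]) * ?c' l) =
      (\<Sum>l\<in>?L. \<Sum>q\<in>?U. ?c l * (bracket_coeff (j, i) q (l ! k) * ?c' (l[k := q])))" if k: "k < u" for k
    unfolding sum.cartesian_product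
    by (rule sum.reindex_bij_witness[of _ "\<lambda>(l, q). (l[k := q], l ! k)" "\<lambda>(l, q). (l[k := q], l ! k)"])
      (use k in \<open>auto simp: bracket_coeff_transpose[of i j]\<close>)
  have "form_ip u (gl.lied (mat_unit (i, j)) c) c' =
      - (\<Sum>l\<in>?L. \<Sum>k<u. \<Sum>q\<in>?U. bracket_coeff (i, j) q (l ! k) * ?c (l[k := q]) * ?c' l)"
    unfolding form_ip_def by (simp add: gl_lied_expand[OF c] sum_distrib_right sum_negf)
  also have "\<dots> = - (\<Sum>k<u. \<Sum>l\<in>?L. \<Sum>q\<in>?U. bracket_coeff (i, j) q (l ! k) * ?c (l[k := q]) * ?c' l)"
    by (subst sum.swap) simp
  also have "\<dots> = - (\<Sum>k<u. \<Sum>l\<in>?L. \<Sum>q\<in>?U. ?c l * (bracket_coeff (j, i) q (l ! k) * ?c' (l[k := q])))"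
    using sw by simp
  also have "\<dots> = - (\<Sum>l\<in>?L. \<Sum>k<u. \<Sum>q\<in>?U. ?c l * (bracket_coeff (j, i) q (l ! k) * ?c' (l[k := q])))"
    by (subst sum.swap) simp
  also have "\<dots> = form_ip u c (gl.lied (mat_unit (j, i)) c')"
    unfolding form_ip_def by (simp add: gl_lied_expand[OF c'] sum_distrib_left sum_negf)
  finally show ?thesis .
qed

definition gl_casimir :: "((real^'m::finite^'m) list \<Rightarrow> real) \<Rightarrow> (real^'m^'m) list \<Rightarrow> real"
  where "gl_casimir c = (\<Sum>p\<in>UNIV. gl.lied (mat_unit p) (gl.lied (mat_unit (prod.swap p)) c))"

lemma gl_lied_lin_on: "lin_on (gl.Alt u) (gl.Alt u) (gl.lied A)"
  by (rule gl.lied_lin_on) simp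

lemma gl_lied_alt: "c \<in> gl.Alt u \<Longrightarrow> gl.lied A c \<in> gl.Alt u"
  by (rule lin_on_in[OF gl_lied_lin_on])

lemma gl_casimir_lin: "lin_on (gl.Alt u) (gl.Alt u) gl_casimir"
  unfolding gl_casimir_def[abs_def]
  by (intro lin_on_sumI gl.sub_Alt lin_on_compose[OF gl_lied_lin_on gl_lied_lin_on])

lemma gl_casimir_alt: "c \<in> gl.Alt u \<Longrightarrow> gl_casimir c \<in> gl.Alt u"
  by (rule lin_on_in[OF gl_casimir_lin])

lemma form_ip_casimir:
  assumes c: "c \<in> gl.Alt u" and c': "c' \<in> gl.Alt u"
  shows "form_ip u (gl_casimir c) c' =
    (\<Sum>p\<in>UNIV. form_ip u (gl.lied (mat_unit (prod.swap p)) c) (gl.lied (mat_unit (prod.swap p)) c'))"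
  unfolding gl_casimir_def form_ip_sum
  by (intro sum.cong refl) (auto simp: prod.swap_def form_ip_adjoint[OF gl_lied_alt[OF c] c'])

lemma form_ip_casimir_sym:
  assumes c: "c \<in> gl.Alt u" and c': "c' \<in> gl.Alt u"
  shows "form_ip u (gl_casimir c) c' = form_ip u c (gl_casimir c')"
  unfolding form_ip_casimir[OF c c'] form_ip_sym[of u c] form_ip_casimir[OF c' c]
  by (simp add: form_ip_sym)

lemma gl_casimir_kernel:
  assumes c: "c \<in> gl.Alt u" and z: "gl_casimir c = 0"
  shows "c \<in> gl_inv_forms_deg u"
proof -
  have "form_ip u 0 c = 0" by (simp add: form_ip_def)
  then have "(\<Sum>p\<in>UNIV. form_ip u (gl.lied (mat_unit (prod.swap p)) c) (gl.lied (mat_unit (prod.swap p)) c)) = 0"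
    using form_ip_casimir[OF c c] z by simp
  then have "form_ip u (gl.lied (mat_unit (prod.swap p)) c) (gl.lied (mat_unit (prod.swap p)) c) = 0" for p
    by (subst (asm) sum_nonneg_eq_0_iff) (auto simp: form_ip_nonneg simp del: split_paired_All)
  then have "gl.lied (mat_unit (prod.swap p)) c = 0" for p
    using form_ip_zero[OF gl_lied_alt[OF c]] by blast
  then have u0: "gl.lied (mat_unit p) c = 0" for p by (metis prod.swap_def swap_swap)
  have "gl.lied A c = 0" for A
  proof (rule lin_on_eq_span[where V = UNIV and W = UNIV and B = "range mat_unit" and h = "\<lambda>A. 0"])
    show "lin_on UNIV UNIV (\<lambda>A. gl.lied A c)" using gl.lied_lin_left[OF _ _ c] by (intro lin_onI) simp_all
  qed (auto simp: u0 lin_on_def mat_unit_span[symmetric])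
  then show ?thesis using c by (simp add: gl_inv_iff)
qed

lemma gl_casimir_inv: "c \<in> gl_inv_forms_deg u \<Longrightarrow> gl_casimir c = 0"
  using lin_on_zero[OF gl_lied_lin_on gl.sub_Alt]
  by (auto simp: gl_inv_iff gl_casimir_def intro!: sum.neutral)

lemma gl_casimir_disjoint:
  assumes b: "b \<in> gl.Alt u" and z: "gl_casimir (gl_casimir b) = 0"
  shows "gl_casimir b = 0"
proof (rule form_ip_zero[OF gl_casimir_alt[OF b]])
  show "form_ip u (gl_casimir b) (gl_casimir b) = 0"
    unfolding form_ip_casimir_sym[OF b gl_casimir_alt[OF b]] z by (simp add: form_ip_def)
qed

text \<open>The complement of the image of the Casimir operator is its kernel, by self-adjointness. For the
  orthogonal projection onto the image to exist, forms are replaced by their restrictions to the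
  tuples of matrix units: these lie in a space of finite dimension.\<close>

lemma gl_casimir_split:
  assumes c: "c \<in> gl.Alt u"
  shows "\<exists>z\<in>gl.Alt u. \<exists>b\<in>gl.Alt u. gl_casimir z = 0 \<and> c = z + gl_casimir b"
proof -
  let ?L = "map mat_unit ` {l :: ('a \<times> 'a) list. length l = u}"
  have finL: "finite ?L" by (simp add: finite_index_lists)
  define X where "X = {f :: (real^'a^'a) list \<Rightarrow> real. \<forall>xs. xs \<notin> ?L \<longrightarrow> f xs = 0}"
  define \<rho> where "\<rho> f xs = (if xs \<in> ?L then f xs else 0)" for f :: "(real^'a^'a) list \<Rightarrow> real" and xs
  have X: "subspace X" by (auto simp: X_def subspace_def)
  have \<rho>X: "\<rho> f \<in> X" for f by (simp add: X_def \<rho>_def)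
  have \<rho>lin: "\<rho> (r *\<^sub>R f + s *\<^sub>R h) = r *\<^sub>R \<rho> f + s *\<^sub>R \<rho> h" for r s f h
    by (simp add: \<rho>_def fun_eq_iff)
  have ip_\<rho>: "form_ip u (\<rho> f) h = form_ip u f h" for f h
    by (auto simp: form_ip_def \<rho>_def intro!: sum.cong)
  define T where "T = (\<lambda>xs ys. if ys = xs then 1 else 0 :: real) ` ?L"
  have "X \<subseteq> span T"
  proof
    fix f assume f: "f \<in> X"
    have "f = (\<Sum>xs\<in>?L. f xs *\<^sub>R (\<lambda>ys. if ys = xs then 1 else 0))"
    proof
      fix ys
      show "f ys = (\<Sum>xs\<in>?L. f xs *\<^sub>R (\<lambda>ys. if ys = xs then 1 else 0)) ys"
        using f finL by (cases "ys \<in> ?L") (auto simp: X_def if_distrib[where f = "\<lambda>u. _ * u"] cong: if_cong)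
    qed
    also have "\<dots> \<in> span T" by (intro span_sum span_scale span_base) (auto simp: T_def)
    finally show "f \<in> span T" .
  qed
  define R where "R = (\<lambda>a. \<rho> (gl_casimir a)) ` gl.Alt u"
  have lin: "lin_on (gl.Alt u) X (\<lambda>a. \<rho> (gl_casimir a))"
    by (rule lin_on_compose[OF gl_casimir_lin lin_onI]) (rule \<rho>X, rule \<rho>lin)
  have R: "subspace R" unfolding R_def by (rule subspace_lin_image[OF lin gl.sub_Alt])
  obtain B where B: "B \<subseteq> R" "independent B" "R \<subseteq> span B"
    using maximal_independent_subset[of R] by blast
  have RX: "R \<subseteq> X" using \<rho>X by (auto simp: R_def)
  have "finite B"
    using independent_span_bound[of T B] B RX \<open>X \<subseteq> span T\<close> finL by (auto simp: T_def)
  have posX: "f = 0" if "f \<in> X" "form_ip u f f = 0" for f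
  proof
    fix xs
    have "f (map mat_unit l) = 0" if "length l = u" for l
      using \<open>form_ip u f f = 0\<close> that unfolding form_ip_def
      by (subst (asm) sum_nonneg_eq_0_iff) (auto simp: finite_index_lists)
    then have "f xs = 0" if "xs \<in> ?L" using that by blast
    then show "f xs = 0 xs" using \<open>f \<in> X\<close> by (cases "xs \<in> ?L") (auto simp: X_def)
  qed
  obtain w where w: "w \<in> span B" "\<forall>b\<in>span B. form_ip u (\<rho> c - w) b = 0"
    using orthogonal_projection[OF X form_ip_sym form_ip_comb posX \<open>finite B\<close> _ \<rho>X[of c]] B(1) RX by blast
  have "span B \<subseteq> R" using B(1) R by (rule span_minimal)
  then obtain a where a: "a \<in> gl.Alt u" and w_eq: "w = \<rho> (gl_casimir a)" using w(1) by (auto simp: R_def)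
  define z where "z = c - gl_casimir a"
  have zA: "z \<in> gl.Alt u" unfolding z_def by (rule subspace_diff[OF gl.sub_Alt c gl_casimir_alt[OF a]])
  have perp: "form_ip u z (gl_casimir b) = 0" if b: "b \<in> gl.Alt u" for b
  proof -
    have "\<rho> (gl_casimir b) \<in> span B" using b B(3) by (auto simp: R_def)
    then have "form_ip u (\<rho> c - w) (\<rho> (gl_casimir b)) = 0" using w(2) by blast
    moreover have "\<rho> c - w = \<rho> z" using \<rho>lin[of 1 c "-1" "gl_casimir a"] by (simp add: z_def w_eq)
    ultimately show ?thesis using ip_\<rho> form_ip_sym by metis
  qed
  have "form_ip u (gl_casimir z) (gl_casimir z) = 0"
    unfolding form_ip_casimir_sym[OF zA gl_casimir_alt[OF zA]] using perp[OF gl_casimir_alt[OF zA]] .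
  then have "gl_casimir z = 0" by (rule form_ip_zero[OF gl_casimir_alt[OF zA]])
  then show ?thesis using zA a by (intro bexI[of _ z] bexI[of _ a]) (auto simp: z_def)
qed

lemma gl_casimir_diff:
  assumes c: "c \<in> gl.Alt u"
  shows "gl.d (gl_casimir c) = gl_casimir (gl.d c)"
  unfolding gl_casimir_def
    lin_on_sum[OF gl.ce_diff_lin_on gl.sub_Alt gl_lied_alt[OF gl_lied_alt[OF c]]]
  by (intro sum.cong refl) (simp add: gl.ce_diff_lied[OF _ gl_lied_alt[OF c]] gl.ce_diff_lied[OF _ c])

text \<open>On closed forms every summand of the Casimir operator is exact by Cartan's formula.\<close>

lemma gl_casimir_exact:
  assumes b: "b \<in> gl.Alt u" and db: "gl.d b = 0"
  shows "gl_casimir b \<in> coboundaries gl_alg triv_module u"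
proof (cases u)
  case 0
  have "gl.lied A c = 0" if "c \<in> gl.Alt 0" for A c
  proof
    fix xs
    have "c (xs[j := B]) = 0" if "j < length xs" for j B
      using that by (intro alt_forms_out[OF \<open>c \<in> gl.Alt 0\<close>]) auto
    then show "gl.lied A c xs = 0 xs" by (simp add: gl_lied)
  qed
  then have "gl_casimir b = 0"
    unfolding gl_casimir_def using gl_lied_alt[OF b] unfolding 0 by (intro sum.neutral ballI) blast
  then show ?thesis using 0 by (simp add: coboundaries_def)
next
  case (Suc v)
  have lin: "lin_on (gl.Alt v) (gl.Alt u) gl.d" unfolding Suc by (rule gl.ce_diff_lin_on)
  let ?f = "\<lambda>p. contract (mat_unit p) (gl.lied (mat_unit (prod.swap p)) b)"
  have f: "?f p \<in> gl.Alt v" for p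
    using gl_lied_alt[OF b] Suc by (intro contract_alt) auto
  have "gl.lied (mat_unit p) (gl.lied (mat_unit (prod.swap p)) b) = gl.d (?f p)" for p
  proof -
    have "gl.d (gl.lied (mat_unit (prod.swap p)) b) = 0"
      using gl.ce_diff_lied[OF _ b] db lin_on_zero[OF gl_lied_lin_on gl.sub_Alt] by simp
    then show ?thesis
      using gl.contract_ce_diff[OF _ gl_lied_alt[OF b], of "mat_unit p" "mat_unit (prod.swap p)"]
      by (simp add: contract_zero del: contract_apply)
  qed
  then have "gl_casimir b = (\<Sum>p\<in>UNIV. gl.d (?f p))" unfolding gl_casimir_def by simp
  also have "\<dots> = gl.d (\<Sum>p\<in>UNIV. ?f p)" by (rule lin_on_sum[OF lin gl.sub_Alt f, symmetric])
  finally have "gl_casimir b = gl.d (\<Sum>p\<in>UNIV. ?f p)" .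
  moreover have "(\<Sum>p\<in>UNIV. ?f p) \<in> gl.Alt v" by (intro subspace_sum[OF gl.sub_Alt] f)
  ultimately show ?thesis using Suc by (auto simp: coboundaries_def cochains_def)
qed

lemma gl_cocycle_inv:
  assumes "\<phi> \<in> gl.Alt u" "gl.d \<phi> = 0"
  shows "\<exists>z\<in>gl_inv_forms_deg u. \<exists>b\<in>coboundaries gl_alg triv_module u. \<phi> = z + b"
proof -
  have "\<exists>z\<in>gl.Alt u. \<exists>b\<in>gl.Alt u. gl_casimir z = 0 \<and> gl.d z = 0 \<and> gl.d b = 0 \<and> \<phi> = z + gl_casimir b"
    by (rule fitting_cocycle[where A = gl.Alt and D = gl.d and L = gl_casimir])
      (assumption | rule gl.sub_Alt gl.ce_diff_lin_on gl_casimir_lin gl_casimir_diff gl_casimir_split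
          assms gl_casimir_disjoint)+
  then obtain z b where z: "z \<in> gl.Alt u" "gl_casimir z = 0" and b: "b \<in> gl.Alt u" "gl.d b = 0"
    and eq: "\<phi> = z + gl_casimir b" by blast
  then show ?thesis using gl_casimir_kernel[OF z] gl_casimir_exact[OF b] by blast
qed

text \<open>A primitive of an invariant form may be chosen in the kernel of the Casimir operator; it is then closed.\<close>

lemma gl_inv_exact:
  assumes z: "z \<in> gl_inv_forms_deg u" and b: "z \<in> coboundaries gl_alg triv_module u"
  shows "z = 0"
proof (cases u)
  case 0
  then show ?thesis using b by (simp add: coboundaries_def)
next
  case (Suc v)
  then obtain a where a: "a \<in> gl.Alt v" and za: "z = gl.d a"
    using b by (auto simp: coboundaries_def cochains_def)
  have L: "gl_casimir (gl.d a) = 0" using gl_casimir_inv[OF z] za by simp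
  have "\<exists>y\<in>gl.Alt v. gl_casimir y = 0 \<and> gl.d y = gl.d a"
    by (rule fitting_exact[where A = gl.Alt and D = gl.d and L = gl_casimir])
      (assumption | rule gl.sub_Alt gl.ce_diff_lin_on gl_casimir_lin gl_casimir_diff gl_casimir_split
          a L gl_casimir_disjoint)+
  then obtain y where "y \<in> gl.Alt v" "gl_casimir y = 0" "gl.d y = gl.d a" by blast
  then show ?thesis using gl_inv_closed[OF gl_casimir_kernel[of y v]] za by simp
qed

section \<open>Weights of the Euler field\<close>

interpretation F: lie_module_on sl_proj "dens_module 1 :: ('m::finite vector_field, 'm scalar_field) lie_module"
  by (rule dens_module)

abbreviation proj :: "'m::finite option \<times> 'm option \<Rightarrow> 'm vector_field"
  where "proj p \<equiv> proj_vf (fst p) (snd p)"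

text \<open>The eigenvalue of \<open>ad E\<close>; translations, linear and quadratic fields have weight \<open>-1\<close>, \<open>0\<close> and \<open>1\<close>.\<close>

definition weight :: "'m option \<times> 'm option \<Rightarrow> int"
  where "weight p = (if snd p = None then 1 else 0) - (if fst p = None then 1 else 0)"

abbreviation weights :: "('m option \<times> 'm option) list \<Rightarrow> int"
  where "weights l \<equiv> (\<Sum>p\<leftarrow>l. weight p)"

lemma sl_carrier_range: "sl_carrier = span (range proj)"
  by (simp add: sl_carrier_eq case_prod_beta)

lemma euler_in: "(euler_vf :: 'm::finite vector_field) \<in> sl_carrier"
proof -
  have "euler_vf = - proj_vf None (None :: 'm option)" by (simp add: proj_vf_def hvec_def fun_eq_iff)
  then show ?thesis using subspace_neg[OF sub_sl proj_in[of None "None :: 'm option"]] by simp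
qed

lemma euler_bracket:
  fixes p :: "'m::finite option \<times> 'm option"
  shows "vf_bracket euler_vf (proj p) = real_of_int (weight p) *\<^sub>R proj p"
proof -
  have "euler_vf = - proj_vf None (None :: 'm option)" by (simp add: proj_vf_def hvec_def fun_eq_iff)
  moreover have "vf_bracket (- proj_vf None None) (proj p) = - vf_bracket (proj_vf None None) (proj p)"
    using vf_bracket_comb[OF smooth_proj_vf smooth_proj_vf, of "proj p" "-1" None None 0 None None]
    by (simp add: vf_bracket_anti[of _ "proj p"])
  ultimately show ?thesis
    unfolding proj_bracket by (cases p) (auto simp: weight_def)
qed

lemma lie_density_euler:
  fixes f :: "'m::finite scalar_field"
  shows "lie_density 1 euler_vf f x = euler f x + real CARD('m) * f x"
proof -
  have "divg (euler_vf :: 'm vector_field) x = real CARD('m)"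
    by (simp add: divg_def euler_vf_eq partial_coord)
  moreover have "deriv_along (euler_vf :: 'm vector_field) f x = euler f x"
    by (simp add: deriv_along_def euler_def euler_vf_eq)
  ultimately show ?thesis by (simp add: lie_density_eq)
qed

abbreviation euler_slots :: "('m::finite vector_field list \<Rightarrow> 'w::real_vector) \<Rightarrow> 'm vector_field list \<Rightarrow> 'w"
  where "euler_slots \<equiv> slots sl_carrier (vf_bracket euler_vf)"

lemma proj_list_in: "set (map proj l) \<subseteq> sl_carrier"
  by (auto simp: proj_in)

lemma euler_slots_proj:
  assumes c: "c \<in> alt_forms sl_carrier W u"
  shows "euler_slots c (map proj l) = real_of_int (weights l) *\<^sub>R c (map proj l)"
proof (cases "length l = u")
  case False
  then have "c xs = 0" if "length xs = length l" for xs
    using that by (intro alt_forms_out[OF c]) auto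
  then show ?thesis by (simp add: slots_def)
next
  case True
  have "c ((map proj l)[j := vf_bracket euler_vf (proj (l ! j))]) = real_of_int (weight (l ! j)) *\<^sub>R c (map proj l)"
    if j: "j < length l" for j
  proof -
    have "(map proj l)[j := proj (l ! j)] = map proj l" using list_update_id[of "map proj l" j] j by simp
    then show ?thesis
      using alt_forms_slot[OF c _ proj_list_in[of l], of j "proj (l ! j)" "proj (l ! j)" "real_of_int (weight (l ! j))" 0] True j
      by (simp add: euler_bracket proj_in)
  qed
  then have "(\<Sum>j<length l. c ((map proj l)[j := vf_bracket euler_vf (proj (l ! j))])) =
      (\<Sum>j<length l. real_of_int (weight (l ! j)) *\<^sub>R c (map proj l))"
    by (intro sum.cong refl) auto
  also have "\<dots> = real_of_int (weights l) *\<^sub>R c (map proj l)"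
    by (simp add: scaleR_sum_left sum_list_sum_nth atLeast0LessThan)
  finally show ?thesis using proj_list_in[of l] by (simp add: slots_def)
qed

lemma alt_forms_zero_proj:
  fixes c :: "'m::finite vector_field list \<Rightarrow> 'w::real_vector"
  assumes "c \<in> alt_forms sl_carrier W u" "\<And>l. length l = u \<Longrightarrow> c (map proj l) = 0"
  shows "c = 0"
proof (rule alt_forms_zero_span[OF assms(1) sl_carrier_range])
  fix xs :: "'m vector_field list" assume xs: "set xs \<subseteq> range proj" "length xs = u"
  have "\<exists>l. xs = map proj l" unfolding ex_map_conv using xs(1) by blast
  then obtain l where l: "xs = map proj l" by blast
  then have "length l = u" using xs(2) by simp
  then show "c xs = 0" unfolding l by (rule assms(2))
qed

lemma euler_slots_alt:
  assumes "subspace W" "c \<in> alt_forms sl_carrier W u"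
  shows "euler_slots c \<in> alt_forms sl_carrier W u"
  using slots_alt[OF sub_sl assms(1) _ assms(2)] F.bracket_lin[OF euler_in] by simp

text \<open>The derivation induced by \<open>ad E\<close> acts on the value at a list of homogeneous fields by its total
  weight. Subtracting a multiple of \<open>c\<close> from its image removes one weight from the support.\<close>

lemma euler_eigenforms:
  assumes "finite T" "subspace W" "c \<in> alt_forms sl_carrier W u"
    and "\<And>l. length l = u \<Longrightarrow> weights l \<notin> T \<Longrightarrow> c (map proj l) = 0"
  shows "\<exists>k. (\<forall>\<tau>\<in>T. k \<tau> \<in> alt_forms sl_carrier W u \<and> euler_slots (k \<tau>) = real_of_int \<tau> *\<^sub>R k \<tau>) \<and> c = (\<Sum>\<tau>\<in>T. k \<tau>)"
  using assms(1,3,4)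
proof (induction T arbitrary: c rule: finite_induct)
  case empty
  then have "c = 0" by (intro alt_forms_zero_proj) auto
  then show ?case by simp
next
  case (insert \<sigma> T)
  note W = \<open>subspace W\<close> and A = subspace_alt_forms[OF \<open>subspace W\<close>]
  define c' where "c' = euler_slots c - real_of_int \<sigma> *\<^sub>R c"
  have c': "c' \<in> alt_forms sl_carrier W u"
    unfolding c'_def by (intro subspace_diff[OF A] subspace_scale[OF A] euler_slots_alt W insert.prems)
  have "c' (map proj l) = 0" if "length l = u" "weights l \<notin> T" for l
    using insert.prems(2)[OF that(1)] that(2)
    by (cases "weights l = \<sigma>") (auto simp: c'_def euler_slots_proj[OF insert.prems(1)])
  then obtain k where k: "\<forall>\<tau>\<in>T. k \<tau> \<in> alt_forms sl_carrier W u \<and> euler_slots (k \<tau>) = real_of_int \<tau> *\<^sub>R k \<tau>"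
    and ck: "c' = (\<Sum>\<tau>\<in>T. k \<tau>)"
    using insert.IH[OF c'] by blast
  define h where "h \<tau> = (1 / real_of_int (\<tau> - \<sigma>)) *\<^sub>R k \<tau>" for \<tau>
  have hA: "h \<tau> \<in> alt_forms sl_carrier W u" if "\<tau> \<in> T" for \<tau>
    using k that by (simp add: h_def subspace_scale[OF A])
  have Slin: "lin_on (alt_forms sl_carrier W u) (alt_forms sl_carrier W u) euler_slots"
    by (rule lin_onI) (auto simp: slots_lin euler_slots_alt[OF W])
  have hS: "euler_slots (h \<tau>) = real_of_int \<tau> *\<^sub>R h \<tau>" if "\<tau> \<in> T" for \<tau>
    unfolding h_def using k that lin_on_scale[OF Slin, of "k \<tau>"] by simp
  have hk: "real_of_int (\<tau> - \<sigma>) *\<^sub>R h \<tau> = k \<tau>" if "\<tau> \<in> T" for \<tau>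
    using that insert.hyps(2) by (auto simp: h_def)
  define e where "e = c - (\<Sum>\<tau>\<in>T. h \<tau>)"
  have sA: "(\<Sum>\<tau>\<in>T. h \<tau>) \<in> alt_forms sl_carrier W u" using hA by (intro subspace_sum[OF A])
  have eA: "e \<in> alt_forms sl_carrier W u" unfolding e_def using insert.prems(1) sA by (intro subspace_diff[OF A])
  have "euler_slots (\<Sum>\<tau>\<in>T. h \<tau>) = (\<Sum>\<tau>\<in>T. euler_slots (h \<tau>))"
    by (rule lin_on_sum[OF Slin A hA])
  then have e1: "euler_slots e = euler_slots c - (\<Sum>\<tau>\<in>T. real_of_int \<tau> *\<^sub>R h \<tau>)"
    unfolding e_def lin_on_diff[OF Slin insert.prems(1) sA] using hS by simp
  have e2: "euler_slots c = real_of_int \<sigma> *\<^sub>R c + (\<Sum>\<tau>\<in>T. real_of_int (\<tau> - \<sigma>) *\<^sub>R h \<tau>)"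
    using hk ck by (simp add: c'_def algebra_simps)
  have eS: "euler_slots e = real_of_int \<sigma> *\<^sub>R e"
    unfolding e1 e2 by (simp add: e_def scaleR_diff_left scaleR_diff_right sum_subtractf scaleR_sum_right)
  have T: "\<tau> \<noteq> \<sigma>" if "\<tau> \<in> T" for \<tau> using that insert.hyps(2) by auto
  show ?case
  proof (intro exI[of _ "\<lambda>\<tau>. if \<tau> = \<sigma> then e else h \<tau>"] conjI ballI)
    fix \<tau> assume "\<tau> \<in> insert \<sigma> T"
    then show "(if \<tau> = \<sigma> then e else h \<tau>) \<in> alt_forms sl_carrier W u"
      and "euler_slots (if \<tau> = \<sigma> then e else h \<tau>) = real_of_int \<tau> *\<^sub>R (if \<tau> = \<sigma> then e else h \<tau>)"
      using eA eS hA hS by auto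
  next
    have "(\<Sum>\<tau>\<in>T. if \<tau> = \<sigma> then e else h \<tau>) = (\<Sum>\<tau>\<in>T. h \<tau>)"
      using T by (intro sum.cong) auto
    then show "c = (\<Sum>\<tau>\<in>insert \<sigma> T. if \<tau> = \<sigma> then e else h \<tau>)"
      using insert.hyps by (simp add: e_def)
  qed
qed

text \<open>The fields of weight one span a space of dimension \<open>m\<close>; an alternating form therefore
  vanishes on homogeneous fields of total weight greater than \<open>m\<close>, and only lists that
  contain all of them and no translation have weight \<open>m\<close>.\<close>

definition top_fields :: "('m option \<times> 'm option) set"
  where "top_fields = range (\<lambda>k. (Some k, None))"

lemma weight_le: "weight p \<le> (if p \<in> top_fields then 1 else 0)"
  by (cases p; cases "fst p"; cases "snd p") (auto simp: weight_def top_fields_def)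

lemma card_top_fields: "card (top_fields :: ('m::finite option \<times> 'm option) set) = CARD('m)"
  unfolding top_fields_def by (subst card_image) (auto simp: inj_on_def)

lemma weights_le_filter: "weights l \<le> int (length (filter (\<lambda>p. p \<in> top_fields) l))"
proof (induction l)
  case (Cons p l)
  then show ?case using weight_le[of p] by auto
qed simp

lemma alt_forms_distinct:
  assumes c: "c \<in> alt_forms G W u" and nz: "c (map f l) \<noteq> 0"
  shows "distinct l"
proof (rule ccontr)
  assume "\<not> distinct l"
  then obtain i j where "i < j" "j < length l" "l ! i = l ! j"
    by (metis distinct_conv_nth linorder_neqE_nat)
  then have "c (map f l) = 0" by (intro alt_forms_repeat[OF c, of i j]) auto
  then show False using nz by simp
qed

lemma distinct_filter_top:
  fixes l :: "('m::finite option \<times> 'm option) list"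
  assumes "distinct l"
  shows "length (filter (\<lambda>p. p \<in> top_fields) l) \<le> CARD('m)"
proof -
  have "length (filter (\<lambda>p. p \<in> top_fields) l) = card (set (filter (\<lambda>p. p \<in> top_fields) l))"
    using distinct_card[of "filter (\<lambda>p. p \<in> top_fields) l"] assms by (metis distinct_filter)
  also have "\<dots> \<le> card (top_fields :: ('m option \<times> 'm option) set)"
    by (intro card_mono) auto
  finally show ?thesis by (simp add: card_top_fields)
qed

lemma weights_le:
  fixes c :: "'m::finite vector_field list \<Rightarrow> 'w::real_vector"
  assumes c: "c \<in> alt_forms sl_carrier W u" and nz: "c (map proj l) \<noteq> 0"
  shows "weights l \<le> int CARD('m)"
  using weights_le_filter[of l] distinct_filter_top[OF alt_forms_distinct[OF c nz]] by linarith

section \<open>The complex of densities retracts to the kernel of the Euler field\<close>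

abbreviation lie_euler :: "('m::finite vector_field list \<Rightarrow> 'm scalar_field) \<Rightarrow> 'm vector_field list \<Rightarrow> 'm scalar_field"
  where "lie_euler \<equiv> F.lied euler_vf"

lemma lie_euler_apply: "lie_euler c = (lie_density 1 euler_vf \<circ> c) - euler_slots c"
  by (simp add: lie_deriv_def)

lemma lie_euler_proj:
  fixes c :: "'m::finite vector_field list \<Rightarrow> 'm scalar_field"
  assumes c: "c \<in> F.Alt u"
  shows "lie_euler c (map proj l) x =
    euler (c (map proj l)) x + real_of_int (int CARD('m) - weights l) * c (map proj l) x"
  unfolding lie_euler_apply using euler_slots_proj[OF c, of l]
  by (simp add: lie_density_euler algebra_simps)

lemma slots_post:
  assumes c: "c \<in> alt_forms G V u" and V: "subspace V" and f: "lin_on V W f"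
  shows "slots G D (f \<circ> c) = f \<circ> slots G D c"
  using lin_on_sum[OF f V, of _ "\<lambda>j. c (_[j := _ j])"] lin_on_zero[OF f V]
  by (auto simp: slots_def fun_eq_iff lin_on_sum[OF f V] alt_forms_mem[OF V c])

lemma F_smooth: "c \<in> F.Alt u \<Longrightarrow> smooth (c xs)"
  using F.Alt_mem by simp

lemma radial_lin: "lin_on {f. smooth f} {f. smooth f} (radial n)"
  by (intro lin_onI) (auto simp: smooth_radial fun_comb radial_comb)

lemma radial0_lin: "lin_on {f. smooth f} {f. smooth f} radial0"
  by (intro lin_onI) (auto simp: smooth_radial0 fun_comb radial0_comb)

definition at_origin :: "'m::finite scalar_field \<Rightarrow> 'm scalar_field"
  where "at_origin f = (\<lambda>x. f 0)"

lemma at_origin_lin: "lin_on {f. smooth f} {f. smooth f} at_origin"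
  by (intro lin_onI) (auto simp: at_origin_def smooth_const)

lemma euler_const: "euler (\<lambda>x. c) x = 0"
  by (simp add: euler_def)

lemma lie_euler_lin: "lin_on (F.Alt u) (F.Alt u) lie_euler"
  by (rule F.lied_lin_on[OF euler_in])

text \<open>On forms whose arguments have total weight \<open>\<tau>\<close> the operator is \<open>x \<cdot> \<partial> + m - \<tau>\<close> on the coefficients. It
  is inverted by \<open>radial (m - \<tau> - 1)\<close> if \<open>\<tau> < m\<close>. For \<open>\<tau> = m\<close> its kernel consists of the constants and
  \<open>radial0\<close> inverts it on the functions that vanish at the origin.\<close>

lemma euler_split_eigen:
  fixes k :: "'m::finite vector_field list \<Rightarrow> 'm scalar_field"
  assumes k: "k \<in> F.Alt u" and S: "euler_slots k = real_of_int \<tau> *\<^sub>R k" and \<tau>: "\<tau> \<le> int CARD('m)"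
  shows "\<exists>z\<in>F.Alt u. \<exists>b\<in>F.Alt u. lie_euler z = 0 \<and> k = z + lie_euler b"
proof -
  note sm = F_smooth[OF k]
  have post: "lie_euler (f \<circ> k) xs x = euler (f (k xs)) x + (real CARD('m) - real_of_int \<tau>) * f (k xs) x"
    if f: "lin_on {f. smooth f} {f. smooth f} f" for f :: "'m scalar_field \<Rightarrow> 'm scalar_field" and xs x
  proof -
    have f': "lin_on F.V F.V f" using f by simp
    have "euler_slots (f \<circ> k) xs = f (real_of_int \<tau> *\<^sub>R k xs)"
      unfolding slots_post[OF k F.sub_mod f'] S by simp
    also have "\<dots> = real_of_int \<tau> *\<^sub>R f (k xs)" using sm by (intro lin_on_scale[OF f]) simp
    finally show ?thesis unfolding lie_euler_apply by (simp add: lie_density_euler algebra_simps)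
  qed
  have alt: "f \<circ> k \<in> F.Alt u" if f: "lin_on {f. smooth f} {f. smooth f} f" for f :: "'m scalar_field \<Rightarrow> 'm scalar_field"
    by (rule post_alt[OF k _ F.sub_mod]) (use f in simp)
  show ?thesis
  proof (cases "\<tau> = int CARD('m)")
    case True
    have "lie_euler (at_origin \<circ> k) = 0"
      using post[OF at_origin_lin] True by (simp add: fun_eq_iff at_origin_def euler_const)
    moreover have "k = (at_origin \<circ> k) + lie_euler (radial0 \<circ> k)"
    proof (intro ext)
      fix xs x
      have "lie_euler (radial0 \<circ> k) xs x = k xs x - k xs 0"
        using post[OF radial0_lin, of xs x] True by (simp add: euler_radial0[OF sm])
      then show "k xs x = ((at_origin \<circ> k) + lie_euler (radial0 \<circ> k)) xs x"
        by (simp add: at_origin_def)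
    qed
    ultimately show ?thesis using alt[OF at_origin_lin] alt[OF radial0_lin] by blast
  next
    case False
    define n where "n = nat (int CARD('m) - \<tau> - 1)"
    have n: "real CARD('m) - real_of_int \<tau> = real (Suc n)" using False \<tau> by (simp add: n_def)
    have "k = 0 + lie_euler (radial n \<circ> k)"
    proof (intro ext)
      fix xs x
      have "lie_euler (radial n \<circ> k) xs x = k xs x"
        using post[OF radial_lin, of n xs x] euler_radial[OF sm, of n xs x] unfolding n by simp
      then show "k xs x = (0 + lie_euler (radial n \<circ> k)) xs x" by simp
    qed
    moreover have "0 \<in> F.Alt u" by (rule subspace_0[OF F.sub_Alt])
    moreover have "lie_euler (0 :: 'm vector_field list \<Rightarrow> 'm scalar_field) = 0" by (rule lin_on_zero[OF lie_euler_lin F.sub_Alt])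
    ultimately show ?thesis using alt[OF radial_lin] by blast
  qed
qed

lemma euler_split:
  fixes c :: "'m::finite vector_field list \<Rightarrow> 'm scalar_field"
  assumes c: "c \<in> F.Alt u"
  shows "\<exists>z\<in>F.Alt u. \<exists>b\<in>F.Alt u. lie_euler z = 0 \<and> c = z + lie_euler b"
proof -
  define T where "T = weights ` {l :: ('m option \<times> 'm option) list. length l = u} \<inter> {..int CARD('m)}"
  have T: "finite T" unfolding T_def by (intro finite_Int disjI1 finite_imageI finite_index_lists)
  have "c (map proj l) = 0" if "length l = u" "weights l \<notin> T" for l
    using that weights_le[OF c, of l] by (auto simp: T_def)
  from euler_eigenforms[OF T F.sub_mod c this] obtain k where
    k: "\<forall>\<tau>\<in>T. k \<tau> \<in> F.Alt u \<and> euler_slots (k \<tau>) = real_of_int \<tau> *\<^sub>R k \<tau>" and ck: "c = (\<Sum>\<tau>\<in>T. k \<tau>)" by blast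
  have "\<forall>\<tau>\<in>T. \<exists>z b. z \<in> F.Alt u \<and> b \<in> F.Alt u \<and> lie_euler z = 0 \<and> k \<tau> = z + lie_euler b"
  proof
    fix \<tau> assume \<tau>: "\<tau> \<in> T"
    then have "\<tau> \<le> int CARD('m)" by (simp add: T_def)
    then show "\<exists>z b. z \<in> F.Alt u \<and> b \<in> F.Alt u \<and> lie_euler z = 0 \<and> k \<tau> = z + lie_euler b"
      using euler_split_eigen[of "k \<tau>" u \<tau>] k \<tau> by blast
  qed
  then obtain z b where zb: "\<And>\<tau>. \<tau> \<in> T \<Longrightarrow> z \<tau> \<in> F.Alt u \<and> b \<tau> \<in> F.Alt u \<and> lie_euler (z \<tau>) = 0 \<and> k \<tau> = z \<tau> + lie_euler (b \<tau>)"
    by metis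
  show ?thesis
  proof -
    have zA: "z \<tau> \<in> F.Alt u" and bA: "b \<tau> \<in> F.Alt u" if "\<tau> \<in> T" for \<tau> using zb[OF that] by auto
    have "(\<Sum>\<tau>\<in>T. z \<tau>) \<in> F.Alt u" by (rule subspace_sum[OF F.sub_Alt zA])
    moreover have "(\<Sum>\<tau>\<in>T. b \<tau>) \<in> F.Alt u" by (rule subspace_sum[OF F.sub_Alt bA])
    moreover have "lie_euler (\<Sum>\<tau>\<in>T. z \<tau>) = (\<Sum>\<tau>\<in>T. lie_euler (z \<tau>))"
      by (rule lin_on_sum[OF lie_euler_lin F.sub_Alt zA])
    moreover have "lie_euler (\<Sum>\<tau>\<in>T. b \<tau>) = (\<Sum>\<tau>\<in>T. lie_euler (b \<tau>))"
      by (rule lin_on_sum[OF lie_euler_lin F.sub_Alt bA])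
    moreover have "c = (\<Sum>\<tau>\<in>T. z \<tau>) + (\<Sum>\<tau>\<in>T. lie_euler (b \<tau>))"
      unfolding ck sum.distrib[symmetric] using zb by (intro sum.cong) auto
    moreover have "(\<Sum>\<tau>\<in>T. lie_euler (z \<tau>)) = 0" using zb by (intro sum.neutral) auto
    ultimately show ?thesis by metis
  qed
qed

text \<open>A smooth function on the whole space is not homogeneous of negative degree, unless it is zero; if
  it is homogeneous of degree zero, it is constant.\<close>

lemma euler_kernel:
  fixes z :: "'m::finite vector_field list \<Rightarrow> 'm scalar_field"
  assumes z: "z \<in> F.Alt u" and L: "lie_euler z = 0"
  shows "z (map proj l) x = z (map proj l) 0" and "weights l \<noteq> int CARD('m) \<Longrightarrow> z (map proj l) = 0"
proof -
  let ?f = "z (map proj l)"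
  have e: "euler ?f x + real_of_int (int CARD('m) - weights l) * ?f x = 0" for x
    using lie_euler_proj[OF z, of l x] L by simp
  show w: "z (map proj l) = 0" if ne: "weights l \<noteq> int CARD('m)"
  proof (cases "weights l < int CARD('m)")
    case True
    define n where "n = nat (int CARD('m) - weights l - 1)"
    have n: "real_of_int (int CARD('m) - weights l) = real (Suc n)" using True by (simp add: n_def)
    show ?thesis using euler_weight_zero[OF F_smooth[OF z], of _ n] e unfolding n by (auto simp: fun_eq_iff)
  next
    case False
    then show ?thesis using weights_le[OF z, of l] ne by auto
  qed
  show "?f x = ?f 0"
  proof (cases "weights l = int CARD('m)")
    case True
    then show ?thesis using e by (intro euler_zero_const F_smooth[OF z]) auto
  qed (simp add: w)
qed

lemma euler_disjoint:
  fixes b :: "'m::finite vector_field list \<Rightarrow> 'm scalar_field"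
  assumes b: "b \<in> F.Alt u" and L: "lie_euler (lie_euler b) = 0"
  shows "lie_euler b = 0"
proof (rule alt_forms_zero_proj[OF F.lied_alt[OF euler_in b]])
  fix l :: "('m option \<times> 'm option) list" assume "length l = u"
  note z = F.lied_alt[OF euler_in b]
  show "lie_euler b (map proj l) = 0"
  proof (cases "weights l = int CARD('m)")
    case True
    have "lie_euler b (map proj l) 0 = euler (b (map proj l)) 0" using lie_euler_proj[OF b, of l 0] True by simp
    also have "\<dots> = 0" by (simp add: euler_def)
    finally have "lie_euler b (map proj l) x = 0" for x using euler_kernel(1)[OF z L, of l x] by simp
    then show ?thesis by (simp add: fun_eq_iff)
  next
    case False
    then show ?thesis by (rule euler_kernel(2)[OF z L])
  qed
qed

text \<open>Cartan's formula.\<close>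

lemma lie_euler_exact:
  assumes b: "b \<in> F.Alt u" and db: "F.d b = 0"
  shows "lie_euler b \<in> coboundaries sl_proj (dens_module 1) u"
proof -
  have e: "lie_euler b = F.d (contract euler_vf b)"
    using F.contract_ce_diff[OF euler_in b] db by (simp add: contract_zero del: contract_apply)
  show ?thesis
  proof (cases u)
    case 0
    then have "contract euler_vf b = 0" using contract_0 b by blast
    then have "lie_euler b = 0" using e F.ce_diff_0 by (simp del: contract_apply)
    then show ?thesis using 0 by (simp add: coboundaries_def)
  next
    case (Suc v)
    then have "contract euler_vf b \<in> F.Alt v" using contract_alt b euler_in by blast
    then show ?thesis using e Suc by (auto simp: coboundaries_def cochains_def simp del: contract_apply)
  qed
qed

lemma euler_cocycle:
  assumes c: "c \<in> F.Alt u" and dc: "F.d c = 0"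
  shows "\<exists>z\<in>F.Alt u. \<exists>b\<in>coboundaries sl_proj (dens_module 1) u. lie_euler z = 0 \<and> F.d z = 0 \<and> c = z + b"
proof -
  have "\<exists>z\<in>F.Alt u. \<exists>b\<in>F.Alt u. lie_euler z = 0 \<and> F.d z = 0 \<and> F.d b = 0 \<and> c = z + lie_euler b"
    by (rule fitting_cocycle[where A = F.Alt and D = F.d and L = lie_euler])
      (assumption | rule F.sub_Alt F.ce_diff_lin_on lie_euler_lin F.ce_diff_lied[OF euler_in] euler_split
          c dc euler_disjoint)+
  then show ?thesis using lie_euler_exact by blast
qed

section \<open>Restriction to the linear fields\<close>

text \<open>The field \<open>\<Sum> A\<^sub>i\<^sub>j x\<^sup>i \<partial>\<^sub>j\<close>; with the indices in this order, the bracket of fields is the commutator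
  of matrices and not its opposite.\<close>

definition lin_vf :: "real^'m^'m \<Rightarrow> 'm::finite vector_field"
  where "lin_vf A = (\<Sum>p\<in>UNIV. (A $ fst p $ snd p) *\<^sub>R proj_vf (Some (fst p)) (Some (snd p)))"

lemma lin_vf_in: "lin_vf A \<in> sl_carrier"
  unfolding lin_vf_def by (intro subspace_sum[OF sub_sl] subspace_scale[OF sub_sl] proj_in)

lemma lin_vf_comb: "lin_vf (r *\<^sub>R A + s *\<^sub>R B) = r *\<^sub>R lin_vf A + s *\<^sub>R lin_vf B"
  by (simp add: lin_vf_def scaleR_sum_right sum.distrib algebra_simps)

lemma lin_vf_comp: "lin_vf A x $ j = (\<Sum>i\<in>UNIV. x $ i * A $ i $ j)"
proof -
  have "lin_vf A x $ j = (\<Sum>i\<in>UNIV. \<Sum>k\<in>UNIV. x $ i * A $ i $ k * \<delta> k j)"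
    by (simp add: lin_vf_def sum_UNIV_pair proj_vf_def hvec_comp mult_ac)
  also have "\<dots> = (\<Sum>i\<in>UNIV. x $ i * A $ i $ j)"
    by (intro sum.cong refl) (subst sum.remove[of UNIV j]; auto)
  finally show ?thesis .
qed

lemma partial_lin_vf: "partial i (\<lambda>y. lin_vf A y $ j) x = A $ i $ j"
proof -
  have "partial i (\<lambda>y. lin_vf A y $ j) = (\<lambda>x. \<Sum>k\<in>UNIV. partial i (\<lambda>y. A $ k $ j * y $ k) x)"
    unfolding lin_vf_comp mult.commute[of _ "A $ _ $ j"] by (intro partial_sum smooth_cmult smooth_coord)
  also have "\<dots> = (\<lambda>x. \<Sum>k\<in>UNIV. A $ k $ j * \<delta> i k)"
    by (simp add: partial_cmult smooth_coord partial_coord)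
  also have "\<dots> = (\<lambda>x. A $ i $ j)" by (subst sum.remove[of UNIV i]) auto
  finally show ?thesis by simp
qed

lemma lin_vf_bracket: "vf_bracket (lin_vf A) (lin_vf B) = lin_vf (gl_bracket A B)"
proof (rule ext, unfold vec_eq_iff, rule allI)
  fix x k
  have e: "deriv_along (lin_vf A) (\<lambda>y. lin_vf B y $ k) x = (\<Sum>i\<in>UNIV. x $ i * (A ** B) $ i $ k)" for A B :: "real^'a^'a"
  proof -
    have "deriv_along (lin_vf A) (\<lambda>y. lin_vf B y $ k) x = (\<Sum>j\<in>UNIV. \<Sum>i\<in>UNIV. x $ i * (A $ i $ j * B $ j $ k))"
      unfolding deriv_along_def partial_lin_vf by (simp add: lin_vf_comp sum_distrib_right mult.assoc)
    also have "\<dots> = (\<Sum>i\<in>UNIV. x $ i * (A ** B) $ i $ k)"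
      by (subst sum.swap) (simp add: matrix_matrix_mult_def sum_distrib_left)
    finally show ?thesis .
  qed
  show "vf_bracket (lin_vf A) (lin_vf B) x $ k = lin_vf (gl_bracket A B) x $ k"
    unfolding vf_bracket_comp e by (simp add: lin_vf_comp gl_bracket_def right_diff_distrib sum_subtractf)
qed

lemma divg_lin_vf: "divg (lin_vf A) x = (\<Sum>i\<in>UNIV. A $ i $ i)"
  by (simp add: divg_def partial_lin_vf)

abbreviation quad_vf :: "'m::finite \<Rightarrow> 'm vector_field"
  where "quad_vf k \<equiv> proj_vf (Some k) None"

lemma lin_quad_bracket: "vf_bracket (lin_vf A) (quad_vf k) = (\<Sum>i\<in>UNIV. A $ i $ k *\<^sub>R quad_vf i)"
proof -
  have "lin_on sl_carrier sl_carrier (vf_bracket (quad_vf k))" using F.bracket_lin[OF proj_in] by simp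
  note lin = this
  have b: "vf_bracket (quad_vf k) (proj_vf (Some i) (Some j)) = - (\<delta> j k *\<^sub>R quad_vf i)" for i j
    using proj_bracket[of "Some k" None "Some i" "Some j"] by (auto simp: eq_commute)
  have e1: "vf_bracket (lin_vf A) (quad_vf k) = - vf_bracket (quad_vf k) (lin_vf A)" by (rule vf_bracket_anti)
  have "vf_bracket (quad_vf k) (lin_vf A) =
      (\<Sum>p\<in>UNIV. (A $ fst p $ snd p) *\<^sub>R vf_bracket (quad_vf k) (proj_vf (Some (fst p)) (Some (snd p))))"
    unfolding lin_vf_def
    by (subst lin_on_sum[OF lin sub_sl]) (auto simp: lin_on_scale[OF lin] proj_in subspace_scale[OF sub_sl])
  also have "\<dots> = - (\<Sum>i\<in>UNIV. \<Sum>j\<in>UNIV. A $ i $ j *\<^sub>R \<delta> j k *\<^sub>R quad_vf i)"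
    unfolding b sum_UNIV_pair by (simp add: sum_negf)
  finally have e2: "vf_bracket (quad_vf k) (lin_vf A) = - (\<Sum>i\<in>UNIV. \<Sum>j\<in>UNIV. A $ i $ j *\<^sub>R \<delta> j k *\<^sub>R quad_vf i)" .
  have e3: "(\<Sum>i\<in>UNIV. \<Sum>j\<in>UNIV. A $ i $ j *\<^sub>R \<delta> j k *\<^sub>R quad_vf i) = (\<Sum>i\<in>UNIV. A $ i $ k *\<^sub>R quad_vf i)"
    by (intro sum.cong refl) (subst sum.remove[of UNIV k]; auto)
  show ?thesis unfolding e1 e2 e3 by simp
qed

lemma sum_lessThan_add: "(\<Sum>j<a + b. f j) = (\<Sum>j<a. f j) + (\<Sum>k<b. f (a + k))"
  for f :: "nat \<Rightarrow> 'a::comm_monoid_add"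
  by (induction b) (simp_all add: add.assoc)

text \<open>An arbitrary enumeration of the coordinates; it fixes the order of the quadratic arguments below.\<close>

definition coords :: "'m::finite list"
  where "coords = (SOME l. set l = UNIV \<and> distinct l)"

lemma coords: "set (coords :: 'm::finite list) = UNIV" "distinct (coords :: 'm list)" "length (coords :: 'm list) = CARD('m)"
proof -
  have "\<exists>l. set l = (UNIV :: 'm set) \<and> distinct l" by (rule finite_distinct_list) simp
  then have "set (coords :: 'm list) = UNIV \<and> distinct (coords :: 'm list)" unfolding coords_def by (rule someI_ex)
  then show "set (coords :: 'm list) = UNIV" "distinct (coords :: 'm list)" "length (coords :: 'm list) = CARD('m)"
    by (auto simp: distinct_card[symmetric])
qed

text \<open>The cochain is evaluated at the origin, with linear fields followed by all the fields \<open>x\<^sup>k E\<close> as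
  arguments.\<close>

definition restrict_form :: "nat \<Rightarrow> ('m::finite vector_field list \<Rightarrow> 'm scalar_field) \<Rightarrow> (real^'m^'m) list \<Rightarrow> real"
  where "restrict_form b c As = (if length As = b then c (map lin_vf As @ map quad_vf coords) 0 else 0)"

lemma restrict_form_comb:
  "restrict_form b (r *\<^sub>R c + s *\<^sub>R c') = r *\<^sub>R restrict_form b c + s *\<^sub>R restrict_form b c'"
  by (simp add: restrict_form_def fun_eq_iff)

lemma restrict_arg_in: "set (map lin_vf As @ map quad_vf ks) \<subseteq> sl_carrier"
  by (auto simp: lin_vf_in proj_in)

lemma restrict_form_alt:
  fixes c :: "'m::finite vector_field list \<Rightarrow> 'm scalar_field"
  assumes c: "c \<in> F.Alt (b + CARD('m))"
  shows "restrict_form b c \<in> gl.Alt b"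
  unfolding alt_forms_def mem_Collect_eq
proof (intro conjI allI impI ballI)
  fix xs :: "(real^'m^'m) list" assume "\<not> (length xs = b \<and> set xs \<subseteq> la_carrier gl_alg)"
  then show "restrict_form b c xs = 0" by (simp add: restrict_form_def)
next
  fix xs i x y r s
  assume xs: "length xs = b \<and> set xs \<subseteq> (la_carrier gl_alg :: (real^'m^'m) set)" and i: "i < b"
  have len: "length (map lin_vf xs @ map quad_vf (coords :: 'm list)) = b + CARD('m)" using xs by (simp add: coords)
  have u: "map lin_vf (xs[i := A]) @ map quad_vf coords = (map lin_vf xs @ map quad_vf coords)[i := lin_vf A]" for A
    using i xs by (simp add: map_update list_update_append1)
  have "c ((map lin_vf xs @ map quad_vf coords)[i := r *\<^sub>R lin_vf x + s *\<^sub>R lin_vf y]) =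
      r *\<^sub>R c ((map lin_vf xs @ map quad_vf coords)[i := lin_vf x]) + s *\<^sub>R c ((map lin_vf xs @ map quad_vf coords)[i := lin_vf y])"
    by (rule alt_forms_slot[OF c len restrict_arg_in _ lin_vf_in lin_vf_in]) (use i in simp)
  then show "restrict_form b c (xs[i := r *\<^sub>R x + s *\<^sub>R y]) = r *\<^sub>R restrict_form b c (xs[i := x]) + s *\<^sub>R restrict_form b c (xs[i := y])"
    using xs by (simp add: restrict_form_def u lin_vf_comb)
next
  fix xs i j assume a: "length xs = b \<and> set xs \<subseteq> (la_carrier gl_alg :: (real^'m^'m) set)" "i < j \<and> j < b \<and> xs ! i = xs ! j"
  then have "c (map lin_vf xs @ map quad_vf coords) = 0"
    by (intro alt_forms_repeat[OF c, of i j]) (auto simp: nth_append)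
  then show "restrict_form b c xs = 0" by (simp add: restrict_form_def)
qed simp

lemma contract_restrict: "contract A (restrict_form (Suc b) c) = restrict_form b (contract (lin_vf A) c)"
  by (simp add: restrict_form_def fun_eq_iff)

text \<open>The contribution of the coefficients to the Lie derivative is the trace of \<open>A\<close>; it is
  cancelled by the action of \<open>A\<close> on the \<open>m\<close> quadratic fields.\<close>

lemma restrict_lied:
  fixes c :: "'m::finite vector_field list \<Rightarrow> 'm scalar_field"
  assumes c: "c \<in> F.Alt (b + CARD('m))"
  shows "restrict_form b (F.lied (lin_vf A) c) = gl.lied A (restrict_form b c)"
proof
  fix As :: "(real^'m^'m) list"
  show "restrict_form b (F.lied (lin_vf A) c) As = gl.lied A (restrict_form b c) As"
  proof (cases "length As = b")
    case False
    then show ?thesis by (simp add: restrict_form_def gl_lied)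
  next
    case True
    let ?Q = "map quad_vf (coords :: 'm list)" and ?m = "CARD('m)"
    let ?X = "map lin_vf As @ ?Q"
    have len: "length ?X = b + ?m" using True by (simp add: coords)
    have act0: "lie_density 1 (lin_vf A) f 0 = (\<Sum>i\<in>UNIV. A $ i $ i) * f 0" for f
      by (simp add: lie_density_eq deriv_along_def lin_vf_comp divg_lin_vf)
    have first: "c (?X[j := vf_bracket (lin_vf A) (?X ! j)]) = c (map lin_vf (As[j := gl_bracket A (As ! j)]) @ ?Q)" if "j < b" for j
      using that True by (simp add: nth_append list_update_append1 map_update lin_vf_bracket)
    have second: "c (?X[b + k := vf_bracket (lin_vf A) (?X ! (b + k))]) = (A $ (coords ! k) $ (coords ! k)) *\<^sub>R c ?X"
      if k: "k < ?m" for k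
    proof -
      define a :: 'm where "a = coords ! k"
      have Xa: "?X ! (b + k) = quad_vf a" using True k by (simp add: nth_append coords a_def)
      define H where "H Y = c (?X[b + k := Y])" for Y
      have Hlin: "lin_on sl_carrier UNIV H"
      proof (rule lin_onI)
        fix x y r s assume "x \<in> (sl_carrier :: 'm vector_field set)" "y \<in> (sl_carrier :: 'm vector_field set)"
        then show "H (r *\<^sub>R x + s *\<^sub>R y) = r *\<^sub>R H x + s *\<^sub>R H y"
          unfolding H_def using k by (intro alt_forms_slot[OF c len restrict_arg_in]) auto
      qed simp
      have Hq: "H (quad_vf i) = (if i = a then c ?X else 0)" for i
      proof (cases "i = a")
        case True
        have "?X[b + k := quad_vf a] = ?X" unfolding Xa[symmetric] by (rule list_update_id)
        then show ?thesis using True by (simp add: H_def)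
      next
        case False
        obtain k' where k': "k' < ?m" "coords ! k' = i" using coords(1,3) by (metis UNIV_I in_set_conv_nth)
        have ne: "k' \<noteq> k" using False k' by (auto simp: a_def)
        have len': "length (?X[b + k := quad_vf i]) = b + ?m" using len by simp
        have "(?X[b + k := quad_vf i]) ! (b + k') = quad_vf i" "(?X[b + k := quad_vf i]) ! (b + k) = quad_vf i"
          using ne k k' len True by (auto simp: nth_list_update nth_append coords)
        then have "c (?X[b + k := quad_vf i]) = 0"
          using alt_forms_repeat[OF c, of "b + k" "b + k'" "?X[b + k := quad_vf i]"]
            alt_forms_repeat[OF c, of "b + k'" "b + k" "?X[b + k := quad_vf i]"] ne k k' len'
          by (cases "k < k'") auto
        then show ?thesis using False by (simp add: H_def)
      qed
      have "H (vf_bracket (lin_vf A) (quad_vf a)) = (\<Sum>i\<in>UNIV. H (A $ i $ a *\<^sub>R quad_vf i))"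
        unfolding lin_quad_bracket
        by (rule lin_on_sum[OF Hlin sub_sl]) (intro subspace_scale[OF sub_sl] proj_in)
      also have "\<dots> = (\<Sum>i\<in>UNIV. A $ i $ a *\<^sub>R (if i = a then c ?X else 0))"
        by (intro sum.cong refl) (simp add: lin_on_scale[OF Hlin proj_in] Hq)
      also have "\<dots> = A $ a $ a *\<^sub>R c ?X" by (subst sum.remove[of UNIV a]) auto
      finally show ?thesis unfolding Xa by (simp add: H_def a_def)
    qed
    have tr: "(\<Sum>k<?m. A $ (coords ! k) $ (coords ! k)) = (\<Sum>i\<in>UNIV. A $ i $ i)"
    proof -
      have "(\<Sum>k<?m. A $ (coords ! k) $ (coords ! k)) = (\<Sum>i\<leftarrow>coords. A $ i $ i)"
        by (simp add: sum_list_sum_nth coords atLeast0LessThan)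
      also have "\<dots> = (\<Sum>i\<in>UNIV. A $ i $ i)" using sum_list_distinct_conv_sum_set[OF coords(2)] by (simp add: coords)
      finally show ?thesis .
    qed
    have "(\<Sum>j<b + ?m. c (?X[j := vf_bracket (lin_vf A) (?X ! j)])) = (\<Sum>j<b. c (map lin_vf (As[j := gl_bracket A (As ! j)]) @ ?Q)) + (\<Sum>i\<in>UNIV. A $ i $ i) *\<^sub>R c ?X"
      unfolding sum_lessThan_add using first second by (simp add: scaleR_sum_left[symmetric] tr)
    then have "F.lied (lin_vf A) c ?X 0 = - (\<Sum>j<b. c (map lin_vf (As[j := gl_bracket A (As ! j)]) @ ?Q) 0)"
      using restrict_arg_in[of As coords] len by (simp add: lie_deriv_def slots_def act0 del: map_append)
    then show ?thesis using True by (simp add: restrict_form_def gl_lied)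
  qed
qed

text \<open>The quadratic fields vanish to second order at the origin and commute with each other.\<close>

lemma restrict_diff_low:
  fixes c :: "'m::finite vector_field list \<Rightarrow> 'm scalar_field"
  assumes c: "c \<in> F.Alt u"
  shows "F.d c (map quad_vf coords) 0 = 0"
proof -
  have q0: "lie_density 1 (quad_vf k) f 0 = 0" for k :: 'm and f
    by (simp add: lie_density_eq deriv_along_proj divg_proj)
  have "vf_bracket (quad_vf k) (quad_vf l) = 0" for k l :: 'm
    by (simp add: proj_bracket)
  moreover have "c (0 # zs) = 0" for zs
  proof (cases u)
    case 0
    then show ?thesis using alt_forms_out[OF c] by auto
  next
    case (Suc v)
    then show ?thesis using alt_forms_lin_head[of c sl_carrier "{f. smooth f}" v 0 0 0 0 zs] c sub_sl subspace_0[OF sub_sl] by simp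
  qed
  ultimately show ?thesis
    by (simp add: ce_diff_def q0)
qed

text \<open>Restriction commutes with contractions and Lie derivatives along linear fields, so Cartan's formula
  allows an induction on the degree.\<close>

lemma restrict_diff:
  fixes c :: "'m::finite vector_field list \<Rightarrow> 'm scalar_field"
  assumes "c \<in> F.Alt (b + CARD('m))"
  shows "gl.d (restrict_form b c) = restrict_form (Suc b) (F.d c)"
  using assms
proof (induction b arbitrary: c)
  have step: "gl.d (restrict_form b c) = restrict_form (Suc b) (F.d c)"
    if c: "c \<in> F.Alt (b + CARD('m))" and IH: "\<And>A. gl.d (contract A (restrict_form b c)) = restrict_form b (F.d (contract (lin_vf A) c))"
    for b and c :: "'m vector_field list \<Rightarrow> 'm scalar_field"
  proof (rule alt_forms_eqI[OF gl.ce_diff_alt[OF restrict_form_alt[OF c]] restrict_form_alt])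
    show "F.d c \<in> F.Alt (Suc b + CARD('m))" using F.ce_diff_alt[OF c] by simp
    fix A
    have "contract A (gl.d (restrict_form b c)) = gl.lied A (restrict_form b c) - gl.d (contract A (restrict_form b c))"
      by (rule gl.contract_ce_diff[OF _ restrict_form_alt[OF c]]) simp
    moreover have "contract A (restrict_form (Suc b) (F.d c)) =
        restrict_form b (1 *\<^sub>R F.lied (lin_vf A) c + (-1) *\<^sub>R F.d (contract (lin_vf A) c))"
      unfolding contract_restrict F.contract_ce_diff[OF lin_vf_in c] by simp
    ultimately show "contract A (gl.d (restrict_form b c)) = contract A (restrict_form (Suc b) (F.d c))"
      unfolding restrict_form_comb restrict_lied[OF c] IH by simp
  qed
  {
    case 0
    show ?case
    proof (rule step[OF 0])
      fix A
      obtain n where n: "CARD('m) = Suc n" using not0_implies_Suc[of "CARD('m)"] by auto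
      have "contract (lin_vf A) c \<in> F.Alt n" using 0 n by (intro contract_alt lin_vf_in) simp
      then have "restrict_form 0 (F.d (contract (lin_vf A) c)) = 0"
        using restrict_diff_low by (auto simp: restrict_form_def fun_eq_iff simp del: contract_apply)
      moreover have "contract A (restrict_form 0 c) = 0" by (simp add: restrict_form_def fun_eq_iff)
      ultimately show "gl.d (contract A (restrict_form 0 c)) = restrict_form 0 (F.d (contract (lin_vf A) c))"
        by (simp add: gl.ce_diff_0 del: contract_apply)
    qed
  next
    case (Suc b)
    show ?case
    proof (rule step[OF Suc.prems])
      fix A
      have "contract (lin_vf A) c \<in> F.Alt (b + CARD('m))" using Suc.prems by (intro contract_alt lin_vf_in) simp
      then show "gl.d (contract A (restrict_form (Suc b) c)) = restrict_form (Suc b) (F.d (contract (lin_vf A) c))"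
        unfolding contract_restrict by (rule Suc.IH)
    qed
  }
qed

lemma restrict_coboundary:
  fixes a :: "'m::finite vector_field list \<Rightarrow> 'm scalar_field"
  assumes a: "a \<in> coboundaries sl_proj (dens_module 1) (b + CARD('m))"
  shows "restrict_form b a \<in> coboundaries gl_alg triv_module b"
proof -
  obtain n where n: "CARD('m) = Suc n" using not0_implies_Suc[of "CARD('m)"] by auto
  obtain e where e: "e \<in> F.Alt (b + n)" and ae: "a = F.d e"
    using a n by (auto simp: coboundaries_def cochains_def)
  show ?thesis
  proof (cases b)
    case 0
    then show ?thesis
      using restrict_diff_low[OF e] ae by (auto simp: restrict_form_def fun_eq_iff coboundaries_def)
  next
    case (Suc b')
    then have e': "e \<in> F.Alt (b' + CARD('m))" using e n by simp
    then have "restrict_form b a = gl.d (restrict_form b' e)" using restrict_diff[OF e'] Suc ae by simp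
    then show ?thesis using restrict_form_alt[OF e'] Suc by (auto simp: coboundaries_def cochains_def)
  qed
qed

lemma weight_sum_parts:
  "weights l = int (length (filter (\<lambda>p. p \<in> top_fields) l)) - int (length (filter (\<lambda>p. weight p < 0) l))"
proof (induction l)
  case (Cons p l)
  have "weight p = (if p \<in> top_fields then 1 else 0) - (if weight p < 0 then 1 else 0)"
    by (cases p; cases "fst p"; cases "snd p") (auto simp: weight_def top_fields_def)
  then show ?case using Cons by (auto split: if_splits)
qed simp

lemma weight_zero_linear:
  assumes "p \<notin> top_fields" "\<not> weight p < 0"
  shows "\<exists>A. proj p = lin_vf A"
proof -
  consider i j where "p = (Some i, Some j)" | "p = (None, None)"
    using assms by (cases p; cases "fst p"; cases "snd p") (auto simp: weight_def top_fields_def)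
  then show ?thesis
  proof cases
    case (1 i j)
    have "proj p x = lin_vf (mat_unit (i, j)) x" for x
    proof (unfold vec_eq_iff, rule allI)
      fix k
      have "(\<Sum>a\<in>UNIV. x $ a * (if i = a \<and> j = k then 1 else 0)) = x $ i * \<delta> j k"
        by (subst sum.remove[of UNIV i]) auto
      then show "proj p x $ k = lin_vf (mat_unit (i, j)) x $ k"
        by (simp add: 1 proj_vf_def hvec_comp lin_vf_comp mat_unit_def)
    qed
    then show ?thesis by blast
  next
    case 2
    have "proj p x = lin_vf (- mat 1) x" for x
    proof (unfold vec_eq_iff, rule allI)
      fix k
      have "(\<Sum>a\<in>UNIV. x $ a * - \<delta> a k) = - x $ k" by (subst sum.remove[of UNIV k]) auto
      then show "proj p x $ k = lin_vf (- mat 1) x $ k"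
        by (simp add: 2 proj_vf_def hvec_comp lin_vf_comp mat_def)
    qed
    then show ?thesis by blast
  qed
qed

text \<open>A list of homogeneous fields at which \<open>z\<close> does not vanish has weight \<open>m\<close>. Its members are distinct, so it
  contains each of the \<open>m\<close> quadratic fields once and no translation: up to order, it is a list at which
  the restriction is evaluated.\<close>

lemma restrict_injective:
  fixes z :: "'m::finite vector_field list \<Rightarrow> 'm scalar_field"
  assumes z: "z \<in> F.Alt u" and L: "lie_euler z = 0" and r: "\<And>b. u = b + CARD('m) \<Longrightarrow> restrict_form b z = 0"
  shows "z = 0"
proof (rule ccontr)
  assume "z \<noteq> 0"
  then obtain l :: "('m option \<times> 'm option) list" where len: "length l = u" and nz: "z (map proj l) \<noteq> 0"
    using alt_forms_zero_proj[OF z] by blast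
  have w: "weights l = int CARD('m)" using euler_kernel(2)[OF z L] nz by blast
  have dist: "distinct l" by (rule alt_forms_distinct[OF z nz])
  let ?top = "filter (\<lambda>p. p \<in> top_fields) l" and ?rest = "filter (\<lambda>p. p \<notin> top_fields) l"
  have "length ?top \<le> CARD('m)" by (rule distinct_filter_top[OF dist])
  then have ltop: "length ?top = CARD('m)" and "length (filter (\<lambda>p. weight p < 0) l) = 0"
    using weight_sum_parts[of l] w by linarith+
  then have neg: "\<not> weight p < 0" if "p \<in> set l" for p using that by (auto simp: filter_empty_conv)
  have top_set: "set ?top = top_fields"
  proof (rule card_subset_eq)
    show "card (set ?top) = card (top_fields :: ('m option \<times> 'm option) set)"
      using distinct_card[of ?top] dist ltop by (simp add: card_top_fields del: set_filter)
  qed (auto simp: top_fields_def)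
  have "distinct ?top" using dist by simp
  moreover have "distinct (map (\<lambda>k. (Some k, None)) (coords :: 'm list) :: ('m option \<times> 'm option) list)"
    by (simp add: distinct_map coords inj_on_def)
  moreover have "set (map (\<lambda>k. (Some k, None)) (coords :: 'm list)) = (top_fields :: ('m option \<times> 'm option) set)"
    by (simp add: coords top_fields_def)
  ultimately have top: "mset ?top = mset (map (\<lambda>k. (Some k, None)) coords)"
    using set_eq_iff_mset_eq_distinct[of ?top "map (\<lambda>k. (Some k, None)) coords"] top_set by simp
  have "\<forall>X\<in>set (map proj ?rest). \<exists>A. X = lin_vf A"
  proof
    fix X assume "X \<in> set (map proj ?rest)"
    then obtain p where p: "p \<in> set l" "p \<notin> top_fields" and X: "X = proj p" by auto
    show "\<exists>A. X = lin_vf A" unfolding X by (rule weight_zero_linear[OF p(2) neg[OF p(1)]])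
  qed
  then obtain As where As: "map proj ?rest = map lin_vf As" using ex_map_conv[of "map proj ?rest" lin_vf] by blast
  let ?l' = "?rest @ map (\<lambda>k. (Some k, None)) coords"
  have "mset l = mset ?rest + mset ?top" by (simp add: add.commute multiset_partition[symmetric])
  then have ml: "mset l = mset ?l'" by (simp only: mset_append top)
  then have m: "mset (map proj l) = mset (map proj ?l')" by (simp only: mset_map)
  have eq: "map proj ?l' = map lin_vf As @ map quad_vf coords" using As by simp
  have lenA: "u = length As + CARD('m)"
  proof -
    have "length ?rest = length As" using arg_cong[OF As, of length] by simp
    then show ?thesis using mset_eq_length[OF ml] len coords(3) by simp
  qed
  have "z (map proj ?l') 0 = 0"
    unfolding eq using fun_cong[OF r[OF lenA], of As] by (simp add: restrict_form_def)
  then have "z (map proj ?l') x = 0" for x using euler_kernel(1)[OF z L, of ?l' x] by simp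
  then have "z (map proj ?l') = 0" by (simp add: fun_eq_iff)
  then have "z (map proj l) = 0" by (rule alt_forms_mset_zero[OF z sub_sl m[symmetric]])
  then show False using nz by simp
qed

text \<open>Conversely, a form on \<open>gl\<^sub>m\<close> is pulled back along the linear part at the origin, and
  multiplied by the \<open>m\<close> one-forms that are dual to the quadratic fields.\<close>

definition linear_part :: "'m::finite vector_field \<Rightarrow> real^'m^'m"
  where "linear_part X = (\<chi> i j. partial i (\<lambda>y. X y $ j) 0)"

text \<open>The divergence of \<open>x\<^sup>k E\<close> is \<open>(m + 1) x\<^sup>k\<close>; the quadratic field with index \<open>k\<close> in the basis is
  \<open>- x\<^sup>k E\<close>, whence the sign.\<close>

definition quad_coeff :: "'m::finite \<Rightarrow> 'm vector_field \<Rightarrow> real"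
  where "quad_coeff k X = - partial k (divg X) 0 / (real CARD('m) + 1)"

definition pull_form :: "((real^'m^'m) list \<Rightarrow> real) \<Rightarrow> 'm::finite vector_field list \<Rightarrow> 'm scalar_field"
  where "pull_form \<phi> xs = (if set xs \<subseteq> sl_carrier then (\<lambda>x. \<phi> (map linear_part xs)) else 0)"

definition quad_wedge :: "'m::finite \<Rightarrow> ('m vector_field list \<Rightarrow> 'm scalar_field) \<Rightarrow> 'm vector_field list \<Rightarrow> 'm scalar_field"
  where "quad_wedge k = wedge sl_carrier (\<lambda>X f. quad_coeff k X *\<^sub>R f)"

lemma linear_part_comb:
  "smooth_vf X \<Longrightarrow> smooth_vf Y \<Longrightarrow> linear_part (r *\<^sub>R X + s *\<^sub>R Y) = r *\<^sub>R linear_part X + s *\<^sub>R linear_part Y"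
  by (simp add: linear_part_def vec_eq_iff partial_add partial_cmult smooth_cmult smooth_vf_comp)

lemma quad_coeff_comb:
  assumes "smooth_vf X" "smooth_vf Y"
  shows "quad_coeff k (r *\<^sub>R X + s *\<^sub>R Y) = r * quad_coeff k X + s * quad_coeff k Y"
proof -
  have "divg (r *\<^sub>R X + s *\<^sub>R Y) = (\<lambda>x. r * divg X x + s * divg Y x)"
    by (rule ext) (rule divg_comb[OF assms])
  then show ?thesis
    using assms by (simp add: quad_coeff_def partial_add partial_cmult smooth_cmult smooth_divg add_divide_distrib diff_divide_distrib)
qed

lemma linear_part_lin: "linear_part (lin_vf A) = A"
  by (simp add: linear_part_def vec_eq_iff partial_lin_vf)

lemma linear_part_proj:
  assumes "weight p \<noteq> 0"
  shows "linear_part (proj p) = 0"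
proof -
  have e: "(\<lambda>y. proj p y $ j) = (\<lambda>y. hcoord (fst p) y * (\<delta> (snd p) (Some j) - \<delta> (snd p) None * y $ j))" for j
    by (simp add: proj_vf_def hvec_comp)
  have "partial i (\<lambda>y. proj p y $ j) 0 = 0" for i j
  proof (cases "snd p")
    case None
    then obtain k where k: "fst p = Some k" using assms by (cases "fst p") (auto simp: weight_def)
    have "(\<lambda>y. proj p y $ j) = (\<lambda>y. - (y $ k * y $ j))" unfolding e using None k by simp
    then show ?thesis
      by (simp add: partial_minus partial_mult smooth_mult smooth_coord)
  next
    case (Some q)
    then have "fst p = None" using assms by (cases "fst p") (auto simp: weight_def)
    then have "(\<lambda>y. proj p y $ j) = (\<lambda>y. \<delta> q j)" unfolding e using Some by simp
    then show ?thesis by simp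
  qed
  then show ?thesis by (simp add: linear_part_def vec_eq_iff)
qed

lemma quad_coeff_proj:
  fixes p :: "'m::finite option \<times> 'm option"
  shows "quad_coeff k (proj p) = (if p = (Some k, None) then 1 else 0)"
proof -
  obtain a b where p: "p = (a, b)" by (cases p)
  have dv: "divg (proj p) = (\<lambda>x. \<delta> a b - (real CARD('m) + 1) * \<delta> b None * hcoord a x)"
    by (rule ext) (simp add: p divg_proj)
  have "partial k (divg (proj p)) 0 = - ((real CARD('m) + 1) * \<delta> b None * partial k (hcoord a) 0)"
    unfolding dv partial_diff[OF smooth_const smooth_cmult[OF smooth_hcoord]] partial_cmult[OF smooth_hcoord] by simp
  moreover have "partial k (hcoord a) 0 = \<delta> a (Some k)"
    by (cases a) (simp_all add: hcoord_def[abs_def] partial_coord eq_commute)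
  ultimately show ?thesis by (simp add: quad_coeff_def p)
qed

lemma quad_coeff_lin: "quad_coeff k (lin_vf A) = 0"
proof -
  have "divg (lin_vf A) = (\<lambda>x. \<Sum>i\<in>UNIV. A $ i $ i)" by (rule ext) (rule divg_lin_vf)
  then show ?thesis by (simp add: quad_coeff_def)
qed

lemma pull_form_alt:
  assumes \<phi>: "\<phi> \<in> gl.Alt b"
  shows "pull_form \<phi> \<in> F.Alt b"
  unfolding alt_forms_def mem_Collect_eq
proof (intro conjI allI impI ballI)
  fix xs :: "'a vector_field list"
  assume "length xs = b \<and> set xs \<subseteq> sl_carrier"
  then show "pull_form \<phi> xs \<in> F.V" by (simp add: pull_form_def smooth_const)
next
  fix xs :: "'a vector_field list"
  assume "\<not> (length xs = b \<and> set xs \<subseteq> sl_carrier)"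
  then show "pull_form \<phi> xs = 0"
    by (auto simp: pull_form_def fun_eq_iff intro!: alt_forms_out[OF \<phi>])
next
  fix xs :: "'a vector_field list" and i x y r s
  assume a: "length xs = b \<and> set xs \<subseteq> sl_carrier" "i < b" "x \<in> (sl_carrier :: 'a vector_field set)" "y \<in> (sl_carrier :: 'a vector_field set)"
  have in_sl: "set (xs[i := w]) \<subseteq> sl_carrier" if "w \<in> sl_carrier" for w
    using a that set_update_subset_insert[of xs i w] by auto
  have "pull_form \<phi> (xs[i := w]) = (\<lambda>t. \<phi> ((map linear_part xs)[i := linear_part w]))" if "w \<in> sl_carrier" for w
    using in_sl[OF that] by (simp add: pull_form_def map_update)
  then show "pull_form \<phi> (xs[i := r *\<^sub>R x + s *\<^sub>R y]) = r *\<^sub>R pull_form \<phi> (xs[i := x]) + s *\<^sub>R pull_form \<phi> (xs[i := y])"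
    using a alt_forms_slot[OF \<phi>, of "map linear_part xs" i "linear_part x" "linear_part y" r s]
    by (simp add: subspace_comb[OF sub_sl] linear_part_comb sl_smooth fun_eq_iff)
next
  fix xs :: "'a vector_field list" and i j
  assume "length xs = b \<and> set xs \<subseteq> sl_carrier" "i < j \<and> j < b \<and> xs ! i = xs ! j"
  then have "\<phi> (map linear_part xs) = 0" by (intro alt_forms_repeat[OF \<phi>, of i j]) auto
  then show "pull_form \<phi> xs = 0" by (simp add: pull_form_def fun_eq_iff)
qed

lemma quad_wedge_alt:
  assumes c: "c \<in> F.Alt u"
  shows "quad_wedge k c \<in> F.Alt (Suc u)"
  unfolding quad_wedge_def
proof (rule wedge_alt[OF sub_sl F.sub_mod F.sub_mod _ _ c])
  fix X Y :: "'a vector_field" and r s :: real and v :: "'a scalar_field"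
  assume X: "X \<in> sl_carrier"
  show "lin_on F.V F.V ((*\<^sub>R) (quad_coeff k X))"
    by (rule lin_onI) (auto simp: subspace_scale[OF subspace_smooth, simplified] algebra_simps)
  assume Y: "Y \<in> sl_carrier"
  show "quad_coeff k (r *\<^sub>R X + s *\<^sub>R Y) *\<^sub>R v = r *\<^sub>R quad_coeff k X *\<^sub>R v + s *\<^sub>R quad_coeff k Y *\<^sub>R v"
    by (simp add: quad_coeff_comb sl_smooth X Y scaleR_add_left)
qed

lemma foldr_quad_wedge_alt: "c \<in> F.Alt u \<Longrightarrow> foldr quad_wedge ks c \<in> F.Alt (u + length ks)"
  by (induction ks) (auto intro: quad_wedge_alt simp del: dens_carrier)

lemma contract_quad_wedge:
  assumes "X \<in> sl_carrier" "c \<in> F.Alt u"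
  shows "contract X (quad_wedge k c) = quad_coeff k X *\<^sub>R c - quad_wedge k (contract X c)"
  unfolding quad_wedge_def using contract_wedge[OF assms, of "\<lambda>X f. quad_coeff k X *\<^sub>R f"]
  by (simp add: fun_eq_iff)

lemma quad_wedge_scale: "quad_wedge k (r *\<^sub>R c) = r *\<^sub>R quad_wedge k c"
  by (auto simp: quad_wedge_def wedge_def fun_eq_iff sum_distrib_left mult_ac intro!: sum.cong)

lemma quad_wedge_zero: "quad_wedge k 0 = 0"
  using quad_wedge_scale[of k 0 0] by simp

lemma pull_form_lin:
  "contract (lin_vf A) (pull_form \<phi>) = pull_form (contract A \<phi>)"
  by (auto simp: pull_form_def fun_eq_iff lin_vf_in linear_part_lin)

lemma foldr_quad_lin:
  assumes "c \<in> F.Alt (Suc u)"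
  shows "contract (lin_vf A) (foldr quad_wedge ks c) = (-1) ^ length ks *\<^sub>R foldr quad_wedge ks (contract (lin_vf A) c)"
proof (induction ks)
  case (Cons k ks)
  have "contract (lin_vf A) (quad_wedge k (foldr quad_wedge ks c)) =
      - quad_wedge k ((-1) ^ length ks *\<^sub>R foldr quad_wedge ks (contract (lin_vf A) c))"
    using contract_quad_wedge[OF lin_vf_in foldr_quad_wedge_alt[OF assms, of ks], of A k]
    unfolding quad_coeff_lin Cons.IH by (simp del: contract_apply)
  then show ?case unfolding quad_wedge_scale by (simp del: contract_apply)
qed simp

text \<open>The one-forms of \<open>quad_wedge\<close> vanish on linear fields; each linear argument passes each of them with
  a change of sign until it reaches \<open>\<phi>\<close>.\<close>

lemma foldr_quad_args:
  fixes \<phi> :: "(real^'m::finite^'m) list \<Rightarrow> real"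
  assumes \<phi>: "\<phi> \<in> gl.Alt (length As)"
  shows "foldr quad_wedge ks (pull_form \<phi>) (map lin_vf As @ zs) =
    (-1) ^ (length ks * length As) *\<^sub>R foldr quad_wedge ks (pull_form (\<lambda>l. if l = [] then \<phi> As else 0)) zs"
  using assms
proof (induction As arbitrary: \<phi>)
  case Nil
  then have "\<phi> = (\<lambda>l. if l = [] then \<phi> [] else 0)" by (auto simp: alt_forms_0_iff fun_eq_iff)
  then show ?case by simp
next
  case (Cons A As)
  have c: "contract A \<phi> \<in> gl.Alt (length As)" using Cons.prems by (intro contract_alt) auto
  have "foldr quad_wedge ks (pull_form \<phi>) (map lin_vf (A # As) @ zs) =
      contract (lin_vf A) (foldr quad_wedge ks (pull_form \<phi>)) (map lin_vf As @ zs)" by simp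
  also have "\<dots> = (-1) ^ length ks *\<^sub>R foldr quad_wedge ks (pull_form (contract A \<phi>)) (map lin_vf As @ zs)"
    using pull_form_alt[OF Cons.prems]
    by (subst foldr_quad_lin) (auto simp: pull_form_lin simp del: contract_apply)
  also have "\<dots> = (-1) ^ (length ks * length (A # As)) *\<^sub>R
      foldr quad_wedge ks (pull_form (\<lambda>l. if l = [] then \<phi> (A # As) else 0)) zs"
    unfolding Cons.IH[OF c] contract_apply by (simp add: power_add)
  finally show ?case .
qed

lemma foldr_quad_other:
  fixes \<phi> :: "(real^'m::finite^'m) list \<Rightarrow> real"
  assumes \<phi>: "\<phi> \<in> gl.Alt u" and k: "k \<notin> set ks"
  shows "contract (quad_vf k) (foldr quad_wedge ks (pull_form \<phi>)) = 0"
  using k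
proof (induction ks)
  case Nil
  have lp: "linear_part (quad_vf k) = 0" using linear_part_proj[of "(Some k, None)"] by (simp add: weight_def)
  have "\<phi> (0 # zs) = 0" for zs
  proof (cases u)
    case 0
    then show ?thesis using \<phi> by (simp add: alt_forms_0_iff)
  next
    case (Suc v)
    then show ?thesis using alt_forms_lin_head[of \<phi> UNIV UNIV v 0 0 0 0 zs] \<phi> by simp
  qed
  then show ?case using lp by (simp add: pull_form_def fun_eq_iff)
next
  case (Cons k' ks)
  have "quad_coeff k' (quad_vf k) = 0" using quad_coeff_proj[of k' "(Some k, None)"] Cons.prems by auto
  moreover have "k \<notin> set ks" using Cons.prems by simp
  then have "contract (quad_vf k) (foldr quad_wedge ks (pull_form \<phi>)) = 0" by (rule Cons.IH)
  ultimately have "contract (quad_vf k) (quad_wedge k' (foldr quad_wedge ks (pull_form \<phi>))) = 0 *\<^sub>R foldr quad_wedge ks (pull_form \<phi>) - quad_wedge k' 0"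
    using contract_quad_wedge[OF proj_in foldr_quad_wedge_alt[OF pull_form_alt[OF \<phi>], of ks], of "Some k" None k'] by simp
  then show ?case unfolding quad_wedge_zero by (simp del: contract_apply)
qed

lemma foldr_quad_all:
  fixes \<phi> :: "(real^'m::finite^'m) list \<Rightarrow> real"
  assumes \<phi>: "\<phi> \<in> gl.Alt u" and "distinct ks"
  shows "foldr quad_wedge ks (pull_form \<phi>) (map quad_vf ks @ zs) = pull_form \<phi> zs"
  using assms(2)
proof (induction ks)
  case (Cons k ks)
  have "contract (quad_vf k) (foldr quad_wedge (k # ks) (pull_form \<phi>)) = foldr quad_wedge ks (pull_form \<phi>)"
    using contract_quad_wedge[OF proj_in foldr_quad_wedge_alt[OF pull_form_alt[OF \<phi>], of ks], of "Some k" None k]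
      foldr_quad_other[OF \<phi>, of k ks] Cons.prems quad_coeff_proj[of k "(Some k, None)"]
    by (simp add: quad_wedge_zero del: contract_apply)
  from fun_cong[OF this, of "map quad_vf ks @ zs"] show ?case using Cons by simp
qed simp

text \<open>The one-forms and \<open>\<phi>\<close> have constant coefficients and vanish on homogeneous fields unless these have
  weight one and zero respectively.\<close>

lemma foldr_quad_weight:
  fixes \<phi> :: "(real^'m::finite^'m) list \<Rightarrow> real"
  assumes \<phi>: "\<phi> \<in> gl.Alt u"
  shows "(\<exists>r. foldr quad_wedge ks (pull_form \<phi>) (map proj l) = (\<lambda>x. r)) \<and>
    (weights l \<noteq> int (length ks) \<longrightarrow> foldr quad_wedge ks (pull_form \<phi>) (map proj l) = 0)"
proof (induction ks arbitrary: l)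
  case Nil
  have "\<phi> (map linear_part (map proj l)) = 0" if "weights l \<noteq> 0"
  proof -
    have "\<exists>p\<in>set l. weight p \<noteq> 0" using that by (induction l) auto
    then obtain p where "p \<in> set l" "linear_part (proj p) = 0" using linear_part_proj by blast
    then have mem: "0 \<in> set (map linear_part (map proj l))" by force
    have \<phi>0: "\<phi> (0 # zs) = 0" for zs
    proof (cases u)
      case 0
      then show ?thesis using \<phi> by (simp add: alt_forms_0_iff)
    next
      case (Suc v)
      then show ?thesis using alt_forms_lin_head[of \<phi> UNIV UNIV v 0 0 0 0 zs] \<phi> by simp
    qed
    show ?thesis by (rule alt_vanish_member[OF \<phi> _ _ \<phi>0 mem]) simp_all
  qed
  then show ?case using proj_list_in[of l] by (auto simp: pull_form_def fun_eq_iff)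
next
  case (Cons k ks)
  let ?c = "foldr quad_wedge ks (pull_form \<phi>)"
  have e: "foldr quad_wedge (k # ks) (pull_form \<phi>) (map proj l) =
      (\<Sum>i<length l. ((-1) ^ i * (if l ! i = (Some k, None) then 1 else 0)) *\<^sub>R ?c (map proj (nths l (- {i}))))"
    using proj_list_in[of l] by (simp add: quad_wedge_def wedge_def quad_coeff_proj nths_map)
  obtain r where r: "\<And>l. ?c (map proj l) = (\<lambda>x. r l)" using Cons.IH by metis
  have "foldr quad_wedge (k # ks) (pull_form \<phi>) (map proj l) = (\<lambda>x. \<Sum>i<length l. ((-1) ^ i * (if l ! i = (Some k, None) then 1 else 0)) * r (nths l (- {i})))"
    unfolding e r by (simp add: fun_eq_iff)
  moreover have "foldr quad_wedge (k # ks) (pull_form \<phi>) (map proj l) = 0" if w: "weights l \<noteq> int (length (k # ks))"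
    unfolding e
  proof (rule sum.neutral, rule ballI)
    fix i assume i: "i \<in> {..<length l}"
    show "((-1) ^ i * (if l ! i = (Some k, None) then 1 else 0)) *\<^sub>R ?c (map proj (nths l (- {i}))) = 0"
    proof (cases "l ! i = (Some k, None)")
      case True
      have "l = take i l @ l ! i # drop (Suc i) l" using i by (simp add: id_take_nth_drop)
      then have "weights l = weights (take i l @ l ! i # drop (Suc i) l)" by simp
      then have "weights l = weights (nths l (- {i})) + weight (l ! i)"
        using i by (simp add: nths_delete)
      then have "weights (nths l (- {i})) \<noteq> int (length ks)" using w True by (simp add: weight_def)
      then have "?c (map proj (nths l (- {i}))) = 0" using Cons.IH by blast
      then show ?thesis by simp
    qed simp
  qed
  ultimately show ?case by blast
qed

lemma restrict_surjective:
  fixes \<phi> :: "(real^'m::finite^'m) list \<Rightarrow> real"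
  assumes \<phi>: "\<phi> \<in> gl.Alt b"
  shows "\<exists>z\<in>F.Alt (b + CARD('m)). lie_euler z = 0 \<and> restrict_form b z = \<phi>"
proof -
  let ?w = "foldr quad_wedge coords (pull_form \<phi>)" and ?s = "(-1 :: real) ^ (CARD('m) * b)"
  have w: "?w \<in> F.Alt (b + CARD('m))"
    using foldr_quad_wedge_alt[OF pull_form_alt[OF \<phi>], of coords] by (simp add: coords)
  have "lie_euler ?w = 0"
  proof (rule alt_forms_zero_proj[OF F.lied_alt[OF euler_in w]])
    fix l :: "('m option \<times> 'm option) list" assume "length l = b + CARD('m)"
    obtain r where r: "?w (map proj l) = (\<lambda>x. r)" using foldr_quad_weight[OF \<phi>, of coords l] by blast
    have "real_of_int (int CARD('m) - weights l) * r = 0"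
      using foldr_quad_weight[OF \<phi>, of coords l] r by (cases "weights l = int CARD('m)") (auto simp: coords fun_eq_iff)
    then show "lie_euler ?w (map proj l) = 0"
      using lie_euler_proj[OF w, of l] by (simp add: fun_eq_iff r euler_const del: of_int_diff)
  qed
  moreover have "restrict_form b ?w = ?s *\<^sub>R \<phi>"
  proof
    fix As :: "(real^'m^'m) list"
    show "restrict_form b ?w As = (?s *\<^sub>R \<phi>) As"
    proof (cases "length As = b")
      case False
      then show ?thesis using alt_forms_out[OF \<phi>] by (simp add: restrict_form_def)
    next
      case True
      have "(\<lambda>l. if l = [] then \<phi> As else 0) \<in> gl.Alt 0" by (simp add: alt_forms_0_iff)
      note q = foldr_quad_all[OF this coords(2), of "[]"]
      have "?w (map lin_vf As @ map quad_vf coords) = ?s *\<^sub>R pull_form (\<lambda>l. if l = [] then \<phi> As else 0) []"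
        using foldr_quad_args[of \<phi> As coords "map quad_vf coords"] \<phi> True q by (simp add: coords)
      then show ?thesis using True by (simp add: restrict_form_def pull_form_def)
    qed
  qed
  then have "restrict_form b (?s *\<^sub>R ?w) = \<phi>"
    using restrict_form_comb[of b ?s ?w 0 0] by (simp add: power_mult_distrib[symmetric])
  moreover have "?s *\<^sub>R ?w \<in> F.Alt (b + CARD('m))" by (rule subspace_scale[OF F.sub_Alt w])
  ultimately show ?thesis using lin_on_scale[OF lie_euler_lin w, of ?s] by auto
qed

section \<open>The cohomology of densities\<close>

definition inv_part :: "nat \<Rightarrow> ((real^'m::finite^'m) list \<Rightarrow> real) \<Rightarrow> (real^'m^'m) list \<Rightarrow> real"
  where "inv_part b \<phi> = (THE z. z \<in> gl_inv_forms_deg b \<and> \<phi> - z \<in> coboundaries gl_alg triv_module b)"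

lemma subspace_gl_inv: "subspace (gl_inv_forms_deg b :: ((real^'m::finite^'m) list \<Rightarrow> real) set)"
proof -
  have "gl_inv_forms_deg b = (\<Inter>A. {c \<in> gl.Alt b. gl.lied A c = 0} :: ((real^'m^'m) list \<Rightarrow> real) set)"
    by (auto simp: gl_inv_iff)
  moreover have "subspace {c \<in> gl.Alt b. gl.lied A c = 0}" for A :: "real^'m^'m"
    by (rule subspace_lin_kernel[OF gl_lied_lin_on gl.sub_Alt])
  ultimately show ?thesis by (auto intro!: subspace_Inter)
qed

lemma inv_partI:
  assumes "z \<in> gl_inv_forms_deg b" "\<phi> - z \<in> coboundaries gl_alg triv_module b"
  shows "inv_part b \<phi> = z"
  unfolding inv_part_def
proof (rule the_equality)
  fix y assume y: "y \<in> gl_inv_forms_deg b \<and> \<phi> - y \<in> coboundaries gl_alg triv_module b"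
  have "y - z \<in> gl_inv_forms_deg b" using y assms subspace_diff[OF subspace_gl_inv] by blast
  moreover have "(\<phi> - z) - (\<phi> - y) \<in> coboundaries gl_alg triv_module b"
    using y assms subspace_diff[OF gl.subspace_coboundaries] by blast
  ultimately have "y - z = 0" by (intro gl_inv_exact) auto
  then show "y = z" by simp
qed (use assms in blast)

lemma inv_part:
  assumes "\<phi> \<in> gl.Alt b" "gl.d \<phi> = 0"
  shows "inv_part b \<phi> \<in> gl_inv_forms_deg b" "\<phi> - inv_part b \<phi> \<in> coboundaries gl_alg triv_module b"
proof -
  obtain z w where "z \<in> gl_inv_forms_deg b" "w \<in> coboundaries gl_alg triv_module b" "\<phi> = z + w"
    using gl_cocycle_inv[OF assms] by blast
  then have z: "z \<in> gl_inv_forms_deg b" "\<phi> - z \<in> coboundaries gl_alg triv_module b" by auto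
  then show "inv_part b \<phi> \<in> gl_inv_forms_deg b" "\<phi> - inv_part b \<phi> \<in> coboundaries gl_alg triv_module b"
    using inv_partI[OF z] by auto
qed

lemma inv_part_comb:
  assumes "\<phi> \<in> gl.Alt b" "gl.d \<phi> = 0" "\<psi> \<in> gl.Alt b" "gl.d \<psi> = 0"
  shows "inv_part b (r *\<^sub>R \<phi> + s *\<^sub>R \<psi>) = r *\<^sub>R inv_part b \<phi> + s *\<^sub>R inv_part b \<psi>"
proof (rule inv_partI)
  note p = inv_part[OF assms(1,2)] and q = inv_part[OF assms(3,4)]
  show "r *\<^sub>R inv_part b \<phi> + s *\<^sub>R inv_part b \<psi> \<in> gl_inv_forms_deg b"
    by (rule subspace_comb[OF subspace_gl_inv p(1) q(1)])
  have "r *\<^sub>R \<phi> + s *\<^sub>R \<psi> - (r *\<^sub>R inv_part b \<phi> + s *\<^sub>R inv_part b \<psi>) =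
      r *\<^sub>R (\<phi> - inv_part b \<phi>) + s *\<^sub>R (\<psi> - inv_part b \<psi>)" by (simp add: algebra_simps)
  then show "r *\<^sub>R \<phi> + s *\<^sub>R \<psi> - (r *\<^sub>R inv_part b \<phi> + s *\<^sub>R inv_part b \<psi>) \<in> coboundaries gl_alg triv_module b"
    using subspace_comb[OF gl.subspace_coboundaries p(2) q(2)] by simp
qed

lemma inv_part_zero_iff:
  assumes "\<phi> \<in> gl.Alt b" "gl.d \<phi> = 0"
  shows "inv_part b \<phi> = 0 \<longleftrightarrow> \<phi> \<in> coboundaries gl_alg triv_module b"
  using inv_part(2)[OF assms] inv_partI[of 0 b \<phi>] subspace_0[OF subspace_gl_inv] by auto

text \<open>The invariant form that represents the class of the restriction.\<close>

definition dens_class :: "nat \<Rightarrow> ('m::finite vector_field list \<Rightarrow> 'm scalar_field) \<Rightarrow> (real^'m^'m) list \<Rightarrow> real"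
  where "dens_class b c = inv_part b (restrict_form b c)"

abbreviation dens_cocycles :: "nat \<Rightarrow> ('m::finite vector_field list \<Rightarrow> 'm scalar_field) set"
  where "dens_cocycles \<equiv> cocycles sl_proj (dens_module 1)"

lemma restrict_cocycle:
  fixes c :: "'m::finite vector_field list \<Rightarrow> 'm scalar_field"
  assumes "c \<in> dens_cocycles (b + CARD('m))"
  shows "restrict_form b c \<in> gl.Alt b" "gl.d (restrict_form b c) = 0"
proof -
  have c: "c \<in> F.Alt (b + CARD('m))" "F.d c = 0" using assms by (auto simp: cocycles_def cochains_def)
  show "restrict_form b c \<in> gl.Alt b" by (rule restrict_form_alt[OF c(1)])
  show "gl.d (restrict_form b c) = 0"
    unfolding restrict_diff[OF c(1)] c(2) by (simp add: restrict_form_def fun_eq_iff)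
qed

lemma dens_class_lin:
  "lin_on (dens_cocycles (b + CARD('m::finite)) :: ('m vector_field list \<Rightarrow> 'm scalar_field) set) (gl_inv_forms_deg b) (dens_class b)"
  by (rule lin_onI)
    (simp_all add: dens_class_def inv_part(1)[OF restrict_cocycle] restrict_form_comb
      inv_part_comb[OF restrict_cocycle restrict_cocycle])

lemma dens_class_surj:
  fixes \<phi> :: "(real^'m::finite^'m) list \<Rightarrow> real"
  assumes \<phi>: "\<phi> \<in> gl_inv_forms_deg b"
  shows "\<exists>c\<in>dens_cocycles (b + CARD('m)). dens_class b c = \<phi>"
proof -
  have a: "\<phi> \<in> gl.Alt b" using \<phi> by (simp add: gl_inv_iff)
  obtain z where z: "z \<in> F.Alt (b + CARD('m))" "lie_euler z = 0" "restrict_form b z = \<phi>"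
    using restrict_surjective[OF a] by blast
  have "F.d z = 0"
  proof (rule restrict_injective[OF F.ce_diff_alt[OF z(1)]])
    show "lie_euler (F.d z) = 0"
      unfolding F.ce_diff_lied[OF euler_in z(1), symmetric] z(2) by (rule F.ce_diff_0)
    fix b' assume "Suc (b + CARD('m)) = b' + CARD('m)"
    then have "b' = Suc b" by simp
    then show "restrict_form b' (F.d z) = 0"
      using restrict_diff[OF z(1)] z(3) gl_inv_closed[OF \<phi>] by simp
  qed
  then have "z \<in> dens_cocycles (b + CARD('m))" using z(1) by (simp add: cocycles_def cochains_def)
  moreover have "dens_class b z = \<phi>"
    unfolding dens_class_def z(3) using subspace_0[OF gl.subspace_coboundaries] by (intro inv_partI \<phi>) simp
  ultimately show ?thesis by blast
qed

text \<open>A primitive of the restriction extends to a cochain in the kernel of the Lie derivative along \<open>E\<close>, where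
  restriction is injective.\<close>

lemma dens_class_zero_iff:
  fixes c :: "'m::finite vector_field list \<Rightarrow> 'm scalar_field"
  assumes c: "c \<in> dens_cocycles (b + CARD('m))"
  shows "dens_class b c = 0 \<longleftrightarrow> c \<in> coboundaries sl_proj (dens_module 1) (b + CARD('m))"
proof
  assume "c \<in> coboundaries sl_proj (dens_module 1) (b + CARD('m))"
  then show "dens_class b c = 0"
    using inv_part_zero_iff[OF restrict_cocycle[OF c]] restrict_coboundary by (simp add: dens_class_def)
next
  let ?B = "coboundaries sl_proj (dens_module 1) (b + CARD('m)) :: ('m vector_field list \<Rightarrow> 'm scalar_field) set"
  assume "dens_class b c = 0"
  then have rc: "restrict_form b c \<in> coboundaries gl_alg triv_module b"
    using inv_part_zero_iff[OF restrict_cocycle[OF c]] by (simp add: dens_class_def)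
  obtain z w where z: "z \<in> F.Alt (b + CARD('m))" "lie_euler z = 0" and w: "w \<in> ?B" and cw: "c = z + w"
    using euler_cocycle[of c "b + CARD('m)"] c by (auto simp: cocycles_def cochains_def)
  have "restrict_form b z = restrict_form b c - restrict_form b w"
    using restrict_form_comb[of b 1 c "-1" w] cw by simp
  then have rz: "restrict_form b z \<in> coboundaries gl_alg triv_module b"
    using subspace_diff[OF gl.subspace_coboundaries rc restrict_coboundary[OF w]] by simp
  have "z \<in> ?B"
  proof (cases b)
    case 0
    have "z = 0"
      by (rule restrict_injective[OF z]) (use rz 0 in \<open>auto simp: coboundaries_def\<close>)
    then show ?thesis using subspace_0[OF F.subspace_coboundaries] by simp
  next
    case (Suc b')
    then obtain \<psi> where \<psi>: "\<psi> \<in> gl.Alt b'" "restrict_form b z = gl.d \<psi>"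
      using rz by (auto simp: coboundaries_def cochains_def)
    obtain y where y: "y \<in> F.Alt (b' + CARD('m))" "lie_euler y = 0" "restrict_form b' y = \<psi>"
      using restrict_surjective[OF \<psi>(1)] by blast
    have dy: "F.d y \<in> F.Alt (b + CARD('m))" using F.ce_diff_alt[OF y(1)] Suc by simp
    have "z - F.d y = 0"
    proof (rule restrict_injective[OF subspace_diff[OF F.sub_Alt z(1) dy]])
      have "lie_euler (F.d y) = 0"
        unfolding F.ce_diff_lied[OF euler_in y(1), symmetric] y(2) by (rule F.ce_diff_0)
      then show "lie_euler (z - F.d y) = 0" using lin_on_diff[OF lie_euler_lin z(1) dy] z(2) by simp
      fix b'' assume "b + CARD('m) = b'' + CARD('m)"
      then have "b'' = b" by simp
      then show "restrict_form b'' (z - F.d y) = 0"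
        using restrict_form_comb[of b 1 z "-1" "F.d y"] \<psi>(2) restrict_diff[OF y(1)] y(3) Suc by simp
    qed
    then have "z = F.d y" by simp
    then show ?thesis using y(1) Suc by (auto simp: coboundaries_def cochains_def)
  qed
  then show "c \<in> ?B" unfolding cw using w by (rule subspace_add[OF F.subspace_coboundaries])
qed

text \<open>Fewer than \<open>m\<close> arguments cannot have total weight \<open>m\<close>.\<close>

lemma dens_low_degree:
  fixes c :: "'m::finite vector_field list \<Rightarrow> 'm scalar_field"
  assumes c: "c \<in> dens_cocycles u" and u: "u < CARD('m)"
  shows "c \<in> coboundaries sl_proj (dens_module 1) u"
proof -
  obtain z w where z: "z \<in> F.Alt u" "lie_euler z = 0" and w: "w \<in> coboundaries sl_proj (dens_module 1) u" and cw: "c = z + w"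
    using euler_cocycle[of c u] c by (auto simp: cocycles_def cochains_def)
  have "z = 0" by (rule restrict_injective[OF z]) (use u in auto)
  then show ?thesis using cw w by simp
qed

section \<open>Differential operators\<close>

definition term_op :: "'m::finite scalar_field \<Rightarrow> 'm list \<Rightarrow> 'm operator"
  where "term_op a js = on_smooth (\<lambda>f x. a x * iter_partial js f x)"

definition mult_op :: "'m::finite scalar_field \<Rightarrow> 'm operator \<Rightarrow> 'm operator"
  where "mult_op a A = (\<lambda>f x. a x * A f x)"

definition post_partial :: "'m::finite \<Rightarrow> 'm operator \<Rightarrow> 'm operator"
  where "post_partial i A = (\<lambda>f. partial i (A f))"

definition pre_partial :: "'m::finite \<Rightarrow> 'm operator \<Rightarrow> 'm operator"
  where "pre_partial i A = on_smooth (\<lambda>f. A (partial i f))"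

text \<open>The commutator with a multiplication operator lowers the order by one; the commutator with a
  coordinate is the derivative of the symbol with respect to the dual variable.\<close>

definition ad_op :: "'m::finite scalar_field \<Rightarrow> 'm operator \<Rightarrow> 'm operator"
  where "ad_op a A = on_smooth (\<lambda>f. A (\<lambda>x. a x * f x) - (\<lambda>x. a x * A f x))"

lemma smooth_iter_partial: "smooth f \<Longrightarrow> smooth (iter_partial js f)"
  by (induction js) (auto simp: iter_partial_Cons smooth_partial)

lemma iter_partial_commute: "smooth f \<Longrightarrow> partial i (iter_partial js f) = iter_partial js (partial i f)"
  by (induction js) (auto simp: iter_partial_Cons partial_commute[of _ i] smooth_iter_partial)

lemma iter_partial_comb:
  "smooth f \<Longrightarrow> smooth h \<Longrightarrow>
    iter_partial js (\<lambda>x. r * f x + s * h x) = (\<lambda>x. r * iter_partial js f x + s * iter_partial js h x)"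
  by (induction js) (simp_all add: iter_partial_Cons partial_add partial_cmult smooth_cmult smooth_iter_partial)

lemma finite_multi_indices: "finite {js :: 'm::finite list. length js \<le> k}"
  using finite_lists_length_le[of "UNIV :: 'm set" k] by simp

lemma term_op_apply: "term_op a js f = (if smooth f then (\<lambda>x. a x * iter_partial js f x) else 0)"
  by (simp add: term_op_def on_smooth_def)

text \<open>As the indices range over lists, the coefficients are not determined by the operator. Statements
  about operators are therefore proved for a single term and extended by additivity
  (\<open>diff_ops_lift\<close>).\<close>

lemma diff_ops_iff:
  fixes A :: "'m::finite operator"
  shows "A \<in> diff_ops k \<longleftrightarrow> (\<exists>a. (\<forall>js. smooth (a js)) \<and> A = (\<Sum>js | length js \<le> k. term_op (a js) js))"
proof -
  have "on_smooth (\<lambda>f x. \<Sum>js\<in>{js. length js \<le> k}. a js x * iter_partial js f x) = (\<Sum>js | length js \<le> k. term_op (a js) js)" for a :: "'m list \<Rightarrow> 'm scalar_field"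
    by (rule ext) (simp add: on_smooth_def term_op_apply fun_eq_iff)
  then show ?thesis by (simp add: diff_ops_def)
qed

lemma term_op_comb: "term_op (\<lambda>x. r * a x + s * b x) js = r *\<^sub>R term_op a js + s *\<^sub>R term_op b js"
  by (rule ext) (simp add: term_op_apply fun_eq_iff algebra_simps)

lemma term_op_zero: "term_op (\<lambda>x. 0) js = 0"
  by (rule ext) (simp add: term_op_apply fun_eq_iff)

lemma subspace_diff_ops: "subspace (diff_ops k)"
proof -
  have comb: "r *\<^sub>R A + s *\<^sub>R B \<in> diff_ops k" if "A \<in> diff_ops k" "B \<in> diff_ops k" for r s and A B :: "'a operator"
  proof -
    obtain a b where a: "\<forall>js. smooth (a js)" "A = (\<Sum>js | length js \<le> k. term_op (a js) js)"
      and b: "\<forall>js. smooth (b js)" "B = (\<Sum>js | length js \<le> k. term_op (b js) js)"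
      using \<open>A \<in> diff_ops k\<close> \<open>B \<in> diff_ops k\<close> unfolding diff_ops_iff by blast
    have "r *\<^sub>R A + s *\<^sub>R B = (\<Sum>js | length js \<le> k. term_op (\<lambda>x. r * a js x + s * b js x) js)"
      unfolding a(2) b(2) term_op_comb by (simp only: sum.distrib scaleR_sum_right)
    moreover have "\<forall>js. smooth (\<lambda>x. r * a js x + s * b js x)" using a(1) b(1) by (simp add: smooth_add smooth_cmult)
    ultimately show ?thesis
      unfolding diff_ops_iff by (intro exI[of _ "\<lambda>js x. r * a js x + s * b js x"] conjI)
  qed
  have "0 = (\<Sum>js | length js \<le> k. term_op (\<lambda>x. 0) js)" unfolding term_op_zero by simp
  then have "0 \<in> diff_ops k"
    unfolding diff_ops_iff using smooth_const by (intro exI[of _ "\<lambda>js x. 0"]) auto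
  then show ?thesis using comb[of _ _ 1 1] comb[of _ 0 _ 0] by (auto simp: subspace_def)
qed

lemma term_op_in:
  assumes "smooth a" "length js \<le> k"
  shows "term_op a js \<in> diff_ops k"
proof -
  let ?a = "\<lambda>ls. if ls = js then a else (\<lambda>x. 0)"
  have "(\<Sum>ls | length ls \<le> k. term_op (?a ls) ls) = (\<Sum>ls | length ls \<le> k. if ls = js then term_op a js else 0)"
    by (intro sum.cong) (auto simp: term_op_zero)
  also have "\<dots> = term_op a js" using assms(2) by (simp add: finite_multi_indices)
  finally show ?thesis
    unfolding diff_ops_iff using assms(1) smooth_const by (intro exI[of _ ?a]) auto
qed

lemma diff_ops_lift:
  assumes A: "A \<in> diff_ops k" and \<Phi>: "\<And>A B. \<Phi> (A + B) = \<Phi> A + \<Phi> B" and U: "subspace U"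
    and trm: "\<And>a js. smooth a \<Longrightarrow> length js \<le> k \<Longrightarrow> \<Phi> (term_op a js) \<in> U"
  shows "\<Phi> A \<in> U"
proof -
  obtain a where a: "\<forall>js. smooth (a js)" "A = (\<Sum>js | length js \<le> k. term_op (a js) js)"
    using A unfolding diff_ops_iff by blast
  have "Modules.additive \<Phi>" unfolding Modules.additive_def using \<Phi> by blast
  then have "\<Phi> A = (\<Sum>js | length js \<le> k. \<Phi> (term_op (a js) js))"
    unfolding a(2) by (rule additive.sum[where f = \<Phi>])
  then show ?thesis using a(1) trm by (auto intro!: subspace_sum[OF U])
qed

lemma diff_ops_mono: "j \<le> k \<Longrightarrow> diff_ops j \<subseteq> diff_ops k"
proof
  fix A :: "'a operator" assume "j \<le> k" and A: "A \<in> diff_ops j"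
  then show "A \<in> diff_ops k"
    unfolding diff_ops_iff[of A j] by (auto intro!: subspace_sum[OF subspace_diff_ops] term_op_in)
qed

lemma diff_ops_lin:
  assumes A: "A \<in> diff_ops k"
  shows "lin_on {f. smooth f} {f. smooth f} A" and "\<not> smooth f \<Longrightarrow> A f = 0"
proof -
  obtain a where a: "\<forall>js. smooth (a js)" "A = (\<Sum>js | length js \<le> k. term_op (a js) js)"
    using A unfolding diff_ops_iff by blast
  show "lin_on {f. smooth f} {f. smooth f} A"
  proof (rule lin_onI)
    fix f h r s assume f: "f \<in> {f :: 'a scalar_field. smooth f}" and h: "h \<in> {f :: 'a scalar_field. smooth f}"
    have "A f = (\<lambda>x. \<Sum>js | length js \<le> k. a js x * iter_partial js f x)" if "smooth f" for f
      using that by (simp add: a(2) term_op_apply fun_eq_iff)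
    note e = this
    show "A f \<in> {f. smooth f}" using f a(1) by (simp add: e smooth_sum smooth_mult smooth_iter_partial)
    have fh: "smooth (\<lambda>x. r * f x + s * h x)" using f h by (auto intro: smooth_add smooth_cmult)
    have "A (\<lambda>x. r * f x + s * h x) = (\<lambda>x. r * A f x + s * A h x)"
      using f h by (simp add: e fh iter_partial_comb sum_distrib_left sum.distrib[symmetric] algebra_simps)
    then show "A (r *\<^sub>R f + s *\<^sub>R h) = r *\<^sub>R A f + s *\<^sub>R A h" by (simp add: fun_comb)
  qed
  show "A f = 0" if "\<not> smooth f" using that by (simp add: a(2) term_op_apply fun_eq_iff)
qed

lemma diff_ops_smooth: "A \<in> diff_ops k \<Longrightarrow> smooth f \<Longrightarrow> smooth (A f)"
  using lin_on_in[OF diff_ops_lin(1)] by blast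

lemma diff_ops_add: "A \<in> diff_ops k \<Longrightarrow> smooth f \<Longrightarrow> smooth h \<Longrightarrow> A (\<lambda>x. f x + h x) = (\<lambda>x. A f x + A h x)"
  using lin_on_add[OF diff_ops_lin(1), of A k f h] by (simp add: plus_fun_def)

lemma diff_ops_cmult: "A \<in> diff_ops k \<Longrightarrow> smooth f \<Longrightarrow> A (\<lambda>x. c * f x) = (\<lambda>x. c * A f x)"
  using lin_on_scale[OF diff_ops_lin(1), of A k f c] by (simp add: scaleR_fun_def)

lemma diff_ops_sum_arg:
  assumes A: "A \<in> diff_ops k" and f: "\<And>i. i \<in> I \<Longrightarrow> smooth (f i)"
  shows "A (\<lambda>x. \<Sum>i\<in>I. f i x) = (\<lambda>x. \<Sum>i\<in>I. A (f i) x)"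
proof -
  have e: "(\<lambda>x. \<Sum>i\<in>I. g i x) = (\<Sum>i\<in>I. g i)" for g :: "_ \<Rightarrow> 'a scalar_field" by (rule ext) simp
  show ?thesis
    unfolding e using f by (intro lin_on_sum[OF diff_ops_lin(1)[OF A] subspace_smooth]) auto
qed

lemma mult_op_in:
  fixes A :: "'m::finite operator"
  assumes a: "smooth a" and A: "A \<in> diff_ops k"
  shows "mult_op a A \<in> diff_ops k"
proof (rule diff_ops_lift[OF A _ subspace_diff_ops])
  show "mult_op a (A + B) = mult_op a A + mult_op a B" for A B
    by (simp add: mult_op_def fun_eq_iff algebra_simps)
  fix b :: "'m scalar_field" and js :: "'m list" assume b: "smooth b" "length js \<le> k"
  have "mult_op a (term_op b js) = term_op (\<lambda>x. a x * b x) js"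
    by (simp add: mult_op_def term_op_apply fun_eq_iff mult.assoc)
  then show "mult_op a (term_op b js) \<in> diff_ops k" using a b by (simp add: term_op_in smooth_mult)
qed

lemma pre_partial_term: "pre_partial i (term_op a js) = term_op a (js @ [i])"
  by (rule ext) (simp add: pre_partial_def on_smooth_def term_op_apply smooth_partial iter_partial_snoc)

lemma pre_partial_add: "pre_partial i (A + B) = pre_partial i A + pre_partial i B"
  by (rule ext) (simp add: pre_partial_def on_smooth_def)

lemma pre_partial_zero: "pre_partial i 0 = 0"
  by (rule ext) (simp add: pre_partial_def on_smooth_def)

lemma pre_partial_comb: "pre_partial i (r *\<^sub>R A + s *\<^sub>R B) = r *\<^sub>R pre_partial i A + s *\<^sub>R pre_partial i B"
  by (rule ext) (simp add: pre_partial_def on_smooth_def)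

lemma pre_partial_sum: "pre_partial i (\<Sum>j\<in>I. A j) = (\<Sum>j\<in>I. pre_partial i (A j))"
  by (rule ext) (simp add: pre_partial_def on_smooth_def)

lemma pre_partial_in: "A \<in> diff_ops k \<Longrightarrow> pre_partial i A \<in> diff_ops (Suc k)"
  by (erule diff_ops_lift[OF _ pre_partial_add subspace_diff_ops]) (simp add: pre_partial_term term_op_in)

lemma post_pre_partial:
  assumes A: "A \<in> diff_ops k"
  shows "post_partial i A - pre_partial i A \<in> diff_ops k"
proof -
  obtain a where a: "\<forall>js. smooth (a js)" "A = (\<Sum>js | length js \<le> k. term_op (a js) js)"
    using A unfolding diff_ops_iff by blast
  have "post_partial i A - pre_partial i A = (\<Sum>js | length js \<le> k. term_op (partial i (a js)) js)"
  proof
    fix f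
    show "(post_partial i A - pre_partial i A) f = (\<Sum>js | length js \<le> k. term_op (partial i (a js)) js) f"
    proof (cases "smooth f")
      case True
      have d: "partial i (\<lambda>x. \<Sum>js | length js \<le> k. a js x * iter_partial js f x) =
          (\<lambda>x. \<Sum>js | length js \<le> k. partial i (a js) x * iter_partial js f x + a js x * iter_partial js (partial i f) x)"
        using a(1) True by (simp add: partial_sum smooth_mult smooth_iter_partial partial_mult iter_partial_commute)
      have e: "A f = (\<lambda>x. \<Sum>js | length js \<le> k. a js x * iter_partial js f x)" if "smooth f" for f
        using that by (simp add: a(2) term_op_apply fun_eq_iff)
      show ?thesis
        unfolding post_partial_def pre_partial_def on_smooth_def fun_diff_eq e[OF True] d
        using True by (simp add: e[OF smooth_partial[OF True]] term_op_apply fun_eq_iff sum.distrib)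
    next
      case False
      then show ?thesis
        using diff_ops_lin(2)[OF A False]
        by (simp add: post_partial_def pre_partial_def on_smooth_def term_op_apply zero_fun_def) (simp add: fun_eq_iff)
    qed
  qed
  then show ?thesis using a(1) by (auto intro!: subspace_sum[OF subspace_diff_ops] term_op_in smooth_partial)
qed

lemma ad_op_add: "ad_op a (A + B) = ad_op a A + ad_op a B"
  by (rule ext) (simp add: ad_op_def on_smooth_def fun_eq_iff algebra_simps)

lemma ad_op_order_0: "smooth a \<Longrightarrow> ad_op a (term_op b []) = 0"
  by (rule ext) (simp add: ad_op_def on_smooth_def term_op_apply smooth_mult fun_eq_iff mult_ac)

lemma ad_op_pre_partial:
  assumes A: "A \<in> diff_ops k" and a: "smooth a"
  shows "ad_op a (pre_partial i A) = mult_op (partial i a) A + ad_op (partial i a) A + pre_partial i (ad_op a A)"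
proof
  fix f
  show "ad_op a (pre_partial i A) f = (mult_op (partial i a) A + ad_op (partial i a) A + pre_partial i (ad_op a A)) f"
  proof (cases "smooth f")
    case True
    have "A (partial i (\<lambda>x. a x * f x)) = (\<lambda>x. A (\<lambda>x. partial i a x * f x) x + A (\<lambda>x. a x * partial i f x) x)"
      unfolding partial_mult[OF a True] using a True by (intro diff_ops_add[OF A] smooth_mult smooth_partial)
    then show ?thesis
      using a True by (simp add: ad_op_def pre_partial_def mult_op_def on_smooth_def smooth_mult smooth_partial fun_eq_iff)
  next
    case False
    then show ?thesis using diff_ops_lin(2)[OF A False] by (simp add: ad_op_def pre_partial_def mult_op_def on_smooth_def fun_eq_iff)
  qed
qed

lemma ad_op_term:
  assumes b: "smooth b" and a: "smooth a"
  shows "ad_op a (term_op b js) \<in> diff_ops (length js - 1)"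
  using a
proof (induction js arbitrary: a rule: rev_induct)
  case Nil
  show "ad_op a (term_op b []) \<in> diff_ops (length ([] :: 'a list) - 1)"
    unfolding ad_op_order_0[OF Nil.prems] by (rule subspace_0[OF subspace_diff_ops])
next
  case (snoc i js)
  let ?n = "length js"
  have T: "term_op b js \<in> diff_ops ?n" by (rule term_op_in[OF b]) simp
  have "mult_op (partial i a) (term_op b js) \<in> diff_ops ?n"
    by (rule mult_op_in[OF smooth_partial[OF snoc.prems] T])
  moreover have "ad_op (partial i a) (term_op b js) \<in> diff_ops ?n"
    using snoc.IH[OF smooth_partial[OF snoc.prems]] diff_ops_mono[of "?n - 1" ?n] by auto
  moreover have "pre_partial i (ad_op a (term_op b js)) \<in> diff_ops ?n"
  proof (cases js)
    case Nil
    then show ?thesis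
      using subspace_0[OF subspace_diff_ops] by (simp add: ad_op_order_0 snoc.prems pre_partial_zero)
  next
    case (Cons j ls)
    then show ?thesis using pre_partial_in[OF snoc.IH[OF snoc.prems], of i] by simp
  qed
  ultimately have "ad_op a (term_op b (js @ [i])) \<in> diff_ops ?n"
    unfolding pre_partial_term[symmetric] ad_op_pre_partial[OF T snoc.prems]
    by (intro subspace_add[OF subspace_diff_ops])
  then show ?case by simp
qed

lemma ad_op_in:
  fixes A :: "'m::finite operator"
  assumes "A \<in> diff_ops (Suc k)" "smooth a"
  shows "ad_op a A \<in> diff_ops k"
  using assms(1)
proof (rule diff_ops_lift[OF _ ad_op_add subspace_diff_ops])
  fix b :: "'m scalar_field" and js :: "'m list" assume b: "smooth b" and "length js \<le> Suc k"
  then have "length js - 1 \<le> k" by simp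
  then show "ad_op a (term_op b js) \<in> diff_ops k"
    by (rule subsetD[OF diff_ops_mono ad_op_term[OF b assms(2)]])
qed

lemma ad_op_zero:
  assumes "A \<in> diff_ops 0" "smooth a"
  shows "ad_op a A = 0"
proof -
  have "ad_op a A \<in> {0}"
  proof (rule diff_ops_lift[OF assms(1) ad_op_add])
    show "ad_op a (term_op b js) \<in> {0}" if "length js \<le> 0" for b js
      using that ad_op_order_0[OF assms(2), of b] by simp
  qed (rule subspace_single_0)
  then show ?thesis by simp
qed

text \<open>The symbol is homogeneous in the momenta; Euler's identity for it holds, up to terms of lower order,
  at the level of operators.\<close>

abbreviation ad_coord :: "'m::finite \<Rightarrow> 'm operator \<Rightarrow> 'm operator"
  where "ad_coord j \<equiv> ad_op (\<lambda>x. x $ j)"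

definition symbol_euler :: "'m::finite operator \<Rightarrow> 'm operator"
  where "symbol_euler A = (\<Sum>j\<in>UNIV. pre_partial j (ad_coord j A))"

lemma symbol_euler_add: "symbol_euler (A + B) = symbol_euler A + symbol_euler B"
  by (simp add: symbol_euler_def ad_op_add pre_partial_add sum.distrib)

lemma pre_partial_swap: "pre_partial i (pre_partial j A) = pre_partial j (pre_partial i A)"
  by (rule ext) (simp add: pre_partial_def on_smooth_def smooth_partial partial_commute[of _ i])

lemma symbol_euler_term:
  assumes a: "smooth a"
  shows "symbol_euler (term_op a js) = real (length js) *\<^sub>R term_op a js"
proof (induction js rule: rev_induct)
  case Nil
  show ?case by (simp add: symbol_euler_def ad_op_order_0 smooth_coord pre_partial_zero)
next
  case (snoc i js)
  let ?T = "term_op a js"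
  have T: "?T \<in> diff_ops (length js)" by (rule term_op_in[OF a]) simp
  have "ad_coord j (pre_partial i ?T) = \<delta> i j *\<^sub>R ?T + pre_partial i (ad_coord j ?T)" for j
  proof -
    have "mult_op (partial i (\<lambda>x. x $ j)) ?T = \<delta> i j *\<^sub>R ?T"
      by (simp add: mult_op_def partial_coord fun_eq_iff)
    moreover have "ad_op (partial i (\<lambda>x. x $ j)) ?T = 0"
    proof
      fix f
      show "ad_op (partial i (\<lambda>x. x $ j)) ?T f = 0 f"
        by (cases "smooth f") (simp_all add: ad_op_def on_smooth_def partial_coord diff_ops_cmult[OF T] split del: if_split)
    qed
    ultimately show ?thesis unfolding ad_op_pre_partial[OF T smooth_coord] by simp
  qed
  then have "symbol_euler (pre_partial i ?T) = (\<Sum>j\<in>UNIV. pre_partial j (\<delta> i j *\<^sub>R ?T + 1 *\<^sub>R pre_partial i (ad_coord j ?T)))"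
    by (simp add: symbol_euler_def)
  also have "\<dots> = (\<Sum>j\<in>UNIV. \<delta> i j *\<^sub>R pre_partial j ?T) + (\<Sum>j\<in>UNIV. pre_partial i (pre_partial j (ad_coord j ?T)))"
    unfolding pre_partial_comb by (simp add: sum.distrib pre_partial_swap[of i])
  also have "(\<Sum>j\<in>UNIV. \<delta> i j *\<^sub>R pre_partial j ?T) = pre_partial i ?T"
    by (subst sum.remove[of UNIV i]) auto
  also have "(\<Sum>j\<in>UNIV. pre_partial i (pre_partial j (ad_coord j ?T))) = pre_partial i (real (length js) *\<^sub>R ?T + 0 *\<^sub>R ?T)"
    unfolding pre_partial_sum[symmetric] symbol_euler_def[symmetric] snoc.IH by simp
  finally show ?case
    unfolding pre_partial_comb pre_partial_term by (simp add: algebra_simps)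
qed

lemma symbol_euler_order:
  fixes A :: "'m::finite operator"
  assumes "A \<in> diff_ops (Suc k)"
  shows "symbol_euler A - real (Suc k) *\<^sub>R A \<in> diff_ops k"
proof (rule diff_ops_lift[OF assms, where \<Phi> = "\<lambda>A. symbol_euler A - real (Suc k) *\<^sub>R A", OF _ subspace_diff_ops])
  show "symbol_euler (A + B) - real (Suc k) *\<^sub>R (A + B) =
      symbol_euler A - real (Suc k) *\<^sub>R A + (symbol_euler B - real (Suc k) *\<^sub>R B)" for A B :: "'m operator"
    by (simp add: symbol_euler_add algebra_simps)
  fix a :: "'m scalar_field" and js :: "'m list" assume a: "smooth a" and l: "length js \<le> Suc k"
  have e: "symbol_euler (term_op a js) - real (Suc k) *\<^sub>R term_op a js = (real (length js) - real (Suc k)) *\<^sub>R term_op a js"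
    unfolding symbol_euler_term[OF a] by (simp add: algebra_simps)
  show "symbol_euler (term_op a js) - real (Suc k) *\<^sub>R term_op a js \<in> diff_ops k"
  proof (cases "length js = Suc k")
    case True
    then show ?thesis unfolding e using subspace_0[OF subspace_diff_ops] by simp
  next
    case False
    then show ?thesis unfolding e using l a by (intro subspace_scale[OF subspace_diff_ops] term_op_in) auto
  qed
qed

section \<open>The modules of differential operators\<close>

text \<open>In this form each term is visibly of order at most \<open>k\<close>: a derivative that would raise the order
  occurs in a commutator, or next to a commutator that has lowered the order.\<close>

lemma op_act_expand:
  assumes X: "smooth_vf X" and A: "A \<in> diff_ops k"
  shows "op_act 0 1 X A = (\<Sum>i\<in>UNIV. mult_op (\<lambda>x. X x $ i) (post_partial i A - pre_partial i A)
      - pre_partial i (ad_op (\<lambda>x. X x $ i) A)) + mult_op (divg X) A"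
proof
  fix f
  show "op_act 0 1 X A f = ((\<Sum>i\<in>UNIV. mult_op (\<lambda>x. X x $ i) (post_partial i A - pre_partial i A)
      - pre_partial i (ad_op (\<lambda>x. X x $ i) A)) + mult_op (divg X) A) f"
  proof (cases "smooth f")
    case True
    have e: "A (\<lambda>x. \<Sum>i\<in>UNIV. X x $ i * partial i f x) = (\<lambda>x. \<Sum>i\<in>UNIV. A (\<lambda>x. X x $ i * partial i f x) x)"
      using X True by (intro diff_ops_sum_arg[OF A]) (auto intro: smooth_mult smooth_vf_comp smooth_partial)
    then show ?thesis
      using True by (simp add: e op_act_def on_smooth_def lie_density_eq mult_op_def post_partial_def pre_partial_def ad_op_def
          smooth_partial deriv_along_def[abs_def]) (simp add: fun_eq_iff sum.distrib sum_subtractf algebra_simps)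
  next
    case False
    then show ?thesis
      using diff_ops_lin(2)[OF A False]
      by (simp add: op_act_def on_smooth_def mult_op_def post_partial_def pre_partial_def zero_fun_def) (simp add: fun_eq_iff)
  qed
qed

lemma op_act_in:
  assumes X: "smooth_vf X" and A: "A \<in> diff_ops k"
  shows "op_act 0 1 X A \<in> diff_ops k"
proof -
  have "pre_partial i (ad_op (\<lambda>x. X x $ i) A) \<in> diff_ops k" for i
  proof (cases k)
    case 0
    then show ?thesis
      using ad_op_zero[of A "\<lambda>x. X x $ i"] A 0 smooth_vf_comp[OF X] subspace_0[OF subspace_diff_ops]
      by (simp add: pre_partial_zero)
  next
    case (Suc n)
    then show ?thesis using ad_op_in[of A n "\<lambda>x. X x $ i"] A smooth_vf_comp[OF X] pre_partial_in by simp
  qed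
  then show ?thesis
    unfolding op_act_expand[OF X A]
    by (intro subspace_add[OF subspace_diff_ops] subspace_sum[OF subspace_diff_ops] subspace_diff[OF subspace_diff_ops]
        mult_op_in post_pre_partial smooth_vf_comp smooth_divg X A)
qed

lemma op_module:
  assumes U: "subspace (lm_carrier M)" and act: "lm_act M = op_act 0 1"
    and sub: "lm_carrier M \<subseteq> (\<Union>k. diff_ops k)"
    and clos: "\<And>X A. smooth_vf X \<Longrightarrow> A \<in> lm_carrier M \<Longrightarrow> op_act 0 1 X A \<in> lm_carrier M"
  shows "lie_module_on sl_proj (M :: ('m::finite vector_field, 'm operator) lie_module)"
proof (rule sl_moduleI[OF U])
  fix X Y :: "'m vector_field" and A B :: "'m operator" and r s :: real
  assume X: "smooth_vf X" and A: "A \<in> lm_carrier M"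
  obtain k where k: "A \<in> diff_ops k" using A sub by blast
  show "lm_act M X A \<in> lm_carrier M" unfolding act by (rule clos[OF X A])
  show "lm_act M X (r *\<^sub>R A + s *\<^sub>R B) = r *\<^sub>R lm_act M X A + s *\<^sub>R lm_act M X B" if B: "B \<in> lm_carrier M"
  proof -
    obtain l where l: "B \<in> diff_ops l" using B sub by blast
    have "lie_density 1 X (r *\<^sub>R A f + s *\<^sub>R B f) = r *\<^sub>R lie_density 1 X (A f) + s *\<^sub>R lie_density 1 X (B f)" if "smooth f" for f
      by (rule lie_density_comb[OF diff_ops_smooth[OF k that] diff_ops_smooth[OF l that]])
    then show ?thesis unfolding act by (intro ext) (simp add: op_act_def on_smooth_def algebra_simps)
  qed
  assume Y: "smooth_vf Y"
  note s0 = smooth_lie_density[of _ _ 0] and sA = diff_ops_smooth[OF k]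
  show "lm_act M (r *\<^sub>R X + s *\<^sub>R Y) A = r *\<^sub>R lm_act M X A + s *\<^sub>R lm_act M Y A"
  proof
    fix f
    have "A (r *\<^sub>R lie_density 0 X f + s *\<^sub>R lie_density 0 Y f) = r *\<^sub>R A (lie_density 0 X f) + s *\<^sub>R A (lie_density 0 Y f)"
      if "smooth f" using that X Y by (intro lin_on_comb[OF diff_ops_lin(1)[OF k]]) (auto intro: s0)
    then show "lm_act M (r *\<^sub>R X + s *\<^sub>R Y) A f = (r *\<^sub>R lm_act M X A + s *\<^sub>R lm_act M Y A) f"
      unfolding act using lie_density_comb_left[OF X Y, of 1 r s] lie_density_comb_left[OF X Y, of 0 r s]
      by (simp add: op_act_def on_smooth_def algebra_simps)
  qed
  show "lm_act M (vf_bracket X Y) A = lm_act M X (lm_act M Y A) - lm_act M Y (lm_act M X A)"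
  proof
    fix f
    show "lm_act M (vf_bracket X Y) A f = (lm_act M X (lm_act M Y A) - lm_act M Y (lm_act M X A)) f"
    proof (cases "smooth f")
      case True
      have L1: "lie_density 1 X (lie_density 1 Y (A f) - A (lie_density 0 Y f)) =
          lie_density 1 X (lie_density 1 Y (A f)) - lie_density 1 X (A (lie_density 0 Y f))"
        if "smooth_vf X" "smooth_vf Y" for X Y
        using lie_density_comb[of "lie_density 1 Y (A f)" "A (lie_density 0 Y f)" 1 X 1 "-1"] that True
        by (simp add: smooth_lie_density sA)
      have "A (lie_density 0 X (lie_density 0 Y f) - lie_density 0 Y (lie_density 0 X f)) =
          A (lie_density 0 X (lie_density 0 Y f)) - A (lie_density 0 Y (lie_density 0 X f))"
        using X Y True by (intro lin_on_diff[OF diff_ops_lin(1)[OF k]]) (auto intro!: s0)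
      then show ?thesis
        using True X Y L1[OF X Y] L1[OF Y X]
        by (simp add: act op_act_def on_smooth_def s0 sA lie_density_bracket)
    next
      case False
      then show ?thesis by (simp add: act op_act_def on_smooth_def)
    qed
  qed
qed

lemma D_ord_simps: "lm_carrier (D_ord l \<mu> k) = diff_ops k" "lm_act (D_ord l \<mu> k) = op_act l \<mu>"
  and D_all_simps: "lm_carrier (D_all l \<mu>) = (\<Union>k. diff_ops k)" "lm_act (D_all l \<mu>) = op_act l \<mu>"
  by (simp_all add: D_ord_def D_all_def)

lemma D_ord_module: "lie_module_on sl_proj (D_ord 0 1 k)"
  by (rule op_module) (auto simp: D_ord_simps subspace_diff_ops op_act_in)

lemma subspace_all_ops: "subspace (\<Union>k. diff_ops k)"
proof -
  have comb: "r *\<^sub>R A + s *\<^sub>R B \<in> (\<Union>k. diff_ops k)" if "A \<in> diff_ops j" "B \<in> diff_ops k" for r s j k and A B :: "'a operator"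
  proof -
    have "A \<in> diff_ops (max j k)" "B \<in> diff_ops (max j k)"
      using that diff_ops_mono[of j "max j k"] diff_ops_mono[of k "max j k"] by auto
    then have "r *\<^sub>R A + s *\<^sub>R B \<in> diff_ops (max j k)" by (rule subspace_comb[OF subspace_diff_ops])
    then show ?thesis by blast
  qed
  have "0 \<in> (\<Union>k. diff_ops k)" using subspace_0[OF subspace_diff_ops] by blast
  then show ?thesis
    unfolding subspace_def using comb[of _ _ _ _ 1 1] comb[of _ _ _ _ _ 0] by (auto 4 3)
qed

lemma D_all_module: "lie_module_on sl_proj (D_all 0 1)"
  by (rule op_module) (auto simp: D_all_simps subspace_all_ops intro: op_act_in)

section \<open>The Casimir operator on differential operators\<close>

text \<open>Densities of weight one in the notation of homogeneous coordinates: \<open>X\<^sup>a \<partial>\<^sub>b\<close> acts by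
  \<open>g \<mapsto> \<partial>\<^sub>b (X\<^sup>a g)\<close>, where \<open>\<partial>\<^sub>0\<close> takes into account that they are homogeneous of degree \<open>- (m + 1)\<close>.\<close>

definition div_vec :: "'m::finite option \<Rightarrow> 'm scalar_field \<Rightarrow> 'm scalar_field"
  where "div_vec b h x = deriv_along (hvec b) h x - real CARD('m) * \<delta> b None * h x"

lemma lie_density_0_proj: "lie_density 0 (proj_vf a b) f = (\<lambda>x. hcoord a x * deriv_along (hvec b) f x)"
  by (rule ext) (simp add: lie_density_eq deriv_along_proj)

lemma lie_density_1_proj:
  assumes g: "smooth g"
  shows "lie_density 1 (proj_vf a b) g = div_vec b (\<lambda>x. hcoord a x * g x)"
  by (rule ext) (simp add: lie_density_eq deriv_along_proj div_vec_def deriv_along_mult smooth_hcoord g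
      hvec_hcoord divg_proj algebra_simps)

lemma sum_hcoord_hvec: "(\<Sum>a\<in>UNIV. hcoord a x * deriv_along (hvec a) h x) = 0"
  by (simp add: sum_UNIV_option deriv_along_hvec_None deriv_along_hvec_Some euler_def)

lemma sum_hvec_hcoord:
  fixes h :: "'m::finite scalar_field"
  assumes "smooth h"
  shows "(\<Sum>a\<in>UNIV. deriv_along (hvec a) (\<lambda>x. hcoord a x * h x) x) = real CARD('m) * h x"
proof -
  have "(\<Sum>a\<in>UNIV. deriv_along (hvec a) (\<lambda>x. hcoord a x * h x) x) =
      (\<Sum>a\<in>UNIV. (1 - \<delta> a None * hcoord a x) * h x) + (\<Sum>a\<in>UNIV. hcoord a x * deriv_along (hvec a) h x)"
    by (simp add: deriv_along_mult smooth_hcoord assms hvec_hcoord sum.distrib)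
  also have "\<dots> = real CARD('m) * h x"
    unfolding sum_hcoord_hvec by (simp add: sum_UNIV_option)
  finally show ?thesis .
qed

lemma sum_div_vec:
  assumes "smooth h"
  shows "(\<Sum>a\<in>UNIV. div_vec a (\<lambda>x. hcoord a x * h x) x) = 0"
  by (simp add: div_vec_def sum_subtractf sum_hvec_hcoord[OF assms] sum_UNIV_option[of "\<lambda>a. _ * \<delta> a None * _"])
    (simp add: sum_UNIV_option)

lemma sum_hcoord_div_vec: "(\<Sum>a\<in>UNIV. hcoord a x * div_vec a h x) = - real CARD('m) * h x"
  for h :: "'m::finite scalar_field"
proof -
  have "(\<Sum>a\<in>UNIV. hcoord a x * div_vec a h x) = (\<Sum>a\<in>UNIV. hcoord a x * deriv_along (hvec a) h x) -
      (\<Sum>a\<in>UNIV. real CARD('m) * \<delta> a None * h x * hcoord a x)"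
    unfolding sum_subtractf[symmetric] by (intro sum.cong refl) (simp add: div_vec_def algebra_simps)
  then show ?thesis unfolding sum_hcoord_hvec by (simp add: sum_UNIV_option)
qed

lemma smooth_deriv_hvec: "smooth h \<Longrightarrow> smooth (deriv_along (hvec b) h)"
  by (rule smooth_deriv_along[OF smooth_hvec])

lemma smooth_div_vec: "smooth h \<Longrightarrow> smooth (div_vec b h)"
  unfolding div_vec_def[abs_def] by (intro smooth_diff smooth_deriv_hvec smooth_cmult)

lemma div_vec_sum:
  "(\<And>i. i \<in> I \<Longrightarrow> smooth (f i)) \<Longrightarrow> div_vec b (\<lambda>x. \<Sum>i\<in>I. f i x) x = (\<Sum>i\<in>I. div_vec b (f i) x)"
  by (simp add: div_vec_def deriv_along_sum sum_subtractf sum_distrib_left)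

lemma div_vec_cmult: "smooth h \<Longrightarrow> div_vec b (\<lambda>x. c * h x) x = c * div_vec b h x"
  by (simp add: div_vec_def deriv_along_cmult algebra_simps)

lemma casimir_functions:
  assumes f: "smooth (f :: 'm::finite scalar_field)"
  shows "(\<Sum>a\<in>UNIV. \<Sum>b\<in>UNIV. lie_density 0 (proj_vf a b) (lie_density 0 (proj_vf b a) f) x) = 0"
proof -
  have "(\<Sum>a\<in>UNIV. \<Sum>b\<in>UNIV. lie_density 0 (proj_vf a b) (lie_density 0 (proj_vf b a) f) x) =
      (\<Sum>a\<in>UNIV. hcoord a x * (\<Sum>b\<in>UNIV. deriv_along (hvec b) (\<lambda>x. hcoord b x * deriv_along (hvec a) f x) x))"
    by (simp add: lie_density_0_proj sum_distrib_left)
  also have "\<dots> = (\<Sum>a\<in>UNIV. hcoord a x * (real CARD('m) * deriv_along (hvec a) f x))"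
    using sum_hvec_hcoord[OF smooth_deriv_hvec[OF f]] by simp
  also have "\<dots> = real CARD('m) * (\<Sum>a\<in>UNIV. hcoord a x * deriv_along (hvec a) f x)"
    by (simp add: sum_distrib_left mult_ac)
  finally show ?thesis unfolding sum_hcoord_hvec by simp
qed

lemma casimir_densities:
  assumes g: "smooth (g :: 'm::finite scalar_field)"
  shows "(\<Sum>a\<in>UNIV. \<Sum>b\<in>UNIV. lie_density 1 (proj_vf b a) (lie_density 1 (proj_vf a b) g) x) = 0"
proof -
  have s: "smooth (\<lambda>x. hcoord a x * g x)" for a by (intro smooth_mult smooth_hcoord g)
  have s2: "smooth (\<lambda>x. hcoord b x * div_vec b (\<lambda>x. hcoord a x * g x) x)" for a b
    by (intro smooth_mult smooth_hcoord smooth_div_vec s)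
  have "(\<Sum>a\<in>UNIV. \<Sum>b\<in>UNIV. lie_density 1 (proj_vf b a) (lie_density 1 (proj_vf a b) g) x) =
      (\<Sum>a\<in>UNIV. div_vec a (\<lambda>x. \<Sum>b\<in>UNIV. hcoord b x * div_vec b (\<lambda>x. hcoord a x * g x) x) x)"
    by (simp add: lie_density_1_proj g smooth_div_vec s div_vec_sum s2)
  also have "\<dots> = (\<Sum>a\<in>UNIV. - real CARD('m) * div_vec a (\<lambda>x. hcoord a x * g x) x)"
    unfolding sum_hcoord_div_vec by (intro sum.cong refl div_vec_cmult s)
  also have "\<dots> = - real CARD('m) * (\<Sum>a\<in>UNIV. div_vec a (\<lambda>x. hcoord a x * g x) x)"
    by (simp add: sum_distrib_left)
  finally show ?thesis unfolding sum_div_vec[OF g] by simp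
qed

text \<open>The left side is \<open>\<Sum> \<partial>\<^sub>b X\<^sup>a A X\<^sup>b \<partial>\<^sub>a\<close>. In both sums the derivative \<open>\<partial>\<^sub>0\<close> is expressed by the others,
  through the homogeneity of what it acts on; each time this turns a coordinate that stood on one side of
  \<open>A\<close> into a commutator of \<open>A\<close> with it.\<close>

lemma casimir_mixed:
  fixes A :: "'m::finite operator"
  assumes A: "A \<in> diff_ops k" and f: "smooth f"
  shows "(\<Sum>a\<in>UNIV. \<Sum>b\<in>UNIV. lie_density 1 (proj_vf a b) (A (lie_density 0 (proj_vf b a) f)) x) =
    - (\<Sum>j\<in>UNIV. \<Sum>i\<in>UNIV. partial j (ad_coord i (ad_coord j A) (partial i f)) x)"
proof -
  note sA = diff_ops_smooth[OF A]
  let ?D = "\<lambda>a. deriv_along (hvec a) f"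
  have sD: "smooth (?D a)" for a by (rule smooth_deriv_hvec[OF f])
  define R where "R b x = (\<Sum>a\<in>UNIV. hcoord a x * A (\<lambda>x. hcoord b x * ?D a x) x)" for b x
  have sR1: "smooth (\<lambda>x. hcoord a x * A (\<lambda>x. hcoord b x * ?D a x) x)" for a b
    by (intro smooth_mult smooth_hcoord sA sD)
  have sR: "smooth (R b)" for b unfolding R_def[abs_def] by (intro smooth_sum sR1)
  have e1: "(\<Sum>a\<in>UNIV. \<Sum>b\<in>UNIV. lie_density 1 (proj_vf a b) (A (lie_density 0 (proj_vf b a) f)) x) =
      (\<Sum>b\<in>UNIV. div_vec b (R b) x)"
    unfolding R_def[abs_def]
    by (subst sum.swap) (simp add: lie_density_0_proj lie_density_1_proj sA smooth_mult smooth_hcoord sD div_vec_sum sR1)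
  have R0: "div_vec None (R None) x = - (\<Sum>j\<in>UNIV. partial j (\<lambda>x. x $ j * R None x) x)"
    by (simp add: div_vec_def deriv_along_hvec_None partial_mult smooth_coord sR partial_coord sum.distrib euler_def)
  have e2: "(\<Sum>b\<in>UNIV. div_vec b (R b) x) = (\<Sum>j\<in>UNIV. partial j (\<lambda>x. R (Some j) x - x $ j * R None x) x)"
    unfolding sum_UNIV_option R0
    by (simp add: div_vec_def deriv_along_hvec_Some partial_diff sR smooth_mult smooth_coord sum_subtractf)
  have e3: "(\<lambda>x. R (Some j) x - x $ j * R None x) = (\<lambda>x. - (\<Sum>i\<in>UNIV. ad_coord i (ad_coord j A) (partial i f) x))" for j
  proof
    fix x
    have ad: "ad_coord j A \<in> diff_ops k"
      using ad_op_zero[of A "\<lambda>x. x $ j"] ad_op_in[of A "k - 1" "\<lambda>x. x $ j"] A diff_ops_mono[of "k - 1" k]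
        subspace_0[OF subspace_diff_ops] smooth_coord[of j]
      by (cases k) auto
    have "R (Some j) x - x $ j * R None x = (\<Sum>a\<in>UNIV. hcoord a x * ad_coord j A (?D a) x)"
      unfolding R_def sum_distrib_left sum_subtractf[symmetric]
      by (intro sum.cong refl) (simp add: ad_op_def on_smooth_def sD algebra_simps)
    also have "\<dots> = - ad_coord j A (euler f) x + (\<Sum>i\<in>UNIV. x $ i * ad_coord j A (partial i f) x)"
    proof -
      have "?D None = (\<lambda>x. (-1) * euler f x)" by (rule ext) (simp add: deriv_along_hvec_None)
      then have "ad_coord j A (?D None) x = - ad_coord j A (euler f) x"
        using diff_ops_cmult[OF ad smooth_euler[OF f], of "-1"] by simp
      moreover have "?D (Some i) = partial i f" for i by (rule ext) (rule deriv_along_hvec_Some)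
      ultimately show ?thesis by (simp add: sum_UNIV_option)
    qed
    also have "ad_coord j A (euler f) x = (\<Sum>i\<in>UNIV. ad_coord j A (\<lambda>x. x $ i * partial i f x) x)"
      unfolding euler_def[abs_def] using f
      by (subst diff_ops_sum_arg[OF ad]) (auto intro: smooth_mult smooth_coord smooth_partial)
    finally show "R (Some j) x - x $ j * R None x = - (\<Sum>i\<in>UNIV. ad_coord i (ad_coord j A) (partial i f) x)"
      using f by (simp add: ad_op_def[of _ "ad_coord j A"] on_smooth_def smooth_partial sum_subtractf)
  qed
  have sad: "smooth (ad_coord i B h)" if "B \<in> diff_ops l" "smooth h" for i B l h
    using that by (simp add: ad_op_def on_smooth_def fun_diff_eq smooth_diff smooth_mult smooth_coord diff_ops_smooth)
  have ad: "ad_coord j A \<in> diff_ops k" for j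
    using ad_op_zero[of A "\<lambda>x. x $ j"] ad_op_in[of A "k - 1" "\<lambda>x. x $ j"] A diff_ops_mono[of "k - 1" k]
      subspace_0[OF subspace_diff_ops] smooth_coord[of j]
    by (cases k) auto
  show ?thesis
    unfolding e1 e2 e3 using f
    by (simp add: partial_minus partial_sum smooth_sum sad[OF ad] smooth_partial sum_negf)
qed

definition op_casimir :: "'m::finite operator \<Rightarrow> 'm operator"
  where "op_casimir A = (\<Sum>a\<in>UNIV. \<Sum>b\<in>UNIV. op_act 0 1 (proj_vf b a) (op_act 0 1 (proj_vf a b) A))"

text \<open>The contributions of functions and densities vanish and the mixed terms combine to double
  commutators with coordinates; the Casimir operator is therefore
  \<open>A \<mapsto> 2 \<Sum> \<partial>\<^sub>j \<circ> [[A, x\<^sup>j], x\<^sup>i] \<circ> \<partial>\<^sub>i\<close>.\<close>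

lemma op_casimir_formula:
  fixes A :: "'m::finite operator"
  assumes A: "A \<in> diff_ops k"
  shows "op_casimir A = (\<Sum>j\<in>UNIV. \<Sum>i\<in>UNIV. 2 *\<^sub>R post_partial j (pre_partial i (ad_coord i (ad_coord j A))))"
proof
  fix f
  show "op_casimir A f = (\<Sum>j\<in>UNIV. \<Sum>i\<in>UNIV. 2 *\<^sub>R post_partial j (pre_partial i (ad_coord i (ad_coord j A)))) f"
  proof (cases "smooth f")
    case False
    then show ?thesis
      by (simp add: op_casimir_def op_act_def on_smooth_def post_partial_def pre_partial_def zero_fun_def fun_eq_iff)
  next
    case True
    note sA = diff_ops_smooth[OF A]
    have s: "smooth (lie_density l (proj_vf a b) h)" if "smooth h" for l a b and h :: "'m scalar_field"
      using that by (rule smooth_lie_density[OF smooth_proj_vf])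
    have trm: "op_act 0 1 (proj_vf b a) (op_act 0 1 (proj_vf a b) A) f x =
        lie_density 1 (proj_vf b a) (lie_density 1 (proj_vf a b) (A f)) x
        - lie_density 1 (proj_vf b a) (A (lie_density 0 (proj_vf a b) f)) x
        - lie_density 1 (proj_vf a b) (A (lie_density 0 (proj_vf b a) f)) x
        + A (lie_density 0 (proj_vf a b) (lie_density 0 (proj_vf b a) f)) x" for a b x
    proof -
      have "lie_density 1 (proj_vf b a) (lie_density 1 (proj_vf a b) (A f) - A (lie_density 0 (proj_vf a b) f)) =
          lie_density 1 (proj_vf b a) (lie_density 1 (proj_vf a b) (A f)) - lie_density 1 (proj_vf b a) (A (lie_density 0 (proj_vf a b) f))"
        using lie_density_comb[of "lie_density 1 (proj_vf a b) (A f)" "A (lie_density 0 (proj_vf a b) f)" 1 "proj_vf b a" 1 "-1"]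
          True by (simp add: s sA)
      then show ?thesis using True by (simp add: op_act_def on_smooth_def s)
    qed
    have last: "(\<Sum>a\<in>UNIV. \<Sum>b\<in>UNIV. A (lie_density 0 (proj_vf a b) (lie_density 0 (proj_vf b a) f)) x) = 0" for x
    proof -
      have "(\<lambda>x. 0) = (\<lambda>x. \<Sum>p\<in>UNIV. lie_density 0 (proj_vf (fst p) (snd p)) (lie_density 0 (proj_vf (snd p) (fst p)) f) x)"
        unfolding sum_UNIV_pair using casimir_functions[OF True] by (simp add: fun_eq_iff)
      then have "A (\<lambda>x. 0) = (\<lambda>x. \<Sum>p\<in>UNIV. A (lie_density 0 (proj_vf (fst p) (snd p)) (lie_density 0 (proj_vf (snd p) (fst p)) f)) x)"
        using diff_ops_sum_arg[OF A, of UNIV "\<lambda>p. lie_density 0 (proj_vf (fst p) (snd p)) (lie_density 0 (proj_vf (snd p) (fst p)) f)"]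
          s[OF s[OF True]] by simp
      moreover have "A (\<lambda>x. 0) = 0" using lin_on_zero[OF diff_ops_lin(1)[OF A] subspace_smooth] by (simp add: zero_fun_def)
      ultimately show ?thesis unfolding sum_UNIV_pair by (simp add: fun_eq_iff)
    qed
    have mixed2: "(\<Sum>a\<in>UNIV. \<Sum>b\<in>UNIV. lie_density 1 (proj_vf b a) (A (lie_density 0 (proj_vf a b) f)) x) =
        (\<Sum>a\<in>UNIV. \<Sum>b\<in>UNIV. lie_density 1 (proj_vf a b) (A (lie_density 0 (proj_vf b a) f)) x)" for x
      by (rule sum.swap)
    show ?thesis
    proof
      fix x
      have "op_casimir A f x = (\<Sum>a\<in>UNIV. \<Sum>b\<in>UNIV. op_act 0 1 (proj_vf b a) (op_act 0 1 (proj_vf a b) A) f x)"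
        by (simp add: op_casimir_def)
      also have "\<dots> = - 2 * (\<Sum>a\<in>UNIV. \<Sum>b\<in>UNIV. lie_density 1 (proj_vf a b) (A (lie_density 0 (proj_vf b a) f)) x)"
        unfolding trm sum.distrib sum_subtractf last mixed2 casimir_densities[OF sA[OF True]] by simp
      also have "\<dots> = (\<Sum>j\<in>UNIV. \<Sum>i\<in>UNIV. 2 *\<^sub>R post_partial j (pre_partial i (ad_coord i (ad_coord j A)))) f x"
        unfolding casimir_mixed[OF A True] using True
        by (simp add: post_partial_def pre_partial_def on_smooth_def sum_distrib_left sum_negf)
      finally show "op_casimir A f x = (\<Sum>j\<in>UNIV. \<Sum>i\<in>UNIV. 2 *\<^sub>R post_partial j (pre_partial i (ad_coord i (ad_coord j A)))) f x" .
    qed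
  qed
qed

text \<open>Moving \<open>\<partial>\<^sub>j\<close> to the right changes the formula by terms of lower order. Then Euler's identity applies
  twice: to the commutators, of order \<open>n + 1\<close>, and to \<open>A\<close>, of order \<open>n + 2\<close>.\<close>

lemma op_casimir_symbol:
  fixes A :: "'m::finite operator"
  assumes A: "A \<in> diff_ops (Suc (Suc n))"
  shows "op_casimir A - (2 * real (Suc (Suc n)) * real (Suc n)) *\<^sub>R A \<in> diff_ops (Suc n)"
proof -
  note sub = subspace_diff_ops[of "Suc n"]
  let ?B = "\<lambda>i j. pre_partial i (ad_coord i (ad_coord j A))"
  have ad: "ad_coord j A \<in> diff_ops (Suc n)" for j by (rule ad_op_in[OF A smooth_coord])
  have B: "?B i j \<in> diff_ops (Suc n)" for i j by (rule pre_partial_in[OF ad_op_in[OF ad smooth_coord]])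
  have 1: "post_partial j (?B i j) - pre_partial j (?B i j) \<in> diff_ops (Suc n)" for i j by (rule post_pre_partial[OF B])
  have 2: "(\<Sum>i\<in>UNIV. pre_partial j (?B i j)) - real (Suc n) *\<^sub>R pre_partial j (ad_coord j A) \<in> diff_ops (Suc n)" for j
  proof -
    have "(\<Sum>i\<in>UNIV. pre_partial j (?B i j)) - real (Suc n) *\<^sub>R pre_partial j (ad_coord j A) =
        pre_partial j (1 *\<^sub>R symbol_euler (ad_coord j A) + (- real (Suc n)) *\<^sub>R ad_coord j A)"
      unfolding pre_partial_comb by (simp add: symbol_euler_def pre_partial_sum del: of_nat_Suc)
    moreover have "pre_partial j (symbol_euler (ad_coord j A) - real (Suc n) *\<^sub>R ad_coord j A) \<in> diff_ops (Suc n)"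
      by (rule pre_partial_in[OF symbol_euler_order[OF ad]])
    ultimately show ?thesis by (simp del: of_nat_Suc)
  qed
  have 3: "symbol_euler A - real (Suc (Suc n)) *\<^sub>R A \<in> diff_ops (Suc n)" by (rule symbol_euler_order[OF A])
  have "op_casimir A - (2 * real (Suc (Suc n)) * real (Suc n)) *\<^sub>R A =
      (\<Sum>j\<in>UNIV. \<Sum>i\<in>UNIV. 2 *\<^sub>R (post_partial j (?B i j) - pre_partial j (?B i j)))
      + (\<Sum>j\<in>UNIV. 2 *\<^sub>R ((\<Sum>i\<in>UNIV. pre_partial j (?B i j)) - real (Suc n) *\<^sub>R pre_partial j (ad_coord j A)))
      + (2 * real (Suc n)) *\<^sub>R (symbol_euler A - real (Suc (Suc n)) *\<^sub>R A)"
    unfolding op_casimir_formula[OF A]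
    by (simp add: scaleR_diff_right sum_subtractf scaleR_sum_right symbol_euler_def mult_ac) (simp add: algebra_simps)
  moreover have "(\<Sum>j\<in>UNIV. \<Sum>i\<in>UNIV. 2 *\<^sub>R (post_partial j (?B i j) - pre_partial j (?B i j))) \<in> diff_ops (Suc n)"
    by (intro subspace_sum[OF sub] subspace_scale[OF sub] 1)
  moreover have "(\<Sum>j\<in>UNIV. 2 *\<^sub>R ((\<Sum>i\<in>UNIV. pre_partial j (?B i j)) - real (Suc n) *\<^sub>R pre_partial j (ad_coord j A))) \<in> diff_ops (Suc n)"
    by (intro subspace_sum[OF sub] subspace_scale[OF sub] 2)
  ultimately show ?thesis
    using subspace_scale[OF sub 3, of "2 * real (Suc n)"] by (simp only: subspace_add[OF sub])
qed

section \<open>Reducing the order of cochains\<close>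

lemma alt_forms_mono: "W \<subseteq> W' \<Longrightarrow> alt_forms G W u \<subseteq> alt_forms G W' u"
  by (auto simp: alt_forms_def)

lemma alt_forms_restrict: "c \<in> alt_forms G W u \<Longrightarrow> (\<And>xs. c xs \<in> U) \<Longrightarrow> c \<in> alt_forms G U u"
  by (simp add: alt_forms_def)

abbreviation op_forms :: "nat \<Rightarrow> nat \<Rightarrow> ('m::finite vector_field list \<Rightarrow> 'm operator) set"
  where "op_forms k \<equiv> alt_forms sl_carrier (diff_ops k)"

abbreviation op_diff :: "('m::finite vector_field list \<Rightarrow> 'm operator) \<Rightarrow> 'm vector_field list \<Rightarrow> 'm operator"
  where "op_diff \<equiv> ce_diff sl_proj (D_all 0 1)"

abbreviation op_coboundaries :: "nat \<Rightarrow> ('m::finite vector_field list \<Rightarrow> 'm operator) set"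
  where "op_coboundaries \<equiv> coboundaries sl_proj (D_all 0 1)"

lemma D_ord_diff: "ce_diff sl_proj (D_ord 0 1 k) = op_diff"
  by (intro ext) (simp add: ce_diff_def D_ord_simps D_all_simps)

lemma op_forms_mono: "j \<le> k \<Longrightarrow> op_forms j u \<subseteq> op_forms k u"
  by (rule alt_forms_mono[OF diff_ops_mono])

lemma op_forms_all: "op_forms k u \<subseteq> alt_forms sl_carrier (\<Union>k. diff_ops k) u"
  by (rule alt_forms_mono) blast

text \<open>A cochain is determined by its values on tuples of generators, of which there are finitely many.\<close>

lemma op_forms_bounded:
  fixes c :: "'m::finite vector_field list \<Rightarrow> 'm operator"
  assumes c: "c \<in> alt_forms sl_carrier (\<Union>k. diff_ops k) u"
  shows "\<exists>k. c \<in> op_forms k u"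
proof -
  let ?S = "{xs :: 'm vector_field list. set xs \<subseteq> range proj \<and> length xs = u}"
  have fin: "finite ?S" by (rule finite_lists_length_eq) simp
  have "\<forall>xs. \<exists>k. c xs \<in> diff_ops k" using alt_forms_mem[OF subspace_all_ops c] by blast
  then obtain k where k: "\<And>xs. c xs \<in> diff_ops (k xs)" by metis
  define K where "K = Max (k ` ?S)"
  have "c xs \<in> diff_ops K" for xs
  proof (rule alt_forms_values[OF c sl_carrier_range subspace_diff_ops])
    fix xs :: "'m vector_field list" assume "set xs \<subseteq> range proj" "length xs = u"
    then have "k xs \<le> K" unfolding K_def using fin by (intro Max_ge) auto
    then show "c xs \<in> diff_ops K" using k diff_ops_mono by blast
  qed
  then have "c \<in> op_forms K u" by (rule alt_forms_restrict[OF c])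
  then show ?thesis by blast
qed

text \<open>The classical choice: the operator paired with \<open>X\<^sup>a \<partial>\<^sub>b\<close> is the action of \<open>X\<^sup>b \<partial>\<^sub>a\<close>, its dual for the trace form.\<close>

definition op_homotopy :: "('m::finite vector_field list \<Rightarrow> 'm operator) \<Rightarrow> 'm vector_field list \<Rightarrow> 'm operator"
  where "op_homotopy = casimir_homotopy UNIV (\<lambda>(a, b). proj_vf a b) (\<lambda>(a, b). op_act 0 1 (proj_vf b a))"

lemma op_act_proj_lin: "lin_on (diff_ops k) (diff_ops k) (op_act 0 1 (proj_vf a b))"
  using lie_module_on.act_lin[OF D_ord_module, of "proj_vf a b" k] proj_in[of a b] by (simp add: D_ord_simps)

lemma op_homotopy_formula:
  fixes c :: "'m::finite vector_field list \<Rightarrow> 'm operator"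
  assumes c: "c \<in> op_forms k u"
  shows "op_diff (op_homotopy c) + op_homotopy (op_diff c) = op_casimir \<circ> c"
proof -
  interpret D: lie_module_on sl_proj "D_ord 0 1 k :: ('m vector_field, 'm operator) lie_module" by (rule D_ord_module)
  have cas: "(\<lambda>A. \<Sum>a\<in>UNIV. \<Sum>b\<in>UNIV. op_act 0 1 (proj_vf b a) (lm_act (D_ord 0 1 k) (proj_vf a b) A)) = op_casimir"
    by (rule ext) (simp add: op_casimir_def D_ord_simps)
  have "ce_diff sl_proj (D_ord 0 1 k) (op_homotopy c) + op_homotopy (ce_diff sl_proj (D_ord 0 1 k) c) =
      (\<lambda>A. \<Sum>a\<in>UNIV. \<Sum>b\<in>UNIV. op_act 0 1 (proj_vf b a) (lm_act (D_ord 0 1 k) (proj_vf a b) A)) \<circ> c"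
    unfolding op_homotopy_def
  proof (rule proj_homotopy_formula[OF D_ord_module, where T = "\<lambda>a b. op_act 0 1 (proj_vf a b)"])
    show "lin_on (lm_carrier (D_ord 0 1 k)) (lm_carrier (D_ord 0 1 k)) (op_act 0 1 (proj_vf a b))" for a b :: "'m option"
      by (simp add: D_ord_simps op_act_proj_lin)
    show "c \<in> alt_forms sl_carrier (lm_carrier (D_ord 0 1 k)) u" using c by (simp add: D_ord_simps)
    fix p q a b :: "'m option" and A :: "'m operator" assume A: "A \<in> lm_carrier (D_ord 0 1 k)"
    have "D.act (proj_vf p q) (D.act (proj_vf a b) A) - D.act (proj_vf a b) (D.act (proj_vf p q) A) =
        D.act (\<delta> q a *\<^sub>R proj_vf p b + (- \<delta> p b) *\<^sub>R proj_vf a q) A"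
      using D.act_bracket[OF proj_in proj_in A, of p q a b] by (simp add: proj_bracket)
    also have "\<dots> = \<delta> q a *\<^sub>R D.act (proj_vf p b) A + (- \<delta> p b) *\<^sub>R D.act (proj_vf a q) A"
      by (rule D.act_lin_left[OF proj_in proj_in A])
    finally show "lm_act (D_ord 0 1 k) (proj_vf p q) (op_act 0 1 (proj_vf a b) A)
        - op_act 0 1 (proj_vf a b) (lm_act (D_ord 0 1 k) (proj_vf p q) A) =
        \<delta> q a *\<^sub>R op_act 0 1 (proj_vf p b) A - \<delta> p b *\<^sub>R op_act 0 1 (proj_vf a q) A"
      by (simp add: D_ord_simps split del: if_split)
  qed
  then show ?thesis unfolding cas D_ord_diff .
qed

lemma op_homotopy_alt:
  assumes c: "c \<in> op_forms k (Suc u)"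
  shows "op_homotopy c \<in> op_forms k u"
proof -
  interpret D: lie_module_on sl_proj "D_ord 0 1 k :: ('a vector_field, 'a operator) lie_module" by (rule D_ord_module)
  show ?thesis
    unfolding op_homotopy_def
    by (rule D.casimir_homotopy_alt[unfolded D_ord_simps, OF _ _ c]) (auto simp: proj_in op_act_proj_lin)
qed

lemma op_homotopy_0:
  assumes c: "c \<in> op_forms k 0"
  shows "op_homotopy c = 0"
proof -
  interpret D: lie_module_on sl_proj "D_ord 0 1 k :: ('a vector_field, 'a operator) lie_module" by (rule D_ord_module)
  show ?thesis
    unfolding op_homotopy_def
    by (rule D.casimir_homotopy_0[unfolded D_ord_simps, OF _ c]) (auto simp: op_act_proj_lin)
qed

lemma op_casimir_lin: "lin_on (diff_ops k) (diff_ops k) op_casimir"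
  unfolding op_casimir_def[abs_def]
  by (intro lin_on_sumI subspace_diff_ops) (rule lin_on_compose[OF op_act_proj_lin op_act_proj_lin])

text \<open>Let \<open>\<alpha> = 2 k (k - 1)\<close> with \<open>k \<ge> 2\<close> the order of \<open>c\<close>. Subtracting \<open>d h c / \<alpha>\<close> leaves \<open>c - \<Omega> c / \<alpha>\<close>, of lower
  order, and \<open>h d c / \<alpha>\<close>, of order one. For cocycles this makes the inclusion of the operators of order
  one surjective in cohomology; for a primitive \<open>c\<close> of a cocycle of order one it gives injectivity.\<close>

lemma order_reduction:
  fixes c :: "'m::finite vector_field list \<Rightarrow> 'm operator"
  assumes c: "c \<in> op_forms (Suc k) u" and dc: "op_diff c \<in> op_forms 1 (Suc u)"
  shows "\<exists>e\<in>op_coboundaries u. c - e \<in> op_forms 1 u"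
  using c dc
proof (induction k arbitrary: c)
  case 0
  interpret D: lie_module_on sl_proj "D_all 0 1 :: ('m vector_field, 'm operator) lie_module" by (rule D_all_module)
  show ?case using 0 subspace_0[OF D.subspace_coboundaries, of u] by (intro bexI[of _ 0]) simp_all
next
  case (Suc n)
  interpret D: lie_module_on sl_proj "D_all 0 1 :: ('m vector_field, 'm operator) lie_module" by (rule D_all_module)
  define \<alpha> where "\<alpha> = 2 * real (Suc (Suc n)) * real (Suc n)"
  have \<alpha>: "\<alpha> \<noteq> 0" by (simp add: \<alpha>_def)
  let ?e = "(1 / \<alpha>) *\<^sub>R op_diff (op_homotopy c)"
  have cD: "c \<in> D.Alt u" using subsetD[OF op_forms_all Suc.prems(1)] by (simp add: D_all_simps)
  have e: "?e \<in> op_coboundaries u"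
  proof (cases u)
    case 0
    then have "op_homotopy c = 0" using op_homotopy_0 Suc.prems(1) by blast
    then show ?thesis using subspace_0[OF D.subspace_coboundaries] D.ce_diff_0 by simp
  next
    case (Suc v)
    then have "op_homotopy c \<in> op_forms (Suc (Suc n)) v" using Suc.prems(1) by (intro op_homotopy_alt) simp
    then have "op_homotopy c \<in> D.Alt v" using op_forms_all by (auto simp: D_all_simps)
    then have "op_diff (op_homotopy c) \<in> op_coboundaries u" using Suc by (simp add: coboundaries_def cochains_def)
    then show ?thesis by (rule subspace_scale[OF D.subspace_coboundaries])
  qed
  have eD: "?e \<in> D.Alt u" "op_diff ?e = 0"
    using subsetD[OF D.coboundaries_cocycles e] by (simp_all add: cocycles_def cochains_def)
  let ?r = "\<lambda>A :: 'm operator. (1 / \<alpha>) *\<^sub>R (\<alpha> *\<^sub>R A - op_casimir A)"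
  have r: "lin_on (diff_ops (Suc (Suc n))) (diff_ops (Suc n)) ?r"
  proof (rule lin_onI)
    fix A :: "'m operator" assume A: "A \<in> diff_ops (Suc (Suc n))"
    have "op_casimir A - \<alpha> *\<^sub>R A \<in> diff_ops (Suc n)" unfolding \<alpha>_def by (rule op_casimir_symbol[OF A])
    then have "(- 1 / \<alpha>) *\<^sub>R (op_casimir A - \<alpha> *\<^sub>R A) \<in> diff_ops (Suc n)" by (rule subspace_scale[OF subspace_diff_ops])
    then show "?r A \<in> diff_ops (Suc n)" by (simp add: algebra_simps)
  next
    fix A B :: "'m operator" and r s :: real assume A: "A \<in> diff_ops (Suc (Suc n))" and B: "B \<in> diff_ops (Suc (Suc n))"
    show "?r (r *\<^sub>R A + s *\<^sub>R B) = r *\<^sub>R ?r A + s *\<^sub>R ?r B"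
      unfolding lin_on_comb[OF op_casimir_lin A B] by (simp add: algebra_simps)
  qed
  have rc: "?r \<circ> c \<in> op_forms (Suc n) u" by (rule post_alt[OF Suc.prems(1) r subspace_diff_ops])
  have hd: "op_homotopy (op_diff c) \<in> op_forms (Suc n) u"
    using op_homotopy_alt[OF Suc.prems(2)] op_forms_mono[of 1 "Suc n" u] by auto
  have f: "op_diff (op_homotopy c) + op_homotopy (op_diff c) = op_casimir \<circ> c" by (rule op_homotopy_formula[OF Suc.prems(1)])
  have "c - ?e = (?r \<circ> c) + (1 / \<alpha>) *\<^sub>R op_homotopy (op_diff c)"
  proof
    fix xs
    have "op_diff (op_homotopy c) xs = op_casimir (c xs) - op_homotopy (op_diff c) xs"
      using fun_cong[OF f, of xs] by (simp only: plus_fun_apply comp_apply) (simp add: algebra_simps)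
    then show "(c - ?e) xs = ((?r \<circ> c) + (1 / \<alpha>) *\<^sub>R op_homotopy (op_diff c)) xs"
      using \<alpha> by (simp only: minus_apply plus_fun_apply comp_apply scaleR_fun_apply) (simp add: algebra_simps)
  qed
  then have 1: "c - ?e \<in> op_forms (Suc n) u"
    using subspace_add[OF subspace_alt_forms[OF subspace_diff_ops] rc
        subspace_scale[OF subspace_alt_forms[OF subspace_diff_ops] hd, of "1 / \<alpha>"]] by simp
  have "op_diff (c - ?e) = op_diff c" using lin_on_diff[OF D.ce_diff_lin_on cD eD(1)] eD(2) by simp
  then have "op_diff (c - ?e) \<in> op_forms 1 (Suc u)" using Suc.prems(2) by simp
  from Suc.IH[OF 1 this] obtain e' where e': "e' \<in> op_coboundaries u" "c - ?e - e' \<in> op_forms 1 u" by blast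
  have "c - (?e + e') \<in> op_forms 1 u" using e'(2) by (simp only: diff_diff_eq)
  then show ?case using subspace_add[OF D.subspace_coboundaries e e'(1)] by blast
qed

section \<open>Splitting the operators of order one\<close>

definition vec_op :: "'m::finite vector_field \<Rightarrow> 'm operator"
  where "vec_op P = on_smooth (deriv_along P)"

text \<open>The projection to the operators of order zero; it is equivariant as \<open>1\<close> is an invariant function.\<close>

definition const_part :: "'m::finite operator \<Rightarrow> 'm operator"
  where "const_part A = term_op (A (\<lambda>x. 1)) []"

lemma term_op_Nil: "term_op a [] = on_smooth (\<lambda>f x. a x * f x)"
  by (simp add: term_op_def iter_partial_Nil)

lemma term_op_one [simp]: "term_op a [] (\<lambda>x. 1) = a"
  by (simp add: term_op_Nil on_smooth_def smooth_const)

lemma vec_op_one [simp]: "vec_op P (\<lambda>x. 1) = 0"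
  by (rule ext) (simp add: vec_op_def on_smooth_def smooth_const deriv_along_def)

lemma diff_ops_0: "(diff_ops 0 :: 'm::finite operator set) = {term_op a [] | a. smooth a}"
proof -
  have "{js :: 'm list. length js \<le> 0} = {[]}" by auto
  then have "(\<Sum>js | length js \<le> 0. term_op (a js) js) = term_op (a []) []" for a :: "'m list \<Rightarrow> 'm scalar_field" by simp
  then have "A \<in> diff_ops 0 \<longleftrightarrow> (\<exists>a :: 'm list \<Rightarrow> 'm scalar_field. (\<forall>js. smooth (a js)) \<and> A = term_op (a []) [])" for A :: "'m operator"
    unfolding diff_ops_iff by (simp only:)
  then show ?thesis by (auto simp: term_op_in)
qed

lemma first_order_op_eq: "first_order_op a P = term_op a [] + vec_op P"
  by (rule ext) (simp add: first_order_op_def term_op_Nil vec_op_def on_smooth_def deriv_along_def fun_eq_iff)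

lemma first_order_cases:
  assumes "A \<in> diff_ops 1"
  obtains a P where "smooth a" "smooth_vf P" "A = term_op a [] + vec_op P"
  using assms unfolding diff_ops_1 first_order_op_eq by blast

lemma first_order_in: "smooth a \<Longrightarrow> smooth_vf P \<Longrightarrow> term_op a [] + vec_op P \<in> diff_ops 1"
  unfolding diff_ops_1 first_order_op_eq by blast

lemma symbol_map_eq: "smooth a \<Longrightarrow> smooth_vf P \<Longrightarrow> symbol_map (term_op a [] + vec_op P) = P"
  unfolding first_order_op_eq[symmetric] by (rule symbol_map_first_order_op)

lemma vec_op_comb: "vec_op (r *\<^sub>R P + s *\<^sub>R Q) = r *\<^sub>R vec_op P + s *\<^sub>R vec_op Q"
  by (rule ext) (simp add: vec_op_def on_smooth_def fun_eq_iff deriv_along_def sum.distrib sum_distrib_left algebra_simps)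

lemma term_op_comb': "term_op (r *\<^sub>R a + s *\<^sub>R b) js = r *\<^sub>R term_op a js + s *\<^sub>R term_op b js"
  using term_op_comb[of r a s b js] by (simp add: fun_comb[of r a])

lemma const_part_eq: "const_part (term_op a [] + vec_op P) = term_op a []"
  unfolding const_part_def plus_fun_apply term_op_one vec_op_one by simp

lemma op_act_term:
  assumes X: "smooth_vf X" and a: "smooth a"
  shows "op_act 0 1 X (term_op a []) = term_op (lie_density 1 X a) []"
proof
  fix f
  show "op_act 0 1 X (term_op a []) f = term_op (lie_density 1 X a) [] f"
    by (cases "smooth f")
      (simp_all add: op_act_def term_op_Nil on_smooth_def lie_density_eq deriv_along_mult a smooth_deriv_along X fun_eq_iff algebra_simps)
qed

lemma op_act_vec:
  assumes X: "smooth_vf X" and P: "smooth_vf P"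
  shows "op_act 0 1 X (vec_op P) = vec_op (lm_act (S1_module 1) X P)"
proof
  fix f
  show "op_act 0 1 X (vec_op P) f = vec_op (lm_act (S1_module 1) X P) f"
  proof (cases "smooth f")
    case True
    then show ?thesis
      using X P by (simp add: deriv_along_S1 op_act_def vec_op_def on_smooth_def lie_density_eq smooth_deriv_along fun_eq_iff)
  qed (simp add: op_act_def vec_op_def on_smooth_def)
qed

lemma op_act_first_order:
  assumes X: "smooth_vf X" and a: "smooth a" and P: "smooth_vf P"
  shows "op_act 0 1 X (term_op a [] + vec_op P) = term_op (lie_density 1 X a) [] + vec_op (lm_act (S1_module 1) X P)"
proof -
  have "smooth (\<lambda>x. 0)" by (rule smooth_const)
  then have "term_op a [] \<in> diff_ops 1" "vec_op P \<in> diff_ops 1"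
    using first_order_in[of "\<lambda>x. 0" P] a P by (simp_all add: term_op_in term_op_zero)
  note A = diff_ops_smooth[OF this(1)] and B = diff_ops_smooth[OF this(2)]
  have "op_act 0 1 X (1 *\<^sub>R term_op a [] + 1 *\<^sub>R vec_op P) = 1 *\<^sub>R op_act 0 1 X (term_op a []) + 1 *\<^sub>R op_act 0 1 X (vec_op P)"
  proof
    fix f
    show "op_act 0 1 X (1 *\<^sub>R term_op a [] + 1 *\<^sub>R vec_op P) f = (1 *\<^sub>R op_act 0 1 X (term_op a []) + 1 *\<^sub>R op_act 0 1 X (vec_op P)) f"
      using lie_density_comb[OF A B, of f f 1 X 1 1]
      by (cases "smooth f") (simp_all add: op_act_def on_smooth_def algebra_simps)
  qed
  then show ?thesis by (simp add: op_act_term[OF X a] op_act_vec[OF X P])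
qed

lemma first_order_eq_comb:
  "r *\<^sub>R (term_op a [] + vec_op P) + s *\<^sub>R (term_op b [] + vec_op Q) =
    term_op (r *\<^sub>R a + s *\<^sub>R b) [] + vec_op (r *\<^sub>R P + s *\<^sub>R Q)"
  unfolding term_op_comb' vec_op_comb by (simp add: algebra_simps)

section \<open>Equivariant maps in cohomology\<close>

definition equivariant :: "'g::real_vector lie_alg \<Rightarrow> ('g, 'v::real_vector) lie_module \<Rightarrow> ('g, 'w::real_vector) lie_module \<Rightarrow> ('v \<Rightarrow> 'w) \<Rightarrow> bool"
  where "equivariant g M N \<phi> \<longleftrightarrow> lin_on (lm_carrier M) (lm_carrier N) \<phi> \<and>
    (\<forall>X\<in>la_carrier g. \<forall>v\<in>lm_carrier M. \<phi> (lm_act M X v) = lm_act N X (\<phi> v))"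

lemma equivariant_post:
  assumes M: "lie_module_on g M" and N: "lie_module_on g N" and \<phi>: "equivariant g M N \<phi>"
    and c: "c \<in> cochains g M u"
  shows "\<phi> \<circ> c \<in> cochains g N u" and "ce_diff g N (\<phi> \<circ> c) = \<phi> \<circ> ce_diff g M c"
proof -
  interpret M: lie_module_on g M by (rule M)
  interpret N: lie_module_on g N by (rule N)
  have f: "lin_on (lm_carrier M) (lm_carrier N) \<phi>" using \<phi> by (simp add: equivariant_def)
  have c': "c \<in> M.Alt u" using c by (simp add: cochains_def)
  show "\<phi> \<circ> c \<in> cochains g N u" unfolding cochains_def by (rule post_alt[OF c' f M.sub_mod])
  show "ce_diff g N (\<phi> \<circ> c) = \<phi> \<circ> ce_diff g M c"
    using \<phi> by (intro M.ce_diff_equivariant[OF N.sub_mod N.act_lin f c']) (auto simp: equivariant_def)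
qed

lemma equivariant_cohomology:
  assumes M: "lie_module_on g M" and N: "lie_module_on g N" and \<phi>: "equivariant g M N \<phi>"
  shows "lin_on (cocycles g M u) (cocycles g N u) (\<lambda>c. \<phi> \<circ> c)"
    and "c \<in> coboundaries g M u \<Longrightarrow> \<phi> \<circ> c \<in> coboundaries g N u"
proof -
  interpret M: lie_module_on g M by (rule M)
  note p = equivariant_post[OF M N \<phi>]
  have f: "lin_on (lm_carrier M) (lm_carrier N) \<phi>" using \<phi> by (simp add: equivariant_def)
  have f0: "\<phi> \<circ> 0 = 0" using lin_on_zero[OF f M.sub_mod] by (simp add: fun_eq_iff)
  show "lin_on (cocycles g M u) (cocycles g N u) (\<lambda>c. \<phi> \<circ> c)"
  proof (rule lin_onI)
    fix c assume "c \<in> cocycles g M u"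
    then show "\<phi> \<circ> c \<in> cocycles g N u" using p[of c u] f0 by (simp add: cocycles_def)
  next
    fix c c' and r s :: real assume "c \<in> cocycles g M u" "c' \<in> cocycles g M u"
    then have "c \<in> M.Alt u" "c' \<in> M.Alt u" by (simp_all add: cocycles_def cochains_def)
    note m = M.Alt_mem[OF this(1)] M.Alt_mem[OF this(2)]
    show "\<phi> \<circ> (r *\<^sub>R c + s *\<^sub>R c') = r *\<^sub>R (\<phi> \<circ> c) + s *\<^sub>R (\<phi> \<circ> c')"
      by (rule ext) (simp only: comp_apply plus_fun_apply scaleR_fun_apply lin_on_comb[OF f m])
  qed
  assume c: "c \<in> coboundaries g M u"
  show "\<phi> \<circ> c \<in> coboundaries g N u"
  proof (cases u)
    case 0
    then show ?thesis using c f0 by (simp add: coboundaries_def)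
  next
    case (Suc v)
    then obtain b where b: "b \<in> cochains g M v" "c = ce_diff g M b" using c by (auto simp: coboundaries_def)
    have "\<phi> \<circ> c = ce_diff g N (\<phi> \<circ> b)" unfolding b(2) by (rule p(2)[OF b(1), symmetric])
    then show ?thesis unfolding Suc coboundaries_def using p(1)[OF b(1)] by simp
  qed
qed

section \<open>Quotients and direct sums\<close>

definition coset :: "'a::real_vector set \<Rightarrow> 'a \<Rightarrow> 'a set"
  where "coset B z = {z + b | b. b \<in> B}"

text \<open>For \<open>F\<close> the composition with a coefficient map this is the map induced in cohomology.\<close>

definition coset_map :: "('a::real_vector \<Rightarrow> 'b::real_vector) \<Rightarrow> 'b set \<Rightarrow> 'a set \<Rightarrow> 'b set"
  where "coset_map F B C = {F c + b | c b. c \<in> C \<and> b \<in> B}"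

lemma quotient_carrier: "vs_carrier (quotient_vs Z B) = coset B ` Z" and quotient_zero: "vs_zero (quotient_vs Z B) = B"
  by (simp_all add: quotient_vs_def coset_def[abs_def])

lemma mem_coset: "w \<in> coset B z \<longleftrightarrow> w - z \<in> B"
  by (auto simp: coset_def) (metis add.commute diff_add_cancel)

lemma coset_eq_iff:
  assumes B: "subspace B"
  shows "coset B z = coset B w \<longleftrightarrow> z - w \<in> B"
proof
  assume "coset B z = coset B w"
  then have "z \<in> coset B w" using subspace_0[OF B] mem_coset[of z B z] by simp
  then show "z - w \<in> B" by (simp add: mem_coset)
next
  assume d: "z - w \<in> B"
  have "x - z \<in> B \<longleftrightarrow> x - w \<in> B" for x
    using subspace_add[OF B _ d, of "x - z"] subspace_diff[OF B _ d, of "x - w"] by auto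
  then show "coset B z = coset B w" by (auto simp: mem_coset)
qed

lemma coset_zero: "coset B 0 = B"
  by (simp add: coset_def)

lemma coset_eq_zero_iff: "subspace B \<Longrightarrow> coset B z = B \<longleftrightarrow> z \<in> B"
  using coset_eq_iff[of B z 0] by (simp add: coset_zero)

lemma coset_add:
  assumes B: "subspace B"
  shows "vs_add (quotient_vs Z B) (coset B z) (coset B w) = coset B (z + w)"
proof (intro set_eqI iffI)
  fix x assume "x \<in> vs_add (quotient_vs Z B) (coset B z) (coset B w)"
  then obtain b b' where "b \<in> B" "b' \<in> B" "x = (z + b) + (w + b')" by (auto simp: quotient_vs_def coset_def)
  then show "x \<in> coset B (z + w)" using subspace_add[OF B, of b b'] by (simp add: mem_coset algebra_simps)
next
  fix x assume "x \<in> coset B (z + w)"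
  then have "x = (x - w) + w" "x - w \<in> coset B z" "w \<in> coset B w" using subspace_0[OF B] by (simp_all add: mem_coset algebra_simps)
  then have "\<exists>c d. x = c + d \<and> c \<in> coset B z \<and> d \<in> coset B w" by blast
  then show "x \<in> vs_add (quotient_vs Z B) (coset B z) (coset B w)" by (simp add: quotient_vs_def)
qed

lemma coset_scale:
  assumes B: "subspace B"
  shows "vs_scale (quotient_vs Z B) r (coset B z) = coset B (r *\<^sub>R z)"
proof (intro set_eqI iffI)
  fix x assume "x \<in> vs_scale (quotient_vs Z B) r (coset B z)"
  then obtain b b' where "b \<in> B" "b' \<in> B" "x = r *\<^sub>R (z + b) + b'" by (auto simp: quotient_vs_def coset_def)
  then show "x \<in> coset B (r *\<^sub>R z)" using subspace_add[OF B subspace_scale[OF B, of b r], of b'] by (simp add: mem_coset algebra_simps)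
next
  fix x assume "x \<in> coset B (r *\<^sub>R z)"
  then have "x = r *\<^sub>R z + (x - r *\<^sub>R z)" "z \<in> coset B z" "x - r *\<^sub>R z \<in> B" using subspace_0[OF B] by (simp_all add: mem_coset)
  then have "\<exists>c b. x = r *\<^sub>R c + b \<and> c \<in> coset B z \<and> b \<in> B" by blast
  then show "x \<in> vs_scale (quotient_vs Z B) r (coset B z)" by (simp add: quotient_vs_def)
qed

lemma coset_map_coset:
  assumes F: "lin_on Z Z' F" and Z: "subspace Z" "B \<subseteq> Z" and B: "subspace B" and B': "subspace B'"
    and FB: "\<And>b. b \<in> B \<Longrightarrow> F b \<in> B'" and z: "z \<in> Z"
  shows "coset_map F B' (coset B z) = coset B' (F z)"
proof (intro set_eqI iffI)
  fix x assume "x \<in> coset_map F B' (coset B z)"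
  then obtain b b' where "b \<in> B" "b' \<in> B'" "x = F (z + b) + b'" by (auto simp: coset_map_def coset_def)
  moreover from this have "F (z + b) = F z + F b" using Z z by (intro lin_on_add[OF F]) auto
  ultimately show "x \<in> coset B' (F z)" using subspace_add[OF B' FB[of b], of b'] by (simp add: mem_coset algebra_simps)
next
  fix x assume "x \<in> coset B' (F z)"
  then have "x = F z + (x - F z)" "z \<in> coset B z" "x - F z \<in> B'" using subspace_0[OF B] by (simp_all add: mem_coset)
  then have "\<exists>c b. x = F c + b \<and> c \<in> coset B z \<and> b \<in> B'" by blast
  then show "x \<in> coset_map F B' (coset B z)" by (simp add: coset_map_def)
qed

locale quotient_morphism =
  fixes Z B :: "'a::real_vector set" and Z' B' :: "'b::real_vector set" and F
  assumes F: "lin_on Z Z' F" and Z: "subspace Z" "B \<subseteq> Z" and B: "subspace B" and B': "subspace B'"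
    and FB: "\<And>b. b \<in> B \<Longrightarrow> F b \<in> B'"
begin

lemma on_coset: "z \<in> Z \<Longrightarrow> coset_map F B' (coset B z) = coset B' (F z)"
  by (rule coset_map_coset[OF F Z B B']) (rule FB)

lemma linear: "linear_vs (quotient_vs Z B) (quotient_vs Z' B') (coset_map F B')"
  unfolding linear_vs_def quotient_carrier
proof (intro conjI ballI allI)
  show "coset_map F B' ` coset B ` Z \<subseteq> coset B' ` Z'" using lin_on_in[OF F] by (auto simp: on_coset)
  fix x r assume "x \<in> coset B ` Z"
  then obtain z where z: "z \<in> Z" "x = coset B z" by blast
  show "coset_map F B' (vs_scale (quotient_vs Z B) r x) = vs_scale (quotient_vs Z' B') r (coset_map F B' x)"
    unfolding z(2) coset_scale[OF B] on_coset[OF z(1)] on_coset[OF subspace_scale[OF Z(1) z(1)]] coset_scale[OF B']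
    by (simp add: lin_on_scale[OF F z(1)])
  fix y assume "y \<in> coset B ` Z"
  then obtain w where w: "w \<in> Z" "y = coset B w" by blast
  show "coset_map F B' (vs_add (quotient_vs Z B) x y) = vs_add (quotient_vs Z' B') (coset_map F B' x) (coset_map F B' y)"
    unfolding z(2) w(2) coset_add[OF B] on_coset[OF z(1)] on_coset[OF w(1)] on_coset[OF subspace_add[OF Z(1) z(1) w(1)]] coset_add[OF B']
    by (simp add: lin_on_add[OF F z(1) w(1)])
qed

lemma zero: "coset_map F B' B = B'"
  using on_coset[OF subspace_0[OF Z(1)]] by (simp add: coset_zero lin_on_zero[OF F Z(1)])

lemma injective:
  assumes "\<And>z. z \<in> Z \<Longrightarrow> F z \<in> B' \<Longrightarrow> z \<in> B"
  shows "inj_on (coset_map F B') (vs_carrier (quotient_vs Z B))"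
  unfolding quotient_carrier
proof (rule inj_onI)
  fix x y assume "x \<in> coset B ` Z" "y \<in> coset B ` Z" and eq: "coset_map F B' x = coset_map F B' y"
  then obtain z w where z: "z \<in> Z" "x = coset B z" and w: "w \<in> Z" "y = coset B w" by blast
  have "F (z - w) \<in> B'"
    using eq unfolding z(2) w(2) by (simp add: on_coset z(1) w(1) coset_eq_iff[OF B'] lin_on_diff[OF F])
  then show "x = y" using assms[of "z - w"] z w by (simp add: coset_eq_iff[OF B] subspace_diff[OF Z(1)])
qed

lemma image:
  "C \<in> coset_map F B' ` vs_carrier (quotient_vs Z B) \<longleftrightarrow> (\<exists>z\<in>Z. C = coset B' (F z))"
  unfolding quotient_carrier image_image using on_coset by (auto simp: image_iff)

lemma surjective:
  assumes "\<And>w. w \<in> Z' \<Longrightarrow> \<exists>z\<in>Z. w - F z \<in> B'"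
  shows "coset_map F B' ` vs_carrier (quotient_vs Z B) = vs_carrier (quotient_vs Z' B')"
proof (rule set_eqI)
  fix C
  show "C \<in> coset_map F B' ` vs_carrier (quotient_vs Z B) \<longleftrightarrow> C \<in> vs_carrier (quotient_vs Z' B')"
    unfolding image unfolding quotient_carrier using assms lin_on_in[OF F] by (auto simp: coset_eq_iff[OF B'])
qed

end

text \<open>Any representative may be used to apply \<open>L\<close> to a coset, since \<open>L\<close> vanishes on \<open>B\<close>.\<close>

lemma quotient_iso_subspace:
  assumes L: "lin_on Z S L" and Z: "subspace Z" "B \<subseteq> Z" and B: "subspace B"
    and surj: "\<And>s. s \<in> S \<Longrightarrow> \<exists>z\<in>Z. L z = s" and ker: "\<And>z. z \<in> Z \<Longrightarrow> L z = 0 \<longleftrightarrow> z \<in> B"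
  shows "iso_map_vs (quotient_vs Z B) (subspace_vs S) (\<lambda>C. L (SOME z. z \<in> C))"
    and "L (SOME z. z \<in> B) = 0"
proof -
  have e: "L (SOME w. w \<in> coset B z) = L z" if z: "z \<in> Z" for z
  proof -
    have "z \<in> coset B z" using subspace_0[OF B] by (simp add: mem_coset)
    then have d: "(SOME w. w \<in> coset B z) - z \<in> B" (is "?w - z \<in> B") unfolding mem_coset[symmetric] by (rule someI)
    have "?w - z + z \<in> Z" using d Z z by (intro subspace_add[OF Z(1)]) auto
    then have w: "?w \<in> Z" by simp
    have "L (?w - z) = 0" using ker[of "?w - z"] d Z(2) by blast
    then show ?thesis using lin_on_diff[OF L w z] by simp
  qed
  let ?f = "\<lambda>C. L (SOME z. z \<in> C)"
  show "?f B = 0" using e[OF subspace_0[OF Z(1)]] lin_on_zero[OF L Z(1)] by (simp add: coset_zero)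
  have "linear_vs (quotient_vs Z B) (subspace_vs S) ?f"
    unfolding linear_vs_def quotient_carrier
    by (auto simp: subspace_vs_def coset_add[OF B] coset_scale[OF B] e lin_on_in[OF L] lin_on_add[OF L] lin_on_scale[OF L]
        subspace_add[OF Z(1)] subspace_scale[OF Z(1)])
  moreover have "bij_betw ?f (coset B ` Z) S"
  proof (rule bij_betw_imageI)
    show "inj_on ?f (coset B ` Z)"
    proof (rule inj_onI)
      fix x y assume "x \<in> coset B ` Z" "y \<in> coset B ` Z" and eq: "?f x = ?f y"
      then obtain z w where z: "z \<in> Z" "x = coset B z" and w: "w \<in> Z" "y = coset B w" by blast
      have "L (z - w) = 0" using eq z w by (simp add: e lin_on_diff[OF L])
      then show "x = y" using ker[of "z - w"] z w by (simp add: coset_eq_iff[OF B] subspace_diff[OF Z(1)])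
    qed
    show "?f ` coset B ` Z = S"
    proof
      show "?f ` coset B ` Z \<subseteq> S" by (auto simp: e lin_on_in[OF L])
      show "S \<subseteq> ?f ` coset B ` Z"
      proof
        fix s assume "s \<in> S"
        then obtain z where "z \<in> Z" "L z = s" using surj by blast
        then show "s \<in> ?f ` coset B ` Z" using e by (intro image_eqI[of _ _ "coset B z"]) auto
      qed
    qed
  qed
  ultimately show "iso_map_vs (quotient_vs Z B) (subspace_vs S) ?f"
    by (simp add: iso_map_vs_def quotient_carrier) (simp add: subspace_vs_def)
qed

lemma direct_sum_simps:
  "h \<in> vs_carrier (direct_sum_vs V) \<longleftrightarrow> (\<forall>u. h u \<in> vs_carrier (V u)) \<and> finite {u. h u \<noteq> vs_zero (V u)}"
  "vs_zero (direct_sum_vs V) = (\<lambda>u. vs_zero (V u))"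
  "vs_add (direct_sum_vs V) h k = (\<lambda>u. vs_add (V u) (h u) (k u))"
  "vs_scale (direct_sum_vs V) r h = (\<lambda>u. vs_scale (V u) r (h u))"
  by (simp_all add: direct_sum_vs_def)

lemma finite_support_map:
  assumes "finite {u. h u \<noteq> z u}" and "\<And>b :: nat. h (b + s) = z (b + s) \<Longrightarrow> k b = z' b"
  shows "finite {b. k b \<noteq> z' b}"
proof -
  have "(\<lambda>b. b + s) ` {b. k b \<noteq> z' b} \<subseteq> {u. h u \<noteq> z u}" using assms(2) by auto
  then have "finite ((\<lambda>b. b + s) ` {b. k b \<noteq> z' b})" using assms(1) by (rule finite_subset)
  then show ?thesis by (rule finite_imageD) (simp add: inj_on_def)
qed

text \<open>The shift \<open>s\<close> accounts for isomorphisms that lower the degree of cohomology.\<close>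

lemma direct_sum_linear:
  assumes f: "\<And>b. linear_vs (V (b + s)) (U b) (f b)" and f0: "\<And>b. f b (vs_zero (V (b + s))) = vs_zero (U b)"
  shows "linear_vs (direct_sum_vs V) (direct_sum_vs U) (\<lambda>h b. f b (h (b + s)))"
proof -
  have "finite {b. f b (h (b + s)) \<noteq> vs_zero (U b)}" if "finite {u. h u \<noteq> vs_zero (V u)}" for h
    by (rule finite_support_map[OF that, of s]) (simp add: f0)
  then show ?thesis
    unfolding linear_vs_def using f unfolding linear_vs_def by (auto simp: direct_sum_simps subset_iff)
qed

text \<open>Preimages can be chosen to vanish where the given element vanishes, and so have finite support.\<close>

lemma direct_sum_preimage:
  assumes w: "w \<in> vs_carrier (direct_sum_vs U)" and f0: "\<And>b. f b (vs_zero (V (b + s))) = vs_zero (U b)"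
    and pre: "\<And>b. w b \<in> f b ` vs_carrier (V (b + s))" and z: "\<And>u. vs_zero (V u) \<in> vs_carrier (V u)"
  shows "\<exists>h\<in>vs_carrier (direct_sum_vs V). (\<lambda>b. f b (h (b + s))) = w"
proof -
  from pre obtain x where x: "\<And>b. x b \<in> vs_carrier (V (b + s))" "\<And>b. f b (x b) = w b" unfolding image_iff by metis
  let ?h = "\<lambda>u. if s \<le> u \<and> w (u - s) \<noteq> vs_zero (U (u - s)) then x (u - s) else vs_zero (V u)"
  have "?h u \<in> vs_carrier (V u)" for u using x(1)[of "u - s"] z by auto
  moreover have "{u. ?h u \<noteq> vs_zero (V u)} \<subseteq> (\<lambda>b. b + s) ` {b. w b \<noteq> vs_zero (U b)}"
    by (auto simp: image_iff split: if_splits) (metis le_add_diff_inverse2)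
  then have "finite {u. ?h u \<noteq> vs_zero (V u)}"
    using w by (rule_tac finite_subset) (auto simp: direct_sum_simps)
  moreover have "(\<lambda>b. f b (?h (b + s))) = w" using x(2) f0 by (auto simp: fun_eq_iff)
  ultimately show ?thesis by (intro bexI[of _ ?h]) (simp_all only: direct_sum_simps simp_thms)
qed

lemma direct_sum_short_exact:
  assumes ex: "\<And>u. short_exact_vs (U u) (f u) (V u) (g u) (W u)"
    and f0: "\<And>u. f u (vs_zero (U u)) = vs_zero (V u)" and g0: "\<And>u. g u (vs_zero (V u)) = vs_zero (W u)"
    and zU: "\<And>u. vs_zero (U u) \<in> vs_carrier (U u)" and zV: "\<And>u. vs_zero (V u) \<in> vs_carrier (V u)"
  shows "short_exact_vs (direct_sum_vs U) (\<lambda>h u. f u (h u)) (direct_sum_vs V) (\<lambda>h u. g u (h u)) (direct_sum_vs W)"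
proof -
  have lf: "linear_vs (direct_sum_vs U) (direct_sum_vs V) (\<lambda>h u. f u (h u))"
    using direct_sum_linear[of U 0 V f] ex f0 by (simp add: short_exact_vs_def)
  have lg: "linear_vs (direct_sum_vs V) (direct_sum_vs W) (\<lambda>h u. g u (h u))"
    using direct_sum_linear[of V 0 W g] ex g0 by (simp add: short_exact_vs_def)
  have "inj_on (\<lambda>h u. f u (h u)) (vs_carrier (direct_sum_vs U))"
  proof (rule inj_onI)
    fix h k assume h: "h \<in> vs_carrier (direct_sum_vs U)" "k \<in> vs_carrier (direct_sum_vs U)" and eq: "(\<lambda>u. f u (h u)) = (\<lambda>u. f u (k u))"
    have "h u = k u" for u
      using h fun_cong[OF eq, of u] ex[of u] by (auto simp: direct_sum_simps short_exact_vs_def inj_on_def)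
    then show "h = k" by (rule ext)
  qed
  moreover have "(\<lambda>h u. f u (h u)) ` vs_carrier (direct_sum_vs U) = {v \<in> vs_carrier (direct_sum_vs V). (\<lambda>u. g u (v u)) = vs_zero (direct_sum_vs W)}"
    (is "?L = ?R")
  proof
    have "g u (f u (h u)) = vs_zero (W u)" if "h \<in> vs_carrier (direct_sum_vs U)" for h u
      using that ex[of u] by (auto simp: direct_sum_simps short_exact_vs_def)
    then show "?L \<subseteq> ?R" using lf by (auto simp: linear_vs_def direct_sum_simps(2))
    show "?R \<subseteq> ?L"
    proof
      fix v assume v: "v \<in> ?R"
      then have "g u (v u) = vs_zero (W u)" "v u \<in> vs_carrier (V u)" for u by (auto simp: direct_sum_simps dest: fun_cong)
      then have "v u \<in> f u ` vs_carrier (U u)" for u using ex[of u] by (auto simp: short_exact_vs_def)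
      then have "\<exists>h\<in>vs_carrier (direct_sum_vs U). (\<lambda>u. f u (h u)) = v"
        using direct_sum_preimage[of v V f U 0] v f0 zU by simp
      then show "v \<in> ?L" by blast
    qed
  qed
  moreover have "(\<lambda>h u. g u (h u)) ` vs_carrier (direct_sum_vs V) = vs_carrier (direct_sum_vs W)"
  proof
    show "(\<lambda>h u. g u (h u)) ` vs_carrier (direct_sum_vs V) \<subseteq> vs_carrier (direct_sum_vs W)" using lg by (simp add: linear_vs_def)
    show "vs_carrier (direct_sum_vs W) \<subseteq> (\<lambda>h u. g u (h u)) ` vs_carrier (direct_sum_vs V)"
    proof
      fix w assume w: "w \<in> vs_carrier (direct_sum_vs W)"
      then have "w u \<in> g u ` vs_carrier (V u)" for u using ex[of u] by (auto simp: direct_sum_simps short_exact_vs_def)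
      then have "\<exists>h\<in>vs_carrier (direct_sum_vs V). (\<lambda>u. g u (h u)) = w"
        using direct_sum_preimage[of w W g V 0] w g0 zV by simp
      then show "w \<in> (\<lambda>h u. g u (h u)) ` vs_carrier (direct_sum_vs V)" by blast
    qed
  qed
  ultimately show ?thesis using lf lg unfolding short_exact_vs_def by blast
qed

lemma direct_sum_iso:
  assumes iso: "\<And>b. iso_map_vs (V (b + s)) (U b) (f b)" and f0: "\<And>b. f b (vs_zero (V (b + s))) = vs_zero (U b)"
    and z: "\<And>u. vs_zero (V u) \<in> vs_carrier (V u)" and low: "\<And>u. u < s \<Longrightarrow> vs_carrier (V u) = {vs_zero (V u)}"
  shows "iso_map_vs (direct_sum_vs V) (direct_sum_vs U) (\<lambda>h b. f b (h (b + s)))"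
proof -
  have lf: "linear_vs (direct_sum_vs V) (direct_sum_vs U) (\<lambda>h b. f b (h (b + s)))"
    using iso f0 by (intro direct_sum_linear) (simp_all add: iso_map_vs_def)
  have "inj_on (\<lambda>h b. f b (h (b + s))) (vs_carrier (direct_sum_vs V))"
  proof (rule inj_onI)
    fix h k assume h: "h \<in> vs_carrier (direct_sum_vs V)" "k \<in> vs_carrier (direct_sum_vs V)"
      and eq: "(\<lambda>b. f b (h (b + s))) = (\<lambda>b. f b (k (b + s)))"
    have "h u = k u" for u
    proof (cases "u < s")
      case True
      then have "h u \<in> {vs_zero (V u)}" "k u \<in> {vs_zero (V u)}"
        unfolding low[OF True, symmetric] using h by (simp_all add: direct_sum_simps)
      then show ?thesis by simp
    next
      case False
      then have u: "u = (u - s) + s" by simp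
      show ?thesis
        using h fun_cong[OF eq, of "u - s"] iso[of "u - s"] u by (auto simp: direct_sum_simps iso_map_vs_def bij_betw_def inj_on_def)
    qed
    then show "h = k" by (rule ext)
  qed
  moreover have "(\<lambda>h b. f b (h (b + s))) ` vs_carrier (direct_sum_vs V) = vs_carrier (direct_sum_vs U)"
  proof
    show "(\<lambda>h b. f b (h (b + s))) ` vs_carrier (direct_sum_vs V) \<subseteq> vs_carrier (direct_sum_vs U)" using lf by (simp add: linear_vs_def)
    show "vs_carrier (direct_sum_vs U) \<subseteq> (\<lambda>h b. f b (h (b + s))) ` vs_carrier (direct_sum_vs V)"
    proof
      fix w assume w: "w \<in> vs_carrier (direct_sum_vs U)"
      then have "w b \<in> f b ` vs_carrier (V (b + s))" for b
        using iso[of b] by (auto simp: direct_sum_simps iso_map_vs_def bij_betw_def)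
      then have "\<exists>h\<in>vs_carrier (direct_sum_vs V). (\<lambda>b. f b (h (b + s))) = w"
        using direct_sum_preimage[of w U f V s] w f0 z by simp
      then show "w \<in> (\<lambda>h b. f b (h (b + s))) ` vs_carrier (direct_sum_vs V)" by blast
    qed
  qed
  ultimately show ?thesis using lf unfolding iso_map_vs_def bij_betw_def by blast
qed

section \<open>Cohomology of split extensions and of isomorphic complexes\<close>

lemma induced_map_eq: "induced_map g N \<phi> = (\<lambda>h u. coset_map (\<lambda>c. \<phi> \<circ> c) (coboundaries g N u) (h u))"
  by (simp add: induced_map_def coset_map_def fun_eq_iff)

lemma equivariant_morphism:
  assumes M: "lie_module_on g M" and N: "lie_module_on g N" and \<phi>: "equivariant g M N \<phi>"
  shows "quotient_morphism (cocycles g M u) (coboundaries g M u) (cocycles g N u) (coboundaries g N u) (\<lambda>c. \<phi> \<circ> c)"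
proof
  show "lin_on (cocycles g M u) (cocycles g N u) (\<lambda>c. \<phi> \<circ> c)" by (rule equivariant_cohomology(1)[OF M N \<phi>])
  show "\<phi> \<circ> c \<in> coboundaries g N u" if "c \<in> coboundaries g M u" for c by (rule equivariant_cohomology(2)[OF M N \<phi> that])
qed (rule lie_module_on.subspace_cocycles[OF M] lie_module_on.coboundaries_cocycles[OF M]
      lie_module_on.subspace_coboundaries[OF M] lie_module_on.subspace_coboundaries[OF N])+

lemma (in lie_module_on) cohomology_zero:
  "vs_zero (cohomology_deg g M u) = coboundaries g M u"
  "coboundaries g M u \<in> vs_carrier (cohomology_deg g M u)"
  using subspace_0[OF subspace_cocycles[of u]] coset_zero[of "coboundaries g M u"]
  unfolding cohomology_deg_def quotient_carrier quotient_zero by (auto intro: rev_image_eqI)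

text \<open>The splitting maps are equivariant and so act on cocycles and coboundaries themselves; exactness can
  be checked in each degree without a connecting map.\<close>

lemma split_short_exact:
  fixes M1 :: "('g::real_vector, 'u::real_vector) lie_module" and M2 :: "('g, 'v::real_vector) lie_module"
    and M3 :: "('g, 'w::real_vector) lie_module"
  assumes M: "lie_module_on g M1" "lie_module_on g M2" "lie_module_on g M3"
    and i: "equivariant g M1 M2 i" and p: "equivariant g M2 M3 p"
    and q: "equivariant g M2 M1 q" and j: "equivariant g M3 M2 j"
    and qi: "\<And>v. v \<in> lm_carrier M1 \<Longrightarrow> q (i v) = v" and pj: "\<And>v. v \<in> lm_carrier M3 \<Longrightarrow> p (j v) = v"
    and pi: "\<And>v. v \<in> lm_carrier M1 \<Longrightarrow> p (i v) = 0" and ij: "\<And>v. v \<in> lm_carrier M2 \<Longrightarrow> i (q v) + j (p v) = v"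
  shows "short_exact_vs (cohomology g M1) (induced_map g M2 i) (cohomology g M2) (induced_map g M3 p) (cohomology g M3)"
proof -
  interpret M1: lie_module_on g M1 by (rule M)
  interpret M2: lie_module_on g M2 by (rule M)
  interpret M3: lie_module_on g M3 by (rule M)
  have m1: "c xs \<in> lm_carrier M1" if "c \<in> cocycles g M1 u" for c u xs
    using that M1.Alt_mem by (auto simp: cocycles_def cochains_def)
  have m2: "c xs \<in> lm_carrier M2" if "c \<in> cocycles g M2 u" for c u xs
    using that M2.Alt_mem by (auto simp: cocycles_def cochains_def)
  have m3: "c xs \<in> lm_carrier M3" if "c \<in> cocycles g M3 u" for c u xs
    using that M3.Alt_mem by (auto simp: cocycles_def cochains_def)
  note q' = equivariant_cohomology[OF M(2,1) q] and j' = equivariant_cohomology[OF M(3,2) j]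
  note p' = equivariant_cohomology[OF M(2,3) p]
  let ?f = "\<lambda>u. coset_map (\<lambda>c. i \<circ> c) (coboundaries g M2 u)" and ?g = "\<lambda>u. coset_map (\<lambda>c. p \<circ> c) (coboundaries g M3 u)"
  have "short_exact_vs (cohomology_deg g M1 u) (?f u) (cohomology_deg g M2 u) (?g u) (cohomology_deg g M3 u)" for u
  proof -
    interpret I: quotient_morphism "cocycles g M1 u" "coboundaries g M1 u" "cocycles g M2 u" "coboundaries g M2 u" "\<lambda>c. i \<circ> c"
      by (rule equivariant_morphism[OF M(1,2) i])
    interpret P: quotient_morphism "cocycles g M2 u" "coboundaries g M2 u" "cocycles g M3 u" "coboundaries g M3 u" "\<lambda>c. p \<circ> c"
      by (rule equivariant_morphism[OF M(2,3) p])
    have inj: "inj_on (?f u) (vs_carrier (cohomology_deg g M1 u))"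
      unfolding cohomology_deg_def
    proof (rule I.injective)
      fix c assume c: "c \<in> cocycles g M1 u" and b: "i \<circ> c \<in> coboundaries g M2 u"
      have "q \<circ> (i \<circ> c) = c" using qi m1[OF c] by (simp add: fun_eq_iff)
      then show "c \<in> coboundaries g M1 u" using q'(2)[OF b] by simp
    qed
    have sur: "?g u ` vs_carrier (cohomology_deg g M2 u) = vs_carrier (cohomology_deg g M3 u)"
      unfolding cohomology_deg_def
    proof (rule P.surjective)
      fix c assume c: "c \<in> cocycles g M3 u"
      have "p \<circ> (j \<circ> c) = c" using pj m3[OF c] by (simp add: fun_eq_iff)
      then have "c - (p \<circ> (j \<circ> c)) \<in> coboundaries g M3 u" using subspace_0[OF M3.subspace_coboundaries] by simp
      then show "\<exists>z\<in>cocycles g M2 u. c - (p \<circ> z) \<in> coboundaries g M3 u" using lin_on_in[OF j'(1) c] by blast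
    qed
    have ker: "(\<exists>z\<in>cocycles g M1 u. coset (coboundaries g M2 u) c = coset (coboundaries g M2 u) (i \<circ> z)) \<longleftrightarrow>
        p \<circ> c \<in> coboundaries g M3 u" if c: "c \<in> cocycles g M2 u" for c
      unfolding coset_eq_iff[OF M2.subspace_coboundaries]
    proof
      assume "\<exists>z\<in>cocycles g M1 u. c - (i \<circ> z) \<in> coboundaries g M2 u"
      then obtain z where z: "z \<in> cocycles g M1 u" and d: "c - (i \<circ> z) \<in> coboundaries g M2 u" by blast
      have "p \<circ> (i \<circ> z) = 0" using pi m1[OF z] by (simp add: fun_eq_iff)
      moreover have "p \<circ> (c - (i \<circ> z)) = (p \<circ> c) - (p \<circ> (i \<circ> z))"
        by (rule lin_on_diff[OF p'(1) c lin_on_in[OF I.F z]])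
      ultimately show "p \<circ> c \<in> coboundaries g M3 u" using p'(2)[OF d] by simp
    next
      assume b: "p \<circ> c \<in> coboundaries g M3 u"
      have "c - (i \<circ> (q \<circ> c)) = j \<circ> (p \<circ> c)"
      proof
        fix xs
        show "(c - (i \<circ> (q \<circ> c))) xs = (j \<circ> (p \<circ> c)) xs"
          using ij[OF m2[OF c, of xs]] by (simp only: minus_apply comp_apply) (metis add_diff_cancel_left')
      qed
      then have "c - (i \<circ> (q \<circ> c)) \<in> coboundaries g M2 u" using j'(2)[OF b] by simp
      then show "\<exists>z\<in>cocycles g M1 u. c - (i \<circ> z) \<in> coboundaries g M2 u" using lin_on_in[OF q'(1) c] by blast
    qed
    have img: "?f u ` vs_carrier (cohomology_deg g M1 u) =
        {v \<in> vs_carrier (cohomology_deg g M2 u). ?g u v = vs_zero (cohomology_deg g M3 u)}"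
    proof (rule set_eqI)
      fix C
      show "C \<in> ?f u ` vs_carrier (cohomology_deg g M1 u) \<longleftrightarrow>
          C \<in> {v \<in> vs_carrier (cohomology_deg g M2 u). ?g u v = vs_zero (cohomology_deg g M3 u)}"
      proof (cases "\<exists>c\<in>cocycles g M2 u. C = coset (coboundaries g M2 u) c")
        case True
        then obtain c where c: "c \<in> cocycles g M2 u" "C = coset (coboundaries g M2 u) c" by blast
        have "?g u C = coboundaries g M3 u \<longleftrightarrow> p \<circ> c \<in> coboundaries g M3 u"
          unfolding c(2) P.on_coset[OF c(1)] by (rule coset_eq_zero_iff[OF M3.subspace_coboundaries])
        then show ?thesis
          unfolding cohomology_deg_def I.image unfolding quotient_carrier quotient_zero using c ker[OF c(1)] by auto
      next
        case False
        then show ?thesis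
          unfolding cohomology_deg_def I.image unfolding quotient_carrier using lin_on_in[OF I.F] by blast
      qed
    qed
    show ?thesis
      unfolding short_exact_vs_def
      using I.linear P.linear inj sur img unfolding cohomology_deg_def by blast
  qed
  moreover have "?f u (vs_zero (cohomology_deg g M1 u)) = vs_zero (cohomology_deg g M2 u)" for u
    unfolding M1.cohomology_zero M2.cohomology_zero by (rule quotient_morphism.zero[OF equivariant_morphism[OF M(1,2) i]])
  moreover have "?g u (vs_zero (cohomology_deg g M2 u)) = vs_zero (cohomology_deg g M3 u)" for u
    unfolding M2.cohomology_zero M3.cohomology_zero by (rule quotient_morphism.zero[OF equivariant_morphism[OF M(2,3) p]])
  ultimately show ?thesis
    unfolding cohomology_def induced_map_eq
    by (rule direct_sum_short_exact) (simp_all add: M1.cohomology_zero M2.cohomology_zero)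
qed

lemma equivariant_iso:
  assumes M: "lie_module_on g M" and N: "lie_module_on g N" and \<phi>: "equivariant g M N \<phi>"
    and inj: "\<And>u c. c \<in> cocycles g M u \<Longrightarrow> \<phi> \<circ> c \<in> coboundaries g N u \<Longrightarrow> c \<in> coboundaries g M u"
    and sur: "\<And>u c. c \<in> cocycles g N u \<Longrightarrow> \<exists>z\<in>cocycles g M u. c - (\<phi> \<circ> z) \<in> coboundaries g N u"
  shows "iso_map_vs (cohomology g M) (cohomology g N) (induced_map g N \<phi>)"
proof -
  interpret M: lie_module_on g M by (rule M)
  interpret N: lie_module_on g N by (rule N)
  let ?f = "\<lambda>u. coset_map (\<lambda>c. \<phi> \<circ> c) (coboundaries g N u)"
  have "iso_map_vs (cohomology_deg g M (u + 0)) (cohomology_deg g N u) (?f u)" for u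
  proof -
    interpret I: quotient_morphism "cocycles g M u" "coboundaries g M u" "cocycles g N u" "coboundaries g N u" "\<lambda>c. \<phi> \<circ> c"
      by (rule equivariant_morphism[OF M N \<phi>])
    show ?thesis
      unfolding iso_map_vs_def bij_betw_def cohomology_deg_def
      using I.linear I.injective[OF inj] I.surjective[OF sur] by simp
  qed
  moreover have "?f u (vs_zero (cohomology_deg g M (u + 0))) = vs_zero (cohomology_deg g N u)" for u
    unfolding M.cohomology_zero N.cohomology_zero add_0_right by (rule quotient_morphism.zero[OF equivariant_morphism[OF M N \<phi>]])
  ultimately have "iso_map_vs (direct_sum_vs (cohomology_deg g M)) (direct_sum_vs (cohomology_deg g N)) (\<lambda>h u. ?f u (h (u + 0)))"
    by (rule direct_sum_iso) (simp_all add: M.cohomology_zero)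
  then show ?thesis unfolding cohomology_def induced_map_eq by simp
qed

lemma cohomology_iso_gl_inv:
  fixes M :: "('m::finite vector_field, 'w::real_vector) lie_module"
    and L :: "nat \<Rightarrow> ('m vector_field list \<Rightarrow> 'w) \<Rightarrow> (real^'m^'m) list \<Rightarrow> real"
  assumes M: "lie_module_on sl_proj M"
    and L: "\<And>b. lin_on (cocycles sl_proj M (b + s)) (gl_inv_forms_deg b) (L b)"
    and surj: "\<And>b \<psi>. \<psi> \<in> gl_inv_forms_deg b \<Longrightarrow> \<exists>z\<in>cocycles sl_proj M (b + s). L b z = \<psi>"
    and ker: "\<And>b z. z \<in> cocycles sl_proj M (b + s) \<Longrightarrow> L b z = 0 \<longleftrightarrow> z \<in> coboundaries sl_proj M (b + s)"
    and low: "\<And>u c. u < s \<Longrightarrow> c \<in> cocycles sl_proj M u \<Longrightarrow> c \<in> coboundaries sl_proj M u"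
  shows "isomorphic_vs (H_sl M) (gl_inv_forms :: (nat \<Rightarrow> (real^'m^'m) list \<Rightarrow> real) vspace)"
proof -
  interpret M: lie_module_on sl_proj M by (rule M)
  let ?f = "\<lambda>b C. L b (SOME z. z \<in> C)"
  note iso = quotient_iso_subspace[OF L M.subspace_cocycles M.coboundaries_cocycles M.subspace_coboundaries surj ker]
  have "iso_map_vs (direct_sum_vs (cohomology_deg sl_proj M)) (direct_sum_vs (\<lambda>b. subspace_vs (gl_inv_forms_deg b)))
      (\<lambda>h b. ?f b (h (b + s)))"
  proof (rule direct_sum_iso)
    show "iso_map_vs (cohomology_deg sl_proj M (b + s)) (subspace_vs (gl_inv_forms_deg b)) (?f b)" for b
      unfolding cohomology_deg_def by (rule iso(1))
    show "?f b (vs_zero (cohomology_deg sl_proj M (b + s))) = vs_zero (subspace_vs (gl_inv_forms_deg b))" for b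
      unfolding M.cohomology_zero using iso(2) by (simp add: subspace_vs_def)
    show "vs_zero (cohomology_deg sl_proj M u) \<in> vs_carrier (cohomology_deg sl_proj M u)" for u
      by (simp add: M.cohomology_zero)
    show "vs_carrier (cohomology_deg sl_proj M u) = {vs_zero (cohomology_deg sl_proj M u)}" if "u < s" for u
    proof -
      have "coset (coboundaries sl_proj M u) c = coboundaries sl_proj M u" if "c \<in> cocycles sl_proj M u" for c
        using low[OF \<open>u < s\<close> that] by (simp add: coset_eq_zero_iff[OF M.subspace_coboundaries])
      then show ?thesis
        using M.cohomology_zero[of u] unfolding cohomology_deg_def quotient_carrier quotient_zero by auto
    qed
  qed
  then show ?thesis unfolding isomorphic_vs_def cohomology_def gl_inv_forms_def by blast
qed

section \<open>The cohomology of densities, symbols and operators\<close>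

lemma D_ord_0_iso:
  "isomorphic_vs (H_sl (D_ord 0 1 0 :: ('m::finite vector_field, 'm operator) lie_module))
    (gl_inv_forms :: (nat \<Rightarrow> (real^'m^'m) list \<Rightarrow> real) vspace)"
proof -
  let ?D = "D_ord 0 1 0 :: ('m vector_field, 'm operator) lie_module"
  let ?F = "dens_module 1 :: ('m vector_field, 'm scalar_field) lie_module"
  let ?\<phi> = "\<lambda>A :: 'm operator. A (\<lambda>x. 1)" and ?\<psi> = "\<lambda>a :: 'm scalar_field. term_op a []"
  have \<phi>: "equivariant sl_proj ?D ?F ?\<phi>"
    unfolding equivariant_def D_ord_simps dens_carrier dens_act diff_ops_0
    by (auto intro!: lin_onI simp: op_act_term sl_smooth)
  have \<psi>: "equivariant sl_proj ?F ?D ?\<psi>"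
    unfolding equivariant_def D_ord_simps dens_carrier dens_act
    by (auto intro!: lin_onI term_op_in simp: op_act_term sl_smooth term_op_comb')
  note p = equivariant_cohomology[OF D_ord_module dens_module \<phi>] and q = equivariant_cohomology[OF dens_module D_ord_module \<psi>]
  have \<phi>\<psi>: "?\<phi> \<circ> (?\<psi> \<circ> c) = c" for c :: "'m vector_field list \<Rightarrow> 'm scalar_field" by (simp add: fun_eq_iff)
  have \<psi>\<phi>: "?\<psi> \<circ> (?\<phi> \<circ> c) = c" if "c \<in> cocycles sl_proj ?D u" for c u
  proof
    fix xs
    have "c xs \<in> diff_ops 0"
      using that lie_module_on.Alt_mem[OF D_ord_module] by (auto simp: cocycles_def cochains_def D_ord_simps)
    then show "(?\<psi> \<circ> (?\<phi> \<circ> c)) xs = c xs" unfolding diff_ops_0 by auto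
  qed
  have iff: "?\<phi> \<circ> c \<in> coboundaries sl_proj ?F u \<longleftrightarrow> c \<in> coboundaries sl_proj ?D u" if "c \<in> cocycles sl_proj ?D u" for c u
    using p(2)[of c u] q(2)[of "?\<phi> \<circ> c" u] \<psi>\<phi>[OF that] by auto
  show ?thesis
  proof (rule cohomology_iso_gl_inv[where s = "CARD('m)" and L = "\<lambda>b c. dens_class b (?\<phi> \<circ> c)", OF D_ord_module])
    show "lin_on (cocycles sl_proj ?D (b + CARD('m))) (gl_inv_forms_deg b) (\<lambda>c. dens_class b (?\<phi> \<circ> c))" for b
      by (rule lin_on_compose[OF p(1) dens_class_lin])
    fix b and \<omega> :: "(real^'m^'m) list \<Rightarrow> real" assume "\<omega> \<in> gl_inv_forms_deg b"
    then obtain c where c: "c \<in> dens_cocycles (b + CARD('m))" "dens_class b c = \<omega>" using dens_class_surj by blast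
    then show "\<exists>z\<in>cocycles sl_proj ?D (b + CARD('m)). dens_class b (?\<phi> \<circ> z) = \<omega>"
      using lin_on_in[OF q(1) c(1)] \<phi>\<psi>[of c] by (intro bexI[of _ "?\<psi> \<circ> c"]) simp_all
  next
    fix b c assume c: "c \<in> cocycles sl_proj ?D (b + CARD('m))"
    show "dens_class b (?\<phi> \<circ> c) = 0 \<longleftrightarrow> c \<in> coboundaries sl_proj ?D (b + CARD('m))"
      unfolding dens_class_zero_iff[OF lin_on_in[OF p(1) c]] by (rule iff[OF c])
  next
    fix u c assume u: "u < CARD('m)" and c: "c \<in> cocycles sl_proj ?D u"
    show "c \<in> coboundaries sl_proj ?D u"
      using dens_low_degree[OF lin_on_in[OF p(1) c] u] iff[OF c] by simp
  qed
qed

text \<open>The connecting map of the acyclic extension is an isomorphism in cohomology; this transfers the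
  result for densities to symbols, with the shift of degree reduced by one.\<close>

lemma connecting_cocycle:
  fixes p :: "'m::finite vector_field list \<Rightarrow> 'm vector_field"
  shows "lin_on (cocycles sl_proj (S1_module 1) u) (dens_cocycles (Suc u)) (connecting :: _ \<Rightarrow> 'm vector_field list \<Rightarrow> _)"
    and "p \<in> cocycles sl_proj (S1_module 1) u \<Longrightarrow>
      connecting p \<in> coboundaries sl_proj (dens_module 1) (Suc u) \<longleftrightarrow> p \<in> coboundaries sl_proj (S1_module 1) u"
proof -
  interpret S: lie_module_on sl_proj "S1_module 1 :: ('m vector_field, _) lie_module" by (rule S1_module)
  have Z: "p \<in> alt_forms sl_carrier {P. smooth_vf P} u" "ce_diff sl_proj (S1_module 1) p = 0"
    if "p \<in> cocycles sl_proj (S1_module 1) u" for p :: "'m vector_field list \<Rightarrow> 'm vector_field" and u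
    using that by (simp_all add: cocycles_def cochains_def)
  show "lin_on (cocycles sl_proj (S1_module 1) u) (dens_cocycles (Suc u)) (connecting :: _ \<Rightarrow> 'm vector_field list \<Rightarrow> _)"
  proof (rule lin_onI)
    fix p :: "'m vector_field list \<Rightarrow> 'm vector_field" assume p: "p \<in> cocycles sl_proj (S1_module 1) u"
    show "connecting p \<in> dens_cocycles (Suc u)"
      using connecting_alt[OF Z(1)[OF p]] connecting_diff[OF Z(1)[OF p]] Z(2)[OF p] connecting_zero
      by (simp add: cocycles_def cochains_def)
    fix p' :: "'m vector_field list \<Rightarrow> 'm vector_field" and r s :: real
    show "connecting (r *\<^sub>R p + s *\<^sub>R p') = r *\<^sub>R connecting p + s *\<^sub>R connecting p'"
      by (rule ext) (simp add: wedge_def div_cocycle_def deriv_along_comb_left fun_eq_iff sum.distrib sum_distrib_left algebra_simps)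
  qed
  assume p: "p \<in> cocycles sl_proj (S1_module 1) u"
  show "connecting p \<in> coboundaries sl_proj (dens_module 1) (Suc u) \<longleftrightarrow> p \<in> coboundaries sl_proj (S1_module 1) u"
  proof
    assume "connecting p \<in> coboundaries sl_proj (dens_module 1) (Suc u)"
    then obtain q where "q \<in> alt_forms sl_carrier {f. smooth f} u" "connecting p = ce_diff sl_proj (dens_module 1) q"
      by (auto simp: coboundaries_def cochains_def)
    then show "p \<in> coboundaries sl_proj (S1_module 1) u" by (rule connecting_injective[OF Z(1)[OF p] Z(2)[OF p]])
  next
    assume b: "p \<in> coboundaries sl_proj (S1_module 1) u"
    show "connecting p \<in> coboundaries sl_proj (dens_module 1) (Suc u)"
    proof (cases u)
      case 0
      then have p0: "p = 0" using b by (simp add: coboundaries_def)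
      show ?thesis unfolding p0 connecting_zero by (rule subspace_0[OF F.subspace_coboundaries])
    next
      case (Suc v)
      then obtain r where r: "r \<in> alt_forms sl_carrier {P. smooth_vf P} v" "p = ce_diff sl_proj (S1_module 1) r"
        using b by (auto simp: coboundaries_def cochains_def)
      have "connecting p = - ce_diff sl_proj (dens_module 1) (connecting r)"
        unfolding r(2) using connecting_diff[OF r(1)] by simp
      moreover have "ce_diff sl_proj (dens_module 1) (connecting r) \<in> coboundaries sl_proj (dens_module 1) (Suc u)"
        using connecting_alt[OF r(1)] Suc by (simp add: coboundaries_def cochains_def)
      ultimately show ?thesis using subspace_neg[OF F.subspace_coboundaries] by simp
    qed
  qed
qed

lemma S1_iso:
  "isomorphic_vs (H_sl (S1_module 1 :: ('m::finite vector_field, 'm vector_field) lie_module))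
    (gl_inv_forms :: (nat \<Rightarrow> (real^'m^'m) list \<Rightarrow> real) vspace)"
proof -
  let ?S = "S1_module 1 :: ('m vector_field, 'm vector_field) lie_module"
  note con = connecting_cocycle[where 'm = 'm]
  \<comment> \<open>a cocycle of degree \<open>b + m - 1\<close> is sent by the connecting map to degree \<open>b + m\<close>\<close>
  define s where "s = CARD('m) - 1"
  have "CARD('m) > 0" by (rule zero_less_card_finite)
  then have m: "Suc (b + s) = b + CARD('m)" for b by (simp add: s_def)
  show ?thesis
  proof (rule cohomology_iso_gl_inv[where s = s and L = "\<lambda>b c. dens_class b (connecting c)", OF S1_module])
    show "lin_on (cocycles sl_proj ?S (b + s)) (gl_inv_forms_deg b) (\<lambda>c. dens_class b (connecting c))" for b
      by (rule lin_on_compose[OF con(1)[of "b + s", unfolded m] dens_class_lin])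
    fix b and \<omega> :: "(real^'m^'m) list \<Rightarrow> real" assume "\<omega> \<in> gl_inv_forms_deg b"
    then obtain c where c: "c \<in> dens_cocycles (Suc (b + s))" "dens_class b c = \<omega>" unfolding m using dens_class_surj by blast
    have c': "c \<in> alt_forms sl_carrier {f. smooth f} (Suc (b + s))" "ce_diff sl_proj (dens_module 1) c = 0"
      using c(1) by (simp_all add: cocycles_def cochains_def)
    obtain p q' where p: "p \<in> alt_forms sl_carrier {P. smooth_vf P} (b + s)" "ce_diff sl_proj ?S p = 0"
      and q': "q' \<in> alt_forms sl_carrier {f. smooth f} (b + s)" and eq: "c = ce_diff sl_proj (dens_module 1) q' + connecting p"
      using connecting_surjective[OF c'] by blast
    have pZ: "p \<in> cocycles sl_proj ?S (b + s)" using p by (simp add: cocycles_def cochains_def)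
    have dB: "ce_diff sl_proj (dens_module 1) q' \<in> coboundaries sl_proj (dens_module 1) (b + CARD('m))"
      using q' by (simp add: coboundaries_def cochains_def flip: m)
    then have dZ: "ce_diff sl_proj (dens_module 1) q' \<in> dens_cocycles (b + CARD('m))" using F.coboundaries_cocycles by blast
    have "dens_class b c = dens_class b (ce_diff sl_proj (dens_module 1) q') + dens_class b (connecting p)"
      unfolding eq by (rule lin_on_add[OF dens_class_lin dZ lin_on_in[OF con(1)[of "b + s", unfolded m] pZ]])
    then have "dens_class b (connecting p) = \<omega>" using dens_class_zero_iff[OF dZ] dB c(2) by simp
    then show "\<exists>z\<in>cocycles sl_proj ?S (b + s). dens_class b (connecting z) = \<omega>" using pZ by blast
  next
    fix b p assume p: "p \<in> cocycles sl_proj ?S (b + s)"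
    show "dens_class b (connecting p) = 0 \<longleftrightarrow> p \<in> coboundaries sl_proj ?S (b + s)"
      using dens_class_zero_iff[OF lin_on_in[OF con(1)[of "b + s", unfolded m] p]] con(2)[OF p] unfolding m by simp
  next
    fix u p assume u: "u < s" and p: "p \<in> cocycles sl_proj ?S u"
    have "Suc u < CARD('m)" using u by (simp add: s_def)
    then show "p \<in> coboundaries sl_proj ?S u"
      using dens_low_degree[OF lin_on_in[OF con(1) p]] con(2)[OF p] by simp
  qed
qed

lemma inclusion_equivariant:
  "equivariant sl_proj (D_ord 0 1 0) (D_ord 0 1 1) (\<lambda>A :: 'm::finite operator. A)"
  "equivariant sl_proj (D_ord 0 1 k) (D_all 0 1) (\<lambda>A :: 'm::finite operator. A)"
  unfolding equivariant_def D_ord_simps D_all_simps using diff_ops_mono[of 0 1, where 'a = 'm]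
  by (auto intro: lin_onI)

lemma first_order_equivariant:
  "equivariant sl_proj (D_ord 0 1 1) (S1_module 1) (symbol_map :: 'm::finite operator \<Rightarrow> 'm vector_field)"
  "equivariant sl_proj (D_ord 0 1 1) (D_ord 0 1 0) (const_part :: 'm operator \<Rightarrow> 'm operator)"
  "equivariant sl_proj (S1_module 1) (D_ord 0 1 1) (vec_op :: 'm vector_field \<Rightarrow> 'm operator)"
proof -
  have s: "smooth_vf (lm_act (S1_module 1) X P)" "smooth (lie_density 1 X a)"
    if "smooth_vf X" "smooth_vf P" "smooth a" for X P :: "'m vector_field" and a
    using that by (auto intro: smooth_S1_act smooth_lie_density)
  have comb: "smooth (r *\<^sub>R a + s *\<^sub>R b)" "smooth_vf (r *\<^sub>R P + s *\<^sub>R Q)"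
    if "smooth a" "smooth b" "smooth_vf P" "smooth_vf Q" for r s a b and P Q :: "'m vector_field"
    using that subspace_comb[OF subspace_smooth, of a b r s] subspace_comb[OF subspace_smooth_vf, of P Q r s] by auto
  show "equivariant sl_proj (D_ord 0 1 1) (S1_module 1) (symbol_map :: 'm operator \<Rightarrow> _)"
    unfolding equivariant_def D_ord_simps S1_carrier
  proof (intro conjI lin_onI ballI)
    fix A :: "'m operator" assume "A \<in> diff_ops 1"
    then obtain a P where A: "smooth a" "smooth_vf P" "A = term_op a [] + vec_op P" by (rule first_order_cases)
    show "symbol_map A \<in> {P. smooth_vf P}" unfolding A(3) by (simp add: symbol_map_eq A)
    show "symbol_map (op_act 0 1 X A) = lm_act (S1_module 1) X (symbol_map A)" if "X \<in> sl_carrier" for X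
      unfolding A(3) op_act_first_order[OF sl_smooth[OF that] A(1,2)]
      by (simp only: symbol_map_eq A s[OF sl_smooth[OF that] A(2,1)])
    fix B :: "'m operator" and r s :: real assume "B \<in> diff_ops 1"
    then obtain b Q where B: "smooth b" "smooth_vf Q" "B = term_op b [] + vec_op Q" by (rule first_order_cases)
    show "symbol_map (r *\<^sub>R A + s *\<^sub>R B) = r *\<^sub>R symbol_map A + s *\<^sub>R symbol_map B"
      unfolding A(3) B(3) first_order_eq_comb by (simp only: symbol_map_eq A B comb[OF A(1) B(1) A(2) B(2)])
  qed
  show "equivariant sl_proj (D_ord 0 1 1) (D_ord 0 1 0) (const_part :: 'm operator \<Rightarrow> _)"
    unfolding equivariant_def D_ord_simps
  proof (intro conjI lin_onI ballI)
    fix A :: "'m operator" assume "A \<in> diff_ops 1"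
    then obtain a P where A: "smooth a" "smooth_vf P" "A = term_op a [] + vec_op P" by (rule first_order_cases)
    show "const_part A \<in> diff_ops 0" unfolding A(3) const_part_eq by (simp add: term_op_in A)
    show "const_part (op_act 0 1 X A) = op_act 0 1 X (const_part A)" if "X \<in> sl_carrier" for X
      unfolding A(3) op_act_first_order[OF sl_smooth[OF that] A(1,2)] const_part_eq
      by (rule op_act_term[OF sl_smooth[OF that] A(1), symmetric])
    fix B :: "'m operator" and r s :: real assume "B \<in> diff_ops 1"
    then obtain b Q where B: "smooth b" "smooth_vf Q" "B = term_op b [] + vec_op Q" by (rule first_order_cases)
    show "const_part (r *\<^sub>R A + s *\<^sub>R B) = r *\<^sub>R const_part A + s *\<^sub>R const_part B"
      unfolding A(3) B(3) first_order_eq_comb const_part_eq by (rule term_op_comb')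
  qed
  show "equivariant sl_proj (S1_module 1) (D_ord 0 1 1) (vec_op :: _ \<Rightarrow> 'm operator)"
    unfolding equivariant_def D_ord_simps S1_carrier
  proof (intro conjI lin_onI ballI)
    fix P Q :: "'m vector_field" and r s :: real assume P: "P \<in> {P. smooth_vf P}"
    show "vec_op P \<in> diff_ops 1" using first_order_in[OF smooth_const[of 0], of P] P by (simp add: term_op_zero)
    show "vec_op (r *\<^sub>R P + s *\<^sub>R Q) = r *\<^sub>R vec_op P + s *\<^sub>R vec_op Q" by (rule vec_op_comb)
    show "vec_op (lm_act (S1_module 1) X P) = op_act 0 1 X (vec_op P)" if "X \<in> sl_carrier" for X
      using op_act_vec[OF sl_smooth[OF that]] P by simp
  qed
qed

lemma first_order_short_exact:
  "short_exact_vs (H_sl (D_ord 0 1 0)) (H_sl_map (D_ord 0 1 1) (\<lambda>A :: 'm::finite operator. A))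
    (H_sl (D_ord 0 1 1)) (H_sl_map (S1_module 1) symbol_map) (H_sl (S1_module 1))"
proof (rule split_short_exact[OF D_ord_module D_ord_module S1_module inclusion_equivariant(1) first_order_equivariant])
  have z: "smooth (\<lambda>x :: real^'m. 0)" "smooth_vf (0 :: 'm vector_field)"
    using smooth_const subspace_0[OF subspace_smooth_vf] by auto
  have v0: "vec_op (0 :: 'm vector_field) = 0" using vec_op_comb[of 0 "0 :: 'm vector_field" 0 0] by simp
  show "const_part A = A" if "A \<in> lm_carrier (D_ord 0 1 0)" for A :: "'m operator"
    using that unfolding D_ord_simps diff_ops_0 const_part_def by auto
  show "symbol_map (vec_op P) = P" if "P \<in> lm_carrier (S1_module 1)" for P :: "'m vector_field"
    using symbol_map_eq[OF z(1), of P] that by (simp add: term_op_zero)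
  show "symbol_map A = 0" if A: "A \<in> lm_carrier (D_ord 0 1 0)" for A :: "'m operator"
  proof -
    obtain a where "smooth a" "A = term_op a []" using A unfolding D_ord_simps diff_ops_0 by blast
    then show ?thesis using symbol_map_eq[of a 0] z(2) by (simp add: v0)
  qed
  fix A :: "'m operator" assume "A \<in> lm_carrier (D_ord 0 1 1)"
  then have "A \<in> diff_ops 1" by (simp add: D_ord_simps)
  then obtain a P where A: "smooth a" "smooth_vf P" "A = term_op a [] + vec_op P" by (rule first_order_cases)
  show "const_part A + vec_op (symbol_map A) = A"
    unfolding A(3) const_part_eq symbol_map_eq[OF A(1,2)] by (rule refl)
qed

lemma first_order_inclusion_iso:
  "iso_map_vs (H_sl (D_ord 0 1 1)) (H_sl (D_all 0 1)) (H_sl_map (D_all 0 1) (\<lambda>A :: 'm::finite operator. A))"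
proof (rule equivariant_iso[OF D_ord_module D_all_module inclusion_equivariant(2)])
  interpret D: lie_module_on sl_proj "D_all 0 1 :: ('m vector_field, 'm operator) lie_module" by (rule D_all_module)
  have id: "(\<lambda>A :: 'm operator. A) \<circ> c = c" for c :: "'m vector_field list \<Rightarrow> 'm operator" by (simp add: fun_eq_iff)
  have red: "\<exists>e\<in>op_coboundaries u. c - e \<in> op_forms 1 u"
    if c: "c \<in> cochains sl_proj (D_all 0 1) u" and dc: "op_diff c \<in> op_forms 1 (Suc u)" for c :: "'m vector_field list \<Rightarrow> 'm operator" and u
  proof -
    obtain k where "c \<in> op_forms k u" using op_forms_bounded[of c u] c by (auto simp: cochains_def D_all_simps)
    then have "c \<in> op_forms (Suc k) u" using op_forms_mono[of k "Suc k" u] by auto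
    then show ?thesis by (rule order_reduction[OF _ dc])
  qed
  fix u and c :: "'m vector_field list \<Rightarrow> 'm operator"
  {
    assume c: "c \<in> cocycles sl_proj (D_ord 0 1 1) u" and b: "(\<lambda>A. A) \<circ> c \<in> coboundaries sl_proj (D_all 0 1) u"
    show "c \<in> coboundaries sl_proj (D_ord 0 1 1) u"
    proof (cases u)
      case 0
      then show ?thesis using b unfolding id by (simp add: coboundaries_def)
    next
      case (Suc v)
      then obtain a where a: "a \<in> cochains sl_proj (D_all 0 1) v" "c = op_diff a" using b unfolding id by (auto simp: coboundaries_def)
      have "op_diff a \<in> op_forms 1 (Suc v)" using c Suc unfolding a(2) by (simp add: cocycles_def cochains_def D_ord_simps)
      then obtain e where e: "e \<in> op_coboundaries v" "a - e \<in> op_forms 1 v" using red[OF a(1)] by blast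
      have "e \<in> D.Alt v" "op_diff e = 0" using subsetD[OF D.coboundaries_cocycles e(1)] by (simp_all add: cocycles_def cochains_def)
      then have "op_diff (a - e) = c" using lin_on_diff[OF D.ce_diff_lin_on, of a v e] a by (simp add: cochains_def)
      then have "c \<in> ce_diff sl_proj (D_ord 0 1 1) ` cochains sl_proj (D_ord 0 1 1) v"
        unfolding D_ord_diff using e(2) by (intro image_eqI[of _ _ "a - e"]) (simp_all add: cochains_def D_ord_simps)
      then show ?thesis by (simp add: coboundaries_def Suc)
    qed
  next
    assume c: "c \<in> cocycles sl_proj (D_all 0 1) u"
    then have c': "c \<in> cochains sl_proj (D_all 0 1) u" "op_diff c = 0" by (simp_all add: cocycles_def)
    have "op_diff c \<in> op_forms 1 (Suc u)"
      unfolding c'(2) by (rule subspace_0[OF subspace_alt_forms[OF subspace_diff_ops]])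
    then obtain e where e: "e \<in> op_coboundaries u" "c - e \<in> op_forms 1 u" using red[OF c'(1)] by blast
    have "e \<in> D.Alt u" "op_diff e = 0" using subsetD[OF D.coboundaries_cocycles e(1)] by (simp_all add: cocycles_def cochains_def)
    then have "op_diff (c - e) = 0" using lin_on_diff[OF D.ce_diff_lin_on, of c u e] c' by (simp add: cochains_def)
    then have "c - e \<in> cocycles sl_proj (D_ord 0 1 1) u"
      using e(2) by (simp add: cocycles_def cochains_def D_ord_simps D_ord_diff)
    moreover have "c - ((\<lambda>A. A) \<circ> (c - e)) \<in> op_coboundaries u" unfolding id using e(1) by simp
    ultimately show "\<exists>z\<in>cocycles sl_proj (D_ord 0 1 1) u. c - ((\<lambda>A. A) \<circ> z) \<in> op_coboundaries u" by blast
  }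
qed

theorem theorem9p3:
  assumes "CARD('m::finite) > 1"
  shows
    "short_exact_vs
       (H_sl (D_ord 0 1 0)) (H_sl_map (D_ord 0 1 1) (\<lambda>A :: 'm operator. A))
       (H_sl (D_ord 0 1 1)) (H_sl_map (S1_module 1) symbol_map)
       (H_sl (S1_module 1)) \<and>
     isomorphic_vs
       (H_sl (D_ord 0 1 0 :: ('m vector_field, 'm operator) lie_module))
       (gl_inv_forms :: (nat \<Rightarrow> (real^'m^'m) list \<Rightarrow> real) vspace) \<and>
     isomorphic_vs
       (H_sl (S1_module 1 :: ('m vector_field, 'm vector_field) lie_module))
       (gl_inv_forms :: (nat \<Rightarrow> (real^'m^'m) list \<Rightarrow> real) vspace) \<and>
     iso_map_vs
       (H_sl (D_ord 0 1 1)) (H_sl (D_all 0 1)) (H_sl_map (D_all 0 1) (\<lambda>A :: 'm operator. A))"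
  by (intro conjI first_order_short_exact D_ord_0_iso S1_iso first_order_inclusion_iso)

end
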